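(* Let $W$ be an $A$-module and $\lambda\in\frac1kL_D$. Then $(V_{\lambda,W},Y_{\lambda,W})$ is a $V$-module. Moreover, $V_{\lambda,W}$ is irreducible if and only if $W$ is simple.
   Context: Fix an integer $\nu\ge1$ and a nonzero integer $k$. Let $L_C=\bigoplus_{i=1}^{\nu}\mathbb{Z}c_i$, $L_D=\bigoplus_{i=1}^{\nu}\mathbb{Z}d_i$, $L=L_C\oplus L_D$, with symmetric bilinear form $(c_i,d_j)=k\delta_{ij}$, $(c_i,c_j)=(d_i,d_j)=0$. Put $\mathfrak{h}=\mathbb{C}\otimes L$, $\mathfrak{h}_C=\mathbb{C}\otimes L_C$, $\mathfrak{h}_D=\mathbb{C}\otimes L_D$. Let $\hat{\mathfrak{h}}=\mathfrak{h}\otimes\mathbb{C}[t,t^{-1}]\oplus\mathbb{C}c$, $\alpha(n)=\alpha\otimes t^n$, $[\alpha(m),\beta(n)]=m(\alpha,\beta)\delta_{m+n,0}c$, $c$ central. $M(1)=S(\mathfrak{h}\otimes t^{-1}\mathbb{C}[t^{-1}])$ is the Fock space with $c=1$. $A$ is the unital associative $\mathbb{C}$-algebra generated by $e_\alpha$ ($\alpha\in L_C$) and $d_i$ ($1\le i\le\nu$) with relations $e_0=1$, $e_{\alpha+\beta}=e_\alpha e_\beta$, $d_ie_\alpha-e_\alpha d_i=(d_i,\alpha)e_\alpha$, $d_id_j=d_jd_i$. $V=M(1)\otimes\mathbb{C}[L_C]$ is the vertex subalgebra of the lattice vertex algebra $V_L$ (with basis elements $e^\alpha$, $\alpha\in L_C$,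 of the group algebra), vacuum $\mathbf 1=1\otimes e^0$. Explicitly, on $V$, $\alpha(n)$ for $n\ne0$ acts on $M(1)$, $\alpha(0)e^\beta=(\alpha,\beta)e^\beta$, $e^\alpha$ acts by multiplication in $\mathbb{C}[L_C]$, and the vertex operators $Y(v,z)$ are given by the same formulas as for $Y_{\lambda,W}$ below with $z^\beta$ ($\beta\in L_C$) acting as the identity. For an $A$-module $W$ and $\lambda\in\frac1kL_D$, $V_{\lambda,W}=M(1)\otimes W$ with: $c=1$; $\alpha(n)$ acts as $\alpha(n)\otimes1$ for $n\ne0$, $\alpha\in\mathfrak{h}$; $\beta(0)$ acts as the scalar $(\beta,\lambda)$ for $\beta\in\mathfrak{h}_C$; $\gamma(0)$ acts as $1\otimes\gamma$ for $\gamma\in\mathfrak{h}_D$ (with $d_i$ acting through $A$); for $\alpha\in L_C$, $e^\alpha$ acts as $1\otimes e_\alpha$ and $z^\alpha$ as $z^{(\alpha,\lambda)}$. Put $\alpha(z)=\sum_{n\in\mathbb{Z}}\alpha(n)z^{-n-1}$, $E^{\pm}(\beta,z)=\exp\big(\sum_{n\in\pm\mathbb{Z}_{>0}}\frac{\beta(n)}{n}z^{-n}\big)$, $\partial_n=\frac1{n!}(\frac{\partial}{\partial z})^n$. Then $Y_{\lambda,W}:V\to(\mathrm{End}\,V_{\lambda,W})[[z,z^{-1}]]$ is the linear map with $$Y_{\lambda,W}(e^\beta,z)=E^-(-\beta,z)E^+(-\beta,z)e^\beta z^\beta,$$ $$Y_{\lambda,W}(\alpha_1(-n_1)\cdots\alpha_s(-n_s)e^\alpha,z)=\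 :(\partial_{n_1-1}\alpha_1(z))\cdots(\partial_{n_s-1}\alpha_s(z))Y_{\lambda,W}(e^\alpha,z):$$ for $\alpha_i\in\mathfrak{h}$, $n_i>0$, where the normal ordering places all $\alpha(n)$ with $n<0$ to the left and all $\alpha(n)$ with $n\ge0$ to the right (in particular $\alpha(0)$ to the right of $e^\alpha$). A $V$-module is a vector space $N$ with a linear map $Y_N:V\to(\mathrm{End}\,N)[[z,z^{-1}]]$, $Y_N(u,z)=\sum u_nz^{-n-1}$, such that $u_nw=0$ for $n$ large, $Y_N(\mathbf 1,z)=1$, and the Jacobi identity $$z_0^{-1}\delta\big(\tfrac{z_1-z_2}{z_0}\big)Y_N(u,z_1)Y_N(v,z_2)-z_0^{-1}\delta\big(\tfrac{z_2-z_1}{-z_0}\big)Y_N(v,z_2)Y_N(u,z_1)=z_2^{-1}\delta\big(\tfrac{z_1-z_0}{z_2}\big)Y_N(Y(u,z_0)v,z_2)$$ holds for $u,v\in V$, with $\delta(z)=\sum_{n\in\mathbb{Z}}z^n$. *)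

theory Defs
  imports
    "HOL-Analysis.Finite_Cartesian_Product"
    "HOL-Library.Multiset"
    "HOL-Library.Poly_Mapping"
    "HOL-Library.Groups_Big_Fun"
    "HOL-Algebra.QuotRing"
    "HOL-Algebra.Algebraic_Closure_Type"
begin

section \<open>The lattice and the ambient space\<close>

text \<open>
  The rank is \<open>CARD('n)\<close>, which is at least 1.  The index \<open>Inl i\<close> stands for $c_i$ and \<open>Inr i\<close>
  for $d_i$; an element of $L_C$ is its vector of integer coordinates.
\<close>

type_synonym 'n lattC = "int ^ 'n"
type_synonym 'n hh = "complex ^ ('n + 'n)"

abbreviation hbasis :: "'n + 'n \<Rightarrow> 'n::finite hh" where
  "hbasis b \<equiv> axis b 1"

definition form :: "int \<Rightarrow> 'n::finite hh \<Rightarrow> 'n hh \<Rightarrow> complex" where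
  "form k \<alpha> \<beta> = of_int k * (\<Sum>i\<in>UNIV. \<alpha> $ Inl i * \<beta> $ Inr i + \<alpha> $ Inr i * \<beta> $ Inl i)"

lemma form_basis:
  "form k (hbasis (Inl i)) (hbasis (Inr j)) = (if i = j then of_int k else 0)"
  "form k (hbasis (Inl i)) (hbasis (Inl j)) = 0"
  "form k (hbasis (Inr i)) (hbasis (Inr j)) = 0"
proof -
  have "(\<Sum>l\<in>UNIV. (if l = i then 1 else 0) * (if l = j then 1 else 0 :: complex)) = (if i = j then 1 else 0)"
    by (subst sum.remove[of UNIV i]) (auto intro!: sum.neutral)
  then show "form k (hbasis (Inl i)) (hbasis (Inr j)) = (if i = j then of_int k else 0)"
    by (simp add: form_def axis_def)
qed (simp_all add: form_def axis_def)

definition emb_C :: "'n::finite lattC \<Rightarrow> 'n hh" where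
  "emb_C \<alpha> = (\<chi> b. case b of Inl i \<Rightarrow> of_int (\<alpha> $ i) | Inr i \<Rightarrow> 0)"

definition scaled_LD :: "int \<Rightarrow> 'n::finite hh set" where
  "scaled_LD k = {lam. \<exists>l :: int ^ 'n.
     lam = (\<chi> b. case b of Inl i \<Rightarrow> 0 | Inr i \<Rightarrow> of_int (l $ i) / of_int k)}"

definition proj_C :: "'n::finite hh \<Rightarrow> 'n hh" where
  "proj_C \<alpha> = (\<chi> b. case b of Inl i \<Rightarrow> \<alpha> $ Inl i | Inr i \<Rightarrow> 0)"


section \<open>The associative algebra A and its modules\<close>

text \<open>The free monoid, so that \<open>'a word \<Rightarrow>\<^sub>0 complex\<close> is the free associative algebra on \<open>'a\<close>.\<close>

datatype 'a word = Word "'a list"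

instantiation word :: (type) monoid_add
begin

definition zero_word :: "'a word" where
  "zero_word = Word []"

fun plus_word :: "'a word \<Rightarrow> 'a word \<Rightarrow> 'a word" where
  "plus_word (Word xs) (Word ys) = Word (xs @ ys)"

instance
proof
  fix a b c :: "'a word"
  show "a + b + c = a + (b + c)" by (cases a; cases b; cases c) simp
  show "0 + a = a" "a + 0 = a" by (cases a; simp add: zero_word_def)+
qed

end

datatype 'n gen = Egen "'n lattC" | Dgen 'n

type_synonym 'n freealg = "'n gen word \<Rightarrow>\<^sub>0 complex"

definition fgen :: "'n::finite gen \<Rightarrow> 'n freealg" where
  "fgen x = Poly_Mapping.single (Word [x]) 1"

definition fconst :: "complex \<Rightarrow> 'n::finite freealg" where
  "fconst c = Poly_Mapping.single 0 c"

definition A_rels :: "int \<Rightarrow> 'n::finite freealg set" where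
  "A_rels k =
     {fgen (Egen 0) - 1}
   \<union> {fgen (Egen (\<alpha> + \<beta>)) - fgen (Egen \<alpha>) * fgen (Egen \<beta>) | \<alpha> \<beta>. True}
   \<union> {fgen (Dgen i) * fgen (Egen \<alpha>) - fgen (Egen \<alpha>) * fgen (Dgen i)
        - fconst (form k (hbasis (Inr i)) (emb_C \<alpha>)) * fgen (Egen \<alpha>) | i \<alpha>. True}
   \<union> {fgen (Dgen i) * fgen (Dgen j) - fgen (Dgen j) * fgen (Dgen i) | i j. True}"

definition A_ideal :: "int \<Rightarrow> 'n::finite freealg set" where
  "A_ideal k = Idl\<^bsub>ring_of_type_algebra\<^esub> (A_rels k)"

definition A_alg :: "int \<Rightarrow> ('n::finite freealg set) ring" where
  "A_alg k = ring_of_type_algebra Quot (A_ideal k)"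

definition A_class :: "int \<Rightarrow> 'n::finite freealg \<Rightarrow> 'n freealg set" where
  "A_class k x = A_ideal k +>\<^bsub>ring_of_type_algebra\<^esub> x"

definition A_e :: "int \<Rightarrow> 'n::finite lattC \<Rightarrow> 'n freealg set" where
  "A_e k \<alpha> = A_class k (fgen (Egen \<alpha>))"

definition A_d :: "int \<Rightarrow> 'n::finite \<Rightarrow> 'n freealg set" where
  "A_d k i = A_class k (fgen (Dgen i))"

text \<open>
  A left module over the unital algebra \<open>A_alg k\<close>: a complex vector space, given by its scalar
  multiplication \<open>s\<close>, with a unital algebra homomorphism \<open>\<rho>\<close> to its endomorphisms.
\<close>

definition A_module ::
  "int \<Rightarrow> (complex \<Rightarrow> 'w::ab_group_add \<Rightarrow> 'w) \<Rightarrow> ('n::finite freealg set \<Rightarrow> 'w \<Rightarrow> 'w) \<Rightarrow> bool" where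
  "A_module k s \<rho> \<longleftrightarrow>
     vector_space s \<and>
     (\<forall>a\<in>carrier (A_alg k). Vector_Spaces.linear s s (\<rho> a)) \<and>
     (\<forall>a\<in>carrier (A_alg k). \<forall>b\<in>carrier (A_alg k). \<forall>w.
        \<rho> (a \<oplus>\<^bsub>A_alg k\<^esub> b) w = \<rho> a w + \<rho> b w \<and>
        \<rho> (a \<otimes>\<^bsub>A_alg k\<^esub> b) w = \<rho> a (\<rho> b w)) \<and>
     (\<forall>w. \<rho> \<one>\<^bsub>A_alg k\<^esub> w = w) \<and>
     (\<forall>c w. \<rho> (A_class k (fconst c)) w = s c w)"

definition A_submodule ::
  "int \<Rightarrow> (complex \<Rightarrow> 'w::ab_group_add \<Rightarrow> 'w) \<Rightarrow> ('n::finite freealg set \<Rightarrow> 'w \<Rightarrow> 'w) \<Rightarrow> 'w set \<Rightarrow> bool" where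
  "A_submodule k s \<rho> U \<longleftrightarrow>
     module.subspace s U \<and> (\<forall>a\<in>carrier (A_alg k). \<forall>w\<in>U. \<rho> a w \<in> U)"

definition A_simple ::
  "int \<Rightarrow> (complex \<Rightarrow> 'w::ab_group_add \<Rightarrow> 'w) \<Rightarrow> ('n::finite freealg set \<Rightarrow> 'w \<Rightarrow> 'w) \<Rightarrow> bool" where
  "A_simple k s \<rho> \<longleftrightarrow>
     (UNIV :: 'w set) \<noteq> {0} \<and> (\<forall>U. A_submodule k s \<rho> U \<longrightarrow> U = {0} \<or> U = UNIV)"


section \<open>The Fock space\<close>

text \<open>
  $M(1) = S(\mathfrak{h} \otimes t^{-1}\mathbb{C}[t^{-1}])$ is the polynomial algebra in the variables
  $b(-j-1)$ with \<open>b\<close> in the chosen basis and \<open>j \<ge> 0\<close>; the pair \<open>(b, j)\<close> is the variable $b(-j-1)$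
  (note the shift) and a monomial is a multiset of variables.
\<close>

type_synonym 'n fvar = "('n + 'n) \<times> nat"
type_synonym 'n M1 = "'n fvar multiset \<Rightarrow>\<^sub>0 complex"

definition pd :: "'n fvar \<Rightarrow> 'n M1 \<Rightarrow> 'n M1" where
  "pd v p = (\<Sum>M\<in>Poly_Mapping.keys p.
     Poly_Mapping.single (M - {#v#}) (of_nat (count M v) * Poly_Mapping.lookup p M))"

text \<open>
  The action of $\alpha(n)$ on $M(1)$ with $c = 1$: for \<open>n < 0\<close> multiplication, for \<open>n > 0\<close> the
  derivation with $\beta(-m) \mapsto n(\alpha,\beta)\delta_{m,n}$, and $\alpha(0) = 0$.
\<close>

definition heis :: "int \<Rightarrow> 'n::finite hh \<Rightarrow> int \<Rightarrow> 'n M1 \<Rightarrow> 'n M1" where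
  "heis k \<alpha> n p =
     (if n < 0
      then (\<Sum>b\<in>UNIV. Poly_Mapping.single {#(b, nat (- n) - 1)#} (\<alpha> $ b)) * p
      else (\<Sum>b\<in>UNIV. Poly_Mapping.single 0 (of_int n * form k \<alpha> (hbasis b)) * pd (b, nat n - 1) p))"

text \<open>
  $M(1) \otimes W$ is the space of finitely supported functions from the monomials (a basis of
  $M(1)$) to \<open>W\<close>; \<open>tens s p w\<close> is the elementary tensor $p \otimes w$.
\<close>

type_synonym ('n, 'w) fock = "'n fvar multiset \<Rightarrow>\<^sub>0 'w"

definition pm_scale :: "(complex \<Rightarrow> 'w \<Rightarrow> 'w) \<Rightarrow> complex \<Rightarrow> ('b \<Rightarrow>\<^sub>0 'w::zero) \<Rightarrow> ('b \<Rightarrow>\<^sub>0 'w)" where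
  "pm_scale s c = Poly_Mapping.map (s c)"

definition tens :: "(complex \<Rightarrow> 'w \<Rightarrow> 'w) \<Rightarrow> 'n M1 \<Rightarrow> 'w \<Rightarrow> ('n, 'w::ab_group_add) fock" where
  "tens s p w = (\<Sum>M\<in>Poly_Mapping.keys p. Poly_Mapping.single M (s (Poly_Mapping.lookup p M) w))"

definition tens_left ::
  "(complex \<Rightarrow> 'w \<Rightarrow> 'w) \<Rightarrow> ('n M1 \<Rightarrow> 'n M1) \<Rightarrow> ('n, 'w::ab_group_add) fock \<Rightarrow> ('n, 'w) fock" where \<comment> \<open>\<open>T \<otimes> 1\<close>\<close>
  "tens_left s T f =
     (\<Sum>M\<in>Poly_Mapping.keys f. tens s (T (Poly_Mapping.single M 1)) (Poly_Mapping.lookup f M))"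

definition tens_right :: "('w \<Rightarrow> 'w) \<Rightarrow> ('n, 'w::ab_group_add) fock \<Rightarrow> ('n, 'w) fock" where \<comment> \<open>\<open>1 \<otimes> g\<close>\<close>
  "tens_right g = Poly_Mapping.map g"


section \<open>Formal series with operator coefficients\<close>

text \<open>
  \<open>F m\<close> is the coefficient of $z^m$ in $F \in (\mathrm{End}\,N)[[z,z^{-1}]]$.  In every product used
  below, only finitely many terms are nonzero after application to a vector, as \<open>Sum_any\<close> requires.
\<close>

type_synonym 'v field = "int \<Rightarrow> 'v \<Rightarrow> 'v"

definition fone :: "'v::ab_group_add field" where
  "fone m w = (if m = 0 then w else 0)"

definition fadd :: "'v field \<Rightarrow> 'v field \<Rightarrow> 'v::ab_group_add field" where
  "fadd F G m w = F m w + G m w"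

definition fmul :: "'v field \<Rightarrow> 'v field \<Rightarrow> 'v::ab_group_add field" where
  "fmul F G m w = Sum_any (\<lambda>j. F (m - j) (G j w))"

primrec fpow :: "'v::ab_group_add field \<Rightarrow> nat \<Rightarrow> 'v field" where
  "fpow F 0 = fone"
| "fpow F (Suc r) = fmul F (fpow F r)"

definition fexp :: "(complex \<Rightarrow> 'v \<Rightarrow> 'v) \<Rightarrow> 'v field \<Rightarrow> 'v::ab_group_add field" where
  "fexp s F m w = Sum_any (\<lambda>r::nat. s (1 / fact r) (fpow F r m w))"

definition fderiv :: "(complex \<Rightarrow> 'v \<Rightarrow> 'v) \<Rightarrow> 'v field \<Rightarrow> 'v field" where
  "fderiv s F m w = s (of_int (m + 1)) (F (m + 1) w)"

definition fdivderiv :: "(complex \<Rightarrow> 'v \<Rightarrow> 'v) \<Rightarrow> nat \<Rightarrow> 'v field \<Rightarrow> 'v field" where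
  "fdivderiv s n F m w = s (1 / fact n) ((fderiv s ^^ n) F m w)"


section \<open>The vertex operators\<close>

text \<open>
  Common formulas for \<open>V\<close> and $V_{\lambda,W}$, for the following data on the second tensor factor:
  \<open>s\<close> is its scalar multiplication, \<open>Z \<alpha>\<close> the action of $\alpha(0)$, \<open>E \<beta>\<close> the action of $e^\beta$,
  and $z^\beta$ acts as $z^{x(\beta)}$ (where \<open>x \<beta>\<close> is an integer in all cases considered).
\<close>

definition mode ::
  "int \<Rightarrow> (complex \<Rightarrow> 'w \<Rightarrow> 'w) \<Rightarrow> ('n::finite hh \<Rightarrow> 'w \<Rightarrow> 'w) \<Rightarrow>
   'n hh \<Rightarrow> int \<Rightarrow> ('n, 'w::ab_group_add) fock \<Rightarrow> ('n, 'w) fock" where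
  "mode k s Z \<alpha> n = (if n = 0 then tens_right (Z \<alpha>) else tens_left s (heis k \<alpha> n))"

text \<open>The parts of $\alpha(z) = \sum_n \alpha(n) z^{-n-1}$ with \<open>n < 0\<close> and with \<open>n \<ge> 0\<close>.\<close>

definition cre ::
  "int \<Rightarrow> (complex \<Rightarrow> 'w \<Rightarrow> 'w) \<Rightarrow> ('n::finite hh \<Rightarrow> 'w \<Rightarrow> 'w) \<Rightarrow> 'n hh \<Rightarrow> ('n, 'w::ab_group_add) fock field" where
  "cre k s Z \<alpha> m w = (if - m - 1 < 0 then mode k s Z \<alpha> (- m - 1) w else 0)"

definition ann ::
  "int \<Rightarrow> (complex \<Rightarrow> 'w \<Rightarrow> 'w) \<Rightarrow> ('n::finite hh \<Rightarrow> 'w \<Rightarrow> 'w) \<Rightarrow> 'n hh \<Rightarrow> ('n, 'w::ab_group_add) fock field" where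
  "ann k s Z \<alpha> m w = (if - m - 1 \<ge> 0 then mode k s Z \<alpha> (- m - 1) w else 0)"

text \<open>$E^+$ and $E^-$; the coefficient of $z^m$ in the exponent comes from \<open>n = - m\<close>.\<close>

definition Eplus ::
  "int \<Rightarrow> (complex \<Rightarrow> 'w \<Rightarrow> 'w) \<Rightarrow> ('n::finite hh \<Rightarrow> 'w \<Rightarrow> 'w) \<Rightarrow> 'n hh \<Rightarrow> ('n, 'w::ab_group_add) fock field" where
  "Eplus k s Z \<beta> = fexp (pm_scale s)
     (\<lambda>m w. if - m > 0 then pm_scale s (1 / of_int (- m)) (mode k s Z \<beta> (- m) w) else 0)"

definition Eminus ::
  "int \<Rightarrow> (complex \<Rightarrow> 'w \<Rightarrow> 'w) \<Rightarrow> ('n::finite hh \<Rightarrow> 'w \<Rightarrow> 'w) \<Rightarrow> 'n hh \<Rightarrow> ('n, 'w::ab_group_add) fock field" where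
  "Eminus k s Z \<beta> = fexp (pm_scale s)
     (\<lambda>m w. if - m < 0 then pm_scale s (1 / of_int (- m)) (mode k s Z \<beta> (- m) w) else 0)"

definition Y_exp ::
  "int \<Rightarrow> (complex \<Rightarrow> 'w \<Rightarrow> 'w) \<Rightarrow> ('n::finite hh \<Rightarrow> 'w \<Rightarrow> 'w) \<Rightarrow> ('n lattC \<Rightarrow> 'w \<Rightarrow> 'w) \<Rightarrow>
   ('n lattC \<Rightarrow> complex) \<Rightarrow> 'n lattC \<Rightarrow> ('n, 'w::ab_group_add) fock field" where
  "Y_exp k s Z E x \<beta> =
     fmul (Eminus k s Z (- emb_C \<beta>)) (fmul (Eplus k s Z (- emb_C \<beta>))
       (\<lambda>m w. if of_int m = x \<beta> then tens_right (E \<beta>) w else 0))"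

text \<open>
  \<open>nop k s Z [(\<alpha>\<^sub>1, n\<^sub>1 - 1), \<dots>, (\<alpha>\<^sub>s, n\<^sub>s - 1)] F\<close> is
  $:(\partial_{n_1-1}\alpha_1(z))\cdots(\partial_{n_s-1}\alpha_s(z))\,F(z):$ as an iterated normally
  ordered product.  The modes \<open>n < 0\<close> commute with each other, and so do the modes \<open>n \<ge> 0\<close>, so this
  has all of the former on the left of \<open>F\<close> and all of the latter on the right.
\<close>

fun nop ::
  "int \<Rightarrow> (complex \<Rightarrow> 'w \<Rightarrow> 'w) \<Rightarrow> ('n::finite hh \<Rightarrow> 'w \<Rightarrow> 'w) \<Rightarrow> ('n hh \<times> nat) list \<Rightarrow>
   ('n, 'w::ab_group_add) fock field \<Rightarrow> ('n, 'w) fock field" where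
  "nop k s Z [] F = F"
| "nop k s Z ((\<alpha>, j) # l) F =
     fadd (fmul (fdivderiv (pm_scale s) j (cre k s Z \<alpha>)) (nop k s Z l F))
          (fmul (nop k s Z l F) (fdivderiv (pm_scale s) j (ann k s Z \<alpha>)))"

type_synonym 'n VV = "('n, 'n lattC \<Rightarrow>\<^sub>0 complex) fock"

text \<open>
  \<open>Y_gen \<dots> v m\<close> is the coefficient of $z^m$ in $Y(v,z)$.  It is given by the formula on the basis
  $b_1(-n_1)\cdots b_s(-n_s) e^\beta$ of \<open>V\<close> (with all $b_i$ among the $c_j$, $d_j$) and extended
  linearly.  As the factors of a normally ordered product may be permuted, it does not matter in
  which order the chosen list enumerates the monomial.
\<close>

definition Y_gen ::
  "int \<Rightarrow> (complex \<Rightarrow> 'w \<Rightarrow> 'w) \<Rightarrow> ('n::finite hh \<Rightarrow> 'w \<Rightarrow> 'w) \<Rightarrow> ('n lattC \<Rightarrow> 'w \<Rightarrow> 'w) \<Rightarrow>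
   ('n lattC \<Rightarrow> complex) \<Rightarrow> 'n VV \<Rightarrow> ('n, 'w::ab_group_add) fock field" where
  "Y_gen k s Z E x v m w =
     (\<Sum>M\<in>Poly_Mapping.keys v. \<Sum>\<beta>\<in>Poly_Mapping.keys (Poly_Mapping.lookup v M).
        pm_scale s (Poly_Mapping.lookup (Poly_Mapping.lookup v M) \<beta>)
          (nop k s Z (map (\<lambda>(b, j). (hbasis b, j)) (SOME l. mset l = M)) (Y_exp k s Z E x \<beta>) m w))"


section \<open>V and the module attached to W\<close>

abbreviation L_scale :: "complex \<Rightarrow> ('n::finite lattC \<Rightarrow>\<^sub>0 complex) \<Rightarrow> ('n lattC \<Rightarrow>\<^sub>0 complex)" where
  "L_scale \<equiv> pm_scale (*)"

abbreviation V_scale :: "complex \<Rightarrow> 'n::finite VV \<Rightarrow> 'n VV" where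
  "V_scale \<equiv> pm_scale L_scale"

definition V_vac :: "'n::finite VV" where
  "V_vac = Poly_Mapping.single {#} (Poly_Mapping.single 0 1)"

definition V_zero_mode :: "int \<Rightarrow> 'n::finite hh \<Rightarrow> ('n lattC \<Rightarrow>\<^sub>0 complex) \<Rightarrow> ('n lattC \<Rightarrow>\<^sub>0 complex)" where
  "V_zero_mode k \<alpha> f = (\<Sum>\<beta>\<in>Poly_Mapping.keys f.
     Poly_Mapping.single \<beta> (form k \<alpha> (emb_C \<beta>) * Poly_Mapping.lookup f \<beta>))"

definition Y_V :: "int \<Rightarrow> 'n::finite VV \<Rightarrow> 'n VV field" where
  "Y_V k = Y_gen k L_scale (V_zero_mode k) (\<lambda>\<beta> f. Poly_Mapping.single \<beta> 1 * f) (\<lambda>\<beta>. 0)"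

definition W_zero_mode ::
  "int \<Rightarrow> (complex \<Rightarrow> 'w::ab_group_add \<Rightarrow> 'w) \<Rightarrow> ('n::finite freealg set \<Rightarrow> 'w \<Rightarrow> 'w) \<Rightarrow> 'n hh \<Rightarrow> 'n hh \<Rightarrow> 'w \<Rightarrow> 'w" where
  "W_zero_mode k s \<rho> lam \<alpha> w =
     s (form k (proj_C \<alpha>) lam) w + (\<Sum>i\<in>UNIV. s (\<alpha> $ Inr i) (\<rho> (A_d k i) w))"

definition Y_W ::
  "int \<Rightarrow> (complex \<Rightarrow> 'w::ab_group_add \<Rightarrow> 'w) \<Rightarrow> ('n::finite freealg set \<Rightarrow> 'w \<Rightarrow> 'w) \<Rightarrow> 'n hh \<Rightarrow>
   'n VV \<Rightarrow> ('n, 'w) fock field" where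
  "Y_W k s \<rho> lam =
     Y_gen k s (W_zero_mode k s \<rho> lam) (\<lambda>\<beta>. \<rho> (A_e k \<beta>)) (\<lambda>\<beta>. form k (emb_C \<beta>) lam)"


section \<open>Modules for a vertex algebra\<close>

text \<open>
  Coefficients of the three delta functions at $z_0^a z_1^b z_2^c$.  \<open>binom_coeff n a b\<close> is the
  coefficient of $x^a y^b$ in $(x-y)^n$, expanded in nonnegative powers of \<open>y\<close>.  For instance
  $z_0^{-1}\delta(\frac{z_1-z_2}{z_0}) = \sum_n z_0^{-n-1}(z_1-z_2)^n$.
\<close>

definition binom_coeff :: "int \<Rightarrow> int \<Rightarrow> int \<Rightarrow> complex" where
  "binom_coeff n a b =
     (if b \<ge> 0 \<and> a + b = n then (-1) ^ nat b * (of_int n gchoose nat b) else 0)"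

definition delta1 :: "int \<Rightarrow> int \<Rightarrow> int \<Rightarrow> complex" where \<comment> \<open>$z_0^{-1}\delta((z_1-z_2)/z_0)$\<close>
  "delta1 a b c = binom_coeff (- a - 1) b c"

definition delta2 :: "int \<Rightarrow> int \<Rightarrow> int \<Rightarrow> complex" where \<comment> \<open>$z_0^{-1}\delta((z_2-z_1)/(-z_0))$\<close>
  "delta2 a b c = (-1) powi (- a - 1) * binom_coeff (- a - 1) c b"

definition delta3 :: "int \<Rightarrow> int \<Rightarrow> int \<Rightarrow> complex" where \<comment> \<open>$z_2^{-1}\delta((z_1-z_0)/z_2)$\<close>
  "delta3 a b c = binom_coeff (- c - 1) b a"

text \<open>
  The Jacobi identity is stated coefficientwise, at $z_0^a z_1^b z_2^c$ and on each vector; by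
  truncation all sums have only finitely many nonzero terms.
\<close>

definition jacobi ::
  "('v \<Rightarrow> 'v field) \<Rightarrow> (complex \<Rightarrow> 'm \<Rightarrow> 'm) \<Rightarrow> ('v \<Rightarrow> 'm::ab_group_add field) \<Rightarrow> bool" where
  "jacobi Y s YN \<longleftrightarrow> (\<forall>u v w a b c.
     Sum_any (\<lambda>(p, q). s (delta1 a (b - p) (c - q)) (YN u p (YN v q w)))
     - Sum_any (\<lambda>(p, q). s (delta2 a (b - p) (c - q)) (YN v q (YN u p w)))
     = Sum_any (\<lambda>(p, q). s (delta3 (a - p) b (c - q)) (YN (Y u p v) q w)))"

text \<open>As $Y_N(u,z) = \sum_n u_n z^{-n-1}$, the operator $u_n$ is \<open>YN u (- n - 1)\<close>.\<close>

definition vertex_module ::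
  "(complex \<Rightarrow> 'v::ab_group_add \<Rightarrow> 'v) \<Rightarrow> ('v \<Rightarrow> 'v field) \<Rightarrow> 'v \<Rightarrow>
   (complex \<Rightarrow> 'm::ab_group_add \<Rightarrow> 'm) \<Rightarrow> ('v \<Rightarrow> 'm field) \<Rightarrow> bool" where
  "vertex_module sV Y vac s YN \<longleftrightarrow>
     vector_space s \<and>
     (\<forall>u m. Vector_Spaces.linear s s (YN u m)) \<and>
     (\<forall>m w. Vector_Spaces.linear sV s (\<lambda>u. YN u m w)) \<and>
     (\<forall>u w. \<exists>n0. \<forall>n\<ge>n0. YN u (- n - 1) w = 0) \<and>
     YN vac = fone \<and>
     jacobi Y s YN"

definition vertex_submodule ::
  "(complex \<Rightarrow> 'm::ab_group_add \<Rightarrow> 'm) \<Rightarrow> ('v \<Rightarrow> 'm field) \<Rightarrow> 'm set \<Rightarrow> bool" where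
  "vertex_submodule s YN U \<longleftrightarrow>
     module.subspace s U \<and> (\<forall>u n. \<forall>w\<in>U. YN u (- n - 1) w \<in> U)"

definition vertex_irreducible ::
  "(complex \<Rightarrow> 'm::ab_group_add \<Rightarrow> 'm) \<Rightarrow> ('v \<Rightarrow> 'm field) \<Rightarrow> bool" where
  "vertex_irreducible s YN \<longleftrightarrow>
     (UNIV :: 'm set) \<noteq> {0} \<and> (\<forall>U. vertex_submodule s YN U \<longrightarrow> U = {0} \<or> U = UNIV)"

end

theory Submission
  imports Defs "HOL-Computational_Algebra.Formal_Power_Series"
begin

text \<open>
  Coefficientwise, the Jacobi identity is the Borcherds identity
  \<open>R(Y u, Y v)(p, n, q) = (\<Sum>i. (p choose i) Y(u\<^sub>(\<^sub>n\<^sub>+\<^sub>i\<^sub>) v)\<^sub>(\<^sub>p\<^sub>+\<^sub>q\<^sub>-\<^sub>i\<^sub>))\<close>, where \<open>R(b, c)(p, n, q)\<close> is the sum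
  \<open>(\<Sum>j. (-1)^j (n choose j) (b\<^sub>(\<^sub>p\<^sub>+\<^sub>n\<^sub>-\<^sub>j\<^sub>) c\<^sub>(\<^sub>q\<^sub>+\<^sub>j\<^sub>) - (-1)^n c\<^sub>(\<^sub>n\<^sub>+\<^sub>q\<^sub>-\<^sub>j\<^sub>) b\<^sub>(\<^sub>p\<^sub>+\<^sub>j\<^sub>)))\<close>.
  If \<open>A\<close> has commutators \<open>[A\<^sub>p, c\<^sub>q] = (\<Sum>s. (p choose s) (Z\<^sub>s)\<^sub>(\<^sub>p\<^sub>+\<^sub>q\<^sub>-\<^sub>s\<^sub>))\<close> with \<open>c\<close>, then
  \<open>R(:A b:, c)\<close> is expressed through \<open>R(b, c)\<close> and \<open>R(b, Z\<^sub>s)\<close>. For \<open>A\<close> a derivative of a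
  Heisenberg field this reduces the identity for \<open>(\<alpha>(-t-1) u, v)\<close> to that for \<open>u\<close>, and by the
  skew symmetry of \<open>R\<close> the second argument is reduced in the same way. What remains are \<open>e\<^sup>\<beta>\<close> and \<open>e\<^sup>\<gamma>\<close>. Their
  fields commute because \<open>L\<^sub>C\<close> is isotropic, and
  \<open>\<partial>\<^sub>m Y(e\<^sup>\<beta>) Y(e\<^sup>\<gamma>) = Y(S\<^sub>m e\<^sup>\<beta>\<^sup>+\<^sup>\<gamma>)\<close> for the coefficients \<open>S\<^sub>m\<close> of \<open>E\<^sup>-(-\<beta>, z)\<close>, since
  \<open>\<partial>Y(e\<^sup>\<beta>) = :\<beta> Y(e\<^sup>\<beta>):\<close> and \<open>m S\<^sub>m = (\<Sum>r=1..m. \<beta>(-r) S\<^sub>(\<^sub>m\<^sub>-\<^sub>r\<^sub>))\<close>.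

  For irreducibility, annihilation operators (available as \<open>k \<noteq> 0\<close>) carry every nonzero vector to
  some nonzero \<open>1 \<otimes> w\<close>, so the submodules of \<open>M(1) \<otimes> W\<close> are the \<open>M(1) \<otimes> U\<close> for \<open>A\<close>-submodules \<open>U\<close>.
\<close>

section \<open>Fields and the Borcherds identity\<close>

text \<open>The order of the induction matters. Reducing the first argument u uses the identity for
  u against all states A_s v, so v has to be arbitrary there. Reducing the second argument is done
  only where the commutator of A with Y(u) is a multiple of Y(u) itself, which holds for u =
  e^\<beta>. Hence v is reduced first, with u an exponential, and u afterwards. Isotropy of L_C
  enters three times: exponential fields commute, no power of z_1 - z_2 arises when they are
  multiplied, and z^\<beta> acts on V as the identity. For n = -1 - m the two expansions of (z_1 -
  z_2)^n therefore merge into one sum over all integers l with the weights binom(p + l, m),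
  polynomial in l; this is how the divided derivative \<partial>_m arises. All sums are infinite but
  finite on each vector, and \<open>Sum_any\<close> returns 0 on infinite support. Rearrangements
  are therefore carried out below a common bound N, obtained from statements that hold
  eventually.\<close>

lemma Sum_any_lessThan:
  "(\<And>i. i \<ge> N \<Longrightarrow> f i = 0) \<Longrightarrow> Sum_any f = sum f {..<N::nat}"
  by (rule Sum_any.expand_superset) (auto simp: not_less[symmetric])

lemma finite_support_nat:
  fixes f :: "nat \<Rightarrow> 'a::zero"
  shows "(\<And>i. i \<ge> N \<Longrightarrow> f i = 0) \<Longrightarrow> finite {i. f i \<noteq> 0}"
  by (rule finite_subset[of _ "{..<N}"]) (auto simp: not_less[symmetric])

lemma Sum_any_inj_reindex:
  fixes h :: "'a \<Rightarrow> 'b"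
  assumes "inj h" "\<And>y. y \<notin> range h \<Longrightarrow> g y = 0"
  shows "Sum_any g = Sum_any (\<lambda>x. g (h x))"
proof -
  have e: "{y. g y \<noteq> 0} = h ` {x. g (h x) \<noteq> 0}"
    using assms(2) by (auto simp: image_def) metis
  show ?thesis
    unfolding Sum_any.expand_set e
    by (subst sum.reindex) (auto intro: inj_on_subset[OF assms(1)] simp: o_def)
qed

lemma additive_Sum_any:
  fixes T :: "'a::ab_group_add \<Rightarrow> 'b::ab_group_add"
  shows "additive T \<Longrightarrow> finite {i. f i \<noteq> 0} \<Longrightarrow> T (Sum_any f) = Sum_any (\<lambda>i. T (f i))"
  by (subst Sum_any.expand_set, subst Sum_any.expand_superset[of "{i. f i \<noteq> 0}"])
     (auto simp: additive.sum additive.zero)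

text \<open>Unlike \<open>Vector_Spaces.linear\<close> this does not carry the vector space axioms,
  which come from the surrounding locale; the two equations serve directly as rewrite rules.\<close>

definition lin :: "(complex \<Rightarrow> 'a::ab_group_add \<Rightarrow> 'a) \<Rightarrow> ('a \<Rightarrow> 'a) \<Rightarrow> bool" where
  "lin s T \<longleftrightarrow> additive T \<and> (\<forall>c x. T (s c x) = s c (T x))"

lemma lin_additive: "lin s T \<Longrightarrow> additive T"
  by (simp add: lin_def)

lemma lin_scale: "lin s T \<Longrightarrow> T (s c x) = s c (T x)"
  by (simp add: lin_def)

lemmas lin_simps = lin_scale additive.add[OF lin_additive] additive.zero[OF lin_additive] additive.diff[OF lin_additive]
  additive.minus[OF lin_additive] additive.sum[OF lin_additive]

lemma linI: "(\<And>x y. T (x + y) = T x + T y) \<Longrightarrow> (\<And>c x. T (s c x) = s c (T x)) \<Longrightarrow> lin s T"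
  by (simp add: lin_def additive_def)

text \<open>
  Fields are indexed by modes: \<open>b n\<close> is the coefficient of \<open>z\<close> to the power \<open>- n - 1\<close>. The vertex
  operators of the definitions are indexed by the power of \<open>z\<close> itself.
\<close>

definition truncated :: "(int \<Rightarrow> 'a \<Rightarrow> 'b::zero) \<Rightarrow> bool" where
  "truncated b \<longleftrightarrow> (\<forall>w. \<exists>n0. \<forall>n\<ge>n0. b n w = 0)"

definition fieldop :: "(complex \<Rightarrow> 'a::ab_group_add \<Rightarrow> 'a) \<Rightarrow> (int \<Rightarrow> 'a \<Rightarrow> 'a) \<Rightarrow> bool" where
  "fieldop s b \<longleftrightarrow> (\<forall>n. lin s (b n)) \<and> truncated b"

lemma fieldop_lin: "fieldop s b \<Longrightarrow> lin s (b n)"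
  by (simp add: fieldop_def)

lemma fieldop_truncated: "fieldop s b \<Longrightarrow> truncated b"
  by (simp add: fieldop_def)

text \<open>Truncation in eventual form, so that finitely many bounds merge into a single N by
  \<open>eventually_conj\<close>.\<close>

lemma truncated_ev:
  assumes "truncated b"
  shows "\<forall>\<^sub>F N in sequentially. \<forall>r\<ge>N. b (p + int r) w = 0"
proof -
  obtain n0 where n0: "\<And>n. n \<ge> n0 \<Longrightarrow> b n w = 0"
    using assms by (auto simp: truncated_def)
  show ?thesis
    unfolding eventually_sequentially
    by (intro exI[of _ "nat (n0 - p)"] allI impI n0) linarith
qed

text \<open>Only finitely many j have f j nonzero, and each of the fields Y (f j) has its own bound,
  so one N serves both indices whatever the offsets p j are.\<close>

lemma truncated_ev_fields:
  assumes "\<And>x. truncated (Y x)" "\<And>n w. Y 0 n w = 0" "\<forall>\<^sub>F N in sequentially. \<forall>j\<ge>N. f j = (0 :: 'v::zero)"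
  shows "\<forall>\<^sub>F N in sequentially. \<forall>i j. i \<ge> N \<or> j \<ge> N \<longrightarrow> Y (f j) (p j + int i) w = 0"
proof -
  obtain J where J: "\<And>j. j \<ge> J \<Longrightarrow> f j = 0"
    using assms(3) by (auto simp: eventually_sequentially)
  have "\<forall>\<^sub>F N in sequentially. \<forall>j\<in>{..<J}. \<forall>i\<ge>N. Y (f j) (p j + int i) w = 0"
    by (intro eventually_ball_finite) (auto intro: truncated_ev assms)
  with eventually_ge_at_top[of J] show ?thesis
  proof eventually_elim
    case (elim N)
    show ?case
    proof (intro allI impI)
      fix i j assume "i \<ge> N \<or> j \<ge> N"
      then show "Y (f j) (p j + int i) w = 0"
        using elim J[of j] assms(2) by (cases "j < J") auto
    qed
  qed
qed

text \<open>The dual situation, one field on a family of vectors. The vector takes the place of the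
  label of a field, with \<open>unit\<close> as a dummy space to act on.\<close>

lemma truncated_ev_family:
  assumes "truncated b" "\<forall>\<^sub>F N in sequentially. \<forall>j\<ge>N. f j = 0" "\<And>n. b n 0 = 0"
  shows "\<forall>\<^sub>F N in sequentially. \<forall>i j. i \<ge> N \<or> j \<ge> N \<longrightarrow> b (p j + int i) (f j) = 0"
  by (rule truncated_ev_fields[where Y = "\<lambda>x n (_ :: unit). b n x"]) (use assms in \<open>auto simp: truncated_def\<close>)

text \<open>Mode q of the normally ordered product \<open>:A(z) b(z):\<close>. Both halves may share
  one \<open>Sum_any\<close>, because for fixed w the vectors b (q + i) w and A i w vanish for large
  i.\<close>

definition nprod :: "(int \<Rightarrow> 'a \<Rightarrow> 'a) \<Rightarrow> (int \<Rightarrow> 'a \<Rightarrow> 'a) \<Rightarrow> int \<Rightarrow> 'a::ab_group_add \<Rightarrow> 'a" where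
  "nprod A b q w = (\<Sum>i::nat. A (- 1 - int i) (b (q + int i) w) + b (q - 1 - int i) (A (int i) w))"

text \<open>
  Coefficient of \<open>z^j\<close> in \<open>(1 - z)^n\<close>.
\<close>

definition sbinom :: "int \<Rightarrow> nat \<Rightarrow> complex" where
  "sbinom n j = (- 1) ^ j * (of_int n gchoose j)"

definition neg1_pow :: "int \<Rightarrow> complex" where
  "neg1_pow n = (- 1) powi n"

lemma neg1_pow_add: "neg1_pow (m + n) = neg1_pow m * neg1_pow n"
  by (simp add: neg1_pow_def power_int_add)

lemma neg1_pow_sq [simp]: "neg1_pow n * neg1_pow n = 1"
  by (simp add: neg1_pow_def power_int_mult_distrib[symmetric])

lemma neg1_pow_minus [simp]: "neg1_pow (- n) = neg1_pow n"
  by (metis neg1_pow_def neg1_pow_sq power_int_minus inverse_unique)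

lemma neg1_pow_diff: "neg1_pow (m - n) = neg1_pow m * neg1_pow n"
  using neg1_pow_add[of m "-n"] by simp

lemma neg1_pow_nat [simp]: "neg1_pow (int j) = (- 1) ^ j"
  by (simp add: neg1_pow_def)

lemma neg1_pow_1 [simp]: "neg1_pow 1 = - 1"
  by (simp add: neg1_pow_def)

text \<open>In residue form: the coefficient of \<open>z_1^-1 z_2^-1\<close> in
  \<open>z_1^p z_2^q\<close> times (z_1 - z_2)^n b(z_1) c(z_2) - (z_1 - z_2)^n c(z_2) b(z_1), where
  the first power is expanded in nonnegative powers of z_2 and the second in those of z_1.\<close>

definition borcherds :: "(complex \<Rightarrow> 'a \<Rightarrow> 'a) \<Rightarrow> (int \<Rightarrow> 'a \<Rightarrow> 'a) \<Rightarrow> (int \<Rightarrow> 'a \<Rightarrow> 'a) \<Rightarrow>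
    int \<Rightarrow> int \<Rightarrow> int \<Rightarrow> 'a::ab_group_add \<Rightarrow> 'a" where
  "borcherds s b c p n q w = (\<Sum>j::nat. s (sbinom n j) (b (p + n - int j) (c (q + int j) w))
      - s (neg1_pow n * sbinom n j) (c (n + q - int j) (b (p + int j) w)))"

section \<open>Convolution identities for binomial coefficients\<close>

lemma gchoose_of_nat: "(of_int (int a) :: complex) gchoose j = of_nat (a choose j)"
  by (simp add: binomial_gbinomial)

lemma gchoose_neg: "(of_int (- 1 - int i) :: complex) gchoose s = (- 1) ^ s * of_nat ((i + s) choose s)"
proof -
  have "(- (of_nat (Suc i)) :: complex) gchoose s = (- 1) ^ s * ((of_nat (Suc i) + of_nat s - 1) gchoose s)"
    by (rule gbinomial_minus)
  also have "of_nat (Suc i) + of_nat s - 1 = (of_nat (i + s) :: complex)" by simp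
  finally show ?thesis by (simp add: binomial_gbinomial)
qed

lemma sbinom_neg: "sbinom (- 1 - int i) s = of_nat ((i + s) choose s)"
  by (simp only: sbinom_def gchoose_neg mult.assoc[symmetric] power_mult_distrib[symmetric]) simp

text \<open>Compare coefficients in (1 - z)^m (1 - z)^n = (1 - z)^(m+n).\<close>

lemma sbinom_Vandermonde: "(\<Sum>i\<le>r. sbinom m i * sbinom n (r - i)) = sbinom (m + n) r"
proof -
  have "(\<Sum>i\<le>r. sbinom m i * sbinom n (r - i)) =
    (\<Sum>i\<le>r. (- 1) ^ r * ((of_int m gchoose i) * (of_int n gchoose (r - i))))"
  proof (intro sum.cong refl)
    fix i assume "i \<in> {..r}"
    then have "(- 1 :: complex) ^ r = (- 1) ^ i * (- 1) ^ (r - i)"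
      by (simp flip: power_add)
    then show "sbinom m i * sbinom n (r - i) = (- 1) ^ r * ((of_int m gchoose i) * (of_int n gchoose (r - i)))"
      by (simp add: sbinom_def)
  qed
  also have "\<dots> = sbinom (m + n) r"
    by (simp add: sbinom_def gbinomial_Vandermonde atMost_atLeast0 flip: sum_distrib_left)
  finally show ?thesis .
qed

lemma gchoose_Vandermonde:
  "(\<Sum>i\<le>r. ((of_int m :: complex) gchoose i) * (of_int n gchoose (r - i))) = of_int (m + n) gchoose r"
  by (simp add: gbinomial_Vandermonde atMost_atLeast0)

text \<open>The binom(i, s) are the coefficients of z^s (1 - z)^(-1-s); multiplied by (1 - z)^n this
  is z^s (1 - z)^(n-1-s). Here the exponent n - 1 - s of \<open>borcherds_nprod\<close> originates,
  for the modes A i with i \<ge> 0.\<close>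

lemma sbinom_conv1:
  "(\<Sum>i\<le>r. of_nat (i choose s) * sbinom n (r - i)) = (if r < s then 0 else sbinom (n - 1 - int s) (r - s))"
proof (cases "r < s")
  case True
  then show ?thesis by (auto intro!: sum.neutral)
next
  case False
  have "(\<Sum>i\<le>r. of_nat (i choose s) * sbinom n (r - i)) = (\<Sum>i\<in>{s..r}. of_nat (i choose s) * sbinom n (r - i))"
    by (rule sum.mono_neutral_right) auto
  also have "\<dots> = (\<Sum>i\<le>r - s. of_nat ((s + i) choose i) * sbinom n (r - s - i))"
  proof (rule sum.reindex_bij_witness[of _ "\<lambda>i. s + i" "\<lambda>i. i - s"])
    fix i assume i: "i \<in> {s..r}"
    then have "(s + (i - s) choose (i - s)) = (i choose s)"
      using binomial_symmetric[of s i] by simp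
    with i show "of_nat (s + (i - s) choose (i - s)) * sbinom n (r - s - (i - s)) = of_nat (i choose s) * sbinom n (r - i)"
      by simp
  qed (use False in auto)
  also have "\<dots> = (\<Sum>i\<le>r - s. sbinom (- 1 - int s) i * sbinom n (r - s - i))"
    by (simp add: sbinom_neg)
  also have "\<dots> = sbinom (n - 1 - int s) (r - s)"
    unfolding sbinom_Vandermonde by (simp add: algebra_simps)
  finally show ?thesis using False by simp
qed

text \<open>The counterpart for the modes A (-1-i): binom(-1-i, s) is (-1)^s times the coefficient
  of z^i in (1 - z)^(-1-s).\<close>

lemma sbinom_conv2:
  "(\<Sum>i\<le>r. (of_int (- 1 - int i) gchoose s) * sbinom n (r - i)) = (- 1) ^ s * sbinom (n - 1 - int s) r"
proof -
  have "(\<Sum>i\<le>r. (of_int (- 1 - int i) gchoose s) * sbinom n (r - i)) =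
      (- 1) ^ s * (\<Sum>i\<le>r. sbinom (- 1 - int s) i * sbinom n (r - i))"
    unfolding sum_distrib_left
  proof (intro sum.cong refl)
    fix i
    have "(i + s choose s) = (s + i choose i)"
      using binomial_symmetric[of s "i + s"] by (simp add: add.commute)
    then show "(of_int (- 1 - int i) gchoose s) * sbinom n (r - i) =
          (- 1) ^ s * (sbinom (- 1 - int s) i * sbinom n (r - i))"
      by (simp only: gchoose_neg sbinom_neg mult.assoc)
  qed
  then show ?thesis
    unfolding sbinom_Vandermonde by (simp add: algebra_simps)
qed

lemma sum_square_conv:
  fixes F :: "nat \<Rightarrow> nat \<Rightarrow> 'a::comm_monoid_add"
  assumes "\<And>i j. i + j \<ge> N \<Longrightarrow> F i j = 0"
  shows "(\<Sum>i<N. \<Sum>j<N. F i j) = (\<Sum>r<N. \<Sum>i\<le>r. F i (r - i))"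
proof -
  have "(\<Sum>i<N. \<Sum>j<N. F i j) = (\<Sum>(i,j)\<in>{..<N} \<times> {..<N}. F i j)"
    by (simp add: sum.cartesian_product)
  also have "\<dots> = (\<Sum>(i,j)\<in>{(i,j). i + j < N}. F i j)"
    using assms by (intro sum.mono_neutral_right) (auto simp: not_less[symmetric])
  also have "\<dots> = (\<Sum>r<N. \<Sum>i\<le>r. F i (r - i))"
    by (rule sum.triangle_reindex)
  finally show ?thesis .
qed

context vector_space
begin

lemma scale_conv:
  fixes N :: nat
  assumes "\<And>r. r \<ge> N \<Longrightarrow> g r = 0"
  shows "(\<Sum>i<N. \<Sum>j<N. scale (f i j) (g (i + j))) = (\<Sum>r<N. scale (\<Sum>i\<le>r. f i (r - i)) (g r))"
proof -
  have "(\<Sum>i<N. \<Sum>j<N. scale (f i j) (g (i + j))) = (\<Sum>r<N. \<Sum>i\<le>r. scale (f i (r - i)) (g (i + (r - i))))"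
    by (rule sum_square_conv[of N "\<lambda>i j. scale (f i j) (g (i + j))"]) (simp add: assms)
  also have "\<dots> = (\<Sum>r<N. scale (\<Sum>i\<le>r. f i (r - i)) (g r))"
    by (intro sum.cong refl) (auto simp: scale_sum_left intro!: sum.cong)
  finally show ?thesis .
qed

end

locale complex_vs = vector_space scale
  for scale :: "complex \<Rightarrow> 'b::ab_group_add \<Rightarrow> 'b"
begin

text \<open>
  Normal ordering the \<open>A\<close>-modes out of \<open>borcherds\<close> produces the first two sums; the third collects
  the commutators of \<open>A\<close> with \<open>c\<close>, which recombine by Vandermonde convolution.
\<close>

lemma borcherds_nprod:
  assumes A: "fieldop scale A" and b: "fieldop scale b" and c: "fieldop scale c" and Z: "\<And>s. fieldop scale (Z s)"
    and comm: "\<And>p q w. A p (c q w) - c q (A p w) = (\<Sum>s<S. scale (of_int p gchoose s) (Z s (p + q - int s) w))"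
  shows "borcherds scale (nprod A b) c p n q w =
     (\<Sum>i::nat. A (- 1 - int i) (borcherds scale b c (p + int i) n q w))
   + (\<Sum>i::nat. borcherds scale b c (p - 1 - int i) n q (A (int i) w))
   + (\<Sum>s<S. borcherds scale b (Z s) p (n - 1 - int s) q w)"
proof -
  note lA = lin_simps[OF fieldop_lin[OF A]] and lb = lin_simps[OF fieldop_lin[OF b]]
    and lc = lin_simps[OF fieldop_lin[OF c]] and lZ = lin_simps[OF fieldop_lin[OF Z]]
  note tA = fieldop_truncated[OF A] and tb = fieldop_truncated[OF b] and tc = fieldop_truncated[OF c] and tZ = fieldop_truncated[OF Z]
  have fc: "\<forall>\<^sub>F N in sequentially. \<forall>j\<ge>N. c (q + int j) w = 0"
    and fA: "\<forall>\<^sub>F N in sequentially. \<forall>i\<ge>N. A (int i) w = 0"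
    using truncated_ev[OF tc, of q w] truncated_ev[OF tA, of 0 w] by simp_all
  \<comment> \<open>One N for all sums below. Some modes act on the vectors A i w or c (q + j) w,
    where the bound has to hold for two indices at once.\<close>
  have ev: "\<forall>\<^sub>F N in sequentially. (\<forall>i j. i \<ge> N \<or> j \<ge> N \<longrightarrow> b (p + n - int j + int i) (c (q + int j) w) = 0) \<and>
      (\<forall>i j. i \<ge> N \<or> j \<ge> N \<longrightarrow> A (0 + int i) (c (q + int j) w) = 0) \<and>
      (\<forall>j\<ge>N. c (q + int j) w = 0) \<and>
      (\<forall>r\<ge>N. b (p + int r) w = 0) \<and>
      (\<forall>i\<ge>N. A (int i) w = 0) \<and>
      (\<forall>j i. j \<ge> N \<or> i \<ge> N \<longrightarrow> b (p - 1 - int i + int j) (A (int i) w) = 0) \<and>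
      (\<forall>j i. j \<ge> N \<or> i \<ge> N \<longrightarrow> c (q + int j) (A (int i) w) = 0) \<and>
      (\<forall>s\<in>{..<S}. \<forall>r\<ge>N. Z s (q - int s + int r) w = 0)"
    (is "\<forall>\<^sub>F N in _. ?P N")
    by (intro eventually_conj truncated_ev_family[OF tb fc] truncated_ev_family[OF tA fc] truncated_ev_family[OF tb fA]
        truncated_ev_family[OF tc fA] fc fA truncated_ev[OF tb] eventually_ball_finite ballI truncated_ev[OF tZ])
       (simp_all add: lA lb lc)
  obtain N where
      E1: "\<And>i j. i \<ge> N \<or> j \<ge> N \<Longrightarrow> b (p + n - int j + int i) (c (q + int j) w) = 0"
    and E2: "\<And>i j. i \<ge> N \<or> j \<ge> N \<Longrightarrow> A (int i) (c (q + int j) w) = 0"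
    and E0: "\<And>j. j \<ge> N \<Longrightarrow> c (q + int j) w = 0"
    and E3: "\<And>r. r \<ge> N \<Longrightarrow> b (p + int r) w = 0"
    and E4: "\<And>i. i \<ge> N \<Longrightarrow> A (int i) w = 0"
    and E5: "\<And>i j. j \<ge> N \<or> i \<ge> N \<Longrightarrow> b (p - 1 - int i + int j) (A (int i) w) = 0"
    and E6: "\<And>i j. j \<ge> N \<or> i \<ge> N \<Longrightarrow> c (q + int j) (A (int i) w) = 0"
    and E7: "\<And>s r. s < S \<Longrightarrow> r \<ge> N \<Longrightarrow> Z s (q - int s + int r) w = 0"
  proof -
    obtain N where "?P N"
      using eventually_happens[OF ev] by auto
    then show thesis
      by (intro that[of N]) auto
  qed
  have E3': "b (p + int j + int i) w = 0" if "i \<ge> N \<or> j \<ge> N" for i j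
    using E3[of "j + i"] that by (auto simp: add.assoc)
  have E5': "b (p + int j - 1 - int i) (A (int i) w) = 0" if "i \<ge> N \<or> j \<ge> N" for i j
    using E5[of j i] that by (auto simp: algebra_simps)
  have np1: "nprod A b (p + n - int j) (c (q + int j) w) =
      (\<Sum>i<N. A (- 1 - int i) (b (p + n - int j + int i) (c (q + int j) w))
            + b (p + n - int j - 1 - int i) (A (int i) (c (q + int j) w)))" for j
    unfolding nprod_def by (rule Sum_any_lessThan) (simp add: E1 E2 lA lb)
  have np2: "nprod A b (p + int j) w =
      (\<Sum>i<N. A (- 1 - int i) (b (p + int j + int i) w) + b (p + int j - 1 - int i) (A (int i) w))" for j
    unfolding nprod_def by (rule Sum_any_lessThan) (simp add: E3' E4 lA lb)
  have np1': "nprod A b (p + n - int j) (c (q + int j) w) = 0" if "j \<ge> N" for j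
    unfolding np1 using that by (simp add: E1 E2 lA lb)
  have np2': "nprod A b (p + int j) w = 0" if "j \<ge> N" for j
    unfolding np2 using that by (simp add: E3' E5' lA lb)
  define t where "t i j = scale (sbinom n j) (A (- 1 - int i) (b (p + n - int j + int i) (c (q + int j) w)))
      + scale (sbinom n j) (b (p + n - int j - 1 - int i) (A (int i) (c (q + int j) w)))
      - scale (neg1_pow n * sbinom n j) (c (n + q - int j) (A (- 1 - int i) (b (p + int j + int i) w)))
      - scale (neg1_pow n * sbinom n j) (c (n + q - int j) (b (p + int j - 1 - int i) (A (int i) w)))" for i j
  have inner: "scale (sbinom n j) (nprod A b (p + n - int j) (c (q + int j) w))
      - scale (neg1_pow n * sbinom n j) (c (n + q - int j) (nprod A b (p + int j) w)) = (\<Sum>i<N. t i j)" for j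
    unfolding np1 np2 t_def lc scale_sum_right scale_right_distrib sum.distrib sum_subtractf
    by (simp add: algebra_simps)
  have L: "borcherds scale (nprod A b) c p n q w = (\<Sum>j<N. \<Sum>i<N. t i j)"
    unfolding borcherds_def
    by (subst Sum_any_lessThan[of N]) (simp add: np1' np2' lc, simp only: inner)
  have B1: "borcherds scale b c (p + int i) n q w = (\<Sum>j<N. scale (sbinom n j) (b (p + int i + n - int j) (c (q + int j) w))
      - scale (neg1_pow n * sbinom n j) (c (n + q - int j) (b (p + int i + int j) w)))" for i
    unfolding borcherds_def by (rule Sum_any_lessThan) (use E3'[of _ i] in \<open>simp add: E0 E3' lb lc algebra_simps\<close>)
  have B2: "borcherds scale b c (p - 1 - int i) n q (A (int i) w) =
     (\<Sum>j<N. scale (sbinom n j) (b (p - 1 - int i + n - int j) (c (q + int j) (A (int i) w)))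
      - scale (neg1_pow n * sbinom n j) (c (n + q - int j) (b (p - 1 - int i + int j) (A (int i) w))))" for i
    unfolding borcherds_def by (rule Sum_any_lessThan) (simp add: E6 E5 lb lc)
  have B1': "borcherds scale b c (p + int i) n q w = 0" if "i \<ge> N" for i
    unfolding B1 using that E1[of i] E3'[of _ i] by (simp add: lc algebra_simps)
  have B2': "borcherds scale b c (p - 1 - int i) n q (A (int i) w) = 0" if "i \<ge> N" for i
    unfolding B2 using that by (simp add: E6 E5 lb lc)
  have R1: "(\<Sum>i::nat. A (- 1 - int i) (borcherds scale b c (p + int i) n q w)) =
      (\<Sum>i<N. A (- 1 - int i) (borcherds scale b c (p + int i) n q w))"
    by (rule Sum_any_lessThan) (simp add: B1' lA)
  have R2: "(\<Sum>i::nat. borcherds scale b c (p - 1 - int i) n q (A (int i) w)) =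
      (\<Sum>i<N. borcherds scale b c (p - 1 - int i) n q (A (int i) w))"
    by (rule Sum_any_lessThan) (simp add: B2')
  \<comment> \<open>The commutator fields depend on i and j through i + j only, which makes the
    convolution along i + j = r possible.\<close>
  define g1 where "g1 s r = b (p + n - 1 - int r) (Z s (q - int s + int r) w)" for s r
  define g2 where "g2 s r = Z s (n + q - 1 - int s - int r) (b (p + int r) w)" for s r
  \<comment> \<open>Terms with A in the middle are rewritten with A outermost: A i moves to the
    right past c, and A (-1-i) to the left past c. The last two sums are the commutators.\<close>
  have d: "t i j = A (- 1 - int i) (scale (sbinom n j) (b (p + int i + n - int j) (c (q + int j) w))
      - scale (neg1_pow n * sbinom n j) (c (n + q - int j) (b (p + int i + int j) w)))
    + (scale (sbinom n j) (b (p - 1 - int i + n - int j) (c (q + int j) (A (int i) w)))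
      - scale (neg1_pow n * sbinom n j) (c (n + q - int j) (b (p - 1 - int i + int j) (A (int i) w))))
    + ((\<Sum>s<S. scale (of_nat (i choose s) * sbinom n j) (g1 s (i + j)))
      + (\<Sum>s<S. scale (neg1_pow n * ((of_int (- 1 - int i) gchoose s) * sbinom n j)) (g2 s (i + j))))" for i j
  proof -
    have 1: "(\<Sum>s<S. scale (of_nat (i choose s) * sbinom n j) (g1 s (i + j))) =
       scale (sbinom n j) (b (p + n - int j - 1 - int i) (A (int i) (c (q + int j) w) - c (q + int j) (A (int i) w)))"
      unfolding comm gchoose_of_nat g1_def
      by (simp add: lb scale_sum_right algebra_simps)
    have 2: "(\<Sum>s<S. scale (neg1_pow n * ((of_int (- 1 - int i) gchoose s) * sbinom n j)) (g2 s (i + j))) =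
       scale (neg1_pow n * sbinom n j) (A (- 1 - int i) (c (n + q - int j) (b (p + int j + int i) w))
          - c (n + q - int j) (A (- 1 - int i) (b (p + int j + int i) w)))"
      unfolding comm g2_def scale_sum_right by (intro sum.cong refl) (simp add: algebra_simps)
    show ?thesis
      unfolding 1 2 t_def lA lb by (simp add: scale_right_diff_distrib algebra_simps)
  qed
  have c1: "(\<Sum>i<N. \<Sum>j<N. scale (of_nat (i choose s) * sbinom n j) (g1 s (i + j))) =
     (\<Sum>r<N. scale (sbinom (n - 1 - int s) r) (b (p + (n - 1 - int s) - int r) (Z s (q + int r) w)))" if s: "s < S" for s
  proof -
    have z: "g1 s r = 0" if "r \<ge> N" for r using E7[OF s that] by (simp add: g1_def lb)
    have "(\<Sum>i<N. \<Sum>j<N. scale (of_nat (i choose s) * sbinom n j) (g1 s (i + j))) =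
      (\<Sum>r<N. scale (\<Sum>i\<le>r. of_nat (i choose s) * sbinom n (r - i)) (g1 s r))"
      by (rule scale_conv) (rule z)
    also have "\<dots> = (\<Sum>r<N. scale (if r < s then 0 else sbinom (n - 1 - int s) (r - s)) (g1 s r))"
      by (simp only: sbinom_conv1)
    \<comment> \<open>The upper end N + s is harmless because g1 vanishes from N on; after the shift
      by s the range is \<open>{..<N}\<close>.\<close>
    also have "\<dots> = (\<Sum>r\<in>{s..<N + s}. scale (sbinom (n - 1 - int s) (r - s)) (g1 s r))"
      by (rule sum.mono_neutral_cong) (auto simp: z)
    also have "\<dots> = (\<Sum>r<N. scale (sbinom (n - 1 - int s) r) (g1 s (r + s)))"
      by (rule sum.reindex_bij_witness[of _ "\<lambda>r. r + s" "\<lambda>r. r - s"]) auto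
    finally show ?thesis by (simp add: g1_def algebra_simps)
  qed
  have c2: "(\<Sum>i<N. \<Sum>j<N. scale (neg1_pow n * ((of_int (- 1 - int i) gchoose s) * sbinom n j)) (g2 s (i + j))) =
     (\<Sum>r<N. scale (neg1_pow n * (- 1) ^ s * sbinom (n - 1 - int s) r) (Z s (n - 1 - int s + q - int r) (b (p + int r) w)))"
     if s: "s < S" for s
  proof -
    have z: "g2 s r = 0" if "r \<ge> N" for r using E3[OF that] by (simp add: g2_def lZ)
    have "(\<Sum>i<N. \<Sum>j<N. scale (neg1_pow n * ((of_int (- 1 - int i) gchoose s) * sbinom n j)) (g2 s (i + j))) =
       (\<Sum>r<N. scale (\<Sum>i\<le>r. neg1_pow n * ((of_int (- 1 - int i) gchoose s) * sbinom n (r - i))) (g2 s r))"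
      by (rule scale_conv) (rule z)
    also have "\<dots> = (\<Sum>r<N. scale (neg1_pow n * ((- 1) ^ s * sbinom (n - 1 - int s) r)) (g2 s r))"
      by (simp only: sbinom_conv2 flip: sum_distrib_left)
    finally show ?thesis by (simp add: g2_def algebra_simps)
  qed
  have B3: "borcherds scale b (Z s) p (n - 1 - int s) q w =
     (\<Sum>r<N. scale (sbinom (n - 1 - int s) r) (b (p + (n - 1 - int s) - int r) (Z s (q + int r) w)))
   + (\<Sum>r<N. scale (neg1_pow n * (- 1) ^ s * sbinom (n - 1 - int s) r) (Z s (n - 1 - int s + q - int r) (b (p + int r) w)))"
    if s: "s < S" for s
  proof -
    have "Z s (q + int r) w = 0" if "r \<ge> N" for r
      using E7[OF s, of "r + s"] that by (simp add: algebra_simps)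
    then have "borcherds scale b (Z s) p (n - 1 - int s) q w =
      (\<Sum>r<N. scale (sbinom (n - 1 - int s) r) (b (p + (n - 1 - int s) - int r) (Z s (q + int r) w)) -
        scale (neg1_pow (n - 1 - int s) * sbinom (n - 1 - int s) r) (Z s (n - 1 - int s + q - int r) (b (p + int r) w)))"
      unfolding borcherds_def by (intro Sum_any_lessThan) (simp add: E3 lb lZ)
    \<comment> \<open>Lowering n by 1 + s changes the sign of the second half of
      \<open>borcherds\<close> by -(-1)^s, which gives the sign found in \<open>c2\<close>.\<close>
    also have "neg1_pow (n - 1 - int s) = - (neg1_pow n * (- 1) ^ s)"
      by (simp add: neg1_pow_diff)
    finally show ?thesis by (simp add: sum.distrib)
  qed
  have "(\<Sum>j<N. \<Sum>i<N. t i j) = (\<Sum>i<N. \<Sum>j<N. t i j)"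
    by (rule sum.swap)
  also have "\<dots> = (\<Sum>i<N. A (- 1 - int i) (borcherds scale b c (p + int i) n q w))
     + (\<Sum>i<N. borcherds scale b c (p - 1 - int i) n q (A (int i) w))
     + ((\<Sum>i<N. \<Sum>j<N. \<Sum>s<S. scale (of_nat (i choose s) * sbinom n j) (g1 s (i + j)))
     + (\<Sum>i<N. \<Sum>j<N. \<Sum>s<S. scale (neg1_pow n * ((of_int (- 1 - int i) gchoose s) * sbinom n j)) (g2 s (i + j))))"
    unfolding d B1 B2 lA(6) sum.distrib by (simp only: add.assoc)
  also have "(\<Sum>i<N. \<Sum>j<N. \<Sum>s<S. scale (of_nat (i choose s) * sbinom n j) (g1 s (i + j))) =
      (\<Sum>s<S. \<Sum>i<N. \<Sum>j<N. scale (of_nat (i choose s) * sbinom n j) (g1 s (i + j)))"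
    by (subst (2) sum.swap, subst sum.swap, rule refl)
  also have "(\<Sum>i<N. \<Sum>j<N. \<Sum>s<S. scale (neg1_pow n * ((of_int (- 1 - int i) gchoose s) * sbinom n j)) (g2 s (i + j))) =
      (\<Sum>s<S. \<Sum>i<N. \<Sum>j<N. scale (neg1_pow n * ((of_int (- 1 - int i) gchoose s) * sbinom n j)) (g2 s (i + j)))"
    by (subst (2) sum.swap, subst sum.swap, rule refl)
  also have "(\<Sum>s<S. \<Sum>i<N. \<Sum>j<N. scale (of_nat (i choose s) * sbinom n j) (g1 s (i + j))) +
     (\<Sum>s<S. \<Sum>i<N. \<Sum>j<N. scale (neg1_pow n * ((of_int (- 1 - int i) gchoose s) * sbinom n j)) (g2 s (i + j)))
     = (\<Sum>s<S. borcherds scale b (Z s) p (n - 1 - int s) q w)"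
    by (subst sum.distrib[symmetric]) (intro sum.cong refl, simp only: c1 c2 B3 lessThan_iff)
  finally show ?thesis
    unfolding L R1 R2 .
qed

text \<open>
  Here \<open>Y\<close> is the state-field map, \<open>AV\<close> and \<open>uV\<close> are the modes on states corresponding to the
  fields \<open>A\<close> and \<open>b\<close>, and \<open>neg\<close> is the expansion of \<open>Y (AV (- 1 - r) x)\<close> as a normally ordered
  product with a divided derivative of \<open>A\<close>.
\<close>

lemma borcherds_nprod_eq:
  fixes Y :: "'v::ab_group_add \<Rightarrow> int \<Rightarrow> 'b \<Rightarrow> 'b" and AV uV :: "int \<Rightarrow> 'v \<Rightarrow> 'v"
  assumes A: "fieldop scale A" and b: "fieldop scale b" and Y: "\<And>v. fieldop scale (Y v)"
    and Yadd: "\<And>n w. additive (\<lambda>v. Y v n w)"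
    and AV: "truncated AV" "\<And>n. additive (AV n)" and uV: "truncated uV" "\<And>n. additive (uV n)"
    and comm: "\<And>S v p q w. (\<And>s. s \<ge> S \<Longrightarrow> AV (int s) v = 0) \<Longrightarrow>
      A p (Y v q w) - Y v q (A p w) = (\<Sum>s<S. scale (of_int p gchoose s) (Y (AV (int s) v) (p + q - int s) w))"
    and neg: "\<And>r x q w. Y (AV (- 1 - int r) x) q w =
      (\<Sum>h::nat. scale (of_nat ((r + h) choose h)) (A (- 1 - int r - int h) (Y x (q + int h) w))
         + scale ((- 1) ^ r * of_nat ((r + h) choose h)) (Y x (q - 1 - int r - int h) (A (int h) w)))"
    and J: "\<And>v p n q w. borcherds scale b (Y v) p n q w =
      (\<Sum>i::nat. scale (of_int p gchoose i) (Y (uV (n + int i) v) (p + q - int i) w))"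
  shows "borcherds scale (nprod A b) (Y v) p n q w =
      (\<Sum>i::nat. scale (of_int p gchoose i) (Y (nprod AV uV (n + int i) v) (p + q - int i) w))"
proof -
  note lA = lin_simps[OF fieldop_lin[OF A]] and lY = lin_simps[OF fieldop_lin[OF Y]]
  note aY = additive.add[OF Yadd] additive.zero[OF Yadd] additive.sum[OF Yadd]
  note aV = additive.zero[OF AV(2)] additive.zero[OF uV(2)]
  have Y0: "Y 0 n w = 0" for n w by (rule additive.zero[OF Yadd])
  have f1: "\<forall>\<^sub>F N in sequentially. \<forall>j\<ge>N. AV (int j) v = 0"
    using truncated_ev[OF AV(1), of 0 v] by simp
  have f2: "\<forall>\<^sub>F N in sequentially. \<forall>j\<ge>N. uV (n + int j) v = 0"
    by (rule truncated_ev[OF uV(1)])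
  have f3: "\<forall>\<^sub>F N in sequentially. \<forall>j\<ge>N. A (int j) w = 0"
    using truncated_ev[OF fieldop_truncated[OF A], of 0 w] by simp
  have ev: "\<forall>\<^sub>F N in sequentially. (\<forall>j\<ge>N. AV (int j) v = 0) \<and> (\<forall>j\<ge>N. uV (n + int j) v = 0) \<and>
     (\<forall>j\<ge>N. A (int j) w = 0) \<and>
     (\<forall>i s. i \<ge> N \<or> s \<ge> N \<longrightarrow> uV (n - 1 - int s + int i) (AV (int s) v) = 0) \<and>
     (\<forall>i j. i \<ge> N \<or> j \<ge> N \<longrightarrow> Y (uV (n + int j) v) (p + q - int j + int i) w = 0)"
    (is "\<forall>\<^sub>F N in _. ?P N")
    by (intro eventually_conj f1 f2 f3 truncated_ev_family[OF uV(1) f1]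
        truncated_ev_fields[where Y = Y and f = "\<lambda>j. uV (n + int j) v", OF fieldop_truncated[OF Y] Y0 f2]) (simp add: aV)
  obtain N where
        N1: "\<And>j. j \<ge> N \<Longrightarrow> AV (int j) v = 0"
    and N2: "\<And>j. j \<ge> N \<Longrightarrow> uV (n + int j) v = 0"
    and N3: "\<And>j. j \<ge> N \<Longrightarrow> A (int j) w = 0"
    and N4: "\<And>i s. i \<ge> N \<or> s \<ge> N \<Longrightarrow> uV (n - 1 - int s + int i) (AV (int s) v) = 0"
    and N5: "\<And>i j. i \<ge> N \<or> j \<ge> N \<Longrightarrow> Y (uV (n + int j) v) (p + q - int j + int i) w = 0"
  proof -
    obtain N where "?P N"
      using eventually_happens[OF ev] by auto
    then show thesis
      by (intro that[of N]) auto
  qed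
  \<comment> \<open>Both sides are linear combinations of the vectors G, H and K: A creating on the
    left, A annihilating on the right, and AV annihilating inside the state. The coefficients are
    compared one kind at a time.\<close>
  define G where "G g j = A (- 1 - int g) (Y (uV (n + int j) v) (p + q - int j + int g) w)" for g j
  define H where "H h j = Y (uV (n + int j) v) (p + q - 1 - int h - int j) (A (int h) w)" for h j
  define K where "K i r = Y (uV (n + int i - 1 - int r) (AV (int r) v)) (p + q - int i) w" for i r
  have G0: "G g j = 0" if "g \<ge> N \<or> j \<ge> N" for g j
    using N5[of g j] that by (auto simp: G_def lA)
  have H0: "H h j = 0" if "h \<ge> N \<or> j \<ge> N" for h j
    using N2[of j] N3[of h] that by (auto simp: H_def lY Y0)
  have K0: "K i r = 0" if "i \<ge> N \<or> r \<ge> N" for i r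
    using N4[of i r] that by (auto simp: K_def Y0 algebra_simps)
  have "borcherds scale (nprod A b) (Y v) p n q w =
      (\<Sum>i::nat. A (- 1 - int i) (borcherds scale b (Y v) (p + int i) n q w))
   + (\<Sum>i::nat. borcherds scale b (Y v) (p - 1 - int i) n q (A (int i) w))
   + (\<Sum>s<N. borcherds scale b (Y (AV (int s) v)) p (n - 1 - int s) q w)"
    by (rule borcherds_nprod[OF A b Y Y comm[OF N1]])
  also have "(\<Sum>i::nat. A (- 1 - int i) (borcherds scale b (Y v) (p + int i) n q w)) =
     (\<Sum>i<N. \<Sum>j<N. scale (of_int (p + int i) gchoose j) (G i j))"
  proof -
    have e: "A (- 1 - int i) (borcherds scale b (Y v) (p + int i) n q w) =
        (\<Sum>j<N. scale (of_int (p + int i) gchoose j) (G i j))" for i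
    proof -
      have "borcherds scale b (Y v) (p + int i) n q w =
         (\<Sum>j<N. scale (of_int (p + int i) gchoose j) (Y (uV (n + int j) v) (p + int i + q - int j) w))"
        unfolding J by (rule Sum_any_lessThan) (simp add: N2 Y0)
      then show ?thesis by (simp add: lA G_def algebra_simps)
    qed
    show ?thesis
      unfolding e by (rule Sum_any_lessThan) (simp add: G0)
  qed
  also have "(\<Sum>i::nat. borcherds scale b (Y v) (p - 1 - int i) n q (A (int i) w)) =
     (\<Sum>i<N. \<Sum>j<N. scale (of_int (p - 1 - int i) gchoose j) (H i j))"
  proof -
    have e: "borcherds scale b (Y v) (p - 1 - int i) n q (A (int i) w) =
         (\<Sum>j<N. scale (of_int (p - 1 - int i) gchoose j) (H i j))" for i
    proof -
      have e1: "p - 1 - int i + q - int j = p + q - 1 - int i - int j" for j by simp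
      show ?thesis
        unfolding J H_def e1 by (rule Sum_any_lessThan) (simp add: N2 Y0)
    qed
    show ?thesis
      unfolding e by (rule Sum_any_lessThan) (simp add: H0)
  qed
  also have "(\<Sum>s<N. borcherds scale b (Y (AV (int s) v)) p (n - 1 - int s) q w) =
     (\<Sum>s<N. \<Sum>i<N. scale (of_int p gchoose i) (K i s))"
  proof (intro sum.cong refl)
    fix s
    have e1: "n - 1 - int s + int i = n + int i - 1 - int s" for i by simp
    show "borcherds scale b (Y (AV (int s) v)) p (n - 1 - int s) q w = (\<Sum>i<N. scale (of_int p gchoose i) (K i s))"
      unfolding J K_def e1 by (rule Sum_any_lessThan) (use N4[of _ s] in \<open>simp add: Y0 e1\<close>)
  qed
  finally have L: "borcherds scale (nprod A b) (Y v) p n q w =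
     (\<Sum>i<N. \<Sum>j<N. scale (of_int (p + int i) gchoose j) (G i j))
   + (\<Sum>i<N. \<Sum>j<N. scale (of_int (p - 1 - int i) gchoose j) (H i j))
   + (\<Sum>s<N. \<Sum>i<N. scale (of_int p gchoose i) (K i s))" .
  have neg': "Y (AV (- 1 - int r) (uV (n + int i + int r) v)) (p + q - int i) w =
      (\<Sum>h<N. scale (of_nat ((r + h) choose h)) (G (r + h) (i + r)))
    + (\<Sum>h<N. scale ((- 1) ^ r * of_nat ((r + h) choose h)) (H h (i + r)))" for i r
  proof -
    have i1: "n + int i + int r = n + int (i + r)" by simp
    have i2: "A (- 1 - int r - int h) (Y (uV (n + int (i + r)) v) (p + q - int i + int h) w) = G (r + h) (i + r)" for h
      by (simp add: G_def algebra_simps)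
    have i3: "Y (uV (n + int (i + r)) v) (p + q - int i - 1 - int r - int h) (A (int h) w) = H h (i + r)" for h
      by (simp add: H_def algebra_simps)
    show ?thesis
      unfolding neg i1 i2 i3 sum.distrib[symmetric] by (rule Sum_any_lessThan) (simp add: G0 H0)
  qed
  have R1: "nprod AV uV (n + int i) v =
     (\<Sum>r<N. AV (- 1 - int r) (uV (n + int i + int r) v) + uV (n + int i - 1 - int r) (AV (int r) v))" for i
    unfolding nprod_def
  proof (rule Sum_any_lessThan)
    fix r assume "r \<ge> N"
    then show "AV (- 1 - int r) (uV (n + int i + int r) v) + uV (n + int i - 1 - int r) (AV (int r) v) = 0"
      using N2[of "i + r"] N1[of r] by (simp add: aV add.assoc)
  qed
  have R2: "Y (nprod AV uV (n + int i) v) (p + q - int i) w =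
     (\<Sum>r<N. \<Sum>h<N. scale (of_nat ((r + h) choose h)) (G (r + h) (i + r)))
   + (\<Sum>r<N. \<Sum>h<N. scale ((- 1) ^ r * of_nat ((r + h) choose h)) (H h (i + r))) + (\<Sum>r<N. K i r)" for i
    unfolding R1 aY neg' K_def by (simp add: sum.distrib)
  have R3: "Y (nprod AV uV (n + int i) v) (p + q - int i) w = 0" if "i \<ge> N" for i
    unfolding R2 using that by (simp add: G0 H0 K0)
  have "(\<Sum>i::nat. scale (of_int p gchoose i) (Y (nprod AV uV (n + int i) v) (p + q - int i) w)) =
    (\<Sum>i<N. scale (of_int p gchoose i) (Y (nprod AV uV (n + int i) v) (p + q - int i) w))"
    by (rule Sum_any_lessThan) (simp add: R3)
  also have "\<dots> = (\<Sum>i<N. \<Sum>r<N. \<Sum>h<N. scale ((of_int p gchoose i) * of_nat ((r + h) choose h)) (G (r + h) (i + r)))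
    + (\<Sum>i<N. \<Sum>r<N. \<Sum>h<N. scale ((of_int p gchoose i) * ((- 1) ^ r * of_nat ((r + h) choose h))) (H h (i + r)))
    + (\<Sum>i<N. \<Sum>r<N. scale (of_int p gchoose i) (K i r))"
    unfolding R2 by (simp add: scale_right_distrib scale_sum_right sum.distrib)
  \<comment> \<open>Regroup by g = r + h and j = i + r. Since binom(r+h, h) = binom(g, r), the
    coefficient of G g j is the Vandermonde sum for binom(p + g, j).\<close>
  also have "(\<Sum>i<N. \<Sum>r<N. \<Sum>h<N. scale ((of_int p gchoose i) * of_nat ((r + h) choose h)) (G (r + h) (i + r))) =
     (\<Sum>g<N. \<Sum>j<N. scale (of_int (p + int g) gchoose j) (G g j))"
  proof -
    have "(\<Sum>r<N. \<Sum>h<N. scale ((of_int p gchoose i) * of_nat ((r + h) choose h)) (G (r + h) (i + r))) =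
        (\<Sum>g<N. \<Sum>r<N. scale ((of_int p gchoose i) * of_nat (g choose r)) (G g (i + r)))" for i
    proof -
      have "(\<Sum>r<N. \<Sum>h<N. scale ((of_int p gchoose i) * of_nat ((r + h) choose h)) (G (r + h) (i + r))) =
         (\<Sum>g<N. \<Sum>r\<le>g. scale ((of_int p gchoose i) * of_nat ((r + (g - r)) choose (g - r))) (G (r + (g - r)) (i + r)))"
        by (rule sum_square_conv[of N "\<lambda>r h. scale ((of_int p gchoose i) * of_nat ((r + h) choose h)) (G (r + h) (i + r))"])
           (simp add: G0)
      also have "\<dots> = (\<Sum>g<N. \<Sum>r\<le>g. scale ((of_int p gchoose i) * of_nat (g choose r)) (G g (i + r)))"
        by (intro sum.cong refl) (simp add: binomial_symmetric[symmetric])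
      also have "\<dots> = (\<Sum>g<N. \<Sum>r<N. scale ((of_int p gchoose i) * of_nat (g choose r)) (G g (i + r)))"
        by (intro sum.cong refl sum.mono_neutral_left) (auto simp: not_le)
      finally show ?thesis .
    qed
    then have "(\<Sum>i<N. \<Sum>r<N. \<Sum>h<N. scale ((of_int p gchoose i) * of_nat ((r + h) choose h)) (G (r + h) (i + r))) =
       (\<Sum>i<N. \<Sum>g<N. \<Sum>r<N. scale ((of_int p gchoose i) * of_nat (g choose r)) (G g (i + r)))"
      by simp
    also have "\<dots> = (\<Sum>g<N. \<Sum>i<N. \<Sum>r<N. scale ((of_int p gchoose i) * of_nat (g choose r)) (G g (i + r)))"
      by (rule sum.swap)
    also have "\<dots> = (\<Sum>g<N. \<Sum>j<N. scale (\<Sum>i\<le>j. (of_int p gchoose i) * of_nat (g choose (j - i))) (G g j))"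
      by (intro sum.cong refl scale_conv) (simp add: G0)
    also have "\<dots> = (\<Sum>g<N. \<Sum>j<N. scale (of_int (p + int g) gchoose j) (G g j))"
      by (simp only: gchoose_Vandermonde[symmetric] gchoose_of_nat)
    finally show ?thesis .
  qed
  \<comment> \<open>Since (-1)^r binom(r+h, h) = binom(-1-h, r), the coefficient of H h j is the
    Vandermonde sum for binom(p - 1 - h, j).\<close>
  also have "(\<Sum>i<N. \<Sum>r<N. \<Sum>h<N. scale ((of_int p gchoose i) * ((- 1) ^ r * of_nat ((r + h) choose h))) (H h (i + r))) =
     (\<Sum>h<N. \<Sum>j<N. scale (of_int (p - 1 - int h) gchoose j) (H h j))"
  proof -
    have "((r + h) choose h) = ((h + r) choose r)" for r h
      using binomial_symmetric[of h "r + h"] by (simp add: add.commute)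
    then have e: "(- 1) ^ r * of_nat ((r + h) choose h) = (of_int (- 1 - int h) :: complex) gchoose r" for r h
      by (simp only: gchoose_neg)
    have "(\<Sum>i<N. \<Sum>r<N. \<Sum>h<N. scale ((of_int p gchoose i) * (of_int (- 1 - int h) gchoose r)) (H h (i + r))) =
      (\<Sum>h<N. \<Sum>i<N. \<Sum>r<N. scale ((of_int p gchoose i) * (of_int (- 1 - int h) gchoose r)) (H h (i + r)))"
      by (subst (2) sum.swap, subst sum.swap, rule refl)
    also have "\<dots> = (\<Sum>h<N. \<Sum>j<N. scale (\<Sum>i\<le>j. (of_int p gchoose i) * (of_int (- 1 - int h) gchoose (j - i))) (H h j))"
      by (intro sum.cong refl scale_conv) (simp add: H0)
    also have "\<dots> = (\<Sum>h<N. \<Sum>j<N. scale (of_int (p - 1 - int h) gchoose j) (H h j))"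
      by (intro sum.cong refl) (simp only: gchoose_Vandermonde, simp add: algebra_simps)
    finally show ?thesis unfolding e .
  qed
  also have "(\<Sum>i<N. \<Sum>r<N. scale (of_int p gchoose i) (K i r)) = (\<Sum>s<N. \<Sum>i<N. scale (of_int p gchoose i) (K i s))"
    by (rule sum.swap)
  finally show ?thesis
    unfolding L by simp
qed

end

section \<open>Formal rules for normally ordered products and for the Borcherds expression\<close>

context complex_vs
begin

lemma lin_add_fun: "lin scale T \<Longrightarrow> lin scale U \<Longrightarrow> lin scale (\<lambda>w. T w + U w)"
  by (auto simp: lin_def additive_def scale_right_distrib)

lemma lin_scale_fun: "lin scale T \<Longrightarrow> lin scale (\<lambda>w. scale c (T w))"
  by (auto simp: lin_def additive_def scale_right_distrib mult.commute)

lemma lin_zero_fun: "lin scale (\<lambda>w. 0)"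
  by (auto simp: lin_def additive_def)

lemma fieldop_scale: "fieldop scale b \<Longrightarrow> fieldop scale (\<lambda>n w. scale c (b n w))"
  by (auto simp: fieldop_def lin_scale_fun truncated_def) (metis scale_zero_right)

lemma fieldop_zero: "fieldop scale (\<lambda>n w. 0)"
  by (auto simp: fieldop_def lin_zero_fun truncated_def)

lemma borcherds_ev:
  assumes b: "fieldop scale b" and c: "fieldop scale c"
  shows "\<forall>\<^sub>F N in sequentially. \<forall>j\<ge>N. b (p + int j) w = 0 \<and> c (q + int j) w = 0"
  using truncated_ev[OF fieldop_truncated[OF b], of p w] truncated_ev[OF fieldop_truncated[OF c], of q w]
  by eventually_elim auto

text \<open>The two halves of \<open>borcherds\<close> trade places when (b, p) and (c, q) do; the
  signs fit because (-1)^n has square 1.\<close>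

lemma borcherds_skew:
  assumes b: "fieldop scale b" and c: "fieldop scale c"
  shows "borcherds scale b c p n q w = scale (- neg1_pow n) (borcherds scale c b q n p w)"
proof -
  note lb = lin_simps[OF fieldop_lin[OF b]] and lc = lin_simps[OF fieldop_lin[OF c]]
  obtain N where N: "\<And>j. j \<ge> N \<Longrightarrow> b (p + int j) w = 0" "\<And>j. j \<ge> N \<Longrightarrow> c (q + int j) w = 0"
    using eventually_happens[OF borcherds_ev[OF b c, of p w q]] by auto
  have 1: "borcherds scale b c p n q w = (\<Sum>j<N. scale (sbinom n j) (b (p + n - int j) (c (q + int j) w))
      - scale (neg1_pow n * sbinom n j) (c (n + q - int j) (b (p + int j) w)))"
    unfolding borcherds_def by (rule Sum_any_lessThan) (simp add: N lb lc)
  have 2: "borcherds scale c b q n p w = (\<Sum>j<N. scale (sbinom n j) (c (q + n - int j) (b (p + int j) w))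
      - scale (neg1_pow n * sbinom n j) (b (n + p - int j) (c (q + int j) w)))"
    unfolding borcherds_def by (rule Sum_any_lessThan) (simp add: N lb lc)
  show ?thesis
    unfolding 1 2 scale_sum_right
    by (intro sum.cong refl) (simp add: scale_right_diff_distrib mult.assoc[symmetric] add.commute)
qed

lemma borcherds_scale_left:
  assumes b: "fieldop scale b" and c: "fieldop scale c"
  shows "borcherds scale (\<lambda>n w. scale a (b n w)) c p n q w = scale a (borcherds scale b c p n q w)"
proof -
  note lb = lin_simps[OF fieldop_lin[OF b]] and lc = lin_simps[OF fieldop_lin[OF c]]
  obtain N where N: "\<And>j. j \<ge> N \<Longrightarrow> b (p + int j) w = 0" "\<And>j. j \<ge> N \<Longrightarrow> c (q + int j) w = 0"
    using eventually_happens[OF borcherds_ev[OF b c, of p w q]] by auto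
  have 1: "borcherds scale b c p n q w = (\<Sum>j<N. scale (sbinom n j) (b (p + n - int j) (c (q + int j) w))
      - scale (neg1_pow n * sbinom n j) (c (n + q - int j) (b (p + int j) w)))"
    unfolding borcherds_def by (rule Sum_any_lessThan) (simp add: N lb lc)
  have 2: "borcherds scale (\<lambda>n w. scale a (b n w)) c p n q w = (\<Sum>j<N. scale (sbinom n j) (scale a (b (p + n - int j) (c (q + int j) w)))
      - scale (neg1_pow n * sbinom n j) (c (n + q - int j) (scale a (b (p + int j) w))))"
    unfolding borcherds_def by (rule Sum_any_lessThan) (simp add: N lb lc)
  show ?thesis
    unfolding 1 2 scale_sum_right lc
    by (intro sum.cong refl) (simp add: scale_right_diff_distrib mult.commute)
qed

lemma borcherds_zero_left:
  assumes "fieldop scale c"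
  shows "borcherds scale (\<lambda>n w. 0) c p n q w = 0"
  using assms by (simp add: borcherds_def lin_simps[OF fieldop_lin])

lemma borcherds_zero_right:
  assumes "fieldop scale b"
  shows "borcherds scale b (\<lambda>n w. 0) p n q w = 0"
  using assms by (simp add: borcherds_def lin_simps[OF fieldop_lin])

text \<open>Identities between normally ordered products are proved by evaluating all of them with
  the same N, which the eventual form supplies.\<close>

lemma nprod_ev:
  assumes A: "fieldop scale A" and b: "fieldop scale b"
  shows "\<forall>\<^sub>F N in sequentially. (\<forall>i\<ge>N. b (q + int i) w = 0 \<and> A (int i) w = 0) \<and>
    nprod A b q w = (\<Sum>i<N. A (- 1 - int i) (b (q + int i) w) + b (q - 1 - int i) (A (int i) w))"
  using truncated_ev[OF fieldop_truncated[OF A], of 0 w] truncated_ev[OF fieldop_truncated[OF b], of q w]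
proof eventually_elim
  case (elim N)
  then show ?case
    unfolding nprod_def
    by (auto simp: lin_simps[OF fieldop_lin[OF A]] lin_simps[OF fieldop_lin[OF b]] intro!: Sum_any_lessThan)
qed

lemma nprod_fieldop:
  assumes A: "fieldop scale A" and b: "fieldop scale b"
  shows "fieldop scale (nprod A b)"
  unfolding fieldop_def
proof (intro conjI allI linI)
  note lA = lin_simps[OF fieldop_lin[OF A]] and lb = lin_simps[OF fieldop_lin[OF b]]
  fix q x y
  have "\<forall>\<^sub>F N in sequentially. nprod A b q (x + y) = nprod A b q x + nprod A b q y"
    using nprod_ev[OF A b, of q x] nprod_ev[OF A b, of q y] nprod_ev[OF A b, of q "x + y"]
    by eventually_elim (simp add: lA lb sum.distrib)
  then show "nprod A b q (x + y) = nprod A b q x + nprod A b q y" by simp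
  fix c
  have "\<forall>\<^sub>F N in sequentially. nprod A b q (scale c x) = scale c (nprod A b q x)"
    using nprod_ev[OF A b, of q x] nprod_ev[OF A b, of q "scale c x"]
    by eventually_elim (simp add: lA lb sum.distrib scale_sum_right scale_right_distrib)
  then show "nprod A b q (scale c x) = scale c (nprod A b q x)" by simp
next
  note lA = lin_simps[OF fieldop_lin[OF A]] and lb = lin_simps[OF fieldop_lin[OF b]]
  show "truncated (nprod A b)"
    unfolding truncated_def
  proof
    fix w
    have fA: "\<forall>\<^sub>F N in sequentially. \<forall>i\<ge>N. A (int i) w = 0"
      using truncated_ev[OF fieldop_truncated[OF A], of 0 w] by simp
    \<comment> \<open>The bound has to be uniform in i, and it can be because only finitely many A i
      w are nonzero.\<close>
    have "\<forall>\<^sub>F N in sequentially. (\<forall>j i. j \<ge> N \<or> i \<ge> N \<longrightarrow> b (- 1 - int i + int j) (A (int i) w) = 0)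
        \<and> (\<forall>r\<ge>N. b (0 + int r) w = 0)"
      by (intro eventually_conj truncated_ev truncated_ev_family[OF fieldop_truncated[OF b] fA] fieldop_truncated[OF b]) (simp add: lb)
    then obtain N where N: "\<And>i j. j \<ge> N \<Longrightarrow> b (- 1 - int i + int j) (A (int i) w) = 0"
        "\<And>r. r \<ge> N \<Longrightarrow> b (int r) w = 0"
      using eventually_happens by fastforce
    show "\<exists>n0. \<forall>n\<ge>n0. nprod A b n w = 0"
    proof (intro exI allI impI)
      fix n assume "n \<ge> int N"
      then obtain r where r: "n = int r" "r \<ge> N"
        by (metis nonneg_int_cases of_nat_0_le_iff of_nat_le_iff order_trans)
      have "b (int r + int i) w = 0" "b (int r - 1 - int i) (A (int i) w) = 0" for i
        using N(2)[of "r + i"] N(1)[of r i] r(2) by (simp_all add: algebra_simps)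
      then show "nprod A b n w = 0"
        by (simp add: nprod_def r lA)
    qed
  qed
qed

lemma nprod_add:
  assumes A: "fieldop scale A" and b: "fieldop scale b" and c: "fieldop scale c" and d: "\<And>n w. d n w = b n w + c n w"
  shows "nprod A d q w = nprod A b q w + nprod A c q w"
proof -
  note lA = lin_simps[OF fieldop_lin[OF A]]
  have "\<forall>\<^sub>F N in sequentially. nprod A d q w = nprod A b q w + nprod A c q w"
    using nprod_ev[OF A b, of q w] nprod_ev[OF A c, of q w]
  proof eventually_elim
    case (elim N)
    have "nprod A d q w = (\<Sum>i<N. A (- 1 - int i) (d (q + int i) w) + d (q - 1 - int i) (A (int i) w))"
      unfolding nprod_def d
      using elim by (intro Sum_any_lessThan) (auto simp: lA lin_simps[OF fieldop_lin[OF b]] lin_simps[OF fieldop_lin[OF c]])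
    then show ?case
      using elim by (simp add: d lA sum.distrib)
  qed
  then show ?thesis by simp
qed

lemma nprod_scale:
  assumes A: "fieldop scale A" and b: "fieldop scale b" and d: "\<And>n w. d n w = scale a (b n w)"
  shows "nprod A d q w = scale a (nprod A b q w)"
proof -
  note lA = lin_simps[OF fieldop_lin[OF A]]
  have "\<forall>\<^sub>F N in sequentially. nprod A d q w = scale a (nprod A b q w)"
    using nprod_ev[OF A b, of q w]
  proof eventually_elim
    case (elim N)
    have "nprod A d q w = (\<Sum>i<N. A (- 1 - int i) (d (q + int i) w) + d (q - 1 - int i) (A (int i) w))"
      unfolding nprod_def d
      using elim by (intro Sum_any_lessThan) (auto simp: lA lin_simps[OF fieldop_lin[OF b]])
    then show ?case
      using elim by (simp add: d lA sum.distrib scale_right_distrib scale_sum_right)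
  qed
  then show ?thesis by simp
qed

lemma nprod_zero_right:
  assumes "fieldop scale A"
  shows "nprod A (\<lambda>n w. 0) q w = 0"
  by (simp add: nprod_def lin_simps[OF fieldop_lin[OF assms]])

lemma nprod_add_left:
  assumes A: "fieldop scale A" and B: "fieldop scale B" and b: "fieldop scale b" and C: "\<And>n w. C n w = A n w + B n w"
  shows "nprod C b q w = nprod A b q w + nprod B b q w"
proof -
  note lb = lin_simps[OF fieldop_lin[OF b]]
  have "\<forall>\<^sub>F N in sequentially. nprod C b q w = nprod A b q w + nprod B b q w"
    using nprod_ev[OF A b, of q w] nprod_ev[OF B b, of q w]
  proof eventually_elim
    case (elim N)
    have "nprod C b q w = (\<Sum>i<N. C (- 1 - int i) (b (q + int i) w) + b (q - 1 - int i) (C (int i) w))"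
      unfolding nprod_def C
      using elim by (intro Sum_any_lessThan) (auto simp: lb lin_simps[OF fieldop_lin[OF A]] lin_simps[OF fieldop_lin[OF B]])
    then show ?case
      using elim by (simp add: C lb sum.distrib)
  qed
  then show ?thesis by simp
qed

lemma nprod_scale_left:
  assumes A: "fieldop scale A" and b: "fieldop scale b" and C: "\<And>n w. C n w = scale a (A n w)"
  shows "nprod C b q w = scale a (nprod A b q w)"
proof -
  note lb = lin_simps[OF fieldop_lin[OF b]]
  have "\<forall>\<^sub>F N in sequentially. nprod C b q w = scale a (nprod A b q w)"
    using nprod_ev[OF A b, of q w]
  proof eventually_elim
    case (elim N)
    have "nprod C b q w = (\<Sum>i<N. C (- 1 - int i) (b (q + int i) w) + b (q - 1 - int i) (C (int i) w))"
      unfolding nprod_def C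
      using elim by (intro Sum_any_lessThan) (auto simp: lb lin_simps[OF fieldop_lin[OF A]])
    then show ?case
      using elim by (simp add: C lb sum.distrib scale_right_distrib scale_sum_right)
  qed
  then show ?thesis by simp
qed

text \<open>After expansion A and B stand both left of b, both right of b, or on opposite sides. The
  mixed terms agree as they are, so only creation modes among themselves and annihilation modes
  among themselves have to commute.\<close>

lemma nprod_commute:
  assumes A: "fieldop scale A" and B: "fieldop scale B" and b: "fieldop scale b"
    and c1: "\<And>i j w. A (- 1 - int i) (B (- 1 - int j) w) = B (- 1 - int j) (A (- 1 - int i) w)"
    and c2: "\<And>i j w. A (int i) (B (int j) w) = B (int j) (A (int i) w)"
  shows "nprod A (nprod B b) q w = nprod B (nprod A b) q w"
proof -
  have main: "\<forall>\<^sub>F N in sequentially. nprod A (nprod B b) q w =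
     (\<Sum>i<N. \<Sum>j<N. A (- 1 - int i) (B (- 1 - int j) (b (q + int i + int j) w))
       + A (- 1 - int i) (b (q + int i - 1 - int j) (B (int j) w))
       + B (- 1 - int j) (b (q - 1 - int i + int j) (A (int i) w))
       + b (q - 1 - int i - 1 - int j) (B (int j) (A (int i) w)))"
    if A: "fieldop scale A" and B: "fieldop scale B" for A B
  proof -
    note lA = lin_simps[OF fieldop_lin[OF A]] and lB = lin_simps[OF fieldop_lin[OF B]] and lb = lin_simps[OF fieldop_lin[OF b]]
    have fA: "\<forall>\<^sub>F N in sequentially. \<forall>i\<ge>N. A (int i) w = 0"
      and fB: "\<forall>\<^sub>F N in sequentially. \<forall>i\<ge>N. B (int i) w = 0"
      using truncated_ev[OF fieldop_truncated[OF A], of 0 w] truncated_ev[OF fieldop_truncated[OF B], of 0 w] by simp_all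
    have fb: "\<forall>\<^sub>F N in sequentially. \<forall>i\<ge>N. b (q + int i) w = 0"
      by (rule truncated_ev[OF fieldop_truncated[OF b]])
    have bA: "\<forall>\<^sub>F N in sequentially. \<forall>j i. j \<ge> N \<or> i \<ge> N \<longrightarrow> b (q - 1 - int i + int j) (A (int i) w) = 0"
      and bB: "\<forall>\<^sub>F N in sequentially. \<forall>j i. j \<ge> N \<or> i \<ge> N \<longrightarrow> b (q - 1 - int i + int j) (B (int i) w) = 0"
      and BA: "\<forall>\<^sub>F N in sequentially. \<forall>j i. j \<ge> N \<or> i \<ge> N \<longrightarrow> B (0 + int j) (A (int i) w) = 0"
      by (rule truncated_ev_family[OF fieldop_truncated[OF b] fA] truncated_ev_family[OF fieldop_truncated[OF b] fB]
          truncated_ev_family[OF fieldop_truncated[OF B] fA], simp add: lb lB)+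
    show ?thesis
      using fA fB fb bA bB BA
    proof eventually_elim
      case (elim N)
      have b1: "b (q + int i + int j) w = 0" if "j \<ge> N \<or> i \<ge> N" for i j
        using elim(3)[rule_format, of "i + j"] that by (auto simp: algebra_simps)
      have b2: "b (q + int i - 1 - int j) (B (int j) w) = 0" if "j \<ge> N \<or> i \<ge> N" for i j
      proof -
        have "b (q - 1 - int j + int i) (B (int j) w) = 0" using elim(5) that by blast
        then show ?thesis by (simp add: algebra_simps)
      qed
      have b3: "b (q - 1 - int i + int j) (A (int i) w) = 0" if "j \<ge> N \<or> i \<ge> N" for i j
        using elim(4) that by blast
      have b4: "B (int j) (A (int i) w) = 0" if "j \<ge> N \<or> i \<ge> N" for i j
        using elim(6) that by auto
      have 1: "nprod B b (q + int i) w = (\<Sum>j<N. B (- 1 - int j) (b (q + int i + int j) w)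
          + b (q + int i - 1 - int j) (B (int j) w))" for i
        unfolding nprod_def by (rule Sum_any_lessThan) (simp add: b1 b2 lB)
      have 2: "nprod B b (q - 1 - int i) (A (int i) w) = (\<Sum>j<N. B (- 1 - int j) (b (q - 1 - int i + int j) (A (int i) w))
          + b (q - 1 - int i - 1 - int j) (B (int j) (A (int i) w)))" for i
        unfolding nprod_def by (rule Sum_any_lessThan) (simp add: b3 b4 lB lb)
      have "nprod A (nprod B b) q w = (\<Sum>i<N. A (- 1 - int i) (nprod B b (q + int i) w)
          + nprod B b (q - 1 - int i) (A (int i) w))"
        unfolding nprod_def[of A "nprod B b"] by (rule Sum_any_lessThan) (simp add: 1 2 b1 b2 b3 b4 lB lA lb)
      then show ?case
        by (simp add: 1 2 lA sum.distrib add.assoc)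
    qed
  qed
  have "\<forall>\<^sub>F N in sequentially. nprod A (nprod B b) q w = nprod B (nprod A b) q w"
    using main[OF A B] main[OF B A]
  proof eventually_elim
    case (elim N)
    show ?case
      unfolding elim by (subst sum.swap) (intro sum.cong refl, simp add: c1 c2 algebra_simps)
  qed
  then show ?thesis by simp
qed

text \<open>Skew symmetry moves \<open>nprod A c\<close> to the first argument, where
  \<open>borcherds_nprod\<close> applies, and then back. As the commutator is a multiple of b
  itself, the correction is again an expression in b and c, with n lowered by 1 + t.\<close>

lemma borcherds_nprod_right:
  assumes A: "fieldop scale A" and b: "fieldop scale b" and c: "fieldop scale c"
    and comm: "\<And>p q w. A p (b q w) - b q (A p w) = scale ((of_int p gchoose t) * (- 1) ^ t * a) (b (p + q - int t) w)"
  shows "borcherds scale b (nprod A c) p n q w =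
     (\<Sum>i::nat. A (- 1 - int i) (borcherds scale b c p n (q + int i) w))
   + (\<Sum>i::nat. borcherds scale b c p n (q - 1 - int i) (A (int i) w))
   - scale a (borcherds scale b c p (n - 1 - int t) q w)"
proof -
  define Z where "Z s = (if s = t then (\<lambda>n w. scale ((- 1) ^ t * a) (b n w)) else (\<lambda>n w. 0))" for s
  have Z: "fieldop scale (Z s)" for s
    by (simp add: Z_def fieldop_scale[OF b] fieldop_zero)
  have "borcherds scale (nprod A c) b q n p w =
     (\<Sum>i::nat. A (- 1 - int i) (borcherds scale c b (q + int i) n p w))
   + (\<Sum>i::nat. borcherds scale c b (q - 1 - int i) n p (A (int i) w))
   + (\<Sum>s<Suc t. borcherds scale c (Z s) q (n - 1 - int s) p w)"
    by (rule borcherds_nprod[OF A c b Z]) (simp add: comm Z_def mult.assoc)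
  also have "(\<Sum>s<Suc t. borcherds scale c (Z s) q (n - 1 - int s) p w) =
      scale (- neg1_pow (n - 1 - int t) * ((- 1) ^ t * a)) (borcherds scale b c p (n - 1 - int t) q w)"
  proof -
    have 1: "borcherds scale c (Z s) q (n - 1 - int s) p w = 0" if "s \<noteq> t" for s
      using that by (simp add: Z_def borcherds_zero_right[OF c])
    have "borcherds scale c (Z t) q (n - 1 - int t) p w =
       scale (- neg1_pow (n - 1 - int t)) (scale ((- 1) ^ t * a) (borcherds scale b c p (n - 1 - int t) q w))"
      unfolding borcherds_skew[OF c Z] by (simp add: Z_def borcherds_scale_left[OF b c])
    then show ?thesis by (simp add: 1)
  qed
  \<comment> \<open>The sign (-1)^t of the hypothesis cancels the one from lowering n; the final
    skew symmetry turns what is left into -a.\<close>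
  also have "- neg1_pow (n - 1 - int t) * ((- 1) ^ t * a) = neg1_pow n * a"
    by (simp add: neg1_pow_diff)
  finally have 1: "borcherds scale (nprod A c) b q n p w =
     (\<Sum>i::nat. A (- 1 - int i) (borcherds scale c b (q + int i) n p w))
   + (\<Sum>i::nat. borcherds scale c b (q - 1 - int i) n p (A (int i) w))
   + scale (neg1_pow n * a) (borcherds scale b c p (n - 1 - int t) q w)" .
  \<comment> \<open>A nonzero factor leaves the support unchanged, so it passes through
    \<open>Sum_any\<close> whether or not the support is finite.\<close>
  have 2: "scale (- neg1_pow n) (Sum_any f) = (\<Sum>i. scale (- neg1_pow n) (f i))" for f :: "nat \<Rightarrow> 'b"
  proof -
    have "neg1_pow n \<noteq> 0" by (simp add: neg1_pow_def)
    then have "{i. scale (- neg1_pow n) (f i) \<noteq> 0} = {i. f i \<noteq> 0}" by auto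
    then show ?thesis
      by (simp add: Sum_any.expand_set scale_sum_right)
  qed
  show ?thesis
    unfolding borcherds_skew[OF b nprod_fieldop[OF A c]] 1 scale_right_distrib 2
      lin_scale[OF fieldop_lin[OF A], symmetric] borcherds_skew[OF b c, symmetric]
    by (simp add: mult.assoc[symmetric])
qed

text \<open>The induction step in the second argument. The commutator of A with the field b lowers n
  by 1 + t, and \<open>commV\<close> says the same of AV and the state modes bV, so the corrections
  on the two sides coincide.\<close>

lemma borcherds_nprod_right_eq:
  fixes Y :: "'v::ab_group_add \<Rightarrow> int \<Rightarrow> 'b \<Rightarrow> 'b" and bV :: "int \<Rightarrow> 'v \<Rightarrow> 'v" and AV :: "'v \<Rightarrow> 'v"
  assumes A: "fieldop scale A" and b: "fieldop scale b" and Y: "\<And>v. fieldop scale (Y v)"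
    and Yadd: "\<And>n w. additive (\<lambda>v. Y v n w)"
    and bV: "truncated bV"
    and comm: "\<And>p q w. A p (b q w) - b q (A p w) = scale ((of_int p gchoose t) * (- 1) ^ t * a) (b (p + q - int t) w)"
    and neg: "\<And>x q w. Y (AV x) q w = nprod A (Y x) q w"
    and commV: "\<And>m q w. Y (bV m (AV v)) q w = Y (AV (bV m v)) q w - scale a (Y (bV (m - 1 - int t) v) q w)"
    and J: "\<And>p n q w. borcherds scale b (Y v) p n q w =
      (\<Sum>i::nat. scale (of_int p gchoose i) (Y (bV (n + int i) v) (p + q - int i) w))"
  shows "borcherds scale b (Y (AV v)) p n q w =
      (\<Sum>i::nat. scale (of_int p gchoose i) (Y (bV (n + int i) (AV v)) (p + q - int i) w))"
proof -
  note lA = lin_simps[OF fieldop_lin[OF A]] and lY = lin_simps[OF fieldop_lin[OF Y]]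
  have Y0: "Y 0 n w = 0" for n w by (rule additive.zero[OF Yadd])
  have f2: "\<forall>\<^sub>F N in sequentially. \<forall>j\<ge>N. bV (n + int j) v = 0"
    and f1: "\<forall>\<^sub>F N in sequentially. \<forall>j\<ge>N. bV (n - 1 - int t + int j) v = 0"
    by (rule truncated_ev[OF bV])+
  have f3: "\<forall>\<^sub>F N in sequentially. \<forall>j\<ge>N. A (int j) w = 0"
    using truncated_ev[OF fieldop_truncated[OF A], of 0 w] by simp
  have ev: "\<forall>\<^sub>F N in sequentially. (\<forall>j\<ge>N. bV (n + int j) v = 0) \<and> (\<forall>j\<ge>N. bV (n - 1 - int t + int j) v = 0) \<and>
     (\<forall>j\<ge>N. A (int j) w = 0) \<and>
     (\<forall>i j. i \<ge> N \<or> j \<ge> N \<longrightarrow> Y (bV (n + int j) v) (p + q - int j + int i) w = 0)"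
    (is "\<forall>\<^sub>F N in _. ?P N")
    by (intro eventually_conj f1 f2 f3
        truncated_ev_fields[where Y = Y and f = "\<lambda>j. bV (n + int j) v", OF fieldop_truncated[OF Y] Y0 f2])
  obtain N where
        N1: "\<And>j. j \<ge> N \<Longrightarrow> bV (n - 1 - int t + int j) v = 0"
    and N2: "\<And>j. j \<ge> N \<Longrightarrow> bV (n + int j) v = 0"
    and N3: "\<And>j. j \<ge> N \<Longrightarrow> A (int j) w = 0"
    and N5: "\<And>i j. i \<ge> N \<or> j \<ge> N \<Longrightarrow> Y (bV (n + int j) v) (p + q - int j + int i) w = 0"
  proof -
    obtain N where "?P N"
      using eventually_happens[OF ev] by auto
    then show thesis
      by (intro that[of N]) auto
  qed
  have e1: "n - 1 - int t + int j = n + int j - 1 - int t" for j by simp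
  have B1: "borcherds scale b (Y v) p n (q + int i) w =
     (\<Sum>j<N. scale (of_int p gchoose j) (Y (bV (n + int j) v) (p + q - int j + int i) w))" for i
  proof -
    have e: "p + (q + int i) - int j = p + q - int j + int i" for j by simp
    show ?thesis unfolding J e by (rule Sum_any_lessThan) (simp add: N2 Y0)
  qed
  have B2: "borcherds scale b (Y v) p n (q - 1 - int i) (A (int i) w) =
     (\<Sum>j<N. scale (of_int p gchoose j) (Y (bV (n + int j) v) (p + q - int j - 1 - int i) (A (int i) w)))" for i
  proof -
    have e: "p + (q - 1 - int i) - int j = p + q - int j - 1 - int i" for j by simp
    show ?thesis unfolding J e by (rule Sum_any_lessThan) (simp add: N2 Y0)
  qed
  have B3: "borcherds scale b (Y v) p (n - 1 - int t) q w =
     (\<Sum>j<N. scale (of_int p gchoose j) (Y (bV (n + int j - 1 - int t) v) (p + q - int j) w))"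
    unfolding J e1 by (rule Sum_any_lessThan) (use N1 in \<open>simp add: Y0 e1\<close>)
  have "borcherds scale b (Y (AV v)) p n q w = borcherds scale b (nprod A (Y v)) p n q w"
    by (simp add: borcherds_def neg)
  also have "\<dots> = (\<Sum>i::nat. A (- 1 - int i) (borcherds scale b (Y v) p n (q + int i) w))
     + (\<Sum>i::nat. borcherds scale b (Y v) p n (q - 1 - int i) (A (int i) w))
     - scale a (borcherds scale b (Y v) p (n - 1 - int t) q w)"
    by (rule borcherds_nprod_right[OF A b Y comm])
  also have "(\<Sum>i::nat. A (- 1 - int i) (borcherds scale b (Y v) p n (q + int i) w)) =
       (\<Sum>i<N. A (- 1 - int i) (borcherds scale b (Y v) p n (q + int i) w))"
    by (rule Sum_any_lessThan) (simp add: B1 N5 lA)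
  also have "(\<Sum>i::nat. borcherds scale b (Y v) p n (q - 1 - int i) (A (int i) w)) =
       (\<Sum>i<N. borcherds scale b (Y v) p n (q - 1 - int i) (A (int i) w))"
    by (rule Sum_any_lessThan) (simp only: B2, simp add: N3 lY)
  finally have L: "borcherds scale b (Y (AV v)) p n q w =
       (\<Sum>i<N. A (- 1 - int i) (borcherds scale b (Y v) p n (q + int i) w)) +
       (\<Sum>i<N. borcherds scale b (Y v) p n (q - 1 - int i) (A (int i) w)) - scale a (borcherds scale b (Y v) p (n - 1 - int t) q w)" .
  have np: "nprod A (Y (bV (n + int j) v)) (p + q - int j) w =
     (\<Sum>i<N. A (- 1 - int i) (Y (bV (n + int j) v) (p + q - int j + int i) w) +
        Y (bV (n + int j) v) (p + q - int j - 1 - int i) (A (int i) w))" for j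
    unfolding nprod_def by (rule Sum_any_lessThan) (simp add: N3 N5 lA lY)
  have "(\<Sum>i::nat. scale (of_int p gchoose i) (Y (bV (n + int i) (AV v)) (p + q - int i) w)) =
    (\<Sum>j<N. scale (of_int p gchoose j) (Y (bV (n + int j) (AV v)) (p + q - int j) w))"
  proof (rule Sum_any_lessThan)
    fix i assume "i \<ge> N"
    then have "Y (bV (n + int i) (AV v)) (p + q - int i) w = 0"
      unfolding commV neg np using N1[of i] N2[of i] N5[of _ i] by (simp add: Y0 lA e1)
    then show "scale (of_int p gchoose i) (Y (bV (n + int i) (AV v)) (p + q - int i) w) = 0" by simp
  qed
  also have "\<dots> = (\<Sum>j<N. \<Sum>i<N. scale (of_int p gchoose j) (A (- 1 - int i) (Y (bV (n + int j) v) (p + q - int j + int i) w)))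
    + (\<Sum>j<N. \<Sum>i<N. scale (of_int p gchoose j) (Y (bV (n + int j) v) (p + q - int j - 1 - int i) (A (int i) w)))
    - scale a (borcherds scale b (Y v) p (n - 1 - int t) q w)"
    unfolding commV neg np B3
    by (simp add: sum.distrib sum_subtractf scale_sum_right scale_right_distrib scale_right_diff_distrib mult.commute)
  also have "(\<Sum>j<N. \<Sum>i<N. scale (of_int p gchoose j) (A (- 1 - int i) (Y (bV (n + int j) v) (p + q - int j + int i) w))) =
     (\<Sum>i<N. A (- 1 - int i) (borcherds scale b (Y v) p n (q + int i) w))"
    unfolding B1 by (subst sum.swap) (simp add: lA)
  also have "(\<Sum>j<N. \<Sum>i<N. scale (of_int p gchoose j) (Y (bV (n + int j) v) (p + q - int j - 1 - int i) (A (int i) w))) =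
     (\<Sum>i<N. borcherds scale b (Y v) p n (q - 1 - int i) (A (int i) w))"
    unfolding B2 by (rule sum.swap)
  finally show ?thesis
    unfolding L by simp
qed

end

section \<open>The Fock space\<close>

text \<open>The coefficient notation of power series clashes with the one of vectors.\<close>

no_notation fps_nth (infixl \<open>$\<close> 75)

lemma pm_sum_single: "(\<Sum>M\<in>Poly_Mapping.keys f. Poly_Mapping.single M (Poly_Mapping.lookup f M)) = f"
proof (rule poly_mapping_eqI)
  fix N
  have "(\<Sum>M\<in>Poly_Mapping.keys f. if M = N then Poly_Mapping.lookup f M else 0) = Poly_Mapping.lookup f N"
    by (simp add: sum.delta in_keys_iff)
  then show "Poly_Mapping.lookup (\<Sum>M\<in>Poly_Mapping.keys f. Poly_Mapping.single M (Poly_Mapping.lookup f M)) N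
      = Poly_Mapping.lookup f N"
    by (simp add: lookup_sum lookup_single when_def)
qed

lemma pm_induct [case_names zero single add]:
  assumes "P 0" "\<And>M w. P (Poly_Mapping.single M w)" "\<And>f g. P f \<Longrightarrow> P g \<Longrightarrow> P (f + g)"
  shows "P (f :: 'a \<Rightarrow>\<^sub>0 'b::comm_monoid_add)"
proof -
  have "P (\<Sum>M\<in>S. Poly_Mapping.single M (Poly_Mapping.lookup f M))" if "finite S" for S
    using that by (induction S rule: finite_induct) (auto intro: assms)
  from this[OF finite_keys[of f]] show ?thesis by (simp only: pm_sum_single)
qed

lemma additive_eqI:
  assumes "additive T" "additive U" "\<And>M w. T (Poly_Mapping.single M w) = U (Poly_Mapping.single M w)"
  shows "T f = U f"
  by (induction f rule: pm_induct) (auto simp: assms additive.zero additive.add)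

lemma lookup_map_0: "g 0 = 0 \<Longrightarrow> Poly_Mapping.lookup (Poly_Mapping.map g f) M = g (Poly_Mapping.lookup f M)"
  by (simp add: Poly_Mapping.map.rep_eq when_def)

text \<open>The operators of the construction are sums over \<open>keys f\<close>, and keys may
  cancel in a sum f + g. Additivity is settled once for this common form.\<close>

definition pm_extend :: "('a \<Rightarrow> 'b::zero \<Rightarrow> 'c::comm_monoid_add) \<Rightarrow> ('a \<Rightarrow>\<^sub>0 'b) \<Rightarrow> 'c" where
  "pm_extend \<phi> f = (\<Sum>M\<in>Poly_Mapping.keys f. \<phi> M (Poly_Mapping.lookup f M))"

lemma pm_extend_superset:
  assumes "\<And>M. \<phi> M 0 = 0" "finite S" "Poly_Mapping.keys f \<subseteq> S"
  shows "pm_extend \<phi> f = (\<Sum>M\<in>S. \<phi> M (Poly_Mapping.lookup f M))"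
  unfolding pm_extend_def using assms by (intro sum.mono_neutral_left) (auto simp: in_keys_iff)

lemma pm_extend_single: "\<phi> M 0 = 0 \<Longrightarrow> pm_extend \<phi> (Poly_Mapping.single M w) = \<phi> M w"
  by (cases "w = 0") (auto simp: pm_extend_def)

lemma pm_extend_additive:
  fixes \<phi> :: "'a \<Rightarrow> 'b::ab_group_add \<Rightarrow> 'c::ab_group_add"
  assumes "\<And>M. additive (\<phi> M)"
  shows "additive (pm_extend \<phi>)"
proof (rule additive.intro)
  fix f g :: "'a \<Rightarrow>\<^sub>0 'b"
  let ?S = "Poly_Mapping.keys f \<union> Poly_Mapping.keys g"
  have "Poly_Mapping.keys (f + g) \<subseteq> ?S" by (rule Poly_Mapping.keys_add)
  then have "pm_extend \<phi> (f + g) = (\<Sum>M\<in>?S. \<phi> M (Poly_Mapping.lookup f M)) + (\<Sum>M\<in>?S. \<phi> M (Poly_Mapping.lookup g M))"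
    by (subst pm_extend_superset[of \<phi> ?S]) (auto simp: additive.zero[OF assms] additive.add[OF assms] lookup_add sum.distrib)
  then show "pm_extend \<phi> (f + g) = pm_extend \<phi> f + pm_extend \<phi> g"
    by (simp add: pm_extend_superset[of \<phi> ?S] additive.zero[OF assms])
qed

context complex_vs
begin

lemma lookup_pm_scale [simp]:
  "Poly_Mapping.lookup (pm_scale scale c f) M = scale c (Poly_Mapping.lookup f M)"
  by (simp add: pm_scale_def lookup_map_0)

lemma pm_scale_single [simp]:
  "pm_scale scale c (Poly_Mapping.single M w) = Poly_Mapping.single M (scale c w)"
  by (rule poly_mapping_eqI) (simp add: lookup_single when_def)

lemma complex_vs_pm: "complex_vs (pm_scale scale)"
  by unfold_locales
     (auto intro!: poly_mapping_eqI simp: lookup_add scale_right_distrib scale_left_distrib)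

lemma lin_ext:
  assumes "additive T" "\<And>M w c. T (Poly_Mapping.single M (scale c w)) = pm_scale scale c (T (Poly_Mapping.single M w))"
  shows "lin (pm_scale scale) T"
proof -
  interpret P: complex_vs "pm_scale scale" by (rule complex_vs_pm)
  have "T (pm_scale scale c f) = pm_scale scale c (T f)" for c f
    by (rule additive_eqI[of "\<lambda>f. T (pm_scale scale c f)"])
       (auto intro!: additive.intro simp: P.scale_right_distrib additive.add[OF assms(1)] assms(2))
  with assms(1) show ?thesis by (simp add: lin_def)
qed

text \<open>Multiplication by the variable v on M(1) \<otimes> W; \<open>annih v\<close> below is
  the partial derivative by v. All Heisenberg modes of nonzero index are combinations of such
  operators.\<close>

definition create :: "'v \<Rightarrow> ('v multiset \<Rightarrow>\<^sub>0 'b) \<Rightarrow> ('v multiset \<Rightarrow>\<^sub>0 'b)" where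
  "create v = pm_extend (\<lambda>M w. Poly_Mapping.single (add_mset v M) w)"

definition annih :: "'v \<Rightarrow> ('v multiset \<Rightarrow>\<^sub>0 'b) \<Rightarrow> ('v multiset \<Rightarrow>\<^sub>0 'b)" where
  "annih v = pm_extend (\<lambda>M w. Poly_Mapping.single (M - {#v#}) (scale (of_nat (count M v)) w))"

lemma create_single [simp]: "create v (Poly_Mapping.single M w) = Poly_Mapping.single (add_mset v M) w"
  by (simp add: create_def pm_extend_single)

lemma annih_single [simp]:
  "annih v (Poly_Mapping.single M w) = Poly_Mapping.single (M - {#v#}) (scale (of_nat (count M v)) w)"
  by (simp add: annih_def pm_extend_single)

lemma create_lin: "lin (pm_scale scale) (create v)"
proof (rule lin_ext)
  show "additive (create v)" unfolding create_def
    by (intro pm_extend_additive additive.intro) (simp add: single_add)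
qed simp

lemma annih_lin: "lin (pm_scale scale) (annih v)"
proof (rule lin_ext)
  show "additive (annih v)" unfolding annih_def
    by (intro pm_extend_additive additive.intro) (simp add: scale_right_distrib single_add)
qed (simp add: mult.commute)

lemmas create_simps = lin_simps[OF create_lin] and annih_simps = lin_simps[OF annih_lin]

lemma create_create: "create v (create u f) = create u (create v f)"
  by (rule additive_eqI[of "\<lambda>f. create v (create u f)" "\<lambda>f. create u (create v f)"]) (auto intro!: additive.intro simp: create_simps add_mset_commute)

lemma annih_annih: "annih v (annih u f) = annih u (annih v f)"
proof (rule additive_eqI[of "\<lambda>f. annih v (annih u f)" "\<lambda>f. annih u (annih v f)"])
  fix M w
  show "annih v (annih u (Poly_Mapping.single M w)) = annih u (annih v (Poly_Mapping.single M w))"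
    by (cases "u = v") (simp_all add: diff_diff_add_mset add.commute mult.commute add_mset_commute)
qed (auto intro!: additive.intro simp: annih_simps)

lemma annih_create: "annih v (create u f) = create u (annih v f) + (if u = v then f else 0)"
proof (rule additive_eqI[of "\<lambda>f. annih v (create u f)" "\<lambda>f. create u (annih v f) + (if u = v then f else 0)"])
  fix M w
  \<comment> \<open>If v does not occur in M, the multiset difference returns M itself, but then the
    factor \<open>count M v\<close> is 0.\<close>
  have "add_mset v (M - {#v#}) = M" if "count M v \<noteq> 0"
    using that by (simp add: not_in_iff)
  then have "Poly_Mapping.single (add_mset v (M - {#v#})) (scale (of_nat (count M v)) w) =
      Poly_Mapping.single M (scale (of_nat (count M v)) w)"
    by (cases "count M v = 0") auto
  moreover have "add_mset u M - {#v#} = add_mset u (M - {#v#})" if "u \<noteq> v" "count M v \<noteq> 0"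
    using that by (simp add: not_in_iff)
  ultimately show "annih v (create u (Poly_Mapping.single M w)) =
      create u (annih v (Poly_Mapping.single M w)) + (if u = v then Poly_Mapping.single M w else 0)"
    by (cases "u = v"; cases "count M v = 0") (auto simp: scale_left_distrib single_add add.commute create_simps)
qed (auto intro!: additive.intro simp: annih_simps create_simps)

lemma tens_eq: "tens scale p w = pm_extend (\<lambda>M c. Poly_Mapping.single M (scale c w)) p"
  by (simp add: tens_def pm_extend_def)

lemma tens_additive: "additive (\<lambda>p. tens scale p w)"
  unfolding tens_eq[abs_def] by (rule pm_extend_additive) (simp add: additive.intro scale_left_distrib single_add)

lemma tens_single [simp]: "tens scale (Poly_Mapping.single M c) w = Poly_Mapping.single M (scale c w)"
  by (simp add: tens_eq pm_extend_single)

lemma tens_additive2: "additive (tens scale p)"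
  by (rule additive.intro) (simp add: tens_def sum.distrib scale_right_distrib single_add)

lemma tens_scale2: "tens scale p (scale c w) = pm_scale scale c (tens scale p w)"
proof -
  interpret P: complex_vs "pm_scale scale" by (rule complex_vs_pm)
  show ?thesis by (simp add: tens_def P.scale_sum_right mult.commute)
qed

lemma tens_left_single: "tens_left scale T (Poly_Mapping.single M w) = tens scale (T (Poly_Mapping.single M 1)) w"
  unfolding tens_left_def
  using pm_extend_single[of "\<lambda>M. tens scale (T (Poly_Mapping.single M 1))" M w]
  by (simp add: pm_extend_def additive.zero[OF tens_additive2])

lemma tens_left_lin: "lin (pm_scale scale) (tens_left scale T)"
proof (rule lin_ext)
  show "additive (tens_left scale T)"
    using pm_extend_additive[of "\<lambda>M. tens scale (T (Poly_Mapping.single M 1))"]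
    by (simp add: tens_additive2 tens_left_def[abs_def] pm_extend_def[abs_def])
qed (simp add: tens_left_single tens_scale2)

lemma tens_right_lin:
  assumes "lin scale g"
  shows "lin (pm_scale scale) (tens_right g)"
  using assms by (intro linI poly_mapping_eqI) (simp_all add: tens_right_def lookup_map_0 lookup_add lin_simps)

lemma tens_right_single: "g 0 = 0 \<Longrightarrow> tens_right g (Poly_Mapping.single M w) = Poly_Mapping.single M (g w)"
  by (rule poly_mapping_eqI) (simp add: tens_right_def lookup_map_0 lookup_single when_def)

end

lemma pd_single: "pd v (Poly_Mapping.single M 1) = Poly_Mapping.single (M - {#v#}) (of_nat (count M v))"
  by (simp add: pd_def)

lemma form_Inl: "form k \<alpha> (hbasis (Inl i)) = of_int k * \<alpha> $ Inr i"
  by (simp add: form_def axis_def if_distrib[of "(*) (_ :: complex)"] cong: if_cong)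

lemma form_Inr: "form k \<alpha> (hbasis (Inr i)) = of_int k * \<alpha> $ Inl i"
  by (simp add: form_def axis_def if_distrib[of "(*) (_ :: complex)"] cong: if_cong)

lemma sum_UNIV_Plus:
  fixes f :: "'a::finite + 'b::finite \<Rightarrow> 'c::comm_monoid_add"
  shows "(\<Sum>b\<in>UNIV. f b) = (\<Sum>i\<in>UNIV. f (Inl i)) + (\<Sum>i\<in>UNIV. f (Inr i))"
  unfolding UNIV_sum by (subst sum.union_disjoint) (auto simp: sum.reindex)

lemma form_expand: "form k \<alpha> \<beta> = (\<Sum>b\<in>UNIV. \<beta> $ b * form k \<alpha> (hbasis b))"
  unfolding sum_UNIV_Plus form_Inl form_Inr
  by (simp add: form_def sum_distrib_left sum.distrib algebra_simps)

lemma form_commute: "form k \<alpha> \<beta> = form k \<beta> \<alpha>"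
  by (simp add: form_def mult.commute add.commute)

lemma form_emb_emb [simp]: "form k (emb_C \<beta>) (emb_C \<gamma>) = 0"
  by (simp add: form_def emb_C_def)

lemma emb_C_add: "emb_C (\<beta> + \<gamma>) = emb_C \<beta> + emb_C \<gamma>"
  by (simp add: emb_C_def vec_eq_iff split: sum.split)

lemma form_add_right: "form k \<alpha> (\<beta> + \<gamma>) = form k \<alpha> \<beta> + form k \<alpha> \<gamma>"
  by (simp add: form_def sum.distrib algebra_simps)

text \<open>
  What \<open>V\<close> and \<open>V_W\<close> have in common: \<open>Z \<alpha>\<close> is the action of \<open>\<alpha>(0)\<close> on the tensor factor, \<open>E \<beta>\<close> that
  of \<open>e\<^sup>\<beta>\<close>, and \<open>x \<beta>\<close> is the exponent in the action of \<open>z\<^sup>\<beta>\<close>.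
\<close>

locale fock_data = complex_vs s
  for s :: "complex \<Rightarrow> 'w::ab_group_add \<Rightarrow> 'w" +
  fixes k :: int and Z :: "'n::finite hh \<Rightarrow> 'w \<Rightarrow> 'w" and E :: "'n lattC \<Rightarrow> 'w \<Rightarrow> 'w" and x :: "'n lattC \<Rightarrow> complex"
  assumes Z_lin: "lin s (Z \<alpha>)" and E_lin: "lin s (E \<beta>)"
    and Z_expand: "Z \<alpha> w = (\<Sum>b\<in>UNIV. s (\<alpha> $ b) (Z (hbasis b) w))"
    and Z_comm: "Z \<alpha> (Z \<alpha>' w) = Z \<alpha>' (Z \<alpha> w)"
    and E_0: "E 0 w = w" and E_add: "E (\<beta> + \<gamma>) w = E \<beta> (E \<gamma> w)"
    and Z_E: "Z \<alpha> (E \<beta> w) = E \<beta> (Z \<alpha> w) + s (form k \<alpha> (emb_C \<beta>)) (E \<beta> w)"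
    and Z_emb: "Z (emb_C \<beta>) w = s (x \<beta>) w"
    and x_int: "x \<beta> \<in> \<int>" and x_0: "x 0 = 0" and x_add: "x (\<beta> + \<gamma>) = x \<beta> + x \<gamma>"
begin

sublocale P: complex_vs "pm_scale s"
  by (rule complex_vs_pm)

abbreviation ps where "ps \<equiv> pm_scale s"
abbreviation h where "h \<equiv> mode k s Z"

lemma h_lin: "lin ps (h \<alpha> n)"
  by (simp add: mode_def tens_left_lin tens_right_lin Z_lin)

lemmas h_simps = lin_simps[OF h_lin]

lemma h_0_single: "h \<alpha> 0 (Poly_Mapping.single M w) = Poly_Mapping.single M (Z \<alpha> w)"
  by (simp add: mode_def tens_right_single lin_simps[OF Z_lin])

lemma h_neg:
  assumes "n < 0"
  shows "h \<alpha> n f = (\<Sum>b\<in>UNIV. ps (\<alpha> $ b) (create (b, nat (- n) - 1) f))"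
proof (rule additive_eqI[of "h \<alpha> n" "\<lambda>f. \<Sum>b\<in>UNIV. ps (\<alpha> $ b) (create (b, nat (- n) - 1) f)"])
  fix M w
  have "heis k \<alpha> n (Poly_Mapping.single M 1) =
      (\<Sum>b\<in>UNIV. Poly_Mapping.single (add_mset (b, nat (- n) - 1) M) (\<alpha> $ b))"
    using assms by (simp add: heis_def sum_distrib_right mult_single)
  then show "h \<alpha> n (Poly_Mapping.single M w) = (\<Sum>b\<in>UNIV. ps (\<alpha> $ b) (create (b, nat (- n) - 1) (Poly_Mapping.single M w)))"
    using assms by (simp add: mode_def tens_left_single additive.sum[OF tens_additive])
qed (auto intro!: additive.intro simp: h_simps create_simps P.scale_right_distrib sum.distrib)

lemma h_pos:
  assumes "n > 0"
  shows "h \<alpha> n f = (\<Sum>b\<in>UNIV. ps (of_int n * form k \<alpha> (hbasis b)) (annih (b, nat n - 1) f))"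
proof (rule additive_eqI[of "h \<alpha> n" "\<lambda>f. \<Sum>b\<in>UNIV. ps (of_int n * form k \<alpha> (hbasis b)) (annih (b, nat n - 1) f)"])
  fix M w
  have "heis k \<alpha> n (Poly_Mapping.single M 1) =
      (\<Sum>b\<in>UNIV. Poly_Mapping.single (M - {#(b, nat n - 1)#})
         (of_int n * form k \<alpha> (hbasis b) * of_nat (count M (b, nat n - 1))))"
    using assms by (simp add: heis_def sum_distrib_right mult_single pd_single)
  then show "h \<alpha> n (Poly_Mapping.single M w) =
      (\<Sum>b\<in>UNIV. ps (of_int n * form k \<alpha> (hbasis b)) (annih (b, nat n - 1) (Poly_Mapping.single M w)))"
    using assms by (simp add: mode_def tens_left_single additive.sum[OF tens_additive])
qed (auto intro!: additive.intro simp: h_simps annih_simps P.scale_right_distrib sum.distrib)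

lemma h_0_commute_create: "h \<alpha> 0 (create v f) = create v (h \<alpha> 0 f)"
  by (rule additive_eqI[of "\<lambda>f. h \<alpha> 0 (create v f)" "\<lambda>f. create v (h \<alpha> 0 f)"]) (auto intro!: additive.intro simp: h_simps create_simps h_0_single)

lemma h_0_commute_annih: "h \<alpha> 0 (annih v f) = annih v (h \<alpha> 0 f)"
  by (rule additive_eqI[of "\<lambda>f. h \<alpha> 0 (annih v f)" "\<lambda>f. annih v (h \<alpha> 0 f)"]) (auto intro!: additive.intro simp: h_simps annih_simps h_0_single lin_simps[OF Z_lin])

lemma h_0_h: "h \<alpha> 0 (h \<beta> n f) = h \<beta> n (h \<alpha> 0 f)"
proof -
  consider "n < 0" | "n = 0" | "n > 0" by linarith
  then show ?thesis
  proof cases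
    case 2
    have "h \<alpha> 0 (h \<beta> 0 f) = h \<beta> 0 (h \<alpha> 0 f)"
      by (rule additive_eqI[of "\<lambda>f. h \<alpha> 0 (h \<beta> 0 f)" "\<lambda>f. h \<beta> 0 (h \<alpha> 0 f)"])
         (auto intro!: additive.intro arg_cong[OF Z_comm] simp: h_simps h_0_single)
    with 2 show ?thesis by simp
  next
    case 1
    then show ?thesis by (simp only: h_neg h_simps h_0_commute_create)
  next
    case 3
    then show ?thesis by (simp only: h_pos h_simps h_0_commute_annih)
  qed
qed

lemma h_pos_neg:
  assumes "m > 0" "n < 0"
  shows "h \<alpha> m (h \<beta> n f) = h \<beta> n (h \<alpha> m f) + (if m + n = 0 then ps (of_int m * form k \<alpha> \<beta>) f else 0)"
proof -
  let ?i = "nat m - 1" and ?j = "nat (- n) - 1"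
  have ij: "nat (- n) - Suc 0 = nat m - Suc 0 \<longleftrightarrow> m + n = 0" using assms by auto
  have "h \<alpha> m (h \<beta> n f) = (\<Sum>b\<in>UNIV. \<Sum>b'\<in>UNIV. ps (of_int m * form k \<alpha> (hbasis b) * \<beta> $ b') (annih (b, ?i) (create (b', ?j) f)))"
    by (simp add: h_pos[OF assms(1)] h_neg[OF assms(2)] annih_simps P.scale_sum_right)
  also have "\<dots> = (\<Sum>b\<in>UNIV. \<Sum>b'\<in>UNIV. ps (of_int m * form k \<alpha> (hbasis b) * \<beta> $ b') (create (b', ?j) (annih (b, ?i) f)))
     + (\<Sum>b\<in>UNIV. \<Sum>b'\<in>UNIV. if b' = b then (if m + n = 0 then ps (of_int m * form k \<alpha> (hbasis b) * \<beta> $ b) f else 0) else 0)"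
    unfolding sum.distrib[symmetric] annih_create
    by (intro sum.cong refl) (auto simp: P.scale_right_distrib ij)
  also have "(\<Sum>b\<in>UNIV. \<Sum>b'\<in>UNIV. ps (of_int m * form k \<alpha> (hbasis b) * \<beta> $ b') (create (b', ?j) (annih (b, ?i) f)))
      = h \<beta> n (h \<alpha> m f)"
    by (subst sum.swap) (simp add: h_pos[OF assms(1)] h_neg[OF assms(2)] create_simps P.scale_sum_right mult_ac)
  also have "(\<Sum>b\<in>UNIV. \<Sum>b'\<in>UNIV. if b' = b then (if m + n = 0 then ps (of_int m * form k \<alpha> (hbasis b) * \<beta> $ b) f else 0) else 0)
      = (if m + n = 0 then ps (of_int m * form k \<alpha> \<beta>) f else 0)"
    by (simp add: form_expand[of k \<alpha> \<beta>] sum_distrib_left P.scale_sum_left mult_ac)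
  finally show ?thesis .
qed

text \<open>The Heisenberg relation with c = 1, by the signs of m and n. Only an annihilation
  operator against a creation operator contributes; zero modes commute with everything, in
  accordance with the factor m.\<close>

lemma h_comm: "h \<alpha> m (h \<beta> n f) - h \<beta> n (h \<alpha> m f) = (if m + n = 0 then ps (of_int m * form k \<alpha> \<beta>) f else 0)"
proof -
  consider "m > 0" "n < 0" | "m < 0" "n > 0" | "m = 0" | "n = 0" | "m > 0" "n > 0" | "m < 0" "n < 0" by linarith
  then show ?thesis
  proof cases
    case 1
    then show ?thesis by (simp add: h_pos_neg)
  next
    case 2
    then show ?thesis
    proof (cases "m + n = 0")
      case True
      then have "m = - n" by simp
      with h_pos_neg[OF 2(2,1), of \<beta> \<alpha> f] show ?thesis
        by (simp add: form_commute[of k \<alpha>])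
    qed (use h_pos_neg[OF 2(2,1), of \<beta> \<alpha> f] in \<open>simp add: add.commute\<close>)
  next
    case 5
    let ?i = "nat m - 1" and ?j = "nat n - 1"
    have "h \<alpha> m (h \<beta> n f) = (\<Sum>b\<in>UNIV. \<Sum>b'\<in>UNIV.
        ps (of_int m * form k \<alpha> (hbasis b) * (of_int n * form k \<beta> (hbasis b'))) (annih (b, ?i) (annih (b', ?j) f)))"
      using 5 by (simp add: h_pos annih_simps P.scale_sum_right)
    also have "\<dots> = (\<Sum>b'\<in>UNIV. \<Sum>b\<in>UNIV.
        ps (of_int n * form k \<beta> (hbasis b') * (of_int m * form k \<alpha> (hbasis b))) (annih (b', ?j) (annih (b, ?i) f)))"
      by (subst sum.swap, intro sum.cong refl) (simp only: mult.commute, rule arg_cong[OF annih_annih])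
    also have "\<dots> = h \<beta> n (h \<alpha> m f)"
      using 5 by (simp add: h_pos annih_simps P.scale_sum_right)
    finally show ?thesis using 5 by simp
  next
    case 6
    let ?i = "nat (- m) - 1" and ?j = "nat (- n) - 1"
    have "h \<alpha> m (h \<beta> n f) = (\<Sum>b\<in>UNIV. \<Sum>b'\<in>UNIV. ps (\<alpha> $ b * \<beta> $ b') (create (b, ?i) (create (b', ?j) f)))"
      using 6 by (simp add: h_neg create_simps P.scale_sum_right)
    also have "\<dots> = (\<Sum>b'\<in>UNIV. \<Sum>b\<in>UNIV. ps (\<beta> $ b' * \<alpha> $ b) (create (b', ?j) (create (b, ?i) f)))"
      by (subst sum.swap, intro sum.cong refl) (simp only: mult.commute, rule arg_cong[OF create_create])
    also have "\<dots> = h \<beta> n (h \<alpha> m f)"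
      using 6 by (simp add: h_neg create_simps P.scale_sum_right)
    finally show ?thesis using 6 by simp
  qed (auto simp: h_0_h)
qed

end

section \<open>Coefficients of exponentials\<close>

text \<open>Both sides run over the triples r \<ge> 1, c \<ge> 0, d \<ge> 0 with r + c + d = a; on
  the left b = r + c.\<close>

lemma sum_shift_triangle:
  fixes F :: "nat \<Rightarrow> nat \<Rightarrow> nat \<Rightarrow> 'a::comm_monoid_add"
  shows "(\<Sum>b\<le>a. \<Sum>r=1..b. F r (b - r) (a - b)) = (\<Sum>r=1..a. \<Sum>c\<le>a - r. F r c (a - r - c))"
proof -
  have "(\<Sum>b\<le>a. \<Sum>r=1..b. F r (b - r) (a - b)) =
     (\<Sum>(b, r)\<in>(SIGMA b:{..a}. {1..b}). F r (b - r) (a - b))"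
    by (rule sum.Sigma) auto
  also have "\<dots> = (\<Sum>(r, c)\<in>(SIGMA r:{1..a}. {..a - r}). F r c (a - r - c))"
    by (rule sum.reindex_bij_witness[of _ "\<lambda>(r, c). (c + r, r)" "\<lambda>(b, r). (r, b - r)"]) auto
  also have "\<dots> = (\<Sum>r=1..a. \<Sum>c\<le>a - r. F r c (a - r - c))"
    by (rule sum.Sigma[symmetric]) auto
  finally show ?thesis .
qed

lemma sum_reverse: "(\<Sum>c\<le>n. H (n - c) c) = (\<Sum>c\<le>n::nat. H c (n - c))"
  by (rule sum.reindex_bij_witness[of _ "\<lambda>c. n - c" "\<lambda>c. n - c"]) auto

context complex_vs
begin

text \<open>
  The coefficients \<open>S a\<close> of the exponential of \<open>(\<Sum>r>0. g\<^sub>r z^r / r)\<close> for commuting \<open>g\<^sub>r\<close>,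
  characterised by applying \<open>z d/dz\<close>.
\<close>

definition exp_seq :: "(nat \<Rightarrow> 'b \<Rightarrow> 'b) \<Rightarrow> (nat \<Rightarrow> 'b \<Rightarrow> 'b) \<Rightarrow> bool" where
  "exp_seq g S \<longleftrightarrow> (\<forall>r. lin scale (g r)) \<and> (\<forall>w. S 0 w = w) \<and>
     (\<forall>a w. scale (of_nat a) (S a w) = (\<Sum>r=1..a. g r (S (a - r) w)))"

lemma exp_seq_0: "exp_seq g S \<Longrightarrow> S 0 w = w"
  by (simp add: exp_seq_def)

lemma exp_seq_rec: "exp_seq g S \<Longrightarrow> scale (of_nat a) (S a w) = (\<Sum>r=1..a. g r (S (a - r) w))"
  by (simp add: exp_seq_def)

lemma exp_seq_g: "exp_seq g S \<Longrightarrow> lin scale (g r)"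
  by (simp add: exp_seq_def)

lemma scale_of_nat_cancel: "a > 0 \<Longrightarrow> scale (of_nat a) x = scale (of_nat a) y \<Longrightarrow> x = y"
  by (simp add: scale_left_imp_eq)

lemma exp_seq_lin:
  assumes "exp_seq g S"
  shows "lin scale (S a)"
proof (induction a rule: less_induct)
  case (less a)
  note lg = lin_simps[OF exp_seq_g[OF assms]]
  show ?case
  proof (cases "a = 0")
    case True
    then show ?thesis by (simp add: exp_seq_0[OF assms] lin_def additive_def)
  next
    case False
    then have a: "a > 0" by simp
    have lS: "S (a - r) (x + y) = S (a - r) x + S (a - r) y"
      "S (a - r) (scale c x) = scale c (S (a - r) x)" if "r \<in> {1..a}" for r x y c
      using lin_simps[OF less[of "a - r"]] that by auto
    show ?thesis
    proof (rule linI)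
      fix x y
      show "S a (x + y) = S a x + S a y"
        by (rule scale_of_nat_cancel[OF a], unfold scale_right_distrib exp_seq_rec[OF assms] sum.distrib[symmetric])
           (intro sum.cong refl, simp add: lS lg)
    next
      fix c x
      have "scale (of_nat a) (S a (scale c x)) = scale c (scale (of_nat a) (S a x))"
        unfolding exp_seq_rec[OF assms] scale_sum_right
        by (intro sum.cong refl) (simp add: lS lg)
      then have "scale (of_nat a) (S a (scale c x)) = scale (of_nat a) (scale c (S a x))"
        by (simp add: mult.commute)
      then show "S a (scale c x) = scale c (S a x)"
        by (rule scale_of_nat_cancel[OF a])
    qed
  qed
qed

text \<open>With G the sum of g_r z^r / r, the hypothesis says [T, G] = \<kappa> z^p, whence
  [T, exp G] = \<kappa> z^p exp G. The induction checks this through the recursion.\<close>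

lemma exp_seq_commutator:
  assumes e: "exp_seq g S" and T: "lin scale T" and p: "p > 0"
    and comm: "\<And>r w. r > 0 \<Longrightarrow> T (g r w) = g r (T w) + (if r = p then scale (of_nat p * \<kappa>) w else 0)"
  shows "T (S a w) = S a (T w) + (if p \<le> a then scale \<kappa> (S (a - p) w) else 0)"
proof (induction a arbitrary: w rule: less_induct)
  case (less a)
  note lg = lin_simps[OF exp_seq_g[OF e]] and lT = lin_simps[OF T]
  show ?case
  proof (cases "a = 0")
    case True
    then show ?thesis using p by (simp add: exp_seq_0[OF e])
  next
    case False
    then have a: "a > 0" by simp
    have "scale (of_nat a) (T (S a w)) = T (\<Sum>r=1..a. g r (S (a - r) w))"
      by (simp only: exp_seq_rec[OF e, symmetric] lin_scale[OF T])
    also have "\<dots> = (\<Sum>r=1..a. g r (T (S (a - r) w)) + (if r = p then scale (of_nat p * \<kappa>) (S (a - r) w) else 0))"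
      unfolding lT by (intro sum.cong refl comm) auto
    also have "\<dots> = (\<Sum>r=1..a. g r (S (a - r) (T w)))
        + (\<Sum>r=1..a. if p \<le> a - r then g r (scale \<kappa> (S (a - r - p) w)) else 0)
        + (\<Sum>r=1..a. if r = p then scale (of_nat p * \<kappa>) (S (a - r) w) else 0)"
      unfolding sum.distrib[symmetric]
    proof (intro sum.cong refl)
      fix r assume "r \<in> {1..a}"
      then have "a - r < a" by auto
      from less[OF this]
      show "g r (T (S (a - r) w)) + (if r = p then scale (of_nat p * \<kappa>) (S (a - r) w) else 0) =
         g r (S (a - r) (T w)) + (if p \<le> a - r then g r (scale \<kappa> (S (a - r - p) w)) else 0)
           + (if r = p then scale (of_nat p * \<kappa>) (S (a - r) w) else 0)"
        by (simp add: lg)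
    qed
    also have "(\<Sum>r=1..a. if r = p then scale (of_nat p * \<kappa>) (S (a - r) w) else 0) =
        (if p \<le> a then scale (of_nat p * \<kappa>) (S (a - p) w) else 0)"
      using p by (subst sum.delta) auto
    also have "(\<Sum>r=1..a. if p \<le> a - r then g r (scale \<kappa> (S (a - r - p) w)) else 0) =
        (if p \<le> a then scale \<kappa> (scale (of_nat (a - p)) (S (a - p) w)) else 0)"
    proof (cases "p \<le> a")
      case True
      have "(\<Sum>r=1..a. if p \<le> a - r then g r (scale \<kappa> (S (a - r - p) w)) else 0) =
        (\<Sum>r=1..a - p. scale \<kappa> (g r (S (a - p - r) w)))"
        using True by (intro sum.mono_neutral_cong_right) (auto simp: lg add.commute)
      then show ?thesis
        using True by (simp only: exp_seq_rec[OF e] scale_sum_right if_True)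
    next
      case False
      then show ?thesis by (auto intro!: sum.neutral)
    qed
    also have "(\<Sum>r=1..a. g r (S (a - r) (T w))) = scale (of_nat a) (S a (T w))"
      by (simp add: exp_seq_rec[OF e])
    \<comment> \<open>The two corrections carry the factors a - p, from the induction hypothesis,
      and p, from the commutator with g p; together they give a.\<close>
    finally have "scale (of_nat a) (T (S a w)) =
      scale (of_nat a) (S a (T w) + (if p \<le> a then scale \<kappa> (S (a - p) w) else 0))"
      by (auto simp: scale_right_distrib add.assoc of_nat_diff algebra_simps simp flip: scale_left_distrib)
    then show ?thesis by (rule scale_of_nat_cancel[OF a])
  qed
qed

lemma exp_seq_commute:
  assumes e: "exp_seq g S" and T: "lin scale T"
    and comm: "\<And>r w. r > 0 \<Longrightarrow> T (g r w) = g r (T w)"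
  shows "T (S a w) = S a (T w)"
  \<comment> \<open>An index p above a together with \<kappa> = 0 removes the correction from
    hypothesis and conclusion alike.\<close>
  using exp_seq_commutator[OF e T, of "Suc a" 0 a w] comm by auto

text \<open>For commuting G and G', exp (G + G') = exp G exp G'. Splitting the weight a as b + (a -
  b) is the Leibniz rule for z d/dz.\<close>

lemma exp_seq_mult:
  assumes e: "exp_seq g S" and e': "exp_seq g' S'" and e'': "exp_seq g'' S''"
    and g'': "\<And>r w. g'' r w = g r w + g' r w"
    and comm: "\<And>r r' w. r > 0 \<Longrightarrow> r' > 0 \<Longrightarrow> g r (g' r' w) = g' r' (g r w)"
  shows "S'' a w = (\<Sum>b\<le>a. S b (S' (a - b) w))"
proof (induction a rule: less_induct)
  case (less a)
  note lg = lin_simps[OF exp_seq_g[OF e]] and lg' = lin_simps[OF exp_seq_g[OF e']]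
  note lS = lin_simps[OF exp_seq_lin[OF e]]
  have gS: "g' r (S b w) = S b (g' r w)" if "r > 0" for r b w
    by (rule exp_seq_commute[OF e exp_seq_g[OF e']]) (use that comm in auto)
  show ?case
  proof (cases "a = 0")
    case True
    then show ?thesis by (simp add: exp_seq_0[OF e] exp_seq_0[OF e'] exp_seq_0[OF e''])
  next
    case False
    have 1: "(\<Sum>b\<le>a. scale (of_nat b) (S b (S' (a - b) w))) = (\<Sum>r=1..a. \<Sum>c\<le>a - r. g r (S c (S' (a - r - c) w)))"
      unfolding exp_seq_rec[OF e]
      by (rule sum_shift_triangle[of "\<lambda>r c d. g r (S c (S' d w))"])
    have "(\<Sum>b\<le>a. scale (of_nat (a - b)) (S b (S' (a - b) w))) =
        (\<Sum>b\<le>a. scale (of_nat b) (S (a - b) (S' b w)))"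
      by (rule sum.reindex_bij_witness[of _ "\<lambda>b. a - b" "\<lambda>b. a - b"]) auto
    also have "\<dots> = (\<Sum>b\<le>a. \<Sum>r=1..b. S (a - b) (g' r (S' (b - r) w)))"
      by (simp add: lS(1)[symmetric] exp_seq_rec[OF e'] lS)
    also have "\<dots> = (\<Sum>r=1..a. \<Sum>c\<le>a - r. S (a - r - c) (g' r (S' c w)))"
      by (rule sum_shift_triangle[of "\<lambda>r c d. S d (g' r (S' c w))"])
    also have "\<dots> = (\<Sum>r=1..a. \<Sum>c\<le>a - r. g' r (S (a - r - c) (S' c w)))"
      by (intro sum.cong refl) (simp add: gS)
    also have "\<dots> = (\<Sum>r=1..a. \<Sum>c\<le>a - r. g' r (S c (S' (a - r - c) w)))"
    proof (rule sum.cong[OF refl])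
      fix r
      show "(\<Sum>c\<le>a - r. g' r (S (a - r - c) (S' c w))) = (\<Sum>c\<le>a - r. g' r (S c (S' (a - r - c) w)))"
        by (rule sum_reverse[of "\<lambda>i j. g' r (S i (S' j w))"])
    qed
    finally have 2: "(\<Sum>b\<le>a. scale (of_nat (a - b)) (S b (S' (a - b) w))) =
       (\<Sum>r=1..a. \<Sum>c\<le>a - r. g' r (S c (S' (a - r - c) w)))" .
    have "scale (of_nat a) (\<Sum>b\<le>a. S b (S' (a - b) w)) =
       (\<Sum>b\<le>a. scale (of_nat b) (S b (S' (a - b) w)) + scale (of_nat (a - b)) (S b (S' (a - b) w)))"
      unfolding scale_sum_right by (intro sum.cong refl) (simp add: of_nat_diff flip: scale_left_distrib)
    also have "\<dots> = (\<Sum>r=1..a. g'' r (\<Sum>c\<le>a - r. S c (S' (a - r - c) w)))"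
      by (simp only: sum.distrib 1 2 g'' lg lg')
    also have "\<dots> = (\<Sum>r=1..a. g'' r (S'' (a - r) w))"
      by (intro sum.cong refl) (simp add: less)
    also have "\<dots> = scale (of_nat a) (S'' a w)"
      by (simp add: exp_seq_rec[OF e''])
    finally show ?thesis
      using scale_of_nat_cancel[of a] False by simp
  qed
qed

lemma exp_seq_closed:
  assumes e: "exp_seq g S" and U: "subspace U" and g: "\<And>r w. r > 0 \<Longrightarrow> w \<in> U \<Longrightarrow> g r w \<in> U" and w: "w \<in> U"
  shows "S a w \<in> U"
proof (induction a rule: less_induct)
  case (less a)
  show ?case
  proof (cases "a = 0")
    case False
    have "scale (of_nat a) (S a w) \<in> U"
      unfolding exp_seq_rec[OF e] by (intro subspace_sum[OF U] g less) auto
    then have "scale (1 / of_nat a) (scale (of_nat a) (S a w)) \<in> U"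
      by (rule subspace_scale[OF U])
    with False show ?thesis by simp
  qed (simp add: exp_seq_0[OF e] w)
qed

text \<open>Leads from the power series in F that defines E^+ and E^- to the recursion. The sign
  \<sigma> lets one proof serve expansions in z (for E^-) and in z^-1 (for E^+); by
  \<open>F0\<close> all exponents of F are at least 1 in the direction of \<sigma>.\<close>

lemma fexp_exp_seq:
  assumes lF: "\<And>m. lin scale (F m)" and comm: "\<And>m m' w. F m (F m' w) = F m' (F m w)"
    and \<sigma>: "\<sigma> = 1 \<or> \<sigma> = - 1" and F0: "\<And>m w. \<sigma> * m < 1 \<Longrightarrow> F m w = 0"
  shows "exp_seq (\<lambda>r w. scale (of_nat r) (F (\<sigma> * int r) w)) (\<lambda>a. fexp scale F (\<sigma> * int a))"
    and "\<sigma> * m < 0 \<Longrightarrow> fexp scale F m w = 0"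
proof -
  note lF' = lin_simps[OF lF]
  have ss: "\<sigma> * (\<sigma> * m) = m" for m using \<sigma> by auto
  \<comment> \<open>The r-th power of F starts at exponent r, so each coefficient of the exponential
    is a finite sum.\<close>
  have pw0: "fpow F r m w = 0" if "\<sigma> * m < int r" for r m w
    using that
  proof (induction r arbitrary: m)
    case 0
    then show ?case by (auto simp: fone_def)
  next
    case (Suc r)
    have "F (m - j) (fpow F r j w) = 0" for j
    proof (cases "\<sigma> * j < int r")
      case True
      then show ?thesis by (simp add: Suc.IH lF')
    next
      case False
      then have "\<sigma> * (m - j) < 1" using Suc.prems by (simp add: algebra_simps)
      then show ?thesis by (rule F0)
    qed
    then show ?case by (simp add: fmul_def)
  qed
  have fexp_eq: "fexp scale F m w = (\<Sum>r<N. scale (1 / fact r) (fpow F r m w))" if "\<sigma> * m < int N" for m w N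
    unfolding fexp_def by (rule Sum_any_lessThan) (use that in \<open>simp add: pw0\<close>)
  then show "fexp scale F m w = 0" if "\<sigma> * m < 0"
    using that fexp_eq[of m 0 w] by simp
  define f where "f r = F (\<sigma> * int r)" for r
  define G where "G r a w = fpow F r (\<sigma> * int a) w" for r a w
  have f0: "f 0 w = 0" for w by (simp add: f_def F0)
  have lf: "lin scale (f r)" for r by (simp add: f_def lF)
  note lf' = lin_simps[OF lf]
  have fc: "f r (f r' w) = f r' (f r w)" for r r' w unfolding f_def by (rule comm)
  have G0: "G 0 a w = (if a = 0 then w else 0)" for a w
    using \<sigma> by (auto simp: G_def fone_def)
  have Gz: "G r a w = 0" if "a < r" for r a w
    using that by (simp add: G_def pw0 ss)
  have GS: "G (Suc r) a w = (\<Sum>b\<le>a. f (a - b) (G r b w))" for r a w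
  proof -
    have "G (Suc r) a w = Sum_any (\<lambda>j. F (\<sigma> * int a - j) (fpow F r j w))"
      by (simp add: G_def fmul_def)
    also have "\<dots> = (\<Sum>j\<in>(\<lambda>b. \<sigma> * int b) ` {..a}. F (\<sigma> * int a - j) (fpow F r j w))"
    proof (rule Sum_any.expand_superset)
      show "{j. F (\<sigma> * int a - j) (fpow F r j w) \<noteq> 0} \<subseteq> (\<lambda>b. \<sigma> * int b) ` {..a}"
      proof
        fix j assume "j \<in> {j. F (\<sigma> * int a - j) (fpow F r j w) \<noteq> 0}"
        then have "\<not> \<sigma> * j < int r" "\<not> \<sigma> * (\<sigma> * int a - j) < 1"
          using pw0[of j r w] F0[of "\<sigma> * int a - j"] by (auto simp: lF')
        then have "\<sigma> * j \<ge> 0" "\<sigma> * j \<le> int a" by (auto simp: right_diff_distrib ss)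
        then have "nat (\<sigma> * j) \<in> {..a}" "j = \<sigma> * int (nat (\<sigma> * j))" by (auto simp: ss)
        then show "j \<in> (\<lambda>b. \<sigma> * int b) ` {..a}" by blast
      qed
    qed simp
    also have "\<dots> = (\<Sum>b\<le>a. F (\<sigma> * int a - \<sigma> * int b) (fpow F r (\<sigma> * int b) w))"
      using \<sigma> by (subst sum.reindex) (auto simp: inj_on_def)
    also have "\<dots> = (\<Sum>b\<le>a. f (a - b) (G r b w))"
      by (intro sum.cong refl) (simp add: f_def G_def of_nat_diff right_diff_distrib)
    finally show ?thesis .
  qed
  \<comment> \<open>The derivation z d/dz takes F^(r+1) to (r+1) (z dF/dz) F^r; this is read off at
    exponent a.\<close>
  have D: "scale (of_nat a) (G (Suc r) a w) = scale (of_nat (Suc r)) (\<Sum>b\<le>a. scale (of_nat (a - b)) (f (a - b) (G r b w)))" for a r w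
  proof (induction r arbitrary: a)
    case 0
    have 1: "G (Suc 0) a w = f a w"
      unfolding GS G0 by (simp add: if_distrib[of "f _"] lf' cong: if_cong)
    have "(\<Sum>b\<le>a. scale (of_nat (a - b)) (f (a - b) (G 0 b w))) = (\<Sum>b\<le>a. if b = 0 then scale (of_nat a) (f a w) else 0)"
      unfolding G0 by (intro sum.cong refl) (auto simp: lf')
    then show ?case
      by (simp add: 1)
  next
    case (Suc r)
    have "scale (of_nat a) (G (Suc (Suc r)) a w) = (\<Sum>b\<le>a. scale (of_nat (a - b)) (f (a - b) (G (Suc r) b w))
        + f (a - b) (scale (of_nat b) (G (Suc r) b w)))"
      unfolding GS[of "Suc r"] scale_sum_right
      by (intro sum.cong refl) (simp add: lf' of_nat_diff flip: scale_left_distrib)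
    also have "\<dots> = (\<Sum>b\<le>a. scale (of_nat (a - b)) (f (a - b) (G (Suc r) b w)))
       + scale (of_nat (Suc r)) (\<Sum>b\<le>a. f (a - b) (\<Sum>c\<le>b. scale (of_nat (b - c)) (f (b - c) (G r c w))))"
      by (simp add: sum.distrib Suc.IH lf' scale_sum_right)
    also have "(\<Sum>b\<le>a. f (a - b) (\<Sum>c\<le>b. scale (of_nat (b - c)) (f (b - c) (G r c w)))) =
       (\<Sum>b\<le>a. \<Sum>c\<le>b. scale (of_nat (b - c)) (f (b - c) (f (a - b) (G r c w))))"
      by (simp add: lf' fc)
    also have "\<dots> = (\<Sum>(b, c)\<in>(SIGMA b:{..a}. {..b}). scale (of_nat (b - c)) (f (b - c) (f (a - b) (G r c w))))"
      by (rule sum.Sigma) auto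
    \<comment> \<open>The involution b -> a + c - b exchanges a - b with b - c, so the weight moves
      to the outer factor.\<close>
    also have "\<dots> = (\<Sum>(b, c)\<in>(SIGMA b:{..a}. {..b}). scale (of_nat (a - b)) (f (a - b) (f (b - c) (G r c w))))"
      by (rule sum.reindex_bij_witness[of _ "\<lambda>(d, c). (a + c - d, c)" "\<lambda>(d, c). (a + c - d, c)"]) auto
    also have "\<dots> = (\<Sum>b\<le>a. \<Sum>c\<le>b. scale (of_nat (a - b)) (f (a - b) (f (b - c) (G r c w))))"
      by (rule sum.Sigma[symmetric]) auto
    also have "\<dots> = (\<Sum>b\<le>a. scale (of_nat (a - b)) (f (a - b) (G (Suc r) b w)))"
      by (simp add: GS lf' scale_sum_right)
    finally show ?case
      by (simp only: of_nat_Suc[of "Suc r"] scale_left_distrib scale_one)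
  qed
  show "exp_seq (\<lambda>r w. scale (of_nat r) (F (\<sigma> * int r) w)) (\<lambda>a. fexp scale F (\<sigma> * int a))"
    unfolding exp_seq_def
  proof (intro conjI allI)
    fix r show "lin scale (\<lambda>w. scale (of_nat r) (F (\<sigma> * int r) w))"
      by (rule lin_scale_fun[OF lF])
  next
    fix w show "fexp scale F (\<sigma> * int 0) w = w"
      using fexp_eq[of 0 1 w] by (simp add: fone_def)
  next
    fix a w
    have S: "fexp scale F (\<sigma> * int b) w = (\<Sum>r<N. scale (1 / fact r) (G r b w))" if "b < N" for b N
      using fexp_eq[of "\<sigma> * int b" N w] that by (simp add: ss G_def)
    have "scale (of_nat a) (fexp scale F (\<sigma> * int a) w) = (\<Sum>r<Suc (Suc a). scale (1 / fact r) (scale (of_nat a) (G r a w)))"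
      by (simp add: S[of a "Suc (Suc a)"] scale_sum_right mult.commute del: sum.lessThan_Suc)
    also have "\<dots> = (\<Sum>r<Suc a. scale (1 / fact (Suc r)) (scale (of_nat a) (G (Suc r) a w)))"
      by (subst sum.lessThan_Suc_shift) (simp add: G0)
    also have "\<dots> = (\<Sum>r<Suc a. \<Sum>b\<le>a. scale (of_nat (a - b)) (f (a - b) (scale (1 / fact r) (G r b w))))"
    proof (intro sum.cong refl)
      fix r
      have "(of_nat (Suc r) :: complex) / fact (Suc r) = 1 / fact r"
        by (simp add: field_simps del: of_nat_Suc)
      then have 1: "scale (1 / fact (Suc r)) (scale (of_nat (Suc r)) y) = scale (1 / fact r) y" for y
        by (simp only: scale_scale times_divide_eq_left mult_1)
      show "scale (1 / fact (Suc r)) (scale (of_nat a) (G (Suc r) a w)) =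
         (\<Sum>b\<le>a. scale (of_nat (a - b)) (f (a - b) (scale (1 / fact r) (G r b w))))"
        unfolding D 1 scale_sum_right by (intro sum.cong refl) (simp add: lf' mult.commute)
    qed
    also have "\<dots> = (\<Sum>b\<le>a. scale (of_nat (a - b)) (f (a - b) (fexp scale F (\<sigma> * int b) w)))"
      by (subst sum.swap) (intro sum.cong refl, simp add: S[of _ "Suc a"] lf' scale_sum_right del: sum.lessThan_Suc)
    also have "\<dots> = (\<Sum>r\<le>a. scale (of_nat r) (f r (fexp scale F (\<sigma> * int (a - r)) w)))"
      by (rule sum.reindex_bij_witness[of _ "\<lambda>b. a - b" "\<lambda>b. a - b"]) auto
    also have "\<dots> = (\<Sum>r=1..a. scale (of_nat r) (f r (fexp scale F (\<sigma> * int (a - r)) w)))"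
      by (rule sum.mono_neutral_right) (auto simp: f0)
    finally show "scale (of_nat a) (fexp scale F (\<sigma> * int a) w) =
        (\<Sum>r=1..a. scale (of_nat r) (F (\<sigma> * int r) (fexp scale F (\<sigma> * int (a - r)) w)))"
      by (simp only: f_def)
  qed
qed

end

context complex_vs
begin

text \<open>\<open>fexp_exp_seq\<close> yields an operator that is 0 at r = 0, whereas the intended
  g 0 is a zero mode. The recursion starts at r = 1 and does not see the difference.\<close>

lemma exp_seq_cong:
  assumes "exp_seq g S" "\<And>r. lin scale (g' r)" "\<And>r w. r > 0 \<Longrightarrow> g' r w = g r w"
  shows "exp_seq g' S"
proof -
  have "(\<Sum>r=1..a. g' r (S (a - r) w)) = (\<Sum>r=1..a. g r (S (a - r) w))" for a w
    by (intro sum.cong refl) (simp add: assms(3))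
  with assms(1,2) show ?thesis by (simp add: exp_seq_def)
qed

text \<open>The factor is never 0, so every monomial of f that contains v leaves a trace in
  \<open>annih v f\<close>. This gives the weight bound and, for irreducibility,
  nonvanishing.\<close>

lemma lookup_annih: "Poly_Mapping.lookup (annih v f) M = scale (of_nat (Suc (count M v))) (Poly_Mapping.lookup f (add_mset v M))"
proof (rule additive_eqI[of "\<lambda>f. Poly_Mapping.lookup (annih v f) M"
      "\<lambda>f. scale (of_nat (Suc (count M v))) (Poly_Mapping.lookup f (add_mset v M))"])
  fix N w
  show "Poly_Mapping.lookup (annih v (Poly_Mapping.single N w)) M =
     scale (of_nat (Suc (count M v))) (Poly_Mapping.lookup (Poly_Mapping.single N w) (add_mset v M))"
    by (cases "v \<in># N") (auto simp: lookup_single when_def not_in_iff dest: multi_member_split)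
qed (auto intro!: additive.intro simp: annih_simps lookup_add scale_right_distrib simp del: of_nat_Suc)

end

lemma single_additive: "additive (Poly_Mapping.single M :: 'a::ab_group_add \<Rightarrow> _)"
  by (rule additive.intro) (rule single_add)

text \<open>
  The weight is the degree of a monomial of \<open>M(1)\<close> (with \<open>snd v\<close> shifted by one: \<open>(b, j)\<close> stands
  for \<open>b(-j-1)\<close>). Bounded weight yields all truncation statements.
\<close>

definition weight :: "'n fvar multiset \<Rightarrow> nat" where
  "weight M = (\<Sum>v\<in>#M. Suc (snd v))"

lemma weight_add [simp]: "weight (add_mset v M) = Suc (snd v) + weight M"
  by (simp add: weight_def)

text \<open>The bound is an integer so that driving it below 0 forces f = 0.\<close>

definition weight_le :: "int \<Rightarrow> ('n fvar multiset \<Rightarrow>\<^sub>0 'w::zero) \<Rightarrow> bool" where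
  "weight_le d f \<longleftrightarrow> (\<forall>M. Poly_Mapping.lookup f M \<noteq> 0 \<longrightarrow> int (weight M) \<le> d)"

lemma weight_le_0 [simp]: "weight_le d 0"
  by (simp add: weight_le_def)

lemma weight_le_add: "weight_le d f \<Longrightarrow> weight_le d g \<Longrightarrow> weight_le d (f + g :: _ \<Rightarrow>\<^sub>0 'w::monoid_add)"
  by (auto simp: weight_le_def lookup_add) (metis add.right_neutral)

lemma weight_le_sum: "(\<And>i. i \<in> I \<Longrightarrow> weight_le d (f i)) \<Longrightarrow> weight_le d (sum f I :: _ \<Rightarrow>\<^sub>0 'w::comm_monoid_add)"
  by (induction I rule: infinite_finite_induct) (auto intro: weight_le_add)

lemma weight_le_neg_0: "weight_le d f \<Longrightarrow> d < 0 \<Longrightarrow> f = 0"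
  by (rule poly_mapping_eqI) (fastforce simp: weight_le_def)

lemma weight_le_exists: "\<exists>d. weight_le d f"
proof
  show "weight_le (\<Sum>M\<in>Poly_Mapping.keys f. int (weight M)) f"
    unfolding weight_le_def
  proof (intro allI impI)
    fix M assume "Poly_Mapping.lookup f M \<noteq> 0"
    then have "M \<in> Poly_Mapping.keys f" by (simp add: in_keys_iff)
    then show "int (weight M) \<le> (\<Sum>M\<in>Poly_Mapping.keys f. int (weight M))"
      by (intro member_le_sum) auto
  qed
qed

lemma (in complex_vs) weight_le_scale: "weight_le d f \<Longrightarrow> weight_le d (pm_scale scale c f)"
  by (auto simp: weight_le_def)

lemma (in complex_vs) weight_le_annih:
  assumes "weight_le d f"
  shows "weight_le (d - int (Suc (snd v))) (annih v f)"
  unfolding weight_le_def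
proof (intro allI impI)
  fix M assume "Poly_Mapping.lookup (annih v f) M \<noteq> 0"
  then have "Poly_Mapping.lookup f (add_mset v M) \<noteq> 0"
    by (auto simp: lookup_annih)
  with assms have "int (weight (add_mset v M)) \<le> d" by (auto simp: weight_le_def)
  then show "int (weight M) \<le> d - int (Suc (snd v))" by simp
qed

section \<open>The vertex operators of e^\<beta> and their commutators with Heisenberg modes\<close>

context fock_data
begin

lemma h_basis_neg: "h (hbasis b) (- 1 - int t) f = create (b, t) f"
proof -
  have n: "- 1 - int t < 0" and i: "nat (- (- 1 - int t)) - 1 = t" by simp_all
  have "h (hbasis b) (- 1 - int t) f = (\<Sum>b'\<in>UNIV. if b' = b then create (b, t) f else 0)"
    unfolding h_neg[OF n] i by (intro sum.cong refl) (auto simp: axis_def)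
  then show ?thesis by simp
qed

lemma h_expand: "h \<alpha> n f = (\<Sum>b\<in>UNIV. ps (\<alpha> $ b) (h (hbasis b) n f))"
proof -
  consider "n < 0" | "n = 0" | "n > 0" by linarith
  then show ?thesis
  proof cases
    case 1
    then have "n = - 1 - int (nat (- n) - 1)" by simp
    then have "h (hbasis b) n f = create (b, nat (- n) - 1) f" for b
      using h_basis_neg[of b "nat (- n) - 1" f] by simp
    with 1 show ?thesis by (simp add: h_neg)
  next
    case 2
    show ?thesis
      unfolding 2
    proof (rule additive_eqI[of "h \<alpha> 0" "\<lambda>f. \<Sum>b\<in>UNIV. ps (\<alpha> $ b) (h (hbasis b) 0 f)"])
      fix M w
      show "h \<alpha> 0 (Poly_Mapping.single M w) = (\<Sum>b\<in>UNIV. ps (\<alpha> $ b) (h (hbasis b) 0 (Poly_Mapping.single M w)))"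
        by (subst h_0_single, subst Z_expand) (simp add: h_0_single additive.sum[OF single_additive])
    qed (auto intro!: additive.intro simp: h_simps P.scale_right_distrib sum.distrib)
  next
    case 3
    have e: "form k \<alpha> \<beta> = (\<Sum>c\<in>UNIV. \<alpha> $ c * form k (hbasis c) \<beta>)" for \<beta>
      unfolding form_commute[of k \<alpha>] form_expand[of k \<beta> \<alpha>] by (simp add: form_commute)
    have "h \<alpha> n f = (\<Sum>b\<in>UNIV. \<Sum>c\<in>UNIV. ps (\<alpha> $ c) (ps (of_int n * form k (hbasis c) (hbasis b)) (annih (b, nat n - 1) f)))"
      unfolding h_pos[OF 3] by (subst e) (simp add: sum_distrib_left P.scale_sum_left mult_ac)
    also have "\<dots> = (\<Sum>c\<in>UNIV. ps (\<alpha> $ c) (h (hbasis c) n f))"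
      by (subst sum.swap) (simp add: h_pos[OF 3] P.scale_sum_right)
    finally show ?thesis .
  qed
qed

lemma h_minus: "h (- \<alpha>) n f = - h \<alpha> n f"
  unfolding h_expand[of "- \<alpha>"] h_expand[of \<alpha>] by (simp add: sum_negf)

lemma h_add_left: "h (\<alpha> + \<beta>) n f = h \<alpha> n f + h \<beta> n f"
  unfolding h_expand[of "\<alpha> + \<beta>"] h_expand[of \<alpha>] h_expand[of \<beta>]
  by (simp add: P.scale_left_distrib sum.distrib)

lemma weight_le_h: "n > 0 \<Longrightarrow> weight_le d f \<Longrightarrow> weight_le (d - n) (h \<alpha> n f)"
  unfolding h_pos
  by (intro weight_le_sum weight_le_scale) (use weight_le_annih[of d f "(_, nat n - 1)"] in auto)

lemma weight_le_h_0: "n > d \<Longrightarrow> n > 0 \<Longrightarrow> weight_le d f \<Longrightarrow> h \<alpha> n f = 0"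
  using weight_le_neg_0[OF weight_le_h[of n d f \<alpha>]] by simp

lemma h_fieldop: "fieldop ps (h \<alpha>)"
  unfolding fieldop_def truncated_def
proof (intro conjI allI h_lin)
  fix w :: "('n, 'w) fock"
  obtain d where "weight_le d w" using weight_le_exists by blast
  then show "\<exists>n0. \<forall>n\<ge>n0. h \<alpha> n w = 0"
    using weight_le_h_0[of d] by (intro exI[of _ "max d 0 + 1"]) auto
qed

text \<open>
  \<open>exp_coeff \<beta> m\<close> is the coefficient of \<open>z^m\<close> in \<open>Y(e\<^sup>\<beta>, z)\<close>. Below, \<open>exp_mode\<close> is the same family
  indexed by modes.
\<close>

definition Em where "Em \<beta> = Eminus k s Z (- emb_C \<beta>)"
definition Ep where "Ep \<beta> = Eplus k s Z (- emb_C \<beta>)"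
definition T where "T \<beta> = (tens_right (E \<beta>) :: ('n, 'w) fock \<Rightarrow> _)"
definition xi :: "'n lattC \<Rightarrow> int" where "xi \<beta> = \<lfloor>Re (x \<beta>)\<rfloor>"
definition exp_coeff where "exp_coeff \<beta> = Y_exp k s Z E x \<beta>"

lemma of_int_xi: "of_int (xi \<beta>) = x \<beta>"
  using x_int[of \<beta>] by (auto simp: xi_def elim!: Ints_cases)

lemma xi_add: "xi (\<beta> + \<gamma>) = xi \<beta> + xi \<gamma>"
  using of_int_xi[of "\<beta> + \<gamma>"] of_int_xi[of \<beta>] of_int_xi[of \<gamma>] x_add[of \<beta> \<gamma>]
  by (metis of_int_add of_int_eq_iff)

lemma h_emb_commute: "h (emb_C \<beta>) m (h (emb_C \<gamma>) n f) = h (emb_C \<gamma>) n (h (emb_C \<beta>) m f)"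
  using h_comm[of "emb_C \<beta>" m "emb_C \<gamma>" n f] by (simp split: if_splits)

text \<open>For m > 0 the exponent of E^-(-\<beta>, z) has the coefficient (-\<beta>)(-m) / (-m) =
  \<beta>(-m) / m: the two signs cancel.\<close>

lemma Em_exp_seq: "P.exp_seq (\<lambda>r. h (emb_C \<beta>) (- int r)) (\<lambda>a. Em \<beta> (int a))"
  and Em_neg: "n < 0 \<Longrightarrow> Em \<beta> n w = 0"
proof -
  define F where "F m w = (if - m < 0 then ps (1 / of_int (- m)) (h (- emb_C \<beta>) (- m) w) else 0)" for m w
  have EF: "Em \<beta> = fexp ps F" by (simp add: Em_def Eminus_def F_def[abs_def])
  have l: "lin ps (F m)" for m
    by (rule linI) (auto simp: F_def h_simps P.scale_right_distrib mult.commute)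
  have c: "F m (F m' w) = F m' (F m w)" for m m' w
    by (auto simp: F_def h_simps h_minus h_emb_commute[of \<beta> "- m"] mult.commute)
  have z: "1 * m < 1 \<Longrightarrow> F m w = 0" for m w by (simp add: F_def)
  note E = P.fexp_exp_seq[of F 1, OF l c _ z]
  show "P.exp_seq (\<lambda>r. h (emb_C \<beta>) (- int r)) (\<lambda>a. Em \<beta> (int a))"
    unfolding EF by (rule P.exp_seq_cong[OF E(1)[unfolded mult_1]]) (auto simp: F_def h_minus h_lin)
  show "n < 0 \<Longrightarrow> Em \<beta> n w = 0"
    using E(2)[of n w] unfolding EF by simp
qed

text \<open>Here z^(-r) has the coefficient (-\<beta>)(r) / r, so the sign stays.\<close>

lemma Ep_exp_seq: "P.exp_seq (\<lambda>r w. - h (emb_C \<beta>) (int r) w) (\<lambda>a. Ep \<beta> (- int a))"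
  and Ep_pos: "n > 0 \<Longrightarrow> Ep \<beta> n w = 0"
proof -
  define F where "F m w = (if - m > 0 then ps (1 / of_int (- m)) (h (- emb_C \<beta>) (- m) w) else 0)" for m w
  have EF: "Ep \<beta> = fexp ps F" by (simp add: Ep_def Eplus_def F_def[abs_def])
  have l: "lin ps (F m)" for m
    by (rule linI) (auto simp: F_def h_simps P.scale_right_distrib mult.commute)
  have c: "F m (F m' w) = F m' (F m w)" for m m' w
    by (auto simp: F_def h_simps h_minus h_emb_commute[of \<beta> "- m"] mult.commute)
  have z: "- 1 * m < 1 \<Longrightarrow> F m w = 0" for m w by (simp add: F_def)
  note E = P.fexp_exp_seq[of F "- 1", OF l c _ z]
  have l': "lin ps (\<lambda>w. - h (emb_C \<beta>) (int r) w)" for r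
    by (rule linI) (auto simp: h_simps)
  show "P.exp_seq (\<lambda>r w. - h (emb_C \<beta>) (int r) w) (\<lambda>a. Ep \<beta> (- int a))"
    unfolding EF by (rule P.exp_seq_cong[OF E(1)[unfolded mult_minus1]]) (auto simp: F_def h_minus l')
  show "n > 0 \<Longrightarrow> Ep \<beta> n w = 0"
    using E(2)[of n w] unfolding EF by simp
qed

lemma Em_lin: "lin ps (Em \<beta> n)"
proof (cases "n < 0")
  case True
  then show ?thesis by (simp add: lin_def additive_def Em_neg)
next
  case False
  then show ?thesis using P.exp_seq_lin[OF Em_exp_seq[of \<beta>], of "nat n"] by simp
qed

lemma Ep_lin: "lin ps (Ep \<beta> n)"
proof (cases "n > 0")
  case True
  then show ?thesis by (simp add: lin_def additive_def Ep_pos)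
next
  case False
  then show ?thesis using P.exp_seq_lin[OF Ep_exp_seq[of \<beta>], of "nat (- n)"] by simp
qed

lemma T_lin: "lin ps (T \<beta>)"
  by (simp add: T_def tens_right_lin E_lin)

lemmas Em_simps = lin_simps[OF Em_lin] and Ep_simps = lin_simps[OF Ep_lin] and T_simps = lin_simps[OF T_lin]

lemma T_single: "T \<beta> (Poly_Mapping.single M w) = Poly_Mapping.single M (E \<beta> w)"
  by (simp add: T_def tens_right_single lin_simps[OF E_lin])

text \<open>For p > 0 only \<beta>(-p) fails to commute with \<alpha>(p), the commutator being p
  (\<alpha>, \<beta>). The factors \<open>Em\<close>, \<open>Ep\<close> and \<open>T\<close> account
  for p > 0, p < 0 and p = 0, with the same constant, and so combine into
  \<open>exp_coeff_commutator\<close>.\<close>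

lemma Em_commutator:
  "h \<alpha> p (Em \<beta> n w) = Em \<beta> n (h \<alpha> p w) + (if p > 0 then ps (form k \<alpha> (emb_C \<beta>)) (Em \<beta> (n - p) w) else 0)"
proof (cases "n < 0")
  case True
  then show ?thesis by (simp add: Em_neg h_simps)
next
  case False
  then have n: "n = int (nat n)" by simp
  note hc = h_comm[of \<alpha> p "emb_C \<beta>" "- int r" for r, unfolded diff_eq_eq]
  show ?thesis
  proof (cases "p > 0")
    case True
    have "h \<alpha> p (Em \<beta> (int (nat n)) w) = Em \<beta> (int (nat n)) (h \<alpha> p w) +
        (if nat p \<le> nat n then ps (form k \<alpha> (emb_C \<beta>)) (Em \<beta> (int (nat n - nat p)) w) else 0)"
      by (rule P.exp_seq_commutator[OF Em_exp_seq h_lin]) (use True in \<open>auto simp: hc\<close>)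
    then show ?thesis using True False by (auto simp: Em_neg nat_diff_distrib[symmetric])
  next
    case p: False
    have "h \<alpha> p (Em \<beta> (int (nat n)) w) = Em \<beta> (int (nat n)) (h \<alpha> p w)"
      by (rule P.exp_seq_commute[OF Em_exp_seq h_lin]) (use p in \<open>auto simp: hc\<close>)
    then show ?thesis using p n by simp
  qed
qed

lemma Ep_commutator:
  "h \<alpha> p (Ep \<beta> n w) = Ep \<beta> n (h \<alpha> p w) + (if p < 0 then ps (form k \<alpha> (emb_C \<beta>)) (Ep \<beta> (n - p) w) else 0)"
proof (cases "n > 0")
  case True
  then show ?thesis by (simp add: Ep_pos h_simps)
next
  case False
  then have n: "n = - int (nat (- n))" by simp
  note hc = h_comm[of \<alpha> p "emb_C \<beta>" "int r" for r, unfolded diff_eq_eq]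
  show ?thesis
  proof (cases "p < 0")
    case True
    have "h \<alpha> p (Ep \<beta> (- int (nat (- n))) w) = Ep \<beta> (- int (nat (- n))) (h \<alpha> p w) +
        (if nat (- p) \<le> nat (- n) then ps (form k \<alpha> (emb_C \<beta>)) (Ep \<beta> (- int (nat (- n) - nat (- p))) w) else 0)"
      by (rule P.exp_seq_commutator[OF Ep_exp_seq h_lin]) (use True in \<open>auto simp: hc h_simps\<close>)
    then show ?thesis using True False by (auto simp: Ep_pos of_nat_diff)
  next
    case p: False
    have "h \<alpha> p (Ep \<beta> (- int (nat (- n))) w) = Ep \<beta> (- int (nat (- n))) (h \<alpha> p w)"
      by (rule P.exp_seq_commute[OF Ep_exp_seq h_lin]) (use p in \<open>auto simp: hc h_simps\<close>)
    then show ?thesis using p n by simp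
  qed
qed

lemma T_create: "T \<beta> (create v f) = create v (T \<beta> f)"
  by (rule additive_eqI[of "\<lambda>f. T \<beta> (create v f)" "\<lambda>f. create v (T \<beta> f)"])
     (auto intro!: additive.intro simp: T_simps create_simps T_single)

lemma T_annih: "T \<beta> (annih v f) = annih v (T \<beta> f)"
  by (rule additive_eqI[of "\<lambda>f. T \<beta> (annih v f)" "\<lambda>f. annih v (T \<beta> f)"])
     (auto intro!: additive.intro simp: T_simps annih_simps T_single lin_simps[OF E_lin])

lemma T_commutator:
  "h \<alpha> p (T \<beta> w) = T \<beta> (h \<alpha> p w) + (if p = 0 then ps (form k \<alpha> (emb_C \<beta>)) (T \<beta> w) else 0)"
proof -
  consider "p < 0" | "p = 0" | "p > 0" by linarith
  then show ?thesis
  proof cases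
    case 1
    then show ?thesis by (simp add: h_neg T_simps T_create)
  next
    case 2
    show ?thesis
      unfolding 2
      by (rule additive_eqI[of "\<lambda>w. h \<alpha> 0 (T \<beta> w)"
            "\<lambda>w. T \<beta> (h \<alpha> 0 w) + (if 0 = (0::int) then ps (form k \<alpha> (emb_C \<beta>)) (T \<beta> w) else 0)"])
         (auto intro!: additive.intro simp: T_simps h_simps T_single h_0_single Z_E single_add P.scale_right_distrib)
  next
    case 3
    then show ?thesis by (simp add: h_pos T_simps T_annih)
  qed
qed

lemma T_T: "T \<beta> (T \<gamma> w) = T (\<beta> + \<gamma>) w"
  by (rule additive_eqI[of "\<lambda>w. T \<beta> (T \<gamma> w)" "T (\<beta> + \<gamma>)"])
     (auto intro!: additive.intro simp: T_simps T_single E_add)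

lemma T_Em: "T \<gamma> (Em \<beta> n w) = Em \<beta> n (T \<gamma> w)"
proof (cases "n < 0")
  case True
  then show ?thesis by (simp add: Em_neg T_simps)
next
  case False
  have "T \<gamma> (Em \<beta> (int (nat n)) w) = Em \<beta> (int (nat n)) (T \<gamma> w)"
    by (rule P.exp_seq_commute[OF Em_exp_seq T_lin]) (simp add: T_commutator)
  then show ?thesis using False by simp
qed

lemma T_Ep: "T \<gamma> (Ep \<beta> n w) = Ep \<beta> n (T \<gamma> w)"
proof (cases "n > 0")
  case True
  then show ?thesis by (simp add: Ep_pos T_simps)
next
  case False
  have "T \<gamma> (Ep \<beta> (- int (nat (- n))) w) = Ep \<beta> (- int (nat (- n))) (T \<gamma> w)"
    by (rule P.exp_seq_commute[OF Ep_exp_seq T_lin]) (simp add: T_commutator T_simps)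
  then show ?thesis using False by simp
qed

lemma Em_commute_gen:
  assumes "lin ps U" "\<And>n w. U (h (emb_C \<beta>) n w) = h (emb_C \<beta>) n (U w)"
  shows "U (Em \<beta> n w) = Em \<beta> n (U w)"
proof (cases "n < 0")
  case True
  then show ?thesis by (simp add: Em_neg lin_simps[OF assms(1)])
next
  case False
  have "U (Em \<beta> (int (nat n)) w) = Em \<beta> (int (nat n)) (U w)"
    by (rule P.exp_seq_commute[OF Em_exp_seq assms(1)]) (simp add: assms)
  then show ?thesis using False by simp
qed

lemma Ep_commute_gen:
  assumes "lin ps U" "\<And>n w. U (h (emb_C \<beta>) n w) = h (emb_C \<beta>) n (U w)"
  shows "U (Ep \<beta> n w) = Ep \<beta> n (U w)"
proof (cases "n > 0")
  case True
  then show ?thesis by (simp add: Ep_pos lin_simps[OF assms(1)])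
next
  case False
  have "U (Ep \<beta> (- int (nat (- n))) w) = Ep \<beta> (- int (nat (- n))) (U w)"
    by (rule P.exp_seq_commute[OF Ep_exp_seq assms(1)]) (simp add: assms lin_simps[OF assms(1)])
  then show ?thesis using False by simp
qed

lemma weight_le_T: "weight_le d w \<Longrightarrow> weight_le d (T \<beta> w)"
  using additive.zero[OF lin_additive[OF E_lin], of \<beta>] by (auto simp: weight_le_def T_def tens_right_def lookup_map_0) metis

text \<open>Each \<beta>(r) with r > 0 lowers the weight by r, and the recursion passes this on to
  all coefficients.\<close>

lemma weight_le_Ep:
  assumes w: "weight_le d w"
  shows "weight_le (d + n) (Ep \<beta> n w)"
proof (cases "n > 0")
  case True
  then show ?thesis by (simp add: Ep_pos)
next
  case False
  have "weight_le (d - int a) (Ep \<beta> (- int a) w)" for a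
  proof (induction a rule: less_induct)
    case (less a)
    show ?case
    proof (cases "a = 0")
      case True
      then show ?thesis using P.exp_seq_0[OF Ep_exp_seq[of \<beta>]] w by simp
    next
      case a: False
      have "weight_le (d - int a) (\<Sum>r=1..a. - h (emb_C \<beta>) (int r) (Ep \<beta> (- int (a - r)) w))"
      proof (rule weight_le_sum)
        fix r assume r: "r \<in> {1..a}"
        then have "weight_le (d - int (a - r)) (Ep \<beta> (- int (a - r)) w)" by (intro less) auto
        from weight_le_h[OF _ this, of "int r" "- emb_C \<beta>"] r
        show "weight_le (d - int a) (- h (emb_C \<beta>) (int r) (Ep \<beta> (- int (a - r)) w))"
          by (simp add: h_minus of_nat_diff)
      qed
      from weight_le_scale[OF this, of "1 / of_nat a"]
      have "weight_le (d - int a) (ps (1 / of_nat a) (ps (of_nat a) (Ep \<beta> (- int a) w)))"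
        by (simp only: P.exp_seq_rec[OF Ep_exp_seq])
      then show ?thesis
        using a by simp
    qed
  qed
  from this[of "nat (- n)"] False show ?thesis by simp
qed

lemma Ep_weight_le_0: "weight_le d w \<Longrightarrow> d + n < 0 \<Longrightarrow> Ep \<beta> n w = 0"
  using weight_le_Ep weight_le_neg_0 by blast

text \<open>The factor z^\<beta> has the single exponent \<open>xi \<beta>\<close>, which collapses
  the inner product of series.\<close>

lemma exp_coeff_eq: "exp_coeff \<beta> m w = Sum_any (\<lambda>j. Em \<beta> (m - j) (Ep \<beta> (j - xi \<beta>) (T \<beta> w)))"
proof -
  have "fmul (Ep \<beta>) (\<lambda>m w. if of_int m = x \<beta> then tens_right (E \<beta>) w else 0) j w = Ep \<beta> (j - xi \<beta>) (T \<beta> w)" for j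
  proof -
    have "Ep \<beta> (j - l) (if of_int l = x \<beta> then tens_right (E \<beta>) w else 0) =
       (if l = xi \<beta> then Ep \<beta> (j - xi \<beta>) (T \<beta> w) else 0)" for l
      by (simp add: of_int_xi[symmetric] Ep_simps T_def)
    then show ?thesis by (simp add: fmul_def)
  qed
  then show ?thesis
    by (simp add: exp_coeff_def Y_exp_def fmul_def[of "Em \<beta>"] flip: Em_def Ep_def)
qed

lemma exp_coeff_supp:
  assumes "weight_le d w"
  shows "{j. Em \<beta> (m - j) (Ep \<beta> (j - xi \<beta>) (T \<beta> w)) \<noteq> 0} \<subseteq> {xi \<beta> - d..m}"
proof
  fix j assume j: "j \<in> {j. Em \<beta> (m - j) (Ep \<beta> (j - xi \<beta>) (T \<beta> w)) \<noteq> 0}"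
  then have "\<not> m - j < 0" using Em_neg[of "m - j"] by auto
  moreover have "\<not> d + (j - xi \<beta>) < 0" using j Ep_weight_le_0[OF weight_le_T[OF assms]] by (auto simp: Em_simps)
  ultimately show "j \<in> {xi \<beta> - d..m}" by auto
qed

lemma exp_coeff_sum:
  assumes "weight_le d w" "finite J" "{xi \<beta> - d..m} \<subseteq> J"
  shows "exp_coeff \<beta> m w = (\<Sum>j\<in>J. Em \<beta> (m - j) (Ep \<beta> (j - xi \<beta>) (T \<beta> w)))"
  unfolding exp_coeff_eq using exp_coeff_supp[OF assms(1)] assms(2,3) by (intro Sum_any.expand_superset) auto

lemma exp_coeff_fin: "finite {j. Em \<beta> (m - j) (Ep \<beta> (j - xi \<beta>) (T \<beta> w)) \<noteq> 0}"
  using weight_le_exists[of w] finite_subset[OF exp_coeff_supp] by auto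

lemma exp_coeff_lin: "lin ps (exp_coeff \<beta> m)"
proof (rule linI)
  fix w v :: "('n, 'w) fock"
  obtain d d' where d: "weight_le d w" "weight_le d' v" using weight_le_exists by metis
  then have "weight_le (max d d') w" "weight_le (max d d') v" by (auto simp: weight_le_def)
  moreover from this have "weight_le (max d d') (w + v)" by (rule weight_le_add)
  ultimately show "exp_coeff \<beta> m (w + v) = exp_coeff \<beta> m w + exp_coeff \<beta> m v"
    by (simp add: exp_coeff_sum[OF _ finite_atLeastAtMost_int order_refl, of "max d d'"] T_simps Ep_simps Em_simps sum.distrib)
  fix c
  from d(1) have "weight_le d (ps c w)" by (rule weight_le_scale)
  with d(1) show "exp_coeff \<beta> m (ps c w) = ps c (exp_coeff \<beta> m w)"
    by (simp add: exp_coeff_sum[OF _ finite_atLeastAtMost_int order_refl, of d] T_simps Ep_simps Em_simps P.scale_sum_right)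
qed

lemmas exp_coeff_simps = lin_simps[OF exp_coeff_lin]

lemma exp_coeff_weight_le_0: "weight_le d w \<Longrightarrow> m < xi \<beta> - d \<Longrightarrow> exp_coeff \<beta> m w = 0"
  by (simp add: exp_coeff_sum[OF _ finite_atLeastAtMost_int order_refl])

definition exp_mode where "exp_mode \<beta> q = exp_coeff \<beta> (- q - 1)"

lemma exp_mode_fieldop: "fieldop ps (exp_mode \<beta>)"
  unfolding fieldop_def truncated_def
proof (intro conjI allI)
  show "lin ps (exp_mode \<beta> n)" for n by (simp add: exp_mode_def exp_coeff_lin)
  fix w :: "('n, 'w) fock"
  obtain d where "weight_le d w" using weight_le_exists by blast
  then show "\<exists>n0. \<forall>n\<ge>n0. exp_mode \<beta> n w = 0"
    by (intro exI[of _ "d - xi \<beta>"]) (auto simp: exp_mode_def intro: exp_coeff_weight_le_0)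
qed

lemma exp_coeff_commutator: "h \<alpha> p (exp_coeff \<beta> m w) = exp_coeff \<beta> m (h \<alpha> p w) + ps (form k \<alpha> (emb_C \<beta>)) (exp_coeff \<beta> (m - p) w)"
proof -
  let ?\<kappa> = "form k \<alpha> (emb_C \<beta>)"
  let ?f = "\<lambda>m w j. Em \<beta> (m - j) (Ep \<beta> (j - xi \<beta>) (T \<beta> w))"
  \<comment> \<open>Exactly one of the three factors contributes. For p < 0 it is \<open>Ep\<close>,
    whose exponent rises by -p, so in this case the summation index has to be shifted.\<close>
  have cases: "h \<alpha> p (?f m w j) = ?f m (h \<alpha> p w) j +
      ps ?\<kappa> (?f (m - p) w (if p < 0 then j - p else j))" for j
  proof -
    consider "p < 0" | "p = 0" | "p > 0" by linarith
    then show ?thesis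
      by cases (simp_all add: Em_commutator Ep_commutator T_commutator Em_simps Ep_simps T_simps algebra_simps)
  qed
  let ?l = "\<lambda>j::int. if p < 0 then j - p else j"
  have bij: "bij ?l" by (rule o_bij[of "\<lambda>j. if p < 0 then j + p else j"]) (auto simp: fun_eq_iff)
  have sh: "Sum_any (\<lambda>j. ?f (m - p) w (?l j)) = exp_coeff \<beta> (m - p) w"
    unfolding exp_coeff_eq by (rule Sum_any.reindex_cong[OF bij, symmetric]) (auto simp: o_def)
  have fin: "finite {j. ?f (m - p) w (?l j) \<noteq> 0}"
  proof -
    have "{j. ?f (m - p) w (?l j) \<noteq> 0} = ?l -` {j. ?f (m - p) w j \<noteq> 0}" by auto
    then show ?thesis
      by (simp only:) (rule finite_vimageI[OF exp_coeff_fin bij_is_inj[OF bij]])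
  qed
  have "h \<alpha> p (exp_coeff \<beta> m w) = Sum_any (\<lambda>j. h \<alpha> p (?f m w j))"
    unfolding exp_coeff_eq by (rule additive_Sum_any[OF lin_additive[OF h_lin] exp_coeff_fin])
  also have "\<dots> = Sum_any (\<lambda>j. ?f m (h \<alpha> p w) j) + Sum_any (\<lambda>j. ps ?\<kappa> (?f (m - p) w (?l j)))"
    unfolding cases
    by (rule Sum_any.distrib[OF exp_coeff_fin]) (rule finite_subset[OF _ fin], auto)
  also have "Sum_any (\<lambda>j. ps ?\<kappa> (?f (m - p) w (?l j))) = ps ?\<kappa> (exp_coeff \<beta> (m - p) w)"
    unfolding sh[symmetric] by (rule additive_Sum_any[symmetric, OF _ fin]) (simp add: additive.intro P.scale_right_distrib)
  finally show ?thesis by (simp add: exp_coeff_eq)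
qed

lemma exp_mode_commutator: "h \<alpha> p (exp_mode \<beta> q w) - exp_mode \<beta> q (h \<alpha> p w) = ps (form k \<alpha> (emb_C \<beta>)) (exp_mode \<beta> (p + q) w)"
proof -
  have "- q - 1 - p = - (p + q) - 1" by simp
  then show ?thesis by (simp only: exp_mode_def exp_coeff_commutator) simp
qed

text \<open>Because (\<beta>, \<gamma>) = 0, Y(e^\<beta>) commutes with all modes of \<gamma> and
  with T \<gamma>, from which Y(e^\<gamma>) is built.\<close>

lemma exp_coeff_exp_coeff_commute: "exp_coeff \<beta> m (exp_coeff \<gamma> m' w) = exp_coeff \<gamma> m' (exp_coeff \<beta> m w)"
proof -
  have c: "exp_coeff \<beta> m (h (emb_C \<gamma>) n w) = h (emb_C \<gamma>) n (exp_coeff \<beta> m w)" for n w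
    by (simp add: exp_coeff_commutator)
  have t: "exp_coeff \<beta> m (T \<gamma> w) = T \<gamma> (exp_coeff \<beta> m w)"
  proof -
    have "T \<beta> (T \<gamma> w) = T \<gamma> (T \<beta> w)" by (simp add: T_T add.commute)
    then show ?thesis
      unfolding exp_coeff_eq by (subst additive_Sum_any[OF lin_additive[OF T_lin] exp_coeff_fin]) (simp add: T_Em T_Ep)
  qed
  have "exp_coeff \<beta> m (exp_coeff \<gamma> m' w) = Sum_any (\<lambda>j. exp_coeff \<beta> m (Em \<gamma> (m' - j) (Ep \<gamma> (j - xi \<gamma>) (T \<gamma> w))))"
    unfolding exp_coeff_eq[of \<gamma>] by (rule additive_Sum_any[OF lin_additive[OF exp_coeff_lin] exp_coeff_fin])
  also have "\<dots> = exp_coeff \<gamma> m' (exp_coeff \<beta> m w)"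
    unfolding exp_coeff_eq[of \<gamma>] Em_commute_gen[of "exp_coeff \<beta> m", OF exp_coeff_lin c] Ep_commute_gen[of "exp_coeff \<beta> m", OF exp_coeff_lin c] t ..
  finally show ?thesis .
qed

end

lemma Sum_any_shift_nat:
  fixes f :: "nat \<Rightarrow> 'a::comm_monoid_add"
  assumes "\<And>i. i < r \<Longrightarrow> f i = 0"
  shows "Sum_any f = Sum_any (\<lambda>i. f (i + r))"
proof (rule Sum_any_inj_reindex)
  show "inj (\<lambda>i::nat. i + r)" by (auto intro: injI)
  fix y assume "y \<notin> range (\<lambda>i. i + r)"
  then have "y < r" by (metis le_add_diff_inverse2 not_le rangeI)
  then show "f y = 0" by (rule assms)
qed

section \<open>Derivatives of Heisenberg fields, products and derivatives of exponential
  fields\<close>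

context fock_data
begin

text \<open>
  Modes of the divided derivative \<open>\<partial>\<^sub>t \<alpha>(z)\<close>.
\<close>

definition dmode :: "'n hh \<Rightarrow> nat \<Rightarrow> int \<Rightarrow> ('n, 'w) fock \<Rightarrow> ('n, 'w) fock" where
  "dmode \<alpha> t j w = ps ((- 1) ^ t * (of_int j gchoose t)) (h \<alpha> (j - int t) w)"

lemma dmode_fieldop: "fieldop ps (dmode \<alpha> t)"
  unfolding fieldop_def truncated_def
proof (intro conjI allI)
  fix n show "lin ps (dmode \<alpha> t n)"
    unfolding dmode_def[abs_def] by (rule P.lin_scale_fun[OF h_lin])
next
  fix w :: "('n, 'w) fock"
  obtain n0 where "\<And>n. n \<ge> n0 \<Longrightarrow> h \<alpha> n w = 0"
    using fieldop_truncated[OF h_fieldop[of \<alpha>], unfolded truncated_def, rule_format, of w] by blast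
  then show "\<exists>n0. \<forall>n\<ge>n0. dmode \<alpha> t n w = 0"
    by (intro exI[of _ "n0 + int t"]) (auto simp: dmode_def)
qed

text \<open>The modes of the derivative are those of \<alpha> shifted by t. Indices i < t carry
  binom(i, t) = 0, so both sums can be reindexed to the split of the modes of \<alpha> at 0.\<close>

lemma nprod_dmode:
  assumes b: "fieldop ps b"
  shows "nprod (dmode \<alpha> t) b q w = (\<Sum>i::nat. ps (of_int (int i) gchoose t) (h \<alpha> (- 1 - int i) (b (q + int i - int t) w))
     + ps (of_int (- 1 - int i) gchoose t) (b (q - 1 - int t - int i) (h \<alpha> (int i) w)))"
proof -
  note lb = lin_simps[OF fieldop_lin[OF b]]
  have c: "(- 1) ^ t * (of_int (- 1 - int i) gchoose t) = (of_int (int (i + t)) gchoose t :: complex)" for i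
    by (simp only: gchoose_neg gchoose_of_nat) (simp flip: mult.assoc power_mult_distrib)
  have c': "(- 1) ^ t * (of_int (int (i + t)) gchoose t) = (of_int (- 1 - int i) gchoose t :: complex)" for i
    by (simp only: gchoose_neg gchoose_of_nat)
  have e1: "dmode \<alpha> t (- 1 - int i) (b (q + int i) w) =
      ps (of_int (int (i + t)) gchoose t) (h \<alpha> (- 1 - int (i + t)) (b (q + int (i + t) - int t) w))" for i
  proof -
    have "- 1 - int i - int t = - 1 - int (i + t)" "q + int (i + t) - int t = q + int i" by simp_all
    then show ?thesis by (simp only: dmode_def c)
  qed
  have e2: "b (q - 1 - int (i + t)) (dmode \<alpha> t (int (i + t)) w) =
      ps (of_int (- 1 - int i) gchoose t) (b (q - 1 - int t - int i) (h \<alpha> (int i) w))" for i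
  proof -
    have "int (i + t) - int t = int i" "q - 1 - int (i + t) = q - 1 - int t - int i" by simp_all
    then show ?thesis by (simp only: dmode_def c' lb)
  qed
  have z1: "(of_int (int i) gchoose t :: complex) = 0" if "i < t" for i
    using that by (simp add: gchoose_of_nat del: of_int_of_nat_eq)
  have z2: "dmode \<alpha> t (int i) w = 0" if "i < t" for i
    by (simp only: dmode_def z1[OF that]) simp
  obtain N where N: "\<And>i. i \<ge> N \<Longrightarrow> b (q + int i) w = 0" "\<And>i. i \<ge> N \<Longrightarrow> dmode \<alpha> t (int i) w = 0"
      "\<And>i. i \<ge> N \<Longrightarrow> b (q - int t + int i) w = 0" "\<And>i. i \<ge> N \<Longrightarrow> h \<alpha> (int i) w = 0"
  proof -
    have "\<forall>\<^sub>F N in sequentially. (\<forall>i\<ge>N. b (q + int i) w = 0) \<and> (\<forall>i\<ge>N. dmode \<alpha> t (0 + int i) w = 0) \<and>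
       (\<forall>i\<ge>N. b (q - int t + int i) w = 0) \<and> (\<forall>i\<ge>N. h \<alpha> (0 + int i) w = 0)" (is "\<forall>\<^sub>F N in _. ?P N")
      by (intro eventually_conj truncated_ev fieldop_truncated[OF b] fieldop_truncated[OF dmode_fieldop] fieldop_truncated[OF h_fieldop])
    from eventually_happens[OF this] obtain N where "?P N" by auto
    then show thesis by (intro that[of N]) auto
  qed
  note fin = finite_support_nat[of N]
  have "nprod (dmode \<alpha> t) b q w = (\<Sum>i::nat. dmode \<alpha> t (- 1 - int i) (b (q + int i) w)) + (\<Sum>i::nat. b (q - 1 - int i) (dmode \<alpha> t (int i) w))"
    unfolding nprod_def
    by (rule Sum_any.distrib) (auto intro!: fin simp: N lin_simps[OF fieldop_lin[OF dmode_fieldop]] lb)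
  also have "(\<Sum>i::nat. dmode \<alpha> t (- 1 - int i) (b (q + int i) w)) =
      (\<Sum>i::nat. ps (of_int (int i) gchoose t) (h \<alpha> (- 1 - int i) (b (q + int i - int t) w)))"
    unfolding e1 by (rule Sum_any_shift_nat[symmetric]) (simp only: z1, simp)
  also have "(\<Sum>i::nat. b (q - 1 - int i) (dmode \<alpha> t (int i) w)) =
      (\<Sum>i::nat. ps (of_int (- 1 - int i) gchoose t) (b (q - 1 - int t - int i) (h \<alpha> (int i) w)))"
    by (subst Sum_any_shift_nat[of t]) (simp_all only: z2 lb e2)
  also have "(\<Sum>i::nat. ps (of_int (int i) gchoose t) (h \<alpha> (- 1 - int i) (b (q + int i - int t) w))) +
     (\<Sum>i::nat. ps (of_int (- 1 - int i) gchoose t) (b (q - 1 - int t - int i) (h \<alpha> (int i) w))) =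
     (\<Sum>i::nat. ps (of_int (int i) gchoose t) (h \<alpha> (- 1 - int i) (b (q + int i - int t) w))
     + ps (of_int (- 1 - int i) gchoose t) (b (q - 1 - int t - int i) (h \<alpha> (int i) w)))"
  proof (rule Sum_any.distrib[symmetric]; rule fin)
    fix i assume "i \<ge> N"
    then have "b (q + int i - int t) w = 0" "h \<alpha> (int i) w = 0" using N(3)[of i] N(4)[of i] by (simp_all add: algebra_simps)
    then show "ps (of_int (int i) gchoose t) (h \<alpha> (- 1 - int i) (b (q + int i - int t) w)) = 0"
        "ps (of_int (- 1 - int i) gchoose t) (b (q - 1 - int t - int i) (h \<alpha> (int i) w)) = 0"
      by (simp_all add: h_simps lb)
  qed
  finally show ?thesis .
qed

lemma h_0_emb: "h (emb_C \<beta>) 0 w = ps (x \<beta>) w"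
  by (rule additive_eqI[of "h (emb_C \<beta>) 0" "ps (x \<beta>)"])
     (auto intro!: additive.intro simp: h_simps h_0_single Z_emb P.scale_right_distrib)

lemma exp_coeff_nat:
  assumes w: "weight_le d w" and N: "d < int N"
  shows "exp_coeff \<beta> m w = (\<Sum>b<N. Em \<beta> (m - xi \<beta> + int b) (Ep \<beta> (- int b) (T \<beta> w)))"
proof -
  let ?f = "\<lambda>j. Em \<beta> (m - j) (Ep \<beta> (j - xi \<beta>) (T \<beta> w))"
  have "exp_coeff \<beta> m w = Sum_any (\<lambda>b::nat. ?f (xi \<beta> - int b))"
    unfolding exp_coeff_eq
  proof (rule Sum_any_inj_reindex)
    show "inj (\<lambda>b. xi \<beta> - int b)" by (auto intro: injI)
    fix j assume "j \<notin> range (\<lambda>b. xi \<beta> - int b)"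
    then have "\<not> j \<le> xi \<beta>" by (auto simp: image_iff dest!: spec[of _ "nat (xi \<beta> - j)"])
    then show "?f j = 0" by (simp add: Ep_pos Em_simps)
  qed
  also have "\<dots> = (\<Sum>b<N. ?f (xi \<beta> - int b))"
  proof (rule Sum_any_lessThan)
    fix b assume "b \<ge> N"
    then have "Ep \<beta> (xi \<beta> - int b - xi \<beta>) (T \<beta> w) = 0" using N by (intro Ep_weight_le_0[OF weight_le_T[OF w]]) auto
    then show "?f (xi \<beta> - int b) = 0" by (simp add: Em_simps)
  qed
  finally show ?thesis by (simp add: algebra_simps)
qed

text \<open>The addition rule of the exponential for E^-. The set L may exceed the support, so that
  one L serves all terms in \<open>exp_coeff_mult\<close>.\<close>

lemma Em_mult:
  assumes "finite L" "{c..n} \<subseteq> L"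
  shows "(\<Sum>l\<in>L. Em \<beta> (l - c) (Em \<gamma> (n - l) u)) = Em (\<beta> + \<gamma>) (n - c) u"
proof -
  have "(\<Sum>l\<in>L. Em \<beta> (l - c) (Em \<gamma> (n - l) u)) = (\<Sum>l\<in>{c..n}. Em \<beta> (l - c) (Em \<gamma> (n - l) u))"
    using assms by (intro sum.mono_neutral_right) (auto simp: not_le Em_neg Em_simps)
  also have "\<dots> = Em (\<beta> + \<gamma>) (n - c) u"
  proof (cases "n < c")
    case True
    then show ?thesis by (simp add: Em_neg)
  next
    case False
    have "(\<Sum>l\<in>{c..n}. Em \<beta> (l - c) (Em \<gamma> (n - l) u)) =
        (\<Sum>b\<le>nat (n - c). Em \<beta> (int b) (Em \<gamma> (int (nat (n - c) - b)) u))"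
      by (rule sum.reindex_bij_witness[of _ "\<lambda>b. int b + c" "\<lambda>l. nat (l - c)"])
         (use False in \<open>auto simp: of_nat_diff\<close>)
    also have "\<dots> = Em (\<beta> + \<gamma>) (int (nat (n - c))) u"
      by (rule P.exp_seq_mult[OF Em_exp_seq Em_exp_seq Em_exp_seq, symmetric])
         (auto simp: emb_C_add h_add_left h_emb_commute[of \<beta>])
    finally show ?thesis using False by simp
  qed
  finally show ?thesis .
qed

lemma Ep_mult: "(\<Sum>b\<le>r. Ep \<beta> (- int b) (Ep \<gamma> (- int (r - b)) u)) = Ep (\<beta> + \<gamma>) (- int r) u"
  by (rule P.exp_seq_mult[OF Ep_exp_seq Ep_exp_seq Ep_exp_seq, symmetric])
     (auto simp: emb_C_add h_add_left h_simps h_emb_commute[of \<beta>])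

lemma Em_Em: "Em \<beta> m (Em \<gamma> n w) = Em \<gamma> n (Em \<beta> m w)"
proof -
  have "Em \<beta> m (h (emb_C \<gamma>) l w) = h (emb_C \<gamma>) l (Em \<beta> m w)" for l w
    by (simp add: Em_commutator)
  from Em_commute_gen[OF Em_lin this] show ?thesis .
qed

lemma Ep_Em: "Ep \<beta> m (Em \<gamma> n w) = Em \<gamma> n (Ep \<beta> m w)"
proof -
  have "Ep \<beta> m (h (emb_C \<gamma>) l w) = h (emb_C \<gamma>) l (Ep \<beta> m w)" for l w
    by (simp add: Ep_commutator)
  from Em_commute_gen[OF Ep_lin this] show ?thesis .
qed

lemma weight_le_max: "weight_le d w \<Longrightarrow> d \<le> d' \<Longrightarrow> weight_le d' w"
  by (auto simp: weight_le_def)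

lemma exp_coeff_exp_coeff_0: 
  assumes "weight_le d w" "l < xi \<beta> - d \<or> l' < xi \<gamma> - d"
  shows "exp_coeff \<beta> l (exp_coeff \<gamma> l' w) = 0"
  using assms(2)
proof
  assume "l < xi \<beta> - d"
  then show ?thesis
    by (subst exp_coeff_exp_coeff_commute) (simp add: exp_coeff_weight_le_0[OF assms(1)] exp_coeff_simps)
qed (simp add: exp_coeff_weight_le_0[OF assms(1)] exp_coeff_simps)

lemma weight_le_exists_nat: "\<exists>d::nat. weight_le (int d) w"
proof -
  obtain d where "weight_le d w" using weight_le_exists by blast
  then have "weight_le (int (nat d)) w" by (rule weight_le_max) simp
  then show ?thesis by blast
qed

text \<open>Exponential fields can be multiplied at the same z: since (\<beta>, \<gamma>) = 0, E^+
  of one commutes with E^- of the other, and equal factors combine. The interval inside L covers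
  every l that the weight of w allows.\<close>

lemma exp_coeff_mult:
  assumes w: "weight_le (int d) w" and L: "finite L" "{xi \<beta> - int d..t - xi \<gamma> + int d} \<subseteq> L"
  shows "(\<Sum>l\<in>L. exp_coeff \<beta> l (exp_coeff \<gamma> (t - l) w)) = exp_coeff (\<beta> + \<gamma>) t w"
proof -
  let ?n = "Suc d" and ?w = "T (\<beta> + \<gamma>) w"
  let ?P = "\<lambda>a b. Ep \<gamma> (- int a) (Ep \<beta> (- int b) ?w)"
  have w': "weight_le (int d) ?w" by (rule weight_le_T[OF w])
  have P0: "?P a b = 0" if "a + b \<ge> ?n" for a b
    by (rule Ep_weight_le_0[OF weight_le_Ep[OF w', of "- int b"]]) (use that in auto)
  have exp: "exp_coeff \<beta> l (exp_coeff \<gamma> l' w) = (\<Sum>a<?n. \<Sum>b<?n. Em \<beta> (l - xi \<beta> + int b) (Em \<gamma> (l' - xi \<gamma> + int a) (?P a b)))" for l l'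
  proof -
    have c: "exp_coeff \<beta> l (h (emb_C \<gamma>) n w) = h (emb_C \<gamma>) n (exp_coeff \<beta> l w)" for n w
      by (simp add: exp_coeff_commutator)
    have e: "exp_coeff \<gamma> l' w = (\<Sum>a<?n. Em \<gamma> (l' - xi \<gamma> + int a) (Ep \<gamma> (- int a) (T \<gamma> w)))"
      by (rule exp_coeff_nat[OF w]) simp
    have "exp_coeff \<beta> l (exp_coeff \<gamma> l' w) = (\<Sum>a<?n. exp_coeff \<beta> l (Em \<gamma> (l' - xi \<gamma> + int a) (Ep \<gamma> (- int a) (T \<gamma> w))))"
      unfolding e exp_coeff_simps ..
    also have "\<dots> = (\<Sum>a<?n. Em \<gamma> (l' - xi \<gamma> + int a) (Ep \<gamma> (- int a) (exp_coeff \<beta> l (T \<gamma> w))))"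
      by (simp only: Em_commute_gen[of "exp_coeff \<beta> l", OF exp_coeff_lin c] Ep_commute_gen[of "exp_coeff \<beta> l", OF exp_coeff_lin c])
    also have "exp_coeff \<beta> l (T \<gamma> w) = (\<Sum>b<?n. Em \<beta> (l - xi \<beta> + int b) (Ep \<beta> (- int b) ?w))"
      using exp_coeff_nat[OF weight_le_T[OF w], of ?n \<beta> l \<gamma>] by (simp add: T_T)
    finally show ?thesis
      by (simp only: Em_simps Ep_simps Ep_Em Em_Em[of \<gamma> _ \<beta>])
  qed
  have "(\<Sum>l\<in>L. exp_coeff \<beta> l (exp_coeff \<gamma> (t - l) w)) =
     (\<Sum>l\<in>L. \<Sum>a<?n. \<Sum>b<?n. Em \<beta> (l - xi \<beta> + int b) (Em \<gamma> (t - l - xi \<gamma> + int a) (?P a b)))"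
    unfolding exp ..
  also have "\<dots> = (\<Sum>a<?n. \<Sum>b<?n. \<Sum>l\<in>L. Em \<beta> (l - xi \<beta> + int b) (Em \<gamma> (t - l - xi \<gamma> + int a) (?P a b)))"
    by (subst sum.swap, intro sum.cong refl, rule sum.swap)
  also have "\<dots> = (\<Sum>a<?n. \<Sum>b<?n. Em (\<beta> + \<gamma>) (t - xi \<beta> - xi \<gamma> + int (a + b)) (?P a b))"
  proof (intro sum.cong refl)
    fix a b assume ab: "a \<in> {..<?n}" "b \<in> {..<?n}"
    have "(\<Sum>l\<in>L. Em \<beta> (l - (xi \<beta> - int b)) (Em \<gamma> ((t - xi \<gamma> + int a) - l) (?P a b))) =
       Em (\<beta> + \<gamma>) ((t - xi \<gamma> + int a) - (xi \<beta> - int b)) (?P a b)"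
    proof (rule Em_mult[OF L(1)])
      have "{xi \<beta> - int b..t - xi \<gamma> + int a} \<subseteq> {xi \<beta> - int d..t - xi \<gamma> + int d}" using ab by auto
      with L(2) show "{xi \<beta> - int b..t - xi \<gamma> + int a} \<subseteq> L" by (rule order_trans[rotated])
    qed
    then show "(\<Sum>l\<in>L. Em \<beta> (l - xi \<beta> + int b) (Em \<gamma> (t - l - xi \<gamma> + int a) (?P a b))) =
       Em (\<beta> + \<gamma>) (t - xi \<beta> - xi \<gamma> + int (a + b)) (?P a b)"
      by (simp add: algebra_simps)
  qed
  \<comment> \<open>Collect by the total degree r that the two factors E^+ remove.\<close>
  also have "\<dots> = (\<Sum>r<?n. \<Sum>a\<le>r. Em (\<beta> + \<gamma>) (t - xi \<beta> - xi \<gamma> + int (a + (r - a))) (?P a (r - a)))"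
    by (rule sum_square_conv) (simp only: P0 Em_simps)
  also have "\<dots> = (\<Sum>r<?n. Em (\<beta> + \<gamma>) (t - xi (\<beta> + \<gamma>) + int r) (Ep (\<beta> + \<gamma>) (- int r) ?w))"
  proof (intro sum.cong refl)
    fix r
    have "Ep (\<beta> + \<gamma>) (- int r) ?w = (\<Sum>a\<le>r. ?P a (r - a))"
      using Ep_mult[of \<gamma> \<beta> r ?w] by (simp add: add.commute)
    then show "(\<Sum>a\<le>r. Em (\<beta> + \<gamma>) (t - xi \<beta> - xi \<gamma> + int (a + (r - a))) (?P a (r - a))) =
       Em (\<beta> + \<gamma>) (t - xi (\<beta> + \<gamma>) + int r) (Ep (\<beta> + \<gamma>) (- int r) ?w)"
      by (simp add: Em_simps xi_add diff_diff_eq)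
  qed
  also have "\<dots> = exp_coeff (\<beta> + \<gamma>) t w"
    by (rule exp_coeff_nat[OF w, symmetric]) simp
  finally show ?thesis .
qed

lemma Em_deriv:
  assumes "n \<le> int N"
  shows "ps (of_int n) (Em \<beta> n w) = (\<Sum>i<N. h (emb_C \<beta>) (- 1 - int i) (Em \<beta> (n - 1 - int i) w))"
proof (cases "n < 0")
  case True
  then show ?thesis by (simp add: Em_neg h_simps)
next
  case False
  then have n: "n = int (nat n)" by simp
  have "(\<Sum>i<N. h (emb_C \<beta>) (- 1 - int i) (Em \<beta> (n - 1 - int i) w)) =
      (\<Sum>i<nat n. h (emb_C \<beta>) (- 1 - int i) (Em \<beta> (n - 1 - int i) w))"
    using assms False by (intro sum.mono_neutral_right) (auto simp: Em_neg h_simps)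
  also have "\<dots> = (\<Sum>r=1..nat n. h (emb_C \<beta>) (- int r) (Em \<beta> (int (nat n - r)) w))"
    by (rule sum.reindex_bij_witness[of _ "\<lambda>r. r - 1" Suc]) (use False in \<open>auto simp: of_nat_diff algebra_simps\<close>)
  also have "\<dots> = ps (of_nat (nat n)) (Em \<beta> (int (nat n)) w)"
    by (simp only: P.exp_seq_rec[OF Em_exp_seq])
  finally show ?thesis using False by (simp add: of_nat_nat)
qed

lemma Ep_deriv:
  assumes "- n < int N"
  shows "ps (of_int n) (Ep \<beta> n w) = (\<Sum>i=1..<N. Ep \<beta> (n + int i) (h (emb_C \<beta>) (int i) w))"
proof (cases "n > 0")
  case True
  then show ?thesis by (simp add: Ep_pos)
next
  case False
  let ?n = "nat (- n)"
  have hE: "h (emb_C \<beta>) (int r) (Ep \<beta> l w) = Ep \<beta> l (h (emb_C \<beta>) (int r) w)" for r l w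
    by (simp add: Ep_commutator)
  have "(\<Sum>i=1..<N. Ep \<beta> (n + int i) (h (emb_C \<beta>) (int i) w)) = (\<Sum>i=1..?n. Ep \<beta> (- int (?n - i)) (h (emb_C \<beta>) (int i) w))"
    using assms False by (intro sum.mono_neutral_cong_right) (auto simp: Ep_pos of_nat_diff add.commute)
  also have "\<dots> = - (\<Sum>r=1..?n. - h (emb_C \<beta>) (int r) (Ep \<beta> (- int (?n - r)) w))"
    by (simp add: sum_negf hE)
  also have "\<dots> = - ps (of_nat ?n) (Ep \<beta> (- int ?n) w)"
    by (simp only: P.exp_seq_rec[OF Ep_exp_seq])
  finally show ?thesis using False by (simp add: of_nat_nat)
qed

text \<open>The derivative of Y(e^\<beta>) at z^(m-1), which is mode -m. Where E^+ removes degree b,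
  the creation modes yield \<open>?c + b\<close> from E^-, the positive modes -b from E^+, and the
  zero mode \<open>x \<beta>\<close>; the total is m.\<close>

lemma exp_coeff_deriv: "ps (of_int m) (exp_coeff \<beta> m w) = nprod (h (emb_C \<beta>)) (exp_mode \<beta>) (- m) w"
proof -
  obtain d :: nat where w: "weight_le (int d) w" using weight_le_exists_nat by blast
  let ?B = "\<lambda>b. Ep \<beta> (- int b) (T \<beta> w)" and ?c = "m - xi \<beta>"
  have w': "weight_le (int d) (h (emb_C \<beta>) (int i) w)" for i
  proof (cases "i = 0")
    case True
    then show ?thesis by (simp add: h_0_emb weight_le_scale[OF w])
  next
    case False
    then show ?thesis using weight_le_h[OF _ w, of "int i" "emb_C \<beta>"] by (auto intro: weight_le_max)
  qed
  have "\<forall>\<^sub>F N in sequentially. N \<ge> Suc d \<and> N \<ge> nat (?c + int d) \<and>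
     nprod (h (emb_C \<beta>)) (exp_mode \<beta>) (- m) w = (\<Sum>i<N. h (emb_C \<beta>) (- 1 - int i) (exp_mode \<beta> (- m + int i) w)
        + exp_mode \<beta> (- m - 1 - int i) (h (emb_C \<beta>) (int i) w))"
    using eventually_ge_at_top[of "Suc d"] eventually_ge_at_top[of "nat (?c + int d)"]
      P.nprod_ev[OF h_fieldop[of "emb_C \<beta>"] exp_mode_fieldop[of \<beta>], of "- m" w]
    by eventually_elim auto
  then obtain N where N: "N \<ge> Suc d" "N \<ge> nat (?c + int d)"
    and np: "nprod (h (emb_C \<beta>)) (exp_mode \<beta>) (- m) w = (\<Sum>i<N. h (emb_C \<beta>) (- 1 - int i) (exp_mode \<beta> (- m + int i) w)
        + exp_mode \<beta> (- m - 1 - int i) (h (emb_C \<beta>) (int i) w))"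
    using eventually_happens by fastforce
  have i1: "exp_mode \<beta> (- m + int i) w = (\<Sum>b<Suc d. Em \<beta> (?c + int b - 1 - int i) (?B b))" for i
    using exp_coeff_nat[OF w, of "Suc d" \<beta> "m - int i - 1"] by (simp add: exp_mode_def algebra_simps)
  have s1: "(\<Sum>i<N. h (emb_C \<beta>) (- 1 - int i) (exp_mode \<beta> (- m + int i) w)) =
     (\<Sum>b<Suc d. ps (of_int (?c + int b)) (Em \<beta> (?c + int b) (?B b)))"
  proof -
    have "(\<Sum>i<N. h (emb_C \<beta>) (- 1 - int i) (exp_mode \<beta> (- m + int i) w)) =
      (\<Sum>b<Suc d. \<Sum>i<N. h (emb_C \<beta>) (- 1 - int i) (Em \<beta> (?c + int b - 1 - int i) (?B b)))"
      unfolding i1 h_simps by (rule sum.swap)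
    also have "\<dots> = (\<Sum>b<Suc d. ps (of_int (?c + int b)) (Em \<beta> (?c + int b) (?B b)))"
      by (intro sum.cong refl Em_deriv[symmetric]) (use N in auto)
    finally show ?thesis .
  qed
  have i2: "exp_mode \<beta> (- m - 1 - int i) (h (emb_C \<beta>) (int i) w) =
     (\<Sum>b<Suc d. Em \<beta> (?c + int b) (Ep \<beta> (- int b + int i) (h (emb_C \<beta>) (int i) (T \<beta> w))))" for i
  proof -
    have "exp_mode \<beta> (- m - 1 - int i) (h (emb_C \<beta>) (int i) w) = exp_coeff \<beta> (m + int i) (h (emb_C \<beta>) (int i) w)"
      by (simp add: exp_mode_def algebra_simps)
    also have "\<dots> = (\<Sum>b<Suc d + i. Em \<beta> (m + int i - xi \<beta> + int b) (Ep \<beta> (- int b) (T \<beta> (h (emb_C \<beta>) (int i) w))))"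
      by (rule exp_coeff_nat[OF w']) simp
    also have "\<dots> = (\<Sum>b<Suc d + i. Em \<beta> (m + int i - xi \<beta> + int b) (Ep \<beta> (- int b) (h (emb_C \<beta>) (int i) (T \<beta> w))))"
      by (simp add: T_commutator)
    also have "\<dots> = (\<Sum>b<Suc d. Em \<beta> (?c + int b) (Ep \<beta> (- int b + int i) (h (emb_C \<beta>) (int i) (T \<beta> w))))"
    proof -
      \<comment> \<open>\<open>?H\<close> vanishes for b < i because \<open>Ep\<close> has no
        positive exponents, and for b > d by weight. So the range that depends on i can be replaced
        by a common one.\<close>
      let ?H = "\<lambda>b::int. Em \<beta> (?c + b) (Ep \<beta> (- b + int i) (h (emb_C \<beta>) (int i) (T \<beta> w)))"
      have H0: "?H b = 0" if "b < int i \<or> b > int d" for b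
      proof (cases "b < int i")
        case True
        then show ?thesis by (simp add: Ep_pos Em_simps)
      next
        case False
        with that have "b > int d" by simp
        have "Ep \<beta> (- b + int i) (h (emb_C \<beta>) (int i) (T \<beta> w)) = 0"
        proof (cases "i = 0")
          case True
          then show ?thesis using Ep_weight_le_0[OF weight_le_T[OF w]] \<open>b > int d\<close> by (simp add: h_0_emb Ep_simps)
        next
          case i: False
          then have "weight_le (int d - int i) (h (emb_C \<beta>) (int i) (T \<beta> w))"
            by (intro weight_le_h weight_le_T w) simp
          from Ep_weight_le_0[OF this] show ?thesis using \<open>b > int d\<close> by auto
        qed
        then show ?thesis by (simp add: Em_simps)
      qed
      have "(\<Sum>b<Suc d + i. Em \<beta> (m + int i - xi \<beta> + int b) (Ep \<beta> (- int b) (h (emb_C \<beta>) (int i) (T \<beta> w)))) =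
          (\<Sum>b<Suc d + i. ?H (int (b + i)))"
        by (intro sum.cong refl) (simp add: algebra_simps)
      also have "\<dots> = (\<Sum>b\<in>{i..<Suc d + i + i}. ?H (int b))"
        by (rule sum.reindex_bij_witness[of _ "\<lambda>b. b - i" "\<lambda>b. b + i"]) auto
      also have "\<dots> = (\<Sum>b<Suc d. ?H (int b))"
      proof (rule sum.mono_neutral_cong)
        show "?H (int b) = 0" if "b \<in> {..<Suc d} - {i..<Suc d + i + i}" for b
          by (rule H0) (use that in auto)
        show "?H (int b) = 0" if "b \<in> {i..<Suc d + i + i} - {..<Suc d}" for b
          by (rule H0) (use that in auto)
      qed auto
      finally show ?thesis .
    qed
    finally show ?thesis .
  qed
  have s2: "(\<Sum>i<N. exp_mode \<beta> (- m - 1 - int i) (h (emb_C \<beta>) (int i) w)) =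
     (\<Sum>b<Suc d. Em \<beta> (?c + int b) (ps (of_int (- int b) + x \<beta>) (?B b)))"
  proof -
    have in1: "(\<Sum>i<N. Ep \<beta> (- int b + int i) (h (emb_C \<beta>) (int i) (T \<beta> w))) = ps (of_int (- int b) + x \<beta>) (?B b)"
      if "b < Suc d" for b
    proof -
      have "{..<N} = insert 0 {1..<N}" using N by auto
      then have "(\<Sum>i<N. Ep \<beta> (- int b + int i) (h (emb_C \<beta>) (int i) (T \<beta> w))) =
         Ep \<beta> (- int b) (h (emb_C \<beta>) 0 (T \<beta> w)) + (\<Sum>i=1..<N. Ep \<beta> (- int b + int i) (h (emb_C \<beta>) (int i) (T \<beta> w)))"
        by simp
      also have "(\<Sum>i=1..<N. Ep \<beta> (- int b + int i) (h (emb_C \<beta>) (int i) (T \<beta> w))) = ps (of_int (- int b)) (?B b)"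
        by (rule Ep_deriv[symmetric]) (use that N in auto)
      finally show ?thesis by (simp add: h_0_emb Ep_simps P.scale_left_diff_distrib)
    qed
    have "(\<Sum>i<N. exp_mode \<beta> (- m - 1 - int i) (h (emb_C \<beta>) (int i) w)) =
       (\<Sum>b<Suc d. Em \<beta> (?c + int b) (\<Sum>i<N. Ep \<beta> (- int b + int i) (h (emb_C \<beta>) (int i) (T \<beta> w))))"
      unfolding i2 Em_simps by (rule sum.swap)
    also have "\<dots> = (\<Sum>b<Suc d. Em \<beta> (?c + int b) (ps (of_int (- int b) + x \<beta>) (?B b)))"
      by (intro sum.cong refl arg_cong[of _ _ "Em _ _"] in1) simp
    finally show ?thesis .
  qed
  have "nprod (h (emb_C \<beta>)) (exp_mode \<beta>) (- m) w =
     (\<Sum>b<Suc d. ps (of_int (?c + int b)) (Em \<beta> (?c + int b) (?B b))) +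
     (\<Sum>b<Suc d. Em \<beta> (?c + int b) (ps (of_int (- int b) + x \<beta>) (?B b)))"
    unfolding np sum.distrib s1 s2 ..
  also have "\<dots> = (\<Sum>b<Suc d. ps (of_int m) (Em \<beta> (?c + int b) (?B b)))"
    unfolding sum.distrib[symmetric]
    by (intro sum.cong refl) (simp add: Em_simps of_int_xi[symmetric] flip: P.scale_left_distrib)
  also have "\<dots> = ps (of_int m) (exp_coeff \<beta> m w)"
    using exp_coeff_nat[OF w, of "Suc d" \<beta> m] by (simp add: P.scale_sum_right del: sum.lessThan_Suc)
  finally show ?thesis ..
qed

end

context complex_vs
begin

text \<open>The two claims share one induction because the insertion step of the first uses the
  second.\<close>

lemma nprod_sum_left:
  assumes "finite S" "\<And>i. fieldop scale (A i)" "fieldop scale b"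
  shows "nprod (\<lambda>n w. \<Sum>i\<in>S. A i n w) b q w = (\<Sum>i\<in>S. nprod (A i) b q w)"
    and "fieldop scale (\<lambda>n w. \<Sum>i\<in>S. A i n w)"
  using assms(1)
proof (induction S rule: finite_induct)
  case empty
  show "nprod (\<lambda>n w. \<Sum>i\<in>{}. A i n w) b q w = (\<Sum>i\<in>{}. nprod (A i) b q w)"
    by (simp add: nprod_def lin_simps[OF fieldop_lin[OF assms(3)]])
  show "fieldop scale (\<lambda>n w. \<Sum>i\<in>{}. A i n w)" by (simp add: fieldop_zero)
next
  case (insert i S)
  have e: "(\<Sum>i\<in>insert i S. A i n w) = A i n w + (\<Sum>i\<in>S. A i n w)" for n w
    using insert by simp
  show "nprod (\<lambda>n w. \<Sum>i\<in>insert i S. A i n w) b q w = (\<Sum>i\<in>insert i S. nprod (A i) b q w)"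
    by (subst nprod_add_left[OF assms(2)[of i] insert.IH(2) assms(3) e]) (use insert in simp)
  show "fieldop scale (\<lambda>n w. \<Sum>i\<in>insert i S. A i n w)"
    unfolding fieldop_def truncated_def
  proof (intro conjI allI)
    show "lin scale (\<lambda>w. \<Sum>i\<in>insert i S. A i n w)" for n
      unfolding e by (rule lin_add_fun[OF fieldop_lin[OF assms(2)] fieldop_lin[OF insert.IH(2)]])
    fix w
    obtain n0 n1 where "\<forall>n\<ge>n0. A i n w = 0" "\<forall>n\<ge>n1. (\<Sum>i\<in>S. A i n w) = 0"
      using fieldop_truncated[OF assms(2)[of i]] fieldop_truncated[OF insert.IH(2)] unfolding truncated_def by meson
    then show "\<exists>n0. \<forall>n\<ge>n0. (\<Sum>i\<in>insert i S. A i n w) = 0"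
      unfolding e by (intro exI[of _ "max n0 n1"]) auto
  qed
qed

lemma fieldop_add:
  assumes "fieldop scale A" "fieldop scale B"
  shows "fieldop scale (\<lambda>n w. A n w + B n w)"
proof -
  have "fieldop scale (\<lambda>n w. \<Sum>i\<in>UNIV. (if i then A else B) n w)"
    by (rule nprod_sum_left(2)[OF _ _ assms(1)]) (use assms in auto)
  then show ?thesis by (simp add: UNIV_bool add.commute)
qed

lemma fdivderiv_eq:
  "fdivderiv scale t F m w = scale (of_int (m + int t) gchoose t) (F (m + int t) w)"
proof -
  have "(fderiv scale ^^ t) F m w = scale (fact t * (of_int (m + int t) gchoose t)) (F (m + int t) w)" for m
  proof (induction t arbitrary: m)
    case (Suc t)
    have m1: "m + 1 + int t = m + int (Suc t)" by simp
    have "(of_int (m + int (Suc t)) :: complex) * (of_int (m + int (Suc t)) gchoose t) =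
        of_nat t * (of_int (m + int (Suc t)) gchoose t) + of_nat (Suc t) * (of_int (m + int (Suc t)) gchoose Suc t)"
      by (rule gbinomial_mult_1)
    then have c: "of_nat (Suc t) * (of_int (m + int (Suc t)) gchoose Suc t) =
        (of_int (m + 1) :: complex) * (of_int (m + int (Suc t)) gchoose t)"
      by (simp add: algebra_simps)
    have "(fderiv scale ^^ Suc t) F m w =
        scale (of_int (m + 1)) (scale (fact t * (of_int (m + 1 + int t) gchoose t)) (F (m + 1 + int t) w))"
      by (simp only: funpow.simps comp_apply fderiv_def[of _ "(fderiv scale ^^ t) F"] Suc.IH)
    also have "\<dots> = scale (fact t * (of_int (m + 1) * (of_int (m + int (Suc t)) gchoose t))) (F (m + int (Suc t)) w)"
      by (simp only: scale_scale m1 mult_ac)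
    also have "fact t * (of_int (m + 1) * (of_int (m + int (Suc t)) gchoose t)) =
       (fact (Suc t) * (of_int (m + int (Suc t)) gchoose Suc t) :: complex)"
      unfolding c[symmetric] by simp
    finally show ?case .
  qed simp
  then show ?thesis by (simp add: fdivderiv_def)
qed

end

section \<open>Weighted products of the fields of e^\<beta> and e^\<gamma>, and their Borcherds
  expression\<close>

context fock_data
begin

text \<open>
  The coefficient of \<open>z^t\<close> in the product of \<open>Y(e\<^sup>\<beta>, z)\<close>, its \<open>l\<close>-th coefficient weighted by \<open>c l\<close>, and
  \<open>Y(e\<^sup>\<gamma>, z)\<close>.
\<close>

definition exp_product :: "'n lattC \<Rightarrow> 'n lattC \<Rightarrow> (int \<Rightarrow> complex) \<Rightarrow> int \<Rightarrow> ('n, 'w) fock \<Rightarrow> ('n, 'w) fock" where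
  "exp_product \<beta> \<gamma> c t w = Sum_any (\<lambda>l. ps (c l) (exp_coeff \<beta> l (exp_coeff \<gamma> (t - l) w)))"

lemma exp_product_supp:
  assumes "weight_le d w"
  shows "{l. ps (c l) (exp_coeff \<beta> l (exp_coeff \<gamma> (t - l) w)) \<noteq> 0} \<subseteq> {xi \<beta> - d..t - xi \<gamma> + d}"
proof
  fix l assume l: "l \<in> {l. ps (c l) (exp_coeff \<beta> l (exp_coeff \<gamma> (t - l) w)) \<noteq> 0}"
  then have "\<not> (l < xi \<beta> - d \<or> t - l < xi \<gamma> - d)"
    using exp_coeff_exp_coeff_0[OF assms, of l \<beta> "t - l" \<gamma>] by auto
  then show "l \<in> {xi \<beta> - d..t - xi \<gamma> + d}" by auto
qed

lemma exp_product_sum: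
  assumes "weight_le d w" "finite L" "{xi \<beta> - d..t - xi \<gamma> + d} \<subseteq> L"
  shows "exp_product \<beta> \<gamma> c t w = (\<Sum>l\<in>L. ps (c l) (exp_coeff \<beta> l (exp_coeff \<gamma> (t - l) w)))"
  unfolding exp_product_def by (intro Sum_any.expand_superset assms(2) order_trans[OF exp_product_supp[OF assms(1)] assms(3)])

lemma exp_product_lin: "lin ps (exp_product \<beta> \<gamma> c t)"
proof (rule linI)
  fix w v :: "('n, 'w) fock"
  obtain d d' where d: "weight_le d w" "weight_le d' v" using weight_le_exists by metis
  then have "weight_le (max d d') w" "weight_le (max d d') v" by (auto simp: weight_le_def)
  moreover from this have "weight_le (max d d') (w + v)" by (rule weight_le_add)
  ultimately show "exp_product \<beta> \<gamma> c t (w + v) = exp_product \<beta> \<gamma> c t w + exp_product \<beta> \<gamma> c t v"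
    by (simp add: exp_product_sum[OF _ finite_atLeastAtMost_int order_refl, of "max d d'"] exp_coeff_simps P.scale_right_distrib sum.distrib)
  fix a
  from d(1) have "weight_le d (ps a w)" by (rule weight_le_scale)
  with d(1) show "exp_product \<beta> \<gamma> c t (ps a w) = ps a (exp_product \<beta> \<gamma> c t w)"
    by (simp add: exp_product_sum[OF _ finite_atLeastAtMost_int order_refl, of d] exp_coeff_simps P.scale_sum_right mult.commute)
qed

lemma exp_product_0: "weight_le d w \<Longrightarrow> t < xi \<beta> + xi \<gamma> - 2 * d \<Longrightarrow> exp_product \<beta> \<gamma> c t w = 0"
  by (simp add: exp_product_sum[OF _ finite_atLeastAtMost_int order_refl])

lemma exp_product_fieldop: "fieldop ps (\<lambda>q. exp_product \<beta> \<gamma> c (a - q))"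
  unfolding fieldop_def truncated_def
proof (intro conjI allI exp_product_lin)
  fix w :: "('n, 'w) fock"
  obtain d where d: "weight_le d w" using weight_le_exists by blast
  then show "\<exists>n0. \<forall>n\<ge>n0. exp_product \<beta> \<gamma> c (a - n) w = 0"
    by (intro exI[of _ "a - xi \<beta> - xi \<gamma> + 2 * d + 1"]) (auto intro!: exp_product_0[OF d])
qed

lemma exp_product_coeff_sum:
  assumes "finite R"
  shows "exp_product \<beta> \<gamma> (\<lambda>l. \<Sum>r\<in>R. a r * c r l) t w = (\<Sum>r\<in>R. ps (a r) (exp_product \<beta> \<gamma> (c r) t w))"
proof -
  obtain d where d: "weight_le d w" using weight_le_exists by blast
  show ?thesis
    unfolding exp_product_sum[OF d finite_atLeastAtMost_int order_refl] P.scale_sum_right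
    by (subst sum.swap) (simp add: P.scale_sum_left)
qed

lemma exp_product_coeff_scale: "exp_product \<beta> \<gamma> (\<lambda>l. a * c l) t w = ps a (exp_product \<beta> \<gamma> c t w)"
  using exp_product_coeff_sum[of "{()}" \<beta> \<gamma> "\<lambda>_. a" "\<lambda>_. c"] by simp

lemma weight_le_h_emb:
  assumes "weight_le d w"
  shows "weight_le (d - int i) (h (emb_C \<beta>) (int i) w)"
proof (cases "i = 0")
  case True
  with assms show ?thesis by (simp add: h_0_emb weight_le_scale)
next
  case False
  then show ?thesis by (intro weight_le_h assms) simp
qed

text \<open>Insert the derivative of Y(e^\<beta>) in the first factor. Creation modes already stand
  on the left, and annihilation modes pass Y(e^\<gamma>) because (\<beta>, \<gamma>) = 0. Each mode
  of \<beta> moves the exponent of the first factor, which the shifts in c compensate.\<close>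

lemma exp_product_deriv:
  "exp_product \<beta> \<gamma> (\<lambda>l. c l * of_int l) t w =
     (\<Sum>i::nat. h (emb_C \<beta>) (- 1 - int i) (exp_product \<beta> \<gamma> (\<lambda>l. c (l + 1 + int i)) (t - 1 - int i) w)
       + exp_product \<beta> \<gamma> (\<lambda>l. c (l - int i)) (t + int i) (h (emb_C \<beta>) (int i) w))"
proof -
  obtain d where d: "weight_le d w" using weight_le_exists by blast
  define L where "L = {xi \<beta> - d..t - xi \<gamma> + d}"
  have L: "finite L" by (simp add: L_def)
  let ?u = "\<lambda>l. exp_coeff \<gamma> (t - l) w"
  have "\<forall>\<^sub>F N in sequentially. \<forall>l\<in>L. nprod (h (emb_C \<beta>)) (exp_mode \<beta>) (- l) (?u l) =
      (\<Sum>i<N. h (emb_C \<beta>) (- 1 - int i) (exp_mode \<beta> (- l + int i) (?u l)) + exp_mode \<beta> (- l - 1 - int i) (h (emb_C \<beta>) (int i) (?u l)))"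
  proof (rule eventually_ball_finite[OF L], rule ballI)
    fix l
    show "\<forall>\<^sub>F N in sequentially. nprod (h (emb_C \<beta>)) (exp_mode \<beta>) (- l) (?u l) =
      (\<Sum>i<N. h (emb_C \<beta>) (- 1 - int i) (exp_mode \<beta> (- l + int i) (?u l)) + exp_mode \<beta> (- l - 1 - int i) (h (emb_C \<beta>) (int i) (?u l)))"
      using P.nprod_ev[OF h_fieldop[of "emb_C \<beta>"] exp_mode_fieldop[of \<beta>], of "- l" "?u l"] by eventually_elim auto
  qed
  moreover have "\<forall>\<^sub>F N in sequentially. \<forall>i\<ge>N. h (emb_C \<beta>) (0 + int i) w = 0"
    by (rule truncated_ev[OF fieldop_truncated[OF h_fieldop]])
  ultimately have "\<forall>\<^sub>F N in sequentially. exp_product \<beta> \<gamma> (\<lambda>l. c l * of_int l) t w =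
     (\<Sum>i::nat. h (emb_C \<beta>) (- 1 - int i) (exp_product \<beta> \<gamma> (\<lambda>l. c (l + 1 + int i)) (t - 1 - int i) w)
       + exp_product \<beta> \<gamma> (\<lambda>l. c (l - int i)) (t + int i) (h (emb_C \<beta>) (int i) w))"
    using eventually_ge_at_top[of "nat (t - xi \<beta> - xi \<gamma> + 2 * d)"]
  proof eventually_elim
    case (elim N)
    have der: "ps (of_int l) (exp_coeff \<beta> l (?u l)) = (\<Sum>i<N. h (emb_C \<beta>) (- 1 - int i) (exp_coeff \<beta> (l - 1 - int i) (?u l)))
       + (\<Sum>i<N. exp_coeff \<beta> (l + int i) (exp_coeff \<gamma> (t - l) (h (emb_C \<beta>) (int i) w)))" if "l \<in> L" for l
    proof -
      have "- (- l + int i) - 1 = l - 1 - int i" "- (- l - 1 - int i) - 1 = l + int i" for i by simp_all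
      then show ?thesis
        using elim(1) that by (simp add: exp_coeff_deriv exp_mode_def exp_coeff_commutator sum.distrib algebra_simps)
    qed
    have B1: "exp_product \<beta> \<gamma> (\<lambda>l. c (l + 1 + int i)) (t - 1 - int i) w = (\<Sum>l\<in>L. ps (c l) (exp_coeff \<beta> (l - 1 - int i) (?u l)))" for i
    proof -
      let ?L = "(\<lambda>l. l - 1 - int i) ` L"
      have "l' \<in> ?L" if "l' \<in> {xi \<beta> - d..t - 1 - int i - xi \<gamma> + d}" for l'
        using that by (intro image_eqI[of _ _ "l' + 1 + int i"]) (auto simp: L_def)
      then have "exp_product \<beta> \<gamma> (\<lambda>l. c (l + 1 + int i)) (t - 1 - int i) w =
          (\<Sum>l\<in>?L. ps (c (l + 1 + int i)) (exp_coeff \<beta> l (exp_coeff \<gamma> (t - 1 - int i - l) w)))"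
        by (intro exp_product_sum[OF d]) (auto simp: L)
      also have "\<dots> = (\<Sum>l\<in>L. ps (c l) (exp_coeff \<beta> (l - 1 - int i) (?u l)))"
        by (subst sum.reindex) (auto simp: inj_on_def algebra_simps intro!: sum.cong)
      finally show ?thesis .
    qed
    have B2: "exp_product \<beta> \<gamma> (\<lambda>l. c (l - int i)) (t + int i) (h (emb_C \<beta>) (int i) w) =
        (\<Sum>l\<in>L. ps (c l) (exp_coeff \<beta> (l + int i) (exp_coeff \<gamma> (t - l) (h (emb_C \<beta>) (int i) w))))" for i
    proof -
      let ?L = "(\<lambda>l. l + int i) ` L"
      have "l' \<in> ?L" if "l' \<in> {xi \<beta> - (d - int i)..t + int i - xi \<gamma> + (d - int i)}" for l'
        using that by (intro image_eqI[of _ _ "l' - int i"]) (auto simp: L_def)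
      then have "exp_product \<beta> \<gamma> (\<lambda>l. c (l - int i)) (t + int i) (h (emb_C \<beta>) (int i) w) =
          (\<Sum>l\<in>?L. ps (c (l - int i)) (exp_coeff \<beta> l (exp_coeff \<gamma> (t + int i - l) (h (emb_C \<beta>) (int i) w))))"
        by (intro exp_product_sum[OF weight_le_h_emb[OF d]]) (auto simp: L)
      also have "\<dots> = (\<Sum>l\<in>L. ps (c l) (exp_coeff \<beta> (l + int i) (exp_coeff \<gamma> (t - l) (h (emb_C \<beta>) (int i) w))))"
        by (subst sum.reindex) (auto simp: inj_on_def algebra_simps intro!: sum.cong)
      finally show ?thesis .
    qed
    have "exp_product \<beta> \<gamma> (\<lambda>l. c l * of_int l) t w = (\<Sum>l\<in>L. ps (c l) (ps (of_int l) (exp_coeff \<beta> l (?u l))))"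
      by (subst exp_product_sum[OF d L]) (auto simp: L_def)
    also have "\<dots> = (\<Sum>l\<in>L. (\<Sum>i<N. ps (c l) (h (emb_C \<beta>) (- 1 - int i) (exp_coeff \<beta> (l - 1 - int i) (?u l))))
       + (\<Sum>i<N. ps (c l) (exp_coeff \<beta> (l + int i) (exp_coeff \<gamma> (t - l) (h (emb_C \<beta>) (int i) w)))))"
      by (intro sum.cong refl) (simp add: der P.scale_right_distrib P.scale_sum_right)
    also have "\<dots> = (\<Sum>i<N. \<Sum>l\<in>L. ps (c l) (h (emb_C \<beta>) (- 1 - int i) (exp_coeff \<beta> (l - 1 - int i) (?u l))))
       + (\<Sum>i<N. \<Sum>l\<in>L. ps (c l) (exp_coeff \<beta> (l + int i) (exp_coeff \<gamma> (t - l) (h (emb_C \<beta>) (int i) w))))"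
      unfolding sum.distrib by (intro arg_cong2[of _ _ _ _ "(+)"]; rule sum.swap)
    also have "\<dots> = (\<Sum>i<N. h (emb_C \<beta>) (- 1 - int i) (exp_product \<beta> \<gamma> (\<lambda>l. c (l + 1 + int i)) (t - 1 - int i) w)
       + exp_product \<beta> \<gamma> (\<lambda>l. c (l - int i)) (t + int i) (h (emb_C \<beta>) (int i) w))"
      unfolding B1 B2 h_simps sum.distrib ..
    also have "\<dots> = (\<Sum>i::nat. h (emb_C \<beta>) (- 1 - int i) (exp_product \<beta> \<gamma> (\<lambda>l. c (l + 1 + int i)) (t - 1 - int i) w)
       + exp_product \<beta> \<gamma> (\<lambda>l. c (l - int i)) (t + int i) (h (emb_C \<beta>) (int i) w))"
    proof (rule Sum_any_lessThan[symmetric])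
      fix i assume i: "i \<ge> N"
      then have "exp_product \<beta> \<gamma> (\<lambda>l. c (l + 1 + int i)) (t - 1 - int i) w = 0"
        using elim(3) by (intro exp_product_0[OF d]) auto
      moreover have "h (emb_C \<beta>) (int i) w = 0" using elim(2) i by simp
      ultimately show "h (emb_C \<beta>) (- 1 - int i) (exp_product \<beta> \<gamma> (\<lambda>l. c (l + 1 + int i)) (t - 1 - int i) w)
         + exp_product \<beta> \<gamma> (\<lambda>l. c (l - int i)) (t + int i) (h (emb_C \<beta>) (int i) w) = 0"
        by (simp add: h_simps lin_simps[OF exp_product_lin])
    qed
    finally show ?case .
  qed
  then show ?thesis by simp
qed

text \<open>
  The modes of \<open>\<partial>\<^sub>m Y(e\<^sup>\<beta>, z) Y(e\<^sup>\<gamma>, z)\<close>.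
\<close>

definition exp_deriv_product :: "'n lattC \<Rightarrow> 'n lattC \<Rightarrow> nat \<Rightarrow> int \<Rightarrow> ('n, 'w) fock \<Rightarrow> ('n, 'w) fock" where
  "exp_deriv_product \<beta> \<gamma> m q = exp_product \<beta> \<gamma> (\<lambda>l. of_int l gchoose m) (int m - 1 - q)"

lemma exp_deriv_product_fieldop: "fieldop ps (exp_deriv_product \<beta> \<gamma> m)"
  unfolding exp_deriv_product_def[abs_def] by (rule exp_product_fieldop)

lemma exp_deriv_product_0: "exp_deriv_product \<beta> \<gamma> 0 q w = exp_mode (\<beta> + \<gamma>) q w"
proof -
  obtain d :: nat where w: "weight_le (int d) w" using weight_le_exists_nat by blast
  have "exp_deriv_product \<beta> \<gamma> 0 q w = (\<Sum>l\<in>{xi \<beta> - int d..(- q - 1) - xi \<gamma> + int d}. exp_coeff \<beta> l (exp_coeff \<gamma> ((- q - 1) - l) w))"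
  proof -
    have e: "int 0 - 1 - q = - q - 1" by simp
    show ?thesis
      unfolding exp_deriv_product_def e by (subst exp_product_sum[OF w finite_atLeastAtMost_int order_refl]) simp
  qed
  also have "\<dots> = exp_coeff (\<beta> + \<gamma>) (- q - 1) w"
    by (rule exp_coeff_mult[OF w]) auto
  finally show ?thesis by (simp add: exp_mode_def)
qed

text \<open>By m \<partial>_m = \<partial>_(m-1) \<partial> and the Leibniz rule for divided
  derivatives; on coefficients these are the absorption identity \<open>ab\<close> and the
  Vandermonde sum \<open>van\<close>. The coefficients of E^- obey the same recursion, which
  \<open>Ymode_Em\<close> exploits.\<close>

lemma exp_deriv_product_rec:
  assumes "m > 0"
  shows "ps (of_nat m) (exp_deriv_product \<beta> \<gamma> m q w) = (\<Sum>r=1..m. nprod (dmode (emb_C \<beta>) (r - 1)) (exp_deriv_product \<beta> \<gamma> (m - r)) q w)"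
proof -
  let ?t = "int m - 1 - q"
  obtain d where d: "weight_le d w" using weight_le_exists by blast
  obtain N where N: "N \<ge> nat (?t - xi \<beta> - xi \<gamma> + 2 * d)" "\<And>i. i \<ge> N \<Longrightarrow> h (emb_C \<beta>) (int i) w = 0"
  proof -
    have "\<forall>\<^sub>F N in sequentially. N \<ge> nat (?t - xi \<beta> - xi \<gamma> + 2 * d) \<and> (\<forall>i\<ge>N. h (emb_C \<beta>) (0 + int i) w = 0)"
      by (intro eventually_conj eventually_ge_at_top truncated_ev[OF fieldop_truncated[OF h_fieldop]])
    from eventually_happens[OF this] show thesis by (auto intro: that)
  qed
  have B0: "exp_product \<beta> \<gamma> c (?t - 1 - int i) w = 0" if "i \<ge> N" for c i
    using N(1) that by (intro exp_product_0[OF d]) auto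
  have van: "(\<Sum>r=1..m. (of_int a gchoose (r - 1)) * (of_int l gchoose (m - r))) =
      (of_int (a + l) gchoose (m - 1) :: complex)" for a l
  proof -
    have "(\<Sum>r=1..m. (of_int a gchoose (r - 1)) * (of_int l gchoose (m - r)) :: complex) =
        (\<Sum>r\<le>m - 1. (of_int a gchoose r) * (of_int l gchoose (m - 1 - r)))"
      by (rule sum.reindex_bij_witness[of _ Suc "\<lambda>r. r - 1"]) (use assms in auto)
    then show ?thesis by (simp only: gchoose_Vandermonde)
  qed
  have ab: "of_nat m * (of_int l gchoose m :: complex) = (of_int (l - 1) gchoose (m - 1)) * of_int l" for l
    using gbinomial_absorption[of "m - 1" "of_int l :: complex"] assms by (simp add: mult.commute)
  have np: "nprod (dmode (emb_C \<beta>) (r - 1)) (exp_deriv_product \<beta> \<gamma> (m - r)) q w =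
     (\<Sum>i<N. ps (of_int (int i) gchoose (r - 1)) (h (emb_C \<beta>) (- 1 - int i) (exp_product \<beta> \<gamma> (\<lambda>l. of_int l gchoose (m - r)) (?t - 1 - int i) w))
       + ps (of_int (- 1 - int i) gchoose (r - 1)) (exp_product \<beta> \<gamma> (\<lambda>l. of_int l gchoose (m - r)) (?t + int i) (h (emb_C \<beta>) (int i) w)))"
    if r: "r \<in> {1..m}" for r
  proof -
    have i1: "int (m - r) - 1 - (q + int i - int (r - 1)) = ?t - 1 - int i" for i
      using r by (auto simp: of_nat_diff)
    have i2: "int (m - r) - 1 - (q - 1 - int (r - 1) - int i) = ?t + int i" for i
      using r by (auto simp: of_nat_diff)
    show ?thesis
      unfolding nprod_dmode[OF exp_deriv_product_fieldop] unfolding exp_deriv_product_def i1 i2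
      by (rule Sum_any_lessThan) (simp only: B0 N(2) h_simps lin_simps[OF exp_product_lin] P.scale_zero_right add_0)
  qed
  have "(\<Sum>r=1..m. nprod (dmode (emb_C \<beta>) (r - 1)) (exp_deriv_product \<beta> \<gamma> (m - r)) q w) =
    (\<Sum>r=1..m. \<Sum>i<N. h (emb_C \<beta>) (- 1 - int i) (ps (of_int (int i) gchoose (r - 1)) (exp_product \<beta> \<gamma> (\<lambda>l. of_int l gchoose (m - r)) (?t - 1 - int i) w))
       + ps (of_int (- 1 - int i) gchoose (r - 1)) (exp_product \<beta> \<gamma> (\<lambda>l. of_int l gchoose (m - r)) (?t + int i) (h (emb_C \<beta>) (int i) w)))"
    by (intro sum.cong refl) (simp only: np h_simps)
  also have "\<dots> = (\<Sum>i<N. h (emb_C \<beta>) (- 1 - int i) (\<Sum>r=1..m. ps (of_int (int i) gchoose (r - 1)) (exp_product \<beta> \<gamma> (\<lambda>l. of_int l gchoose (m - r)) (?t - 1 - int i) w))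
       + (\<Sum>r=1..m. ps (of_int (- 1 - int i) gchoose (r - 1)) (exp_product \<beta> \<gamma> (\<lambda>l. of_int l gchoose (m - r)) (?t + int i) (h (emb_C \<beta>) (int i) w))))"
    by (subst sum.swap) (simp only: sum.distrib h_simps)
  also have "\<dots> = (\<Sum>i<N. h (emb_C \<beta>) (- 1 - int i) (exp_product \<beta> \<gamma> (\<lambda>l. of_int (int i + l) gchoose (m - 1)) (?t - 1 - int i) w)
       + exp_product \<beta> \<gamma> (\<lambda>l. of_int (- 1 - int i + l) gchoose (m - 1)) (?t + int i) (h (emb_C \<beta>) (int i) w))"
    by (simp only: exp_product_coeff_sum[OF finite_atLeastAtMost, symmetric] van)
  also have "\<dots> = (\<Sum>i<N. h (emb_C \<beta>) (- 1 - int i) (exp_product \<beta> \<gamma> (\<lambda>l. of_int (l + 1 + int i - 1) gchoose (m - 1)) (?t - 1 - int i) w)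
       + exp_product \<beta> \<gamma> (\<lambda>l. of_int (l - int i - 1) gchoose (m - 1)) (?t + int i) (h (emb_C \<beta>) (int i) w))"
  proof -
    have "int i + l = l + 1 + int i - 1" "- 1 - int i + l = l - int i - 1" for i l by simp_all
    then show ?thesis by (simp only:)
  qed
  also have "\<dots> = (\<Sum>i::nat. h (emb_C \<beta>) (- 1 - int i) (exp_product \<beta> \<gamma> (\<lambda>l. of_int (l + 1 + int i - 1) gchoose (m - 1)) (?t - 1 - int i) w)
       + exp_product \<beta> \<gamma> (\<lambda>l. of_int (l - int i - 1) gchoose (m - 1)) (?t + int i) (h (emb_C \<beta>) (int i) w))"
    by (rule Sum_any_lessThan[symmetric]) (simp only: B0 N(2) h_simps lin_simps[OF exp_product_lin] add_0)
  also have "\<dots> = exp_product \<beta> \<gamma> (\<lambda>l. (of_int (l - 1) gchoose (m - 1)) * of_int l) ?t w"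
    by (rule exp_product_deriv[symmetric])
  also have "\<dots> = ps (of_nat m) (exp_deriv_product \<beta> \<gamma> m q w)"
    unfolding ab[symmetric] exp_product_coeff_scale exp_deriv_product_def ..
  finally show ?thesis ..
qed

text \<open>For n \<ge> 0 the power (z_1 - z_2)^n is a polynomial whose two expansions agree, and
  the fields commute. Concretely, j -> n - j exchanges the two sums.\<close>

lemma borcherds_exp_mode_exp_mode_pos:
  assumes "n \<ge> 0"
  shows "borcherds ps (exp_mode \<beta>) (exp_mode \<gamma>) p n q w = 0"
proof -
  define m where "m = nat n"
  have n: "n = int m" using assms by (simp add: m_def)
  note le = lin_simps[OF fieldop_lin[OF exp_mode_fieldop]]
  have cf0: "sbinom n j = 0" if "j \<ge> Suc m" for j
    using that by (simp add: sbinom_def n gchoose_of_nat del: of_int_of_nat_eq)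
  have c: "exp_mode \<gamma> a (exp_mode \<beta> b w) = exp_mode \<beta> b (exp_mode \<gamma> a w)" for a b
    by (simp add: exp_mode_def exp_coeff_exp_coeff_commute[of \<gamma>])
  have "borcherds ps (exp_mode \<beta>) (exp_mode \<gamma>) p n q w = (\<Sum>j<Suc m. ps (sbinom n j) (exp_mode \<beta> (p + n - int j) (exp_mode \<gamma> (q + int j) w)) -
      ps (neg1_pow n * sbinom n j) (exp_mode \<beta> (p + int j) (exp_mode \<gamma> (n + q - int j) w)))"
    unfolding borcherds_def c by (rule Sum_any_lessThan) (simp add: cf0)
  also have "\<dots> = (\<Sum>j<Suc m. ps (sbinom n j) (exp_mode \<beta> (p + n - int j) (exp_mode \<gamma> (q + int j) w))) -
      (\<Sum>j<Suc m. ps (neg1_pow n * sbinom n j) (exp_mode \<beta> (p + int j) (exp_mode \<gamma> (n + q - int j) w)))"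
    by (rule sum_subtractf)
  also have "(\<Sum>j<Suc m. ps (neg1_pow n * sbinom n j) (exp_mode \<beta> (p + int j) (exp_mode \<gamma> (n + q - int j) w))) =
      (\<Sum>j<Suc m. ps (sbinom n j) (exp_mode \<beta> (p + n - int j) (exp_mode \<gamma> (q + int j) w)))"
  proof (rule sum.reindex_bij_witness[of _ "\<lambda>j. m - j" "\<lambda>j. m - j"])
    fix j assume j: "j \<in> {..<Suc m}"
    have "sbinom n (m - j) = neg1_pow n * sbinom n j"
    proof -
      have "(- 1 :: complex) ^ (m - j) = (- 1) ^ m * (- 1) ^ j"
      proof -
        have "(- 1 :: complex) ^ m = (- 1) ^ (m - j) * (- 1) ^ j"
          using j by (simp flip: power_add)
        then show ?thesis by (simp add: mult.assoc)
      qed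
      moreover have "m choose (m - j) = m choose j"
        using j binomial_symmetric[of j m] by auto
      ultimately show ?thesis by (simp add: sbinom_def n gchoose_of_nat del: of_int_of_nat_eq)
    qed
    moreover have "p + n - int (m - j) = p + int j" "q + int (m - j) = n + q - int j"
      using j by (auto simp: n of_nat_diff)
    ultimately show "ps (sbinom n (m - j)) (exp_mode \<beta> (p + n - int (m - j)) (exp_mode \<gamma> (q + int (m - j)) w)) =
       ps (neg1_pow n * sbinom n j) (exp_mode \<beta> (p + int j) (exp_mode \<gamma> (n + q - int j) w))"
      by (simp only:)
  qed auto
  finally show ?thesis by simp
qed

text \<open>The two expansions of (z_1 - z_2)^(-1-m) contribute binom(m+j, m) for j \<ge> 0 and,
  signs included, for j \<le> -1-m. This polynomial in j vanishes in the gap between, so one sum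
  over all integers results, and l = m + j - p makes it a weighted product.\<close>

lemma borcherds_exp_mode_exp_mode_neg:
  "borcherds ps (exp_mode \<beta>) (exp_mode \<gamma>) p (- 1 - int m) q w = exp_product \<beta> \<gamma> (\<lambda>l. of_int (p + l) gchoose m) (int m - p - q - 1) w"
proof -
  note le = lin_simps[OF fieldop_lin[OF exp_mode_fieldop]]
  let ?n = "- 1 - int m" and ?t = "int m - p - q - 1"
  define G where "G j = ps (of_int (int m + j) gchoose m) (exp_mode \<beta> (p + ?n - j) (exp_mode \<gamma> (q + j) w))" for j
  have c: "exp_mode \<gamma> a (exp_mode \<beta> b w) = exp_mode \<beta> b (exp_mode \<gamma> a w)" for a b
    by (simp add: exp_mode_def exp_coeff_exp_coeff_commute[of \<gamma>])
  obtain N where N: "\<And>j. j \<ge> N \<Longrightarrow> exp_mode \<beta> (p + int j) w = 0 \<and> exp_mode \<gamma> (q + int j) w = 0"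
    using eventually_happens[OF P.borcherds_ev[OF exp_mode_fieldop[of \<beta>] exp_mode_fieldop[of \<gamma>], of p w q]] by auto
  have G1: "G (int j) = ps (sbinom ?n j) (exp_mode \<beta> (p + ?n - int j) (exp_mode \<gamma> (q + int j) w))" for j
  proof -
    have "(m + j choose j) = (m + j choose m)" using binomial_symmetric[of j "m + j"] by simp
    then have "sbinom ?n j = (of_int (int m + int j) gchoose m)"
      unfolding sbinom_neg of_nat_add[symmetric] gchoose_of_nat by simp
    then show ?thesis by (simp add: G_def)
  qed
  have G2: "G (?n - int j) = - ps (neg1_pow ?n * sbinom ?n j) (exp_mode \<gamma> (?n + q - int j) (exp_mode \<beta> (p + int j) w))" for j
  proof -
    have "(m + j choose j) = (j + m choose m)" using binomial_symmetric[of j "m + j"] by (simp add: add.commute)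
    moreover have "int m + (?n - int j) = - 1 - int j" by simp
    ultimately have e1: "(of_int (int m + (?n - int j)) gchoose m :: complex) = - (neg1_pow ?n * sbinom ?n j)"
      by (simp only: gchoose_neg sbinom_neg neg1_pow_diff) simp
    have e2: "p + ?n - (?n - int j) = p + int j" "q + (?n - int j) = ?n + q - int j" by simp_all
    show ?thesis by (simp only: G_def e1 e2 c P.scale_minus_left)
  qed
  have G0: "G j = 0" if "j \<notin> int ` {..<N} \<union> (\<lambda>j. ?n - int j) ` {..<N}" for j
  proof -
    consider "j \<ge> 0" | "j \<le> ?n" | "?n < j" "j < 0" by linarith
    then show ?thesis
    proof cases
      case 1
      then have "j = int (nat j)" "nat j \<ge> N" using that by (auto simp: image_iff not_less[symmetric] dest: bspec[of _ _ "nat j"])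
      then show ?thesis using N[of "nat j"] by (simp add: G_def le)
    next
      case 2
      then have "j = ?n - int (nat (?n - j))" "nat (?n - j) \<ge> N"
        using that by (auto simp: image_iff not_less[symmetric] dest: bspec[of _ _ "nat (?n - j)"])
      then show ?thesis using N[of "nat (?n - j)"] G2[of "nat (?n - j)"] by (simp add: le)
    next
      case 3
      then have "int m + j = int (nat (int m + j))" "nat (int m + j) < m" by auto
      then have "(of_int (int m + j) gchoose m :: complex) = 0"
        by (metis gchoose_of_nat binomial_eq_0 of_nat_0)
      then show ?thesis by (simp add: G_def)
    qed
  qed
  have "borcherds ps (exp_mode \<beta>) (exp_mode \<gamma>) p ?n q w = (\<Sum>j<N. G (int j) + G (?n - int j))"
    unfolding borcherds_def G1 G2 diff_conv_add_uminus[symmetric]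
    by (rule Sum_any_lessThan) (use N in \<open>simp add: le\<close>)
  also have "\<dots> = (\<Sum>j\<in>int ` {..<N}. G j) + (\<Sum>j\<in>(\<lambda>j. ?n - int j) ` {..<N}. G j)"
    by (simp add: sum.distrib sum.reindex inj_on_def)
  also have "\<dots> = (\<Sum>j\<in>int ` {..<N} \<union> (\<lambda>j. ?n - int j) ` {..<N}. G j)"
    by (rule sum.union_disjoint[symmetric]) auto
  also have "\<dots> = Sum_any G"
    using G0 by (intro Sum_any.expand_superset[symmetric]) auto
  also have "\<dots> = exp_product \<beta> \<gamma> (\<lambda>l. of_int (p + l) gchoose m) ?t w"
    unfolding exp_product_def
  proof (rule Sum_any.reindex_cong[of "\<lambda>j. j + int m - p", symmetric])
    show "bij (\<lambda>j. j + int m - p)"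
      by (rule o_bij[of "\<lambda>j. j - int m + p"]) (auto simp: fun_eq_iff)
    show "(\<lambda>l. ps (of_int (p + l) gchoose m) (exp_coeff \<beta> l (exp_coeff \<gamma> (?t - l) w))) \<circ> (\<lambda>j. j + int m - p) = G"
    proof
      fix j
      have "p + (j + int m - p) = int m + j" "- (p + ?n - j) - 1 = j + int m - p" "- (q + j) - 1 = ?t - (j + int m - p)"
        by simp_all
      then show "((\<lambda>l. ps (of_int (p + l) gchoose m) (exp_coeff \<beta> l (exp_coeff \<gamma> (?t - l) w))) \<circ> (\<lambda>j. j + int m - p)) j = G j"
        by (simp only: G_def comp_apply exp_mode_def)
    qed
  qed
  finally show ?thesis .
qed

end

section \<open>Vertex operators of general vectors\<close>

context fock_data
begin

text \<open>Links the literal definition to \<open>nprod\<close>. Differentiation could carry modes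
  across the border between creation and annihilation, but for those binom(m+t, t) vanishes.\<close>

lemma nop_Cons_nprod:
  assumes G: "fieldop ps (\<lambda>q. nop k s Z l F (- q - 1))"
  shows "nop k s Z ((\<alpha>, t) # l) F (- q - 1) w = nprod (dmode \<alpha> t) (\<lambda>q. nop k s Z l F (- q - 1)) q w"
proof -
  define b where "b q = nop k s Z l F (- q - 1)" for q
  have b: "fieldop ps b" using G by (simp add: b_def[abs_def])
  note lb = lin_simps[OF fieldop_lin[OF b]] and ld = lin_simps[OF fieldop_lin[OF dmode_fieldop]]
  have nb: "nop k s Z l F m = b (- m - 1)" for m by (simp add: b_def)
  have neg: "(of_int (m + int t) gchoose t :: complex) = (- 1) ^ t * (of_int (- 1 - m) gchoose t)" for m
  proof -
    have "of_nat t - of_int (m + int t) - 1 = (of_int (- 1 - m) :: complex)" by simp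
    then show ?thesis
      using gbinomial_negated_upper[of "of_int (m + int t) :: complex" t] by (simp only:)
  qed
  have z: "(of_int m gchoose t :: complex) = 0" if "0 \<le> m" "m < int t" for m
    using gchoose_of_nat[of "nat m" t] that by simp
  have C: "fdivderiv ps t (cre k s Z \<alpha>) m u = (if m \<ge> 0 then dmode \<alpha> t (- 1 - m) u else 0)" for m u
  proof -
    have e: "- (m + int t) - 1 = - 1 - m - int t" by simp
    show ?thesis
      unfolding P.fdivderiv_eq cre_def dmode_def neg[symmetric] e
      using z[of "m + int t"] by (auto simp: not_less)
  qed
  have A: "fdivderiv ps t (ann k s Z \<alpha>) m u = (if m < 0 then dmode \<alpha> t (- 1 - m) u else 0)" for m u
  proof -
    have e: "- (m + int t) - 1 = - 1 - m - int t" by simp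
    have "(of_int (m + int t) gchoose t :: complex) = 0" if "m < 0" "- 1 - m - int t < 0"
      unfolding neg using z[of "- 1 - m"] that by auto
    then show ?thesis
      unfolding P.fdivderiv_eq ann_def dmode_def neg[symmetric] e
      by auto
  qed
  have 1: "fmul (fdivderiv ps t (cre k s Z \<alpha>)) (nop k s Z l F) (- q - 1) w =
      (\<Sum>i::nat. dmode \<alpha> t (- 1 - int i) (b (q + int i) w))"
  proof -
    have "fmul (fdivderiv ps t (cre k s Z \<alpha>)) (nop k s Z l F) (- q - 1) w =
       Sum_any (\<lambda>j. if - q - 1 - j \<ge> 0 then dmode \<alpha> t (- 1 - (- q - 1 - j)) (b (- j - 1) w) else 0)"
      unfolding fmul_def C nb ..
    also have "\<dots> = (\<Sum>i::nat. dmode \<alpha> t (- 1 - int i) (b (q + int i) w))"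
    proof (subst Sum_any_inj_reindex[of "\<lambda>i. - q - 1 - int i"])
      show "inj (\<lambda>i. - q - 1 - int i)" by (auto intro: injI)
      show "(if - q - 1 - j \<ge> 0 then dmode \<alpha> t (- 1 - (- q - 1 - j)) (b (- j - 1) w) else 0) = 0"
        if "j \<notin> range (\<lambda>i. - q - 1 - int i)" for j
        using that by (auto simp: image_iff dest!: spec[of _ "nat (- q - 1 - j)"])
    qed (simp add: algebra_simps)
    finally show ?thesis .
  qed
  have 2: "fmul (nop k s Z l F) (fdivderiv ps t (ann k s Z \<alpha>)) (- q - 1) w =
      (\<Sum>i::nat. b (q - 1 - int i) (dmode \<alpha> t (int i) w))"
  proof -
    have "fmul (nop k s Z l F) (fdivderiv ps t (ann k s Z \<alpha>)) (- q - 1) w =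
       Sum_any (\<lambda>j. b (- (- q - 1 - j) - 1) (if j < 0 then dmode \<alpha> t (- 1 - j) w else 0))"
      unfolding fmul_def A nb ..
    also have "\<dots> = (\<Sum>i::nat. b (q - 1 - int i) (dmode \<alpha> t (int i) w))"
    proof (subst Sum_any_inj_reindex[of "\<lambda>i. - 1 - int i"])
      show "inj (\<lambda>i. - 1 - int i)" by (auto intro: injI)
      show "b (- (- q - 1 - j) - 1) (if j < 0 then dmode \<alpha> t (- 1 - j) w else 0) = 0"
        if "j \<notin> range (\<lambda>i. - 1 - int i)" for j
        using that by (auto simp: lb image_iff dest!: spec[of _ "nat (- 1 - j)"])
    qed (simp add: algebra_simps)
    finally show ?thesis .
  qed
  obtain N where N: "\<And>i. i \<ge> N \<Longrightarrow> b (q + int i) w = 0 \<and> dmode \<alpha> t (int i) w = 0"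
    using eventually_happens[OF P.nprod_ev[OF dmode_fieldop[of \<alpha> t] b, of q w]] by auto
  note fin = finite_support_nat[of N]
  have "nop k s Z ((\<alpha>, t) # l) F (- q - 1) w = (\<Sum>i::nat. dmode \<alpha> t (- 1 - int i) (b (q + int i) w))
      + (\<Sum>i::nat. b (q - 1 - int i) (dmode \<alpha> t (int i) w))"
    by (simp only: nop.simps fadd_def 1 2)
  also have "\<dots> = nprod (dmode \<alpha> t) b q w"
    unfolding nprod_def
    by (rule Sum_any.distrib[symmetric]; rule fin) (use N in \<open>simp_all add: lb ld\<close>)
  finally show ?thesis by (simp add: b_def[abs_def])
qed

definition Ymonom where "Ymonom l \<beta> q = nop k s Z l (exp_coeff \<beta>) (- q - 1)"

lemma Ymonom_fieldop: "fieldop ps (Ymonom l \<beta>)"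
  and Ymonom_Cons: "Ymonom ((\<alpha>, t) # l) \<beta> q w = nprod (dmode \<alpha> t) (Ymonom l \<beta>) q w"
proof -
  show "fieldop ps (Ymonom l \<beta>)"
  proof (induction l)
    case Nil
    then show ?case using exp_mode_fieldop[of \<beta>] by (simp add: Ymonom_def[abs_def] exp_mode_def[abs_def])
  next
    case (Cons a l)
    obtain \<alpha> t where a: "a = (\<alpha>, t)" by (cases a)
    have "Ymonom (a # l) \<beta> = nprod (dmode \<alpha> t) (Ymonom l \<beta>)"
      unfolding a Ymonom_def[abs_def] using Cons by (intro ext nop_Cons_nprod) (simp add: Ymonom_def[abs_def])
    then show ?case using P.nprod_fieldop[OF dmode_fieldop Cons] by simp
  qed
  then show "Ymonom ((\<alpha>, t) # l) \<beta> q w = nprod (dmode \<alpha> t) (Ymonom l \<beta>) q w"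
    unfolding Ymonom_def[abs_def] by (rule nop_Cons_nprod)
qed

lemma Ymonom_Nil: "Ymonom [] \<beta> = exp_mode \<beta>"
  by (simp add: Ymonom_def[abs_def] exp_mode_def[abs_def])

lemma dmode_commute_neg: "dmode \<alpha> t (- 1 - int i) (dmode \<alpha>' t' (- 1 - int j) w) = dmode \<alpha>' t' (- 1 - int j) (dmode \<alpha> t (- 1 - int i) w)"
proof -
  have "h \<alpha> (- 1 - int i - int t) (h \<alpha>' (- 1 - int j - int t') w) = h \<alpha>' (- 1 - int j - int t') (h \<alpha> (- 1 - int i - int t) w)"
    using h_comm[of \<alpha> "- 1 - int i - int t" \<alpha>' "- 1 - int j - int t'" w] by simp
  then show ?thesis by (simp add: dmode_def h_simps mult.commute)
qed

text \<open>Mode i of the derivative involves \<alpha>(i - t), a creation operator for i < t; its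
  coefficient binom(i, t) is then 0.\<close>

lemma dmode_commute_pos: "dmode \<alpha> t (int i) (dmode \<alpha>' t' (int j) w) = dmode \<alpha>' t' (int j) (dmode \<alpha> t (int i) w)"
proof (cases "i < t \<or> j < t'")
  case True
  then have "(of_int (int i) gchoose t :: complex) = 0 \<or> (of_int (int j) gchoose t' :: complex) = 0"
    by (auto simp: gchoose_of_nat simp del: of_int_of_nat_eq)
  then show ?thesis by (auto simp: dmode_def h_simps)
next
  case False
  have "h \<alpha> (int i - int t) (h \<alpha>' (int j - int t') w) = h \<alpha>' (int j - int t') (h \<alpha> (int i - int t) w)"
  proof (cases "i = t \<and> j = t'")
    case True
    then have "int i - int t = 0" "int j - int t' = 0" by auto
    then show ?thesis by (simp only:) (rule h_0_h)
  next
    case False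
    with \<open>\<not> (i < t \<or> j < t')\<close> have "int i - int t + (int j - int t') \<noteq> 0" by auto
    then show ?thesis
      using h_comm[of \<alpha> "int i - int t" \<alpha>' "int j - int t'" w] by simp
  qed
  then show ?thesis by (simp add: dmode_def h_simps mult.commute)
qed

lemma Ymonom_swap: "Ymonom (a # b # l) \<beta> = Ymonom (b # a # l) \<beta>"
proof (intro ext)
  fix q w
  obtain \<alpha> t \<alpha>' t' where ab: "a = (\<alpha>, t)" "b = (\<alpha>', t')" by (cases a; cases b)
  have e: "Ymonom ((\<alpha>, t) # l) \<beta> = nprod (dmode \<alpha> t) (Ymonom l \<beta>)" for \<alpha> t by (intro ext Ymonom_Cons)
  show "Ymonom (a # b # l) \<beta> q w = Ymonom (b # a # l) \<beta> q w"
    unfolding ab Ymonom_Cons e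
    by (rule P.nprod_commute[OF dmode_fieldop dmode_fieldop Ymonom_fieldop dmode_commute_neg dmode_commute_pos])
qed

lemma Ymonom_Cons_cong: "Ymonom l \<beta> = Ymonom l' \<beta> \<Longrightarrow> Ymonom (a # l) \<beta> = Ymonom (a # l') \<beta>"
  by (cases a) (intro ext, simp add: Ymonom_Cons)

lemma Ymonom_perm: "mset l = mset l' \<Longrightarrow> Ymonom l \<beta> = Ymonom l' \<beta>"
proof (induction l arbitrary: l')
  case Nil
  then show ?case by simp
next
  case (Cons a l)
  have "a \<in> set l'" using Cons.prems by (metis list.set_intros(1) mset_eq_setD)
  then obtain ys zs where l': "l' = ys @ a # zs" by (meson split_list)
  with Cons.prems have "Ymonom l \<beta> = Ymonom (ys @ zs) \<beta>" by (intro Cons.IH) simp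
  then have "Ymonom (a # l) \<beta> = Ymonom (a # ys @ zs) \<beta>" by (rule Ymonom_Cons_cong)
  also have "\<dots> = Ymonom (ys @ a # zs) \<beta>"
  proof (induction ys)
    case (Cons y ys)
    have "Ymonom (a # y # ys @ zs) \<beta> = Ymonom (y # a # ys @ zs) \<beta>" by (rule Ymonom_swap)
    also have "\<dots> = Ymonom (y # ys @ a # zs) \<beta>" by (rule Ymonom_Cons_cong[OF Cons])
    finally show ?case by simp
  qed simp
  finally show ?case by (simp add: l')
qed

text \<open>
  The enumeration chosen by \<open>SOME\<close> is irrelevant by \<open>Ymonom_perm\<close>.
\<close>

abbreviation modelist :: "'n fvar multiset \<Rightarrow> ('n hh \<times> nat) list" where
  "modelist M \<equiv> map (\<lambda>(b, j). (hbasis b, j)) (SOME l. mset l = M)"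

lemma Ymonom_modelist_add: "Ymonom (modelist (add_mset (b, t) M)) \<beta> q w = nprod (dmode (hbasis b) t) (Ymonom (modelist M) \<beta>) q w"
proof -
  have S: "mset (SOME l. mset l = M) = M" for M :: "'n fvar multiset"
    by (rule someI_ex) (rule ex_mset)
  have "mset (modelist (add_mset (b, t) M)) = mset ((hbasis b, t) # modelist M)"
    by (simp add: S)
  from Ymonom_perm[OF this] show ?thesis by (simp add: Ymonom_Cons)
qed

definition Ymode :: "'n VV \<Rightarrow> int \<Rightarrow> ('n, 'w) fock \<Rightarrow> ('n, 'w) fock" where
  "Ymode v q w = Y_gen k s Z E x v (- q - 1) w"

lemma Ymode_pm_extend: "Ymode v q w = pm_extend (\<lambda>M u. pm_extend (\<lambda>\<beta> c. ps c (Ymonom (modelist M) \<beta> q w)) u) v"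
  by (simp add: Ymode_def Y_gen_def pm_extend_def Ymonom_def exp_coeff_def)

lemma Ymode_additive: "additive (\<lambda>v. Ymode v q w)"
  unfolding Ymode_pm_extend[abs_def] by (intro pm_extend_additive additive.intro) (simp add: P.scale_left_distrib)

lemma Ymode_single: "Ymode (Poly_Mapping.single M (Poly_Mapping.single \<beta> c)) q w = ps c (Ymonom (modelist M) \<beta> q w)"
proof -
  have "additive (pm_extend (\<lambda>\<beta> c. ps c (Ymonom (modelist M) \<beta> q w)))" for M
    by (intro pm_extend_additive additive.intro) (simp add: P.scale_left_distrib)
  then show ?thesis
    unfolding Ymode_pm_extend by (simp add: pm_extend_single additive.zero)
qed

end

lemma complex_vs_complex: "complex_vs ((*) :: complex \<Rightarrow> complex \<Rightarrow> complex)"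
  by unfold_locales (auto simp: algebra_simps)

lemma V_zero_mode_pm_extend: "V_zero_mode k \<alpha> = pm_extend (\<lambda>\<beta> c. Poly_Mapping.single \<beta> (form k \<alpha> (emb_C \<beta>) * c))"
  by (rule ext) (simp add: V_zero_mode_def pm_extend_def)

lemma V_zero_mode_additive: "additive (V_zero_mode k \<alpha>)"
  unfolding V_zero_mode_pm_extend by (intro pm_extend_additive additive.intro) (simp add: distrib_left single_add)

lemma V_zero_mode_single:
  "V_zero_mode k \<alpha> (Poly_Mapping.single \<beta> c) = Poly_Mapping.single \<beta> (form k \<alpha> (emb_C \<beta>) * c)"
  unfolding V_zero_mode_pm_extend by (rule pm_extend_single) simp

text \<open>As L_C is isotropic, \<beta>(0) acts on the group algebra by 0, which agrees with the
  exponent 0 of z^\<beta> on V.\<close>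

lemma V_fock_data:
  "fock_data L_scale k (V_zero_mode k) (\<lambda>\<beta> f. Poly_Mapping.single (\<beta> :: 'n::finite lattC) 1 * f) (\<lambda>\<beta>. 0)"
proof -
  interpret C: complex_vs "(*) :: complex \<Rightarrow> complex \<Rightarrow> complex" by (rule complex_vs_complex)
  interpret L: complex_vs "L_scale :: complex \<Rightarrow> ('n lattC \<Rightarrow>\<^sub>0 complex) \<Rightarrow> _" by (rule C.complex_vs_pm)
  have aE: "additive (\<lambda>f. Poly_Mapping.single (\<beta> :: 'n lattC) (1 :: complex) * f)" for \<beta>
    by (rule additive.intro) (simp add: distrib_left)
  note aZ = V_zero_mode_additive
  show ?thesis
  proof (intro fock_data.intro fock_data_axioms.intro L.complex_vs_axioms)
    fix \<alpha> \<alpha>' :: "'n hh" and \<beta> \<gamma> :: "'n lattC" and w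
    show "lin L_scale (V_zero_mode k \<alpha>)"
      by (rule C.lin_ext[OF aZ]) (simp add: V_zero_mode_single mult_ac del: C.scale_scale)
    show "lin L_scale ((*) (Poly_Mapping.single \<beta> 1))"
      by (rule C.lin_ext[OF aE]) (simp add: mult_single)
    show "V_zero_mode k \<alpha> w = (\<Sum>b\<in>UNIV. L_scale (\<alpha> $ b) (V_zero_mode k (hbasis b) w))"
    proof (rule additive_eqI[of "V_zero_mode k \<alpha>" "\<lambda>w. \<Sum>b\<in>UNIV. L_scale (\<alpha> $ b) (V_zero_mode k (hbasis b) w)"])
      fix \<beta> c
      have "form k \<alpha> (emb_C \<beta>) = (\<Sum>b\<in>UNIV. \<alpha> $ b * form k (hbasis b) (emb_C \<beta>))"
        unfolding form_commute[of k \<alpha>] form_expand[of k _ \<alpha>] by (simp add: form_commute)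
      then show "V_zero_mode k \<alpha> (Poly_Mapping.single \<beta> c) =
          (\<Sum>b\<in>UNIV. L_scale (\<alpha> $ b) (V_zero_mode k (hbasis b) (Poly_Mapping.single \<beta> c)))"
        by (simp add: V_zero_mode_single additive.sum[OF single_additive, symmetric] sum_distrib_left sum_distrib_right mult_ac del: C.scale_scale)
    qed (auto intro!: additive.intro simp: aZ additive.add[OF aZ] L.scale_right_distrib sum.distrib)
    show "V_zero_mode k \<alpha> (V_zero_mode k \<alpha>' w) = V_zero_mode k \<alpha>' (V_zero_mode k \<alpha> w)"
      by (rule additive_eqI[of "\<lambda>w. V_zero_mode k \<alpha> (V_zero_mode k \<alpha>' w)" "\<lambda>w. V_zero_mode k \<alpha>' (V_zero_mode k \<alpha> w)"])
         (auto intro!: additive.intro simp: additive.add[OF aZ] V_zero_mode_single mult_ac simp del: C.scale_scale)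
    show "Poly_Mapping.single 0 1 * w = w" by simp
    show "Poly_Mapping.single (\<beta> + \<gamma>) 1 * w = Poly_Mapping.single \<beta> 1 * (Poly_Mapping.single \<gamma> 1 * w)"
      by (simp add: mult_single flip: mult.assoc)
    show "V_zero_mode k \<alpha> (Poly_Mapping.single \<beta> 1 * w) = Poly_Mapping.single \<beta> 1 * V_zero_mode k \<alpha> w
        + L_scale (form k \<alpha> (emb_C \<beta>)) (Poly_Mapping.single \<beta> 1 * w)"
      by (rule additive_eqI[of "\<lambda>w. V_zero_mode k \<alpha> (Poly_Mapping.single \<beta> 1 * w)"
            "\<lambda>w. Poly_Mapping.single \<beta> 1 * V_zero_mode k \<alpha> w + L_scale (form k \<alpha> (emb_C \<beta>)) (Poly_Mapping.single \<beta> 1 * w)"])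
         (auto intro!: additive.intro simp: additive.add[OF aZ] distrib_left L.scale_right_distrib V_zero_mode_single
            mult_single emb_C_add form_add_right distrib_right single_add add.commute)
    show "V_zero_mode k (emb_C \<beta>) w = L_scale 0 w"
      by (rule additive_eqI[of "V_zero_mode k (emb_C \<beta>)" "L_scale 0"])
         (auto intro!: additive.intro simp: aZ V_zero_mode_single additive.add[OF aZ])
  qed auto
qed

context complex_vs
begin

lemma nprod_sum_right:
  assumes "finite S" "fieldop scale A" "\<And>i. fieldop scale (b i)"
  shows "nprod A (\<lambda>n w. \<Sum>i\<in>S. b i n w) q w = (\<Sum>i\<in>S. nprod A (b i) q w)"
  using assms(1)
proof (induction S rule: finite_induct)
  case empty
  show ?case by (simp add: nprod_zero_right[OF assms(2)])
next
  case (insert i S)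
  have e: "(\<Sum>i\<in>insert i S. b i n w) = b i n w + (\<Sum>i\<in>S. b i n w)" for n w
    using insert by simp
  show ?case
    by (subst nprod_add[OF assms(2) assms(3)[of i] nprod_sum_left(2)[OF insert.hyps(1) assms(3) assms(2)] e])
       (use insert in simp)
qed

lemma nprod_shift: "nprod A (\<lambda>q. b (c + q)) q w = nprod A b (c + q) w"
  by (simp add: nprod_def algebra_simps)

lemma fieldop_shift: "fieldop scale b \<Longrightarrow> fieldop scale (\<lambda>q. b (c + q))"
  unfolding fieldop_def truncated_def
proof (intro conjI allI, goal_cases)
  case (1 n) then show ?case by blast
next
  case (2 w)
  then obtain n0 where "\<forall>n\<ge>n0. b n w = 0" by blast
  then show ?case by (intro exI[of _ "n0 - c"]) auto
qed

lemma borcherds_add_left: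
  assumes b: "fieldop scale b" and b': "fieldop scale b'" and c: "fieldop scale c" and d: "\<And>n w. d n w = b n w + b' n w"
  shows "borcherds scale d c p n q w = borcherds scale b c p n q w + borcherds scale b' c p n q w"
proof -
  have lc: "c n (x + y) = c n x + c n y" "c n 0 = 0" for n x y
    using lin_simps[OF fieldop_lin[OF c]] by auto
  have b0: "b n 0 = 0" "b' n 0 = 0" for n
    using lin_simps(3)[OF fieldop_lin[OF b]] lin_simps(3)[OF fieldop_lin[OF b']] by auto
  have "\<forall>\<^sub>F N in sequentially. borcherds scale d c p n q w = borcherds scale b c p n q w + borcherds scale b' c p n q w"
    using borcherds_ev[OF b c, of p w q] borcherds_ev[OF b' c, of p w q]
  proof eventually_elim
    case (elim N)
    have e: "borcherds scale f c p n q w = (\<Sum>j<N. scale (sbinom n j) (f (p + n - int j) (c (q + int j) w))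
      - scale (neg1_pow n * sbinom n j) (c (n + q - int j) (f (p + int j) w)))"
      if "\<And>n. f n 0 = 0" "\<And>j. j \<ge> N \<Longrightarrow> f (p + int j) w = 0" for f
      unfolding borcherds_def by (rule Sum_any_lessThan) (use that elim in \<open>simp add: lc\<close>)
    have "borcherds scale d c p n q w = (\<Sum>j<N. scale (sbinom n j) (d (p + n - int j) (c (q + int j) w))
      - scale (neg1_pow n * sbinom n j) (c (n + q - int j) (d (p + int j) w)))"
      by (rule e) (use elim in \<open>auto simp: d b0\<close>)
    also have "\<dots> = borcherds scale b c p n q w + borcherds scale b' c p n q w"
      by (subst e[of b], use elim b0 in simp, use elim in simp, subst e[of b'], use elim b0 in simp, use elim in simp)
         (simp add: d lc scale_right_distrib sum.distrib sum_subtractf)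
    finally show ?case .
  qed
  then show ?thesis by simp
qed

end

lemma L_scale_single [simp]: "L_scale c (Poly_Mapping.single \<beta> d) = Poly_Mapping.single \<beta> (c * d)"
  by (rule complex_vs.pm_scale_single[OF complex_vs_complex])

lemma sum_lessThan_eq:
  fixes f :: "nat \<Rightarrow> 'a::comm_monoid_add"
  assumes "\<And>s. s \<ge> S \<Longrightarrow> f s = 0" "\<And>s. s \<ge> S' \<Longrightarrow> f s = 0"
  shows "sum f {..<S} = sum f {..<S'}"
  by (rule sum.mono_neutral_cong) (auto simp: assms)

abbreviation eV :: "'n::finite lattC \<Rightarrow> 'n VV" where
  "eV \<beta> \<equiv> Poly_Mapping.single {#} (Poly_Mapping.single \<beta> 1)"

lemma pm2_induct [case_names zero single add]:
  assumes "P 0" "\<And>M \<beta> c. P (Poly_Mapping.single M (Poly_Mapping.single \<beta> c))" "\<And>v v'. P v \<Longrightarrow> P v' \<Longrightarrow> P (v + v')"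
  shows "P (v :: 'a \<Rightarrow>\<^sub>0 'b \<Rightarrow>\<^sub>0 'c::comm_monoid_add)"
proof (induction v rule: pm_induct)
  case (single M u)
  show ?case
    by (induction u rule: pm_induct) (auto simp: assms single_add)
qed (auto intro: assms)

section \<open>States of V as fields, and their commutators with Heisenberg modes\<close>

context fock_data
begin

text \<open>
  \<open>V\<close> is itself an instance of the locale, so \<open>V.Ymode\<close> are the modes of \<open>V\<close> acting on \<open>V\<close>.
\<close>

interpretation V: fock_data L_scale k "V_zero_mode k" "\<lambda>\<beta> f. Poly_Mapping.single \<beta> 1 * f" "\<lambda>\<beta>. 0"
  by (rule V_fock_data)

text \<open>Every state arises from the \<open>eV \<beta>\<close> by creation modes of basis
  vectors, scaling and sums; unlike induction on monomials this matches the recursion of the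
  fields.\<close>

lemma V_induct [case_names zero base scale add step]:
  assumes "P 0" and base: "\<And>\<beta>. P (eV \<beta>)" and scale: "\<And>c v. P v \<Longrightarrow> P (V_scale c v)"
    and add: "\<And>v v'. P v \<Longrightarrow> P v' \<Longrightarrow> P (v + v')"
    and step: "\<And>b t v. P v \<Longrightarrow> P (V.h (hbasis b) (- 1 - int t) v)"
  shows "P v"
proof (induction v rule: pm2_induct)
  case (single M \<beta> c)
  show ?case
  proof (induction M)
    case empty
    from scale[OF base, of c \<beta>] show ?case by simp
  next
    case (add v M)
    obtain b t where v: "v = (b, t)" by (cases v)
    from step[OF add, of b t] show ?case
      by (simp add: v V.h_basis_neg)
  qed
qed (use assms in auto)

lemma Ymode_0: "Ymode 0 q w = 0"
  by (rule additive.zero[OF Ymode_additive])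

lemma Ymode_add: "Ymode (u + v) q w = Ymode u q w + Ymode v q w"
  by (rule additive.add[OF Ymode_additive])

lemma Ymode_scale: "Ymode (V_scale c v) q w = ps c (Ymode v q w)"
  by (induction v rule: pm2_induct)
     (simp_all add: Ymode_0 Ymode_add Ymode_single V.P.scale_right_distrib P.scale_right_distrib)

lemma Ymode_eV: "Ymode (eV \<beta>) = exp_mode \<beta>"
  by (intro ext) (simp add: Ymode_single Ymonom_Nil)

lemma Ymode_fieldop: "fieldop ps (Ymode v)"
proof (induction v rule: pm2_induct)
  case zero
  have "Ymode 0 = (\<lambda>n w. 0)" by (intro ext Ymode_0)
  then show ?case by (simp add: P.fieldop_zero)
next
  case (single M \<beta> c)
  have "Ymode (Poly_Mapping.single M (Poly_Mapping.single \<beta> c)) = (\<lambda>q w. ps c (Ymonom (modelist M) \<beta> q w))"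
    by (intro ext Ymode_single)
  then show ?case by (simp add: P.fieldop_scale[OF Ymonom_fieldop])
next
  case (add u v)
  have "Ymode (u + v) = (\<lambda>q w. Ymode u q w + Ymode v q w)" by (intro ext Ymode_add)
  with add show ?case by (simp add: P.fieldop_add)
qed

lemmas Ymode_simps = lin_simps[OF fieldop_lin[OF Ymode_fieldop]]

lemma Ymode_h_basis: "Ymode (V.h (hbasis b) (- 1 - int t) v) q w = nprod (dmode (hbasis b) t) (Ymode v) q w"
proof (induction v rule: pm2_induct)
  case zero
  have "Ymode 0 = (\<lambda>n w. 0)" by (intro ext Ymode_0)
  then show ?case by (simp add: V.h_simps Ymode_0 P.nprod_zero_right[OF dmode_fieldop])
next
  case (single M \<beta> c)
  have "nprod (dmode (hbasis b) t) (Ymode (Poly_Mapping.single M (Poly_Mapping.single \<beta> c))) q w =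
      ps c (nprod (dmode (hbasis b) t) (Ymonom (modelist M) \<beta>) q w)"
    by (rule P.nprod_scale[OF dmode_fieldop Ymonom_fieldop Ymode_single])
  also have "\<dots> = Ymode (Poly_Mapping.single (add_mset (b, t) M) (Poly_Mapping.single \<beta> c)) q w"
    by (simp only: Ymode_single Ymonom_modelist_add)
  finally show ?case
    by (simp only: V.h_basis_neg V.create_single)
next
  case (add u v)
  have e: "nprod (dmode (hbasis b) t) (Ymode (u + v)) q w = nprod (dmode (hbasis b) t) (Ymode u) q w + nprod (dmode (hbasis b) t) (Ymode v) q w"
    by (rule P.nprod_add[OF dmode_fieldop Ymode_fieldop Ymode_fieldop Ymode_add])
  show ?case
    unfolding e using add by (simp add: V.h_simps Ymode_add)
qed

lemma dmode_expand: "dmode \<alpha> t n w = (\<Sum>b\<in>UNIV. ps (\<alpha> $ b) (dmode (hbasis b) t n w))"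
  unfolding dmode_def by (subst h_expand) (simp add: P.scale_sum_right mult.commute)

text \<open>The extension beyond basis vectors is what the recursion for E^- calls for, where modes
  of \<beta> in L_C occur.\<close>

lemma Ymode_h: "Ymode (V.h \<alpha> (- 1 - int t) v) q w = nprod (dmode \<alpha> t) (Ymode v) q w"
proof -
  have e: "dmode \<alpha> t = (\<lambda>n w. \<Sum>b\<in>UNIV. ps (\<alpha> $ b) (dmode (hbasis b) t n w))"
    by (intro ext dmode_expand)
  have "Ymode (V.h \<alpha> (- 1 - int t) v) q w = (\<Sum>b\<in>UNIV. ps (\<alpha> $ b) (nprod (dmode (hbasis b) t) (Ymode v) q w))"
    by (subst V.h_expand) (simp add: additive.sum[OF Ymode_additive] Ymode_scale Ymode_h_basis)
  also have "\<dots> = (\<Sum>b\<in>UNIV. nprod (\<lambda>n w. ps (\<alpha> $ b) (dmode (hbasis b) t n w)) (Ymode v) q w)"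
    by (intro sum.cong refl P.nprod_scale_left[symmetric, OF dmode_fieldop Ymode_fieldop])
  also have "\<dots> = nprod (dmode \<alpha> t) (Ymode v) q w"
    unfolding e by (rule P.nprod_sum_left(1)[symmetric]) (auto intro: P.fieldop_scale dmode_fieldop Ymode_fieldop)
  finally show ?thesis .
qed

text \<open>Origin of the constant: (-1)^t binom(t-p, t) p = p binom(p-1, t) = (t+1) binom(p, t+1),
  by upper negation and absorption. It matches the term s = t + 1 of
  \<open>Ymode_commutator_sum\<close>.\<close>

lemma h_dmode:
  "h \<alpha> p (dmode \<alpha>' t j w) = dmode \<alpha>' t j (h \<alpha> p w) +
     (if j = int t - p then ps (form k \<alpha> \<alpha>' * (of_nat (Suc t) * (of_int p gchoose Suc t))) w else 0)"
proof -
  have c: "(- 1) ^ t * (of_int (int t - p) gchoose t) * of_int p = (of_nat (Suc t) * (of_int p gchoose Suc t) :: complex)"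
  proof -
    have "of_nat t - of_int (int t - p) - 1 = (of_int p - 1 :: complex)" by simp
    then have "(- 1) ^ t * (of_int (int t - p) gchoose t :: complex) = (of_int p - 1) gchoose t"
      using gbinomial_negated_upper[of "of_int (int t - p) :: complex" t] by (simp flip: mult.assoc power_mult_distrib)
    then show ?thesis
      using gbinomial_absorption[of t "of_int p :: complex"] by (simp add: mult.commute)
  qed
  have "h \<alpha> p (dmode \<alpha>' t j w) = ps ((- 1) ^ t * (of_int j gchoose t)) (h \<alpha>' (j - int t) (h \<alpha> p w) +
     (if p + (j - int t) = 0 then ps (of_int p * form k \<alpha> \<alpha>') w else 0))"
    unfolding dmode_def h_simps using h_comm[of \<alpha> p \<alpha>' "j - int t" w] by (simp add: diff_eq_eq add.commute)
  also have "\<dots> = dmode \<alpha>' t j (h \<alpha> p w) +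
     (if j = int t - p then ps ((- 1) ^ t * (of_int (int t - p) gchoose t) * of_int p * form k \<alpha> \<alpha>') w else 0)"
    by (auto simp: dmode_def P.scale_right_distrib mult.assoc)
  finally show ?thesis
    unfolding c by (simp only: mult.commute)
qed

text \<open>\<alpha>(p) acts as a derivation: R is its commutator with b, and the remaining term is
  its contraction with \<alpha>'.\<close>

lemma nprod_commutator:
  assumes b: "fieldop ps b" and R: "\<And>q w. R q w = h \<alpha> p (b q w) - b q (h \<alpha> p w)"
  shows "h \<alpha> p (nprod (dmode \<alpha>' t) b q w) - nprod (dmode \<alpha>' t) b q (h \<alpha> p w) =
    nprod (dmode \<alpha>' t) R q w + ps (form k \<alpha> \<alpha>' * (of_nat (Suc t) * (of_int p gchoose Suc t))) (b (p + q - int (Suc t)) w)"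
proof -
  note lb = lin_simps[OF fieldop_lin[OF b]] and ld = lin_simps[OF fieldop_lin[OF dmode_fieldop]]
  let ?K = "form k \<alpha> \<alpha>' * (of_nat (Suc t) * (of_int p gchoose Suc t))"
  \<comment> \<open>The contraction sits in exactly one summand: the annihilation mode i = t - p if
    p \<le> t, and otherwise the creation mode -1 - i with i = p - t - 1.\<close>
  define i0 where "i0 = (if p \<le> int t then nat (int t - p) else nat (p - int t - 1))"
  have fR: "fieldop ps R"
    unfolding fieldop_def truncated_def
  proof (intro conjI allI)
    show "lin ps (R n)" for n
      by (rule linI) (simp_all add: R[abs_def] h_simps lb P.scale_right_diff_distrib)
    fix w
    obtain n0 n1 where "\<forall>n\<ge>n0. b n w = 0" "\<forall>n\<ge>n1. b n (h \<alpha> p w) = 0"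
      using fieldop_truncated[OF b] unfolding truncated_def by meson
    then show "\<exists>n0. \<forall>n\<ge>n0. R n w = 0"
      by (intro exI[of _ "max n0 n1"]) (auto simp: R h_simps)
  qed
  have bc: "h \<alpha> p (b n u) = b n (h \<alpha> p u) + R n u" for n u by (simp add: R)
  have "\<forall>\<^sub>F N in sequentially. h \<alpha> p (nprod (dmode \<alpha>' t) b q w) - nprod (dmode \<alpha>' t) b q (h \<alpha> p w) =
    nprod (dmode \<alpha>' t) R q w + ps ?K (b (p + q - int (Suc t)) w)"
    using P.nprod_ev[OF dmode_fieldop[of \<alpha>' t] b, of q w] P.nprod_ev[OF dmode_fieldop[of \<alpha>' t] b, of q "h \<alpha> p w"]
      P.nprod_ev[OF dmode_fieldop[of \<alpha>' t] fR, of q w] eventually_gt_at_top[of i0]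
  proof eventually_elim
    case (elim N)
    note e = elim(1)[THEN conjunct2] elim(2)[THEN conjunct2] elim(3)[THEN conjunct2]
    have t: "h \<alpha> p (dmode \<alpha>' t (- 1 - int i) (b (q + int i) w) + b (q - 1 - int i) (dmode \<alpha>' t (int i) w)) =
      (dmode \<alpha>' t (- 1 - int i) (b (q + int i) (h \<alpha> p w)) + b (q - 1 - int i) (dmode \<alpha>' t (int i) (h \<alpha> p w)))
      + (dmode \<alpha>' t (- 1 - int i) (R (q + int i) w) + R (q - 1 - int i) (dmode \<alpha>' t (int i) w))
      + (if i = i0 then ps ?K (b (p + q - int (Suc t)) w) else 0)" for i
    proof -
      have c1: "(if - 1 - int i = int t - p then ps ?K (b (q + int i) w) else 0) +
          (if int i = int t - p then ps ?K (b (q - 1 - int i) w) else 0) =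
          (if i = i0 then ps ?K (b (p + q - int (Suc t)) w) else 0)"
      proof -
        define B where "B = b (p + q - int (Suc t)) w"
        have B1: "b (q + int i) w = B" if "- 1 - int i = int t - p"
        proof -
          have "q + int i = p + q - int (Suc t)" using that by simp
          then show ?thesis by (simp only: B_def)
        qed
        have B2: "b (q - 1 - int i) w = B" if "int i = int t - p"
        proof -
          have "q - 1 - int i = p + q - int (Suc t)" using that by simp
          then show ?thesis by (simp only: B_def)
        qed
        have i: "- 1 - int i = int t - p \<longleftrightarrow> p > int t \<and> i = i0" "int i = int t - p \<longleftrightarrow> p \<le> int t \<and> i = i0"
          by (auto simp: i0_def)
        have "(if - 1 - int i = int t - p then ps ?K (b (q + int i) w) else 0) =
            (if p > int t \<and> i = i0 then ps ?K B else 0)"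
          using B1 i(1) by presburger
        moreover have "(if int i = int t - p then ps ?K (b (q - 1 - int i) w) else 0) =
            (if p \<le> int t \<and> i = i0 then ps ?K B else 0)"
          using B2 i(2) by presburger
        ultimately show ?thesis
          by (cases "p \<le> int t") (simp_all only: B_def not_le not_less if_True if_False add_0_left add_0_right simp_thms split: if_split, auto)
      qed
      have c2: "h \<alpha> p (dmode \<alpha>' t (- 1 - int i) (b (q + int i) w)) = dmode \<alpha>' t (- 1 - int i) (b (q + int i) (h \<alpha> p w))
          + dmode \<alpha>' t (- 1 - int i) (R (q + int i) w) + (if - 1 - int i = int t - p then ps ?K (b (q + int i) w) else 0)"
        by (simp only: h_dmode bc ld)
      have c3: "h \<alpha> p (b (q - 1 - int i) (dmode \<alpha>' t (int i) w)) = b (q - 1 - int i) (dmode \<alpha>' t (int i) (h \<alpha> p w))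
          + (if int i = int t - p then ps ?K (b (q - 1 - int i) w) else 0) + R (q - 1 - int i) (dmode \<alpha>' t (int i) w)"
        by (simp only: h_dmode bc lb if_distrib[of "b _"])
      show ?thesis
        unfolding h_simps(2) c2 c3 c1[symmetric] by (simp only: ac_simps)
    qed
    have "h \<alpha> p (nprod (dmode \<alpha>' t) b q w) =
       nprod (dmode \<alpha>' t) b q (h \<alpha> p w) + nprod (dmode \<alpha>' t) R q w + (\<Sum>i<N. if i = i0 then ps ?K (b (p + q - int (Suc t)) w) else 0)"
      unfolding e unfolding h_simps(6) unfolding t unfolding sum.distrib by (simp only: add.assoc)
    also have "(\<Sum>i<N. if i = i0 then ps ?K (b (p + q - int (Suc t)) w) else 0) = ps ?K (b (p + q - int (Suc t)) w)"
      using elim(4) by (simp add: sum.delta)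
    finally show ?case by simp
  qed
  then show ?thesis by simp
qed

lemma V_h_finite: "\<exists>S. \<forall>s\<ge>S. V.h \<alpha> (int s) v = 0"
  using truncated_ev[OF fieldop_truncated[OF V.h_fieldop[of \<alpha>]], of 0 v] by (auto simp: eventually_sequentially)

text \<open>S is an arbitrary bound because the induction splits v into pieces with bounds of their
  own; \<open>sum_lessThan_eq\<close> mediates between the ranges.\<close>

lemma Ymode_commutator_sum:
  assumes "\<And>s. s \<ge> S \<Longrightarrow> V.h \<alpha> (int s) v = 0"
  shows "h \<alpha> p (Ymode v q w) - Ymode v q (h \<alpha> p w) =
    (\<Sum>s<S. ps (of_int p gchoose s) (Ymode (V.h \<alpha> (int s) v) (p + q - int s) w))"
  using assms
proof (induction v arbitrary: S q w rule: V_induct)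
  case zero
  then show ?case by (simp add: Ymode_0 h_simps V.h_simps)
next
  case (base \<beta>)
  have pos: "V.h \<alpha> (int s) (eV \<beta>) = 0" if "s > 0" for s
    using that by (simp add: V.h_pos)
  have 0: "V.h \<alpha> 0 (eV \<beta>) = V_scale (form k \<alpha> (emb_C \<beta>)) (eV \<beta>)"
    by (simp add: V.h_0_single V_zero_mode_single)
  have "(\<Sum>s<S. ps (of_int p gchoose s) (Ymode (V.h \<alpha> (int s) (eV \<beta>)) (p + q - int s) w)) =
     (\<Sum>s<Suc 0. ps (of_int p gchoose s) (Ymode (V.h \<alpha> (int s) (eV \<beta>)) (p + q - int s) w))"
    by (rule sum_lessThan_eq) (simp_all only: base.prems pos Suc_le_eq Ymode_0 P.scale_zero_right)
  also have "\<dots> = ps (form k \<alpha> (emb_C \<beta>)) (exp_mode \<beta> (p + q) w)"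
    by (simp add: 0 Ymode_scale Ymode_eV del: V.pm_scale_single V.P.pm_scale_single)
  finally show ?case by (simp add: Ymode_eV exp_mode_commutator)
next
  case (scale c v)
  obtain S' where S': "\<And>s. s \<ge> S' \<Longrightarrow> V.h \<alpha> (int s) v = 0" using V_h_finite by blast
  have "(\<Sum>s<S. ps (of_int p gchoose s) (Ymode (V.h \<alpha> (int s) (V_scale c v)) (p + q - int s) w)) =
     (\<Sum>s<S'. ps (of_int p gchoose s) (Ymode (V.h \<alpha> (int s) (V_scale c v)) (p + q - int s) w))"
    by (rule sum_lessThan_eq) (simp add: scale.prems Ymode_0, simp add: S' Ymode_0 V.h_simps)
  moreover have "h \<alpha> p (Ymode v q w) - Ymode v q (h \<alpha> p w) =
      (\<Sum>s<S'. ps (of_int p gchoose s) (Ymode (V.h \<alpha> (int s) v) (p + q - int s) w))"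
    by (rule scale.IH) (rule S')
  ultimately show ?case
    by (simp add: V.h_simps Ymode_scale h_simps Ymode_simps P.scale_sum_right mult.commute flip: P.scale_right_diff_distrib)
next
  case (add v v')
  obtain S1 where S1: "\<And>s. s \<ge> S1 \<Longrightarrow> V.h \<alpha> (int s) v = 0" using V_h_finite by blast
  obtain S2 where S2: "\<And>s. s \<ge> S2 \<Longrightarrow> V.h \<alpha> (int s) v' = 0" using V_h_finite by blast
  let ?S = "max S1 S2"
  have "(\<Sum>s<S. ps (of_int p gchoose s) (Ymode (V.h \<alpha> (int s) (v + v')) (p + q - int s) w)) =
     (\<Sum>s<?S. ps (of_int p gchoose s) (Ymode (V.h \<alpha> (int s) (v + v')) (p + q - int s) w))"
    by (rule sum_lessThan_eq) (simp add: add.prems Ymode_0, simp add: S1 S2 Ymode_0 V.h_simps)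
  moreover have "h \<alpha> p (Ymode v q w) - Ymode v q (h \<alpha> p w) =
      (\<Sum>s<?S. ps (of_int p gchoose s) (Ymode (V.h \<alpha> (int s) v) (p + q - int s) w))"
    by (rule add.IH(1)) (simp add: S1)
  moreover have "h \<alpha> p (Ymode v' q w) - Ymode v' q (h \<alpha> p w) =
      (\<Sum>s<?S. ps (of_int p gchoose s) (Ymode (V.h \<alpha> (int s) v') (p + q - int s) w))"
    by (rule add.IH(2)) (simp add: S2)
  ultimately show ?case
    by (simp add: V.h_simps Ymode_add h_simps Ymode_simps P.scale_right_distrib sum.distrib algebra_simps)
next
  case (step b t v)
  let ?\<kappa> = "form k \<alpha> (hbasis b)"
  obtain S1 where S1: "\<And>s. s \<ge> S1 \<Longrightarrow> V.h \<alpha> (int s) v = 0" using V_h_finite by blast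
  \<comment> \<open>The range must contain s = t + 1, the index at which \<alpha>(s) contracts with
    the new mode.\<close>
  define S' where "S' = max S1 (Suc (Suc t))"
  have S': "\<And>s. s \<ge> S' \<Longrightarrow> V.h \<alpha> (int s) v = 0" using S1 by (simp add: S'_def)
  have hh: "V.h \<alpha> (int s) (V.h (hbasis b) (- 1 - int t) v) = V.h (hbasis b) (- 1 - int t) (V.h \<alpha> (int s) v) +
     (if s = Suc t then V_scale (of_nat (Suc t) * ?\<kappa>) v else 0)" for s
    using V.h_comm[of \<alpha> "int s" "hbasis b" "- 1 - int t" v] by (auto simp: diff_eq_eq add.commute)
  have R: "(\<lambda>q w. \<Sum>s<S'. ps (of_int p gchoose s) (Ymode (V.h \<alpha> (int s) v) (p + q - int s) w)) q w =
       h \<alpha> p (Ymode v q w) - Ymode v q (h \<alpha> p w)" for q w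
    using step.IH[OF S'] by simp
  have fs: "fieldop ps (\<lambda>q w. ps (of_int p gchoose s) (Ymode (V.h \<alpha> (int s) v) (p - int s + q) w))" for s
    by (rule P.fieldop_scale[OF P.fieldop_shift[OF Ymode_fieldop]])
  have "(\<Sum>s<S. ps (of_int p gchoose s) (Ymode (V.h \<alpha> (int s) (V.h (hbasis b) (- 1 - int t) v)) (p + q - int s) w)) =
     (\<Sum>s<S'. ps (of_int p gchoose s) (Ymode (V.h \<alpha> (int s) (V.h (hbasis b) (- 1 - int t) v)) (p + q - int s) w))"
    by (rule sum_lessThan_eq) (simp add: step.prems Ymode_0, use S' in \<open>simp add: hh Ymode_0 V.h_simps S'_def\<close>)
  also have "\<dots> = (\<Sum>s<S'. ps (of_int p gchoose s) (nprod (dmode (hbasis b) t) (Ymode (V.h \<alpha> (int s) v)) (p - int s + q) w))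
     + (\<Sum>s<S'. if s = Suc t then ps (of_int p gchoose Suc t) (ps (of_nat (Suc t) * ?\<kappa>) (Ymode v (p + q - int (Suc t)) w)) else 0)"
    unfolding sum.distrib[symmetric] hh Ymode_add Ymode_h_basis
  proof (intro sum.cong refl)
    fix s
    have "p + q - int s = p - int s + q" by simp
    then show "ps (of_int p gchoose s) (nprod (dmode (hbasis b) t) (Ymode (V.h \<alpha> (int s) v)) (p + q - int s) w
           + Ymode (if s = Suc t then V_scale (of_nat (Suc t) * ?\<kappa>) v else 0) (p + q - int s) w) =
        ps (of_int p gchoose s) (nprod (dmode (hbasis b) t) (Ymode (V.h \<alpha> (int s) v)) (p - int s + q) w)
        + (if s = Suc t then ps (of_int p gchoose Suc t) (ps (of_nat (Suc t) * ?\<kappa>) (Ymode v (p + q - int (Suc t)) w)) else 0)"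
      by (cases "s = Suc t") (simp_all only: simp_thms if_True if_False Ymode_scale Ymode_0 P.scale_right_distrib add_0_right)
  qed
  also have "(\<Sum>s<S'. ps (of_int p gchoose s) (nprod (dmode (hbasis b) t) (Ymode (V.h \<alpha> (int s) v)) (p - int s + q) w)) =
     (\<Sum>s<S'. nprod (dmode (hbasis b) t) (\<lambda>q w. ps (of_int p gchoose s) (Ymode (V.h \<alpha> (int s) v) (p - int s + q) w)) q w)"
  proof (intro sum.cong refl)
    fix s
    have "nprod (dmode (hbasis b) t) (\<lambda>q w. ps (of_int p gchoose s) (Ymode (V.h \<alpha> (int s) v) (p - int s + q) w)) q w =
      ps (of_int p gchoose s) (nprod (dmode (hbasis b) t) (\<lambda>q. Ymode (V.h \<alpha> (int s) v) (p - int s + q)) q w)"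
      by (rule P.nprod_scale[OF dmode_fieldop P.fieldop_shift[OF Ymode_fieldop]]) simp
    then show "ps (of_int p gchoose s) (nprod (dmode (hbasis b) t) (Ymode (V.h \<alpha> (int s) v)) (p - int s + q) w) =
      nprod (dmode (hbasis b) t) (\<lambda>q w. ps (of_int p gchoose s) (Ymode (V.h \<alpha> (int s) v) (p - int s + q) w)) q w"
      by (simp add: P.nprod_shift)
  qed
  also have "\<dots> = nprod (dmode (hbasis b) t) (\<lambda>q w. \<Sum>s<S'. ps (of_int p gchoose s) (Ymode (V.h \<alpha> (int s) v) (p - int s + q) w)) q w"
    by (rule P.nprod_sum_right[symmetric, OF _ dmode_fieldop fs]) simp
  also have "(\<lambda>q w. \<Sum>s<S'. ps (of_int p gchoose s) (Ymode (V.h \<alpha> (int s) v) (p - int s + q) w)) =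
     (\<lambda>q w. \<Sum>s<S'. ps (of_int p gchoose s) (Ymode (V.h \<alpha> (int s) v) (p + q - int s) w))"
    by (simp add: algebra_simps)
  also have "(\<Sum>s<S'. if s = Suc t then ps (of_int p gchoose Suc t) (ps (of_nat (Suc t) * ?\<kappa>) (Ymode v (p + q - int (Suc t)) w)) else 0)
     = ps (?\<kappa> * (of_nat (Suc t) * (of_int p gchoose Suc t))) (Ymode v (p + q - int (Suc t)) w)"
    by (simp add: S'_def sum.delta mult_ac less_max_iff_disj)
  finally show ?case
    unfolding Ymode_h_basis nprod_commutator[OF Ymode_fieldop R] ..
qed

end

lemma of_nat_choose_fact: "(of_nat ((a + b) choose a) :: complex) = fact (a + b) / (fact a * fact b)"
  using binomial_fact[of a "a + b", where 'a = complex] by simp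

section \<open>The Borcherds identity for all pairs of states\<close>

context fock_data
begin

interpretation V: fock_data L_scale k "V_zero_mode k" "\<lambda>\<beta> f. Poly_Mapping.single \<beta> 1 * f" "\<lambda>\<beta>. 0"
  by (rule V_fock_data)

text \<open>Hypothesis \<open>neg\<close> of \<open>borcherds_nprod_eq\<close>. The field of
  \<alpha>(-1-r-t) v contains \<partial>_(r+t) \<alpha>, and \<partial>_r \<partial>_t = binom(r+t,
  t) \<partial>_(r+t) turns this into modes of \<partial>_t \<alpha>.\<close>

lemma Ymode_dmode:
  "Ymode (V.dmode \<alpha> t (- 1 - int r) v) q w =
    (\<Sum>i::nat. ps (of_nat ((r + i) choose i)) (dmode \<alpha> t (- 1 - int r - int i) (Ymode v (q + int i) w))
       + ps ((- 1) ^ r * of_nat ((r + i) choose i)) (Ymode v (q - 1 - int r - int i) (dmode \<alpha> t (int i) w)))"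
proof -
  note ld = lin_simps[OF fieldop_lin[OF dmode_fieldop]]
  let ?c = "(- 1) ^ t * (of_int (- 1 - int r) gchoose t) :: complex"
  let ?f = "\<lambda>i::nat. ps (of_nat ((r + i) choose i)) (dmode \<alpha> t (- 1 - int r - int i) (Ymode v (q + int i) w))"
  let ?g = "\<lambda>i::nat. ps ((- 1) ^ r * of_nat ((r + i) choose i)) (Ymode v (q - 1 - int r - int i) (dmode \<alpha> t (int i) w))"
  have c: "?c = of_nat ((r + t) choose t)"
    using sbinom_neg[of r t] by (simp add: sbinom_def)
  have g: "(- 1) ^ m * (of_int (- 1 - int i) gchoose m) = (of_nat ((i + m) choose m) :: complex)" for i m
    using sbinom_neg[of i m] by (simp add: sbinom_def)
  have e1: "ps ?c (dmode \<alpha> (r + t) (- 1 - int i) (Ymode v (q + int i) w)) = ?f i" for i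
  proof -
    have "- 1 - int r - int i = - 1 - int (r + i)" "- 1 - int (r + i) - int t = - 1 - int i - int (r + t)" by simp_all
    \<comment> \<open>Both products equal (i + r + t)! / (i! r! t!).\<close>
    moreover have "(of_nat ((r + t) choose t) * of_nat ((i + (r + t)) choose (r + t)) :: complex) =
        of_nat ((r + i) choose i) * of_nat ((r + i + t) choose t)"
      using of_nat_choose_fact[of t r] of_nat_choose_fact[of "r + t" i] of_nat_choose_fact[of i r] of_nat_choose_fact[of t "r + i"]
      by (simp add: add_ac)
    ultimately show ?thesis
      unfolding dmode_def c g by (simp only: P.scale_scale g)
  qed
  have e2: "ps ?c (Ymode v (q - 1 - int (i + r)) (dmode \<alpha> (r + t) (int (i + r)) w)) = ?g i" for i
  proof (cases "i < t")
    case True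
    then have "(of_int (int (i + r)) gchoose (r + t) :: complex) = 0" "(of_int (int i) gchoose t :: complex) = 0"
      unfolding gchoose_of_nat by simp_all
    then show ?thesis unfolding dmode_def by (simp only:) (simp add: Ymode_simps)
  next
    case False
    have a: "int (i + r) - int (r + t) = int i - int t" "q - 1 - int (i + r) = q - 1 - int r - int i" by simp_all
    obtain l where l: "i = t + l" using False by (metis le_iff_add not_less)
    have "(of_nat ((r + t) choose t) * of_nat ((i + r) choose (r + t)) :: complex) =
        of_nat ((r + i) choose i) * of_nat (i choose t)"
      using of_nat_choose_fact[of t r] of_nat_choose_fact[of "r + t" l] of_nat_choose_fact[of i r] of_nat_choose_fact[of t l]
      by (simp add: l add_ac)
    then have b: "?c * ((- 1) ^ (r + t) * (of_int (int (i + r)) gchoose (r + t))) =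
        (- 1) ^ r * of_nat ((r + i) choose i) * ((- 1) ^ t * (of_int (int i) gchoose t) :: complex)"
      unfolding c gchoose_of_nat power_add by (simp only: mult_ac)
    show ?thesis
      unfolding dmode_def a Ymode_simps P.scale_scale b ..
  qed
  have z: "dmode \<alpha> (r + t) (int i) w = 0" if "i < r" for i
  proof -
    have "(of_int (int i) gchoose (r + t) :: complex) = 0" unfolding gchoose_of_nat using that by simp
    then show ?thesis unfolding dmode_def by (simp only:) simp
  qed
  obtain N where N: "\<And>i. i \<ge> N \<Longrightarrow> Ymode v (q + int i) w = 0" "\<And>i. i \<ge> N \<Longrightarrow> dmode \<alpha> (r + t) (int i) w = 0"
      "\<And>i. i \<ge> N \<Longrightarrow> dmode \<alpha> t (int i) w = 0"
  proof -
    have "\<forall>\<^sub>F N in sequentially. (\<forall>i\<ge>N. Ymode v (q + int i) w = 0) \<and> (\<forall>i\<ge>N. dmode \<alpha> (r + t) (0 + int i) w = 0) \<and>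
       (\<forall>i\<ge>N. dmode \<alpha> t (0 + int i) w = 0)" (is "\<forall>\<^sub>F N in _. ?P N")
      by (intro eventually_conj truncated_ev fieldop_truncated[OF Ymode_fieldop] fieldop_truncated[OF dmode_fieldop])
    from eventually_happens[OF this] obtain N where "?P N" by auto
    then show thesis by (intro that[of N]) auto
  qed
  note fin = finite_support_nat[of N]
  have i: "- 1 - int r - int t = - 1 - int (r + t)" by simp
  have "Ymode (V.dmode \<alpha> t (- 1 - int r) v) q w = ps ?c (nprod (dmode \<alpha> (r + t)) (Ymode v) q w)"
    unfolding V.dmode_def Ymode_scale i Ymode_h ..
  also have "nprod (dmode \<alpha> (r + t)) (Ymode v) q w = (\<Sum>i::nat. dmode \<alpha> (r + t) (- 1 - int i) (Ymode v (q + int i) w))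
       + (\<Sum>i::nat. Ymode v (q - 1 - int i) (dmode \<alpha> (r + t) (int i) w))"
    unfolding nprod_def by (rule Sum_any.distrib; rule fin) (simp_all add: N ld Ymode_simps)
  also have "ps ?c \<dots> = (\<Sum>i::nat. ps ?c (dmode \<alpha> (r + t) (- 1 - int i) (Ymode v (q + int i) w)))
      + (\<Sum>i::nat. ps ?c (Ymode v (q - 1 - int i) (dmode \<alpha> (r + t) (int i) w)))"
    unfolding P.scale_right_distrib
    by (intro arg_cong2[of _ _ _ _ "(+)"] additive_Sum_any fin)
       (simp_all add: additive.intro P.scale_right_distrib N ld Ymode_simps)
  also have "(\<Sum>i::nat. ps ?c (dmode \<alpha> (r + t) (- 1 - int i) (Ymode v (q + int i) w))) = Sum_any ?f"
    unfolding e1 ..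
  also have "(\<Sum>i::nat. ps ?c (Ymode v (q - 1 - int i) (dmode \<alpha> (r + t) (int i) w))) = Sum_any ?g"
    by (subst Sum_any_shift_nat[of r]) (simp_all only: z Ymode_simps P.scale_zero_right e2)
  also have "Sum_any ?f + Sum_any ?g = Sum_any (\<lambda>i. ?f i + ?g i)"
    by (rule Sum_any.distrib[symmetric]; rule fin) (simp_all add: N ld Ymode_simps)
  finally show ?thesis .
qed

text \<open>Hypothesis \<open>comm\<close> of \<open>borcherds_nprod_eq\<close>: the commutator
  formula at p - t with indices shifted by t, where binom(p, s+t) binom(s+t, t) = binom(p, t)
  binom(p-t, s).\<close>

lemma Ymode_dmode_commutator:
  assumes S: "\<And>s. s \<ge> S \<Longrightarrow> V.dmode \<alpha> t (int s) v = 0"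
  shows "dmode \<alpha> t p (Ymode v q w) - Ymode v q (dmode \<alpha> t p w) =
    (\<Sum>s<S. ps (of_int p gchoose s) (Ymode (V.dmode \<alpha> t (int s) v) (p + q - int s) w))"
proof -
  let ?c = "(- 1) ^ t * (of_int p gchoose t) :: complex"
  let ?f = "\<lambda>s. ps (of_int p gchoose s) (Ymode (V.dmode \<alpha> t (int s) v) (p + q - int s) w)"
  obtain S' where S': "\<And>s. s \<ge> S' \<Longrightarrow> V.h \<alpha> (int s) v = 0" using V_h_finite by blast
  have f: "?f (s + t) = ps ?c (ps (of_int (p - int t) gchoose s) (Ymode (V.h \<alpha> (int s) v) (p - int t + q - int s) w))" for s
  proof -
    have "(of_int p gchoose (s + t)) * (of_nat (s + t) gchoose t) =
        (of_int p gchoose t) * ((of_int p - of_nat t :: complex) gchoose (s + t - t))"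
      by (rule gbinomial_trinomial_revision) simp
    then have "(of_int p gchoose (s + t)) * (of_int (int (s + t)) gchoose t) =
        (of_int p gchoose t) * (of_int (p - int t) gchoose s :: complex)" by simp
    then have c: "(of_int p gchoose (s + t)) * ((- 1) ^ t * (of_int (int (s + t)) gchoose t)) =
       ?c * (of_int (p - int t) gchoose s :: complex)" by (simp only: mult_ac)
    have i: "int (s + t) - int t = int s" "p + q - int (s + t) = p - int t + q - int s" by simp_all
    show ?thesis
      unfolding V.dmode_def Ymode_scale i P.scale_scale c ..
  qed
  have z: "V.dmode \<alpha> t (int s) v = 0" if "s < t" for s
  proof -
    have "(of_int (int s) gchoose t :: complex) = 0" unfolding gchoose_of_nat using that by simp
    then show ?thesis unfolding V.dmode_def by (simp only:) simp
  qed
  have "dmode \<alpha> t p (Ymode v q w) - Ymode v q (dmode \<alpha> t p w) =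
      ps ?c (h \<alpha> (p - int t) (Ymode v q w) - Ymode v q (h \<alpha> (p - int t) w))"
    by (simp add: dmode_def Ymode_simps P.scale_right_diff_distrib)
  also have "\<dots> = (\<Sum>s<S'. ?f (s + t))"
  proof -
    have "h \<alpha> (p - int t) (Ymode v q w) - Ymode v q (h \<alpha> (p - int t) w) =
        (\<Sum>s<S'. ps (of_int (p - int t) gchoose s) (Ymode (V.h \<alpha> (int s) v) (p - int t + q - int s) w))"
      by (rule Ymode_commutator_sum) (rule S')
    then show ?thesis
      by (simp only: f P.scale_sum_right)
  qed
  also have "\<dots> = (\<Sum>s\<in>{t..<S' + t}. ?f s)"
    by (rule sum.reindex_bij_witness[of _ "\<lambda>s. s - t" "\<lambda>s. s + t"]) auto
  also have "\<dots> = (\<Sum>s<S' + t. ?f s)"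
    by (rule sum.mono_neutral_left) (auto simp: z Ymode_0)
  also have "\<dots> = (\<Sum>s<S. ?f s)"
  proof (rule sum_lessThan_eq)
    fix s assume s: "s \<ge> S' + t"
    then have i: "int s - int t = int (s - t)" "s - t \<ge> S'" by auto
    have "V.dmode \<alpha> t (int s) v = 0"
      unfolding V.dmode_def i(1) S'[OF i(2)] by simp
    then show "?f s = 0" by (simp add: Ymode_0)
  next
    fix s assume "s \<ge> S"
    from S[OF this] show "?f s = 0" by (simp add: Ymode_0)
  qed
  finally show ?thesis .
qed

text \<open>On e^\<gamma> the factor E^+ is trivial for reasons of weight and z^\<beta> acts as 1,
  so only E^- remains.\<close>

lemma V_exp_mode_eV: "V.exp_mode \<beta> q (eV \<gamma>) = V.Em \<beta> (- q - 1) (eV (\<beta> + \<gamma>))"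
proof -
  have "weight_le 0 (eV \<gamma>)" by (auto simp: weight_le_def weight_def lookup_single when_def)
  then have "V.exp_mode \<beta> q (eV \<gamma>) = (\<Sum>b<1. V.Em \<beta> (- q - 1 - V.xi \<beta> + int b) (V.Ep \<beta> (- int b) (V.T \<beta> (eV \<gamma>))))"
    unfolding V.exp_mode_def by (rule V.exp_coeff_nat) simp
  also have "\<dots> = V.Em \<beta> (- q - 1) (V.Ep \<beta> (- int 0) (V.T \<beta> (eV \<gamma>)))"
    by (simp add: V.xi_def)
  also have "\<dots> = V.Em \<beta> (- q - 1) (V.T \<beta> (eV \<gamma>))"
    by (simp only: V.P.exp_seq_0[OF V.Ep_exp_seq])
  finally show ?thesis by (simp add: V.T_single mult_single)
qed

text \<open>
  Both sides satisfy the same recursion in \<open>m\<close>, the left one by \<open>exp_seq_rec\<close>.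
\<close>

lemma Ymode_Em: "Ymode (V.Em \<beta> (int m) (eV (\<beta> + \<gamma>))) = exp_deriv_product \<beta> \<gamma> m"
proof (induction m rule: less_induct)
  case (less m)
  show ?case
  proof (cases "m = 0")
    case True
    have "Ymode (V.Em \<beta> (int 0) (eV (\<beta> + \<gamma>))) = exp_deriv_product \<beta> \<gamma> 0"
      by (simp only: V.P.exp_seq_0[OF V.Em_exp_seq]) (intro ext, simp add: exp_deriv_product_0 Ymode_eV)
    with True show ?thesis by simp
  next
    case False
    show ?thesis
    proof (intro ext)
      fix q w
      have "ps (of_nat m) (Ymode (V.Em \<beta> (int m) (eV (\<beta> + \<gamma>))) q w) =
         Ymode (\<Sum>r=1..m. V.h (emb_C \<beta>) (- int r) (V.Em \<beta> (int (m - r)) (eV (\<beta> + \<gamma>)))) q w"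
        by (simp only: V.P.exp_seq_rec[OF V.Em_exp_seq, symmetric] Ymode_scale)
      also have "\<dots> = (\<Sum>r=1..m. nprod (dmode (emb_C \<beta>) (r - 1)) (exp_deriv_product \<beta> \<gamma> (m - r)) q w)"
        unfolding additive.sum[OF Ymode_additive]
      proof (rule sum.cong[OF refl])
        fix r assume r: "r \<in> {1..m}"
        then have "- int r = - 1 - int (r - 1)" by (auto simp: of_nat_diff)
        moreover have "m - r < m" using r by auto
        ultimately show "Ymode (V.h (emb_C \<beta>) (- int r) (V.Em \<beta> (int (m - r)) (eV (\<beta> + \<gamma>)))) q w =
            nprod (dmode (emb_C \<beta>) (r - 1)) (exp_deriv_product \<beta> \<gamma> (m - r)) q w"
          by (simp only: Ymode_h less.IH)
      qed
      also have "\<dots> = ps (of_nat m) (exp_deriv_product \<beta> \<gamma> m q w)"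
        using False by (simp only: exp_deriv_product_rec neq0_conv)
      finally have eq: "ps (of_nat m) (Ymode (V.Em \<beta> (int m) (eV (\<beta> + \<gamma>))) q w) = ps (of_nat m) (exp_deriv_product \<beta> \<gamma> m q w)" .
      show "Ymode (V.Em \<beta> (int m) (eV (\<beta> + \<gamma>))) q w = exp_deriv_product \<beta> \<gamma> m q w"
        by (rule P.scale_of_nat_cancel[OF _ eq]) (use False in simp)
    qed
  qed
qed

definition borcherds_id :: "'n VV \<Rightarrow> 'n VV \<Rightarrow> bool" where
  "borcherds_id u v \<longleftrightarrow> (\<forall>p n q w. borcherds ps (Ymode u) (Ymode v) p n q w =
     (\<Sum>i::nat. ps (of_int p gchoose i) (Ymode (V.Ymode u (n + int i) v) (p + q - int i) w)))"

lemma borcherds_id_fin: "finite {i::nat. ps (c i) (Ymode (V.Ymode u (n + int i) v) (f i) w) \<noteq> 0}"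
proof -
  obtain N where N: "\<And>i. i \<ge> N \<Longrightarrow> V.Ymode u (n + int i) v = 0"
    using truncated_ev[OF fieldop_truncated[OF V.Ymode_fieldop[of u]], of n v] by (auto simp: eventually_sequentially)
  have "{i::nat. ps (c i) (Ymode (V.Ymode u (n + int i) v) (f i) w) \<noteq> 0} \<subseteq> {..<N}"
  proof (rule subsetI, rule ccontr)
    fix i assume i: "i \<in> {i. ps (c i) (Ymode (V.Ymode u (n + int i) v) (f i) w) \<noteq> 0}" "i \<notin> {..<N}"
    then have "V.Ymode u (n + int i) v = 0" by (intro N) simp
    with i show False by (simp add: Ymode_0)
  qed
  then show ?thesis by (rule finite_subset) simp
qed

lemma borcherds_id_zero: "borcherds_id 0 v" "borcherds_id u 0"
proof -
  have "Ymode 0 = (\<lambda>n w. 0)" by (intro ext Ymode_0)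
  then show "borcherds_id 0 v" "borcherds_id u 0"
    by (simp_all add: borcherds_id_def P.borcherds_zero_left[OF Ymode_fieldop] P.borcherds_zero_right[OF Ymode_fieldop] V.Ymode_0 Ymode_0 V.Ymode_simps)
qed

lemma borcherds_id_add_left: "borcherds_id u v \<Longrightarrow> borcherds_id u' v \<Longrightarrow> borcherds_id (u + u') v"
  unfolding borcherds_id_def P.borcherds_add_left[OF Ymode_fieldop Ymode_fieldop Ymode_fieldop Ymode_add] V.Ymode_add Ymode_add P.scale_right_distrib
  by (simp add: Sum_any.distrib[OF borcherds_id_fin borcherds_id_fin])

lemma borcherds_id_add_right: "borcherds_id u v \<Longrightarrow> borcherds_id u v' \<Longrightarrow> borcherds_id u (v + v')"
  unfolding borcherds_id_def P.borcherds_skew[OF Ymode_fieldop Ymode_fieldop, of u "v + v'"]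
    P.borcherds_add_left[OF Ymode_fieldop Ymode_fieldop Ymode_fieldop Ymode_add] V.Ymode_simps Ymode_add P.scale_right_distrib
    P.borcherds_skew[OF Ymode_fieldop Ymode_fieldop, of u, symmetric]
  by (simp add: Sum_any.distrib[OF borcherds_id_fin borcherds_id_fin])

lemma borcherds_id_sum_scale: "ps a (Sum_any (\<lambda>i::nat. ps (c i) (Ymode (V.Ymode u (n + int i) v) (f i) w))) =
    Sum_any (\<lambda>i::nat. ps (c i) (ps a (Ymode (V.Ymode u (n + int i) v) (f i) w)))"
  by (subst additive_Sum_any[OF _ borcherds_id_fin]) (simp_all add: additive.intro P.scale_right_distrib mult.commute)

lemma borcherds_id_scale_left: "borcherds_id u v \<Longrightarrow> borcherds_id (V_scale a u) v"
proof -
  assume J: "borcherds_id u v"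
  have e: "Ymode (V_scale a u) = (\<lambda>n w. ps a (Ymode u n w))" by (intro ext Ymode_scale)
  show ?thesis
    using J unfolding borcherds_id_def e P.borcherds_scale_left[OF Ymode_fieldop Ymode_fieldop] V.Ymode_scale Ymode_scale
    by (simp only: borcherds_id_sum_scale) simp
qed

lemma borcherds_id_scale_right: "borcherds_id u v \<Longrightarrow> borcherds_id u (V_scale a v)"
proof -
  assume J: "borcherds_id u v"
  have e: "Ymode (V_scale a v) = (\<lambda>n w. ps a (Ymode v n w))" by (intro ext Ymode_scale)
  have "borcherds ps (Ymode u) (Ymode (V_scale a v)) p n q w = ps a (borcherds ps (Ymode u) (Ymode v) p n q w)" for p n q w
    unfolding P.borcherds_skew[OF Ymode_fieldop Ymode_fieldop, of u] unfolding e P.borcherds_scale_left[OF Ymode_fieldop Ymode_fieldop]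
    by (simp add: mult.commute)
  then show ?thesis
    using J unfolding borcherds_id_def V.Ymode_simps Ymode_scale
    by (simp only: borcherds_id_sum_scale) simp
qed

text \<open>For n \<ge> 0 the left side is 0 since the fields commute, the right side since E^- has
  no negative powers. For n = -1 - m both sides are the same weighted product.\<close>

lemma borcherds_id_eV_eV: "borcherds_id (eV \<beta>) (eV \<gamma>)"
  unfolding borcherds_id_def Ymode_eV V.Ymode_eV V_exp_mode_eV
proof (intro allI)
  fix p n q w
  show "borcherds ps (exp_mode \<beta>) (exp_mode \<gamma>) p n q w =
    (\<Sum>i::nat. ps (of_int p gchoose i) (Ymode (V.Em \<beta> (- (n + int i) - 1) (eV (\<beta> + \<gamma>))) (p + q - int i) w))"
  proof (cases "n \<ge> 0")
    case True
    then have "V.Em \<beta> (- (n + int i) - 1) (eV (\<beta> + \<gamma>)) = 0" for i by (intro V.Em_neg) simp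
    then show ?thesis by (simp add: borcherds_exp_mode_exp_mode_pos[OF True] Ymode_0)
  next
    case False
    define m where "m = nat (- 1 - n)"
    have n: "n = - 1 - int m" using False by (simp add: m_def)
    have "(\<Sum>i::nat. ps (of_int p gchoose i) (Ymode (V.Em \<beta> (- (n + int i) - 1) (eV (\<beta> + \<gamma>))) (p + q - int i) w)) =
       (\<Sum>i<Suc m. ps (of_int p gchoose i) (Ymode (V.Em \<beta> (- (n + int i) - 1) (eV (\<beta> + \<gamma>))) (p + q - int i) w))"
      by (rule Sum_any_lessThan) (simp add: n V.Em_neg Ymode_0)
    \<comment> \<open>The total exponent does not depend on i, so the sum over i affects the weights
      alone, and Vandermonde turns them into binom(p + l, m).\<close>
    also have "\<dots> = (\<Sum>i\<le>m. ps (of_int p gchoose i) (exp_product \<beta> \<gamma> (\<lambda>l. of_int l gchoose (m - i)) (int m - p - q - 1) w))"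
    proof (rule sum.cong)
      fix i assume "i \<in> {..m}"
      then have i: "- (n + int i) - 1 = int (m - i)" "int (m - i) - 1 - (p + q - int i) = int m - p - q - 1"
        by (auto simp: n of_nat_diff)
      show "ps (of_int p gchoose i) (Ymode (V.Em \<beta> (- (n + int i) - 1) (eV (\<beta> + \<gamma>))) (p + q - int i) w) =
        ps (of_int p gchoose i) (exp_product \<beta> \<gamma> (\<lambda>l. of_int l gchoose (m - i)) (int m - p - q - 1) w)"
        unfolding i Ymode_Em exp_deriv_product_def ..
    qed auto
    also have "\<dots> = exp_product \<beta> \<gamma> (\<lambda>l. of_int (p + l) gchoose m) (int m - p - q - 1) w"
      by (simp only: exp_product_coeff_sum[OF finite_atMost, symmetric] gchoose_Vandermonde)
    finally show ?thesis unfolding n borcherds_exp_mode_exp_mode_neg ..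
  qed
qed

text \<open>With an exponential as first argument, the commutator of a Heisenberg field with it is a
  multiple of the same field, as \<open>borcherds_nprod_right_eq\<close> demands.\<close>

lemma borcherds_id_eV: "borcherds_id (eV \<beta>) v"
proof (induction v rule: V_induct)
  case (step b t v)
  have comm: "dmode (hbasis b) t p (exp_mode \<beta> q w) - exp_mode \<beta> q (dmode (hbasis b) t p w) =
     ps ((of_int p gchoose t) * (- 1) ^ t * form k (hbasis b) (emb_C \<beta>)) (exp_mode \<beta> (p + q - int t) w)" for p q w
  proof -
    have i: "p - int t + q = p + q - int t" by simp
    have "dmode (hbasis b) t p (exp_mode \<beta> q w) - exp_mode \<beta> q (dmode (hbasis b) t p w) =
       ps ((- 1) ^ t * (of_int p gchoose t)) (h (hbasis b) (p - int t) (exp_mode \<beta> q w) - exp_mode \<beta> q (h (hbasis b) (p - int t) w))"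
      by (simp add: dmode_def lin_simps[OF fieldop_lin[OF exp_mode_fieldop]] P.scale_right_diff_distrib)
    then show ?thesis
      unfolding exp_mode_commutator i by (simp add: mult_ac)
  qed
  have commV: "Ymode (V.exp_mode \<beta> m (V.h (hbasis b) (- 1 - int t) v)) q w = Ymode (V.h (hbasis b) (- 1 - int t) (V.exp_mode \<beta> m v)) q w
      - ps (form k (hbasis b) (emb_C \<beta>)) (Ymode (V.exp_mode \<beta> (m - 1 - int t) v) q w)" for m q w
  proof -
    have i: "- 1 - int t + m = m - 1 - int t" by simp
    have "V.h (hbasis b) (- 1 - int t) (V.exp_mode \<beta> m v) = V.exp_mode \<beta> m (V.h (hbasis b) (- 1 - int t) v)
       + V_scale (form k (hbasis b) (emb_C \<beta>)) (V.exp_mode \<beta> (m - 1 - int t) v)"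
      using V.exp_mode_commutator[of "hbasis b" "- 1 - int t" \<beta> m v] unfolding i by (simp add: diff_eq_eq add.commute)
    then show ?thesis by (simp only: Ymode_add Ymode_scale add_diff_cancel_right')
  qed
  show ?case
    unfolding borcherds_id_def Ymode_eV V.Ymode_eV
    by (intro allI P.borcherds_nprod_right_eq[where Y = Ymode and AV = "V.h (hbasis b) (- 1 - int t)" and bV = "V.exp_mode \<beta>",
          OF dmode_fieldop exp_mode_fieldop Ymode_fieldop Ymode_additive fieldop_truncated[OF V.exp_mode_fieldop] comm Ymode_h commV])
       (use step in \<open>simp only: borcherds_id_def Ymode_eV V.Ymode_eV\<close>)
qed (auto intro: borcherds_id_zero borcherds_id_eV_eV borcherds_id_scale_right borcherds_id_add_right)

text \<open>v is kept arbitrary because the step for the first argument invokes the identity for u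
  against every state that annihilation modes produce from v.\<close>

lemma borcherds_id_all: "borcherds_id u v"
proof (induction u arbitrary: v rule: V_induct)
  case (step b t u)
  have e1: "Ymode (V.h (hbasis b) (- 1 - int t) u) = nprod (dmode (hbasis b) t) (Ymode u)"
    by (intro ext Ymode_h)
  have e2: "V.Ymode (V.h (hbasis b) (- 1 - int t) u) = nprod (V.dmode (hbasis b) t) (V.Ymode u)"
    by (intro ext V.Ymode_h)
  show ?case
    unfolding borcherds_id_def e1 e2
    by (intro allI P.borcherds_nprod_eq[where Y = Ymode and AV = "V.dmode (hbasis b) t" and uV = "V.Ymode u",
          OF dmode_fieldop Ymode_fieldop Ymode_fieldop Ymode_additive fieldop_truncated[OF V.dmode_fieldop] lin_additive[OF fieldop_lin[OF V.dmode_fieldop]]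
            fieldop_truncated[OF V.Ymode_fieldop] lin_additive[OF fieldop_lin[OF V.Ymode_fieldop]] Ymode_dmode_commutator Ymode_dmode])
       (use step in \<open>simp_all only: borcherds_id_def\<close>)
qed (auto intro: borcherds_id_zero borcherds_id_eV borcherds_id_scale_left borcherds_id_add_left)

end

section \<open>The module structure and irreducibility\<close>

lemma linearI':
  assumes "vector_space s1" "vector_space s2" "\<And>x y. f (x + y) = f x + f y" "\<And>c x. f (s1 c x) = s2 c (f x)"
  shows "Vector_Spaces.linear s1 s2 f"
proof -
  interpret v1: vector_space s1 by fact
  interpret v2: vector_space s2 by fact
  show ?thesis
    by unfold_locales (auto simp: assms)
qed

context fock_data
begin

interpretation V: fock_data L_scale k "V_zero_mode k" "\<lambda>\<beta> f. Poly_Mapping.single \<beta> 1 * f" "\<lambda>\<beta>. 0"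
  by (rule V_fock_data)

abbreviation YN where "YN \<equiv> Y_gen k s Z E x"

lemma YN_eq: "YN v m w = Ymode v (- m - 1) w"
  by (simp add: Ymode_def)

lemma Y_V_eq: "Y_V k v m u = V.Ymode v (- m - 1) u"
  by (simp add: V.Ymode_def Y_V_def)

lemma h_zero: "h 0 n f = 0"
  by (subst h_expand) simp

lemma emb_C_0: "emb_C 0 = 0"
  by (simp add: emb_C_def vec_eq_iff split: sum.split)

lemma Em_0: "Em 0 n w = (if n = 0 then w else 0)"
proof (cases "n < 0")
  case False
  then have n: "n = int (nat n)" by simp
  have "ps (of_nat (nat n)) (Em 0 (int (nat n)) w) = 0"
    by (subst P.exp_seq_rec[OF Em_exp_seq]) (simp add: emb_C_0 h_zero)
  then show ?thesis using n P.exp_seq_0[OF Em_exp_seq[of 0], of w] by auto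
qed (simp add: Em_neg)

lemma exp_mode_0: "exp_mode 0 q w = (if q = - 1 then w else 0)"
proof -
  obtain d :: nat where w: "weight_le (int d) w" using weight_le_exists_nat by blast
  have T: "T 0 w = w"
    by (rule additive_eqI[of "T 0" "\<lambda>w. w"]) (auto intro!: additive.intro simp: T_simps T_single E_0)
  have xi: "xi 0 = 0" by (simp add: xi_def x_0)
  have Ep: "Ep 0 (- int b) w = (if b = 0 then w else 0)" for b
  proof -
    have "ps (of_nat b) (Ep 0 (- int b) w) = 0"
      by (subst P.exp_seq_rec[OF Ep_exp_seq]) (simp add: emb_C_0 h_zero)
    then show ?thesis using P.exp_seq_0[OF Ep_exp_seq[of 0], of w] by auto
  qed
  have "exp_mode 0 q w = (\<Sum>b<Suc d. if b = 0 then Em 0 (- q - 1) w else 0)"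
    unfolding exp_mode_def
    by (subst exp_coeff_nat[OF w, of "Suc d"], simp) (intro sum.cong refl, simp add: T xi Ep Em_simps)
  also have "\<dots> = Em 0 (- q - 1) w"
    by (subst sum.delta) auto
  finally show ?thesis by (auto simp: Em_0)
qed

lemma YN_vac: "YN V_vac = fone"
  by (intro ext) (simp only: YN_eq V_vac_def Ymode_eV exp_mode_0 fone_def, simp)

text \<open>
  Coefficient extraction: each delta function restricts the double sum to one diagonal, on which it
  becomes a sum over \<open>nat\<close>.
\<close>

lemma borcherds_id_jacobi: "jacobi (Y_V k) ps YN"
  unfolding jacobi_def
proof (intro allI)
  fix u v w and a b c :: int
  \<comment> \<open>Mode numbers belonging to z_1, z_0 and z_2, in this order.\<close>
  define p n q where "p = - b - 1" and "n = - a - 1" and "q = - c - 1"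
  note l = Ymode_simps
  obtain N where N: "\<And>j. j \<ge> N \<Longrightarrow> Ymode u (p + int j) w = 0 \<and> Ymode v (q + int j) w = 0"
    using eventually_happens[OF P.borcherds_ev[OF Ymode_fieldop[of u] Ymode_fieldop[of v], of p w q]] by auto
  have 1: "Sum_any (\<lambda>(i, j). ps (delta1 a (b - i) (c - j)) (YN u i (YN v j w))) =
     (\<Sum>j::nat. ps (sbinom n j) (Ymode u (p + n - int j) (Ymode v (q + int j) w)))"
  proof (subst Sum_any_inj_reindex[of "\<lambda>j. (b - n + int j, c - int j)"])
    show "inj (\<lambda>j. (b - n + int j, c - int j))" by (auto intro: injI)
    fix y :: "int \<times> int" assume y: "y \<notin> range (\<lambda>j. (b - n + int j, c - int j))"
    obtain i j where ij: "y = (i, j)" by (cases y)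
    have "\<not> (c - j \<ge> 0 \<and> b - i + (c - j) = n)"
    proof
      assume "c - j \<ge> 0 \<and> b - i + (c - j) = n"
      then have "y = (b - n + int (nat (c - j)), c - int (nat (c - j)))" by (auto simp: ij)
      with y show False by blast
    qed
    then have "binom_coeff (- a - 1) (b - i) (c - j) = 0"
      unfolding binom_coeff_def n_def by (rule if_not_P)
    then show "(case y of (i, j) \<Rightarrow> ps (delta1 a (b - i) (c - j)) (YN u i (YN v j w))) = 0"
      by (simp add: ij delta1_def)
  next
    have "delta1 a (b - (b - n + int j)) (c - (c - int j)) = sbinom n j" for j
      by (simp add: delta1_def binom_coeff_def n_def sbinom_def)
    moreover have "- (b - n + int j) - 1 = p + n - int j" "- (c - int j) - 1 = q + int j" for j
      by (simp_all add: p_def q_def)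
    ultimately show "Sum_any (\<lambda>j. case (b - n + int j, c - int j) of (i, j) \<Rightarrow> ps (delta1 a (b - i) (c - j)) (YN u i (YN v j w))) =
        (\<Sum>j::nat. ps (sbinom n j) (Ymode u (p + n - int j) (Ymode v (q + int j) w)))"
      by (simp only: prod.case YN_eq)
  qed
  have 2: "Sum_any (\<lambda>(i, j). ps (delta2 a (b - i) (c - j)) (YN v j (YN u i w))) =
     (\<Sum>j::nat. ps (neg1_pow n * sbinom n j) (Ymode v (n + q - int j) (Ymode u (p + int j) w)))"
  proof (subst Sum_any_inj_reindex[of "\<lambda>j. (b - int j, c - n + int j)"])
    show "inj (\<lambda>j. (b - int j, c - n + int j))" by (auto intro: injI)
    fix y :: "int \<times> int" assume y: "y \<notin> range (\<lambda>j. (b - int j, c - n + int j))"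
    obtain i j where ij: "y = (i, j)" by (cases y)
    have "\<not> (b - i \<ge> 0 \<and> c - j + (b - i) = n)"
    proof
      assume "b - i \<ge> 0 \<and> c - j + (b - i) = n"
      then have "y = (b - int (nat (b - i)), c - n + int (nat (b - i)))" by (auto simp: ij)
      with y show False by blast
    qed
    then have "binom_coeff (- a - 1) (c - j) (b - i) = 0"
      unfolding binom_coeff_def n_def by (rule if_not_P)
    then show "(case y of (i, j) \<Rightarrow> ps (delta2 a (b - i) (c - j)) (YN v j (YN u i w))) = 0"
      by (simp add: ij delta2_def)
  next
    have "delta2 a (b - (b - int j)) (c - (c - n + int j)) = neg1_pow n * sbinom n j" for j
      by (simp add: delta2_def binom_coeff_def n_def sbinom_def neg1_pow_def)
    moreover have "- (c - n + int j) - 1 = n + q - int j" "- (b - int j) - 1 = p + int j" for j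
      by (simp_all add: p_def q_def)
    ultimately show "Sum_any (\<lambda>j. case (b - int j, c - n + int j) of (i, j) \<Rightarrow> ps (delta2 a (b - i) (c - j)) (YN v j (YN u i w))) =
        (\<Sum>j::nat. ps (neg1_pow n * sbinom n j) (Ymode v (n + q - int j) (Ymode u (p + int j) w)))"
      by (simp only: prod.case YN_eq)
  qed
  have 3: "Sum_any (\<lambda>(i, j). ps (delta3 (a - i) b (c - j)) (YN (Y_V k u i v) j w)) =
     (\<Sum>i::nat. ps (of_int p gchoose i) (Ymode (V.Ymode u (n + int i) v) (p + q - int i) w))"
  proof (subst Sum_any_inj_reindex[of "\<lambda>i. (a - int i, int i + b + c + 1)"])
    show "inj (\<lambda>i. (a - int i, int i + b + c + 1))" by (auto intro: injI)
    fix y :: "int \<times> int" assume y: "y \<notin> range (\<lambda>i. (a - int i, int i + b + c + 1))"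
    obtain i j where ij: "y = (i, j)" by (cases y)
    have "\<not> (a - i \<ge> 0 \<and> b + (a - i) = - (c - j) - 1)"
    proof
      assume "a - i \<ge> 0 \<and> b + (a - i) = - (c - j) - 1"
      then have "y = (a - int (nat (a - i)), int (nat (a - i)) + b + c + 1)" by (auto simp: ij)
      with y show False by blast
    qed
    then have "binom_coeff (- (c - j) - 1) b (a - i) = 0"
      unfolding binom_coeff_def by (rule if_not_P)
    then show "(case y of (i, j) \<Rightarrow> ps (delta3 (a - i) b (c - j)) (YN (Y_V k u i v) j w)) = 0"
      by (simp add: ij delta3_def)
  next
    \<comment> \<open>(-1)^i binom(b+i, i) = binom(-b-1, i) by upper negation, and p = -b-1.\<close>
    have "delta3 (a - (a - int i)) b (c - (int i + b + c + 1)) = of_int p gchoose i" for i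
    proof -
      have "delta3 (a - (a - int i)) b (c - (int i + b + c + 1)) = (- 1) ^ i * (of_int (int i + b) gchoose i)"
        by (simp add: delta3_def binom_coeff_def)
      also have "(of_int (int i + b) gchoose i :: complex) = (- 1) ^ i * ((of_nat i - of_int (int i + b) - 1) gchoose i)"
        by (rule gbinomial_negated_upper)
      also have "of_nat i - of_int (int i + b) - 1 = (of_int p :: complex)" by (simp add: p_def)
      finally show ?thesis by (simp flip: mult.assoc power_mult_distrib)
    qed
    moreover have "- (a - int i) - 1 = n + int i" "- (int i + b + c + 1) - 1 = p + q - int i" for i
      by (simp_all add: p_def q_def n_def)
    ultimately show "Sum_any (\<lambda>i. case (a - int i, int i + b + c + 1) of (i, j) \<Rightarrow> ps (delta3 (a - i) b (c - j)) (YN (Y_V k u i v) j w)) =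
        (\<Sum>i::nat. ps (of_int p gchoose i) (Ymode (V.Ymode u (n + int i) v) (p + q - int i) w))"
      by (simp only: prod.case YN_eq Y_V_eq)
  qed
  have "(\<Sum>j::nat. ps (sbinom n j) (Ymode u (p + n - int j) (Ymode v (q + int j) w))) -
      (\<Sum>j::nat. ps (neg1_pow n * sbinom n j) (Ymode v (n + q - int j) (Ymode u (p + int j) w))) =
      (\<Sum>j<N. ps (sbinom n j) (Ymode u (p + n - int j) (Ymode v (q + int j) w))) -
      (\<Sum>j<N. ps (neg1_pow n * sbinom n j) (Ymode v (n + q - int j) (Ymode u (p + int j) w)))"
    by (intro arg_cong2[of _ _ _ _ "(-)"] Sum_any_lessThan) (simp_all add: N l)
  also have "\<dots> = borcherds ps (Ymode u) (Ymode v) p n q w"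
    unfolding borcherds_def sum_subtractf[symmetric] by (rule Sum_any_lessThan[symmetric]) (simp add: N l)
  also have "\<dots> = (\<Sum>i::nat. ps (of_int p gchoose i) (Ymode (V.Ymode u (n + int i) v) (p + q - int i) w))"
    using borcherds_id_all unfolding borcherds_id_def by blast
  finally show "Sum_any (\<lambda>(i, j). ps (delta1 a (b - i) (c - j)) (YN u i (YN v j w))) -
      Sum_any (\<lambda>(i, j). ps (delta2 a (b - i) (c - j)) (YN v j (YN u i w))) =
      Sum_any (\<lambda>(i, j). ps (delta3 (a - i) b (c - j)) (YN (Y_V k u i v) j w))"
    unfolding 1 2 3 .
qed

lemma vertex_module_YN: "vertex_module V_scale (Y_V k) V_vac ps YN"
  unfolding vertex_module_def
proof (intro conjI allI)
  show "vector_space ps" by (rule P.vector_space_axioms)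
  show "Vector_Spaces.linear ps ps (YN u m)" for u m
    by (rule linearI'[OF P.vector_space_axioms P.vector_space_axioms]) (simp_all add: YN_eq Ymode_simps)
  show "Vector_Spaces.linear V_scale ps (\<lambda>u. YN u m w)" for m w
    by (rule linearI'[OF V.P.vector_space_axioms P.vector_space_axioms]) (simp_all add: YN_eq Ymode_add Ymode_scale)
  show "\<exists>n0. \<forall>n\<ge>n0. YN u (- n - 1) w = 0" for u w
    using fieldop_truncated[OF Ymode_fieldop[of u]] by (auto simp: truncated_def YN_eq)
qed (rule YN_vac borcherds_id_jacobi)+

section \<open>Submodules and irreducibility\<close>

lemma nprod_id:
  assumes id: "\<And>q w. I q w = (if q = - 1 then w else 0)"
  shows "nprod (h \<alpha>) I n w = h \<alpha> n w"
proof -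
  have "nprod (h \<alpha>) I n w = (\<Sum>i::nat. if i = (if n \<ge> 0 then nat n else nat (- 1 - n)) then h \<alpha> n w else 0)"
    unfolding nprod_def
  proof (rule Sum_any.cong)
    fix i
    have "n + int i = - 1 \<longleftrightarrow> n < 0 \<and> i = nat (- 1 - n)" "n - 1 - int i = - 1 \<longleftrightarrow> n \<ge> 0 \<and> i = nat n" by auto
    then show "h \<alpha> (- 1 - int i) (I (n + int i) w) + I (n - 1 - int i) (h \<alpha> (int i) w) =
        (if i = (if n \<ge> 0 then nat n else nat (- 1 - n)) then h \<alpha> n w else 0)"
      unfolding id by (cases "n \<ge> 0") (auto simp: h_simps)
  qed
  then show ?thesis by simp
qed

text \<open>Heisenberg modes are modes of the state \<alpha>(-1) 1, so vertex submodules are stable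
  under them.\<close>

lemma h_from_Ymode: "h \<alpha> n w = Ymode (V.h \<alpha> (- 1) (eV 0)) n w"
proof -
  have id: "Ymode (eV 0) q w = (if q = - 1 then w else 0)" for q w by (simp only: Ymode_eV exp_mode_0)
  have d: "dmode \<alpha> 0 = h \<alpha>" by (intro ext) (simp add: dmode_def)
  have i: "- 1 - int 0 = - 1" by simp
  have "Ymode (V.h \<alpha> (- 1) (eV 0)) n w = nprod (h \<alpha>) (Ymode (eV 0)) n w"
    using Ymode_h[of \<alpha> 0 "eV 0" n w] unfolding i d .
  then show ?thesis by (simp only: nprod_id[OF id])
qed

lemma exp_coeff_from_Ymode: "exp_coeff \<beta> m w = Ymode (eV \<beta>) (- m - 1) w"
  by (simp add: Ymode_eV exp_mode_def)

lemma subspace_Sum_any: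
  assumes "P.subspace U" "\<And>i. f i \<in> U"
  shows "Sum_any f \<in> U"
  unfolding Sum_any.expand_set using assms by (auto intro: P.subspace_sum)

text \<open>U is M(1) \<otimes> U0. Each operator entering the vertex operators acts on coefficients
  by \<open>Z\<close>, \<open>E\<close>, scalars and finite sums, all of which preserve U0.\<close>

lemma Ymode_closed:
  assumes U0: "subspace U0" and Zc: "\<And>\<alpha> w. w \<in> U0 \<Longrightarrow> Z \<alpha> w \<in> U0" and Ec: "\<And>\<beta> w. w \<in> U0 \<Longrightarrow> E \<beta> w \<in> U0"
  defines "U \<equiv> {f. \<forall>M. Poly_Mapping.lookup f M \<in> U0}"
  shows "P.subspace U" and "w \<in> U \<Longrightarrow> Ymode v q w \<in> U"
proof -
  show sU: "P.subspace U"
    unfolding U_def by (rule P.subspaceI) (auto simp: lookup_add subspace_0[OF U0] subspace_add[OF U0] subspace_scale[OF U0])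
  have single: "Poly_Mapping.single M w \<in> U" if "w \<in> U0" for M w
    using that by (auto simp: U_def lookup_single when_def subspace_0[OF U0])
  have crU: "create v f \<in> U" if "f \<in> U" for v f
    unfolding create_def pm_extend_def using that by (intro P.subspace_sum[OF sU] single) (auto simp: U_def)
  have anU: "annih v f \<in> U" if "f \<in> U" for v f
    unfolding annih_def pm_extend_def using that
    by (intro P.subspace_sum[OF sU] single subspace_scale[OF U0]) (auto simp: U_def)
  have hU: "h \<alpha> n f \<in> U" if "f \<in> U" for \<alpha> n f
  proof -
    consider "n < 0" | "n = 0" | "n > 0" by linarith
    then show ?thesis
    proof cases
      case 1
      then show ?thesis unfolding h_neg[OF 1]
        by (intro P.subspace_sum[OF sU] P.subspace_scale[OF sU] crU that)
    next
      case 2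
      then show ?thesis using that Zc
        by (simp add: U_def mode_def tens_right_def lookup_map_0 lin_simps[OF Z_lin])
    next
      case 3
      then show ?thesis unfolding h_pos[OF 3]
        by (intro P.subspace_sum[OF sU] P.subspace_scale[OF sU] anU that)
    qed
  qed
  have TU: "T \<beta> f \<in> U" if "f \<in> U" for \<beta> f
    using that Ec by (simp add: U_def T_def tens_right_def lookup_map_0 lin_simps[OF E_lin])
  have EmU: "Em \<beta> n f \<in> U" if "f \<in> U" for \<beta> n f
  proof (cases "n < 0")
    case True
    then show ?thesis by (simp add: Em_neg P.subspace_0[OF sU])
  next
    case False
    have "Em \<beta> (int (nat n)) f \<in> U"
      by (rule P.exp_seq_closed[OF Em_exp_seq sU]) (auto intro: hU that)
    with False show ?thesis by simp
  qed
  have EpU: "Ep \<beta> n f \<in> U" if "f \<in> U" for \<beta> n f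
  proof (cases "n > 0")
    case True
    then show ?thesis by (simp add: Ep_pos P.subspace_0[OF sU])
  next
    case False
    have "Ep \<beta> (- int (nat (- n))) f \<in> U"
      by (rule P.exp_seq_closed[OF Ep_exp_seq sU]) (auto intro: P.subspace_neg[OF sU] hU that)
    with False show ?thesis by simp
  qed
  have ebU: "exp_mode \<beta> n f \<in> U" if "f \<in> U" for \<beta> n f
    unfolding exp_mode_def exp_coeff_eq by (intro subspace_Sum_any[OF sU] EmU EpU TU that)
  show "Ymode v q w \<in> U" if "w \<in> U" for w
    using that
  proof (induction v arbitrary: q w rule: V_induct)
    case (base \<beta>)
    then show ?case by (simp add: Ymode_eV ebU)
  next
    case (step b t v)
    have dU: "dmode (hbasis b) t n f \<in> U" if "f \<in> U" for n f
      unfolding dmode_def by (intro P.subspace_scale[OF sU] hU that)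
    show ?case
      unfolding Ymode_h_basis nprod_def
      by (intro subspace_Sum_any[OF sU] P.subspace_add[OF sU] dU step)
  qed (auto simp: Ymode_0 Ymode_scale Ymode_add P.subspace_0[OF sU] intro: P.subspace_scale[OF sU] P.subspace_add[OF sU])
qed

text \<open>At the exponent \<open>xi \<beta>\<close> both exponentials contribute their constant
  term 1 on 1 \<otimes> w, so the action of \<open>E \<beta>\<close> is recovered from a vertex
  operator.\<close>

lemma exp_coeff_vac: "exp_coeff \<beta> (xi \<beta>) (Poly_Mapping.single {#} w) = Poly_Mapping.single {#} (E \<beta> w)"
proof -
  have "weight_le 0 (Poly_Mapping.single {#} w :: ('n, 'w) fock)" by (auto simp: weight_le_def weight_def lookup_single when_def)
  then have "exp_coeff \<beta> (xi \<beta>) (Poly_Mapping.single {#} w) =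
      (\<Sum>b<1. Em \<beta> (xi \<beta> - xi \<beta> + int b) (Ep \<beta> (- int b) (T \<beta> (Poly_Mapping.single {#} w))))"
    by (rule exp_coeff_nat) simp
  also have "\<dots> = Em \<beta> (int 0) (Ep \<beta> (- int 0) (T \<beta> (Poly_Mapping.single {#} w)))" by simp
  finally show ?thesis
    by (simp only: P.exp_seq_0[OF Ep_exp_seq] P.exp_seq_0[OF Em_exp_seq] T_single)
qed

lemma annih_from_h:
  assumes "k \<noteq> 0"
  shows "\<exists>\<alpha> c n. \<forall>f. annih (b, j) f = ps c (h \<alpha> n f)"
proof -
  \<comment> \<open>The form pairs c_i with d_i only, so the partner b' of b isolates a single
    derivative, up to the factor (j+1) k.\<close>
  define b' where "b' = (case b of Inl i \<Rightarrow> Inr i | Inr i \<Rightarrow> Inl i)"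
  have f: "form k (hbasis b') (hbasis c) = (if c = b then of_int k else 0)" for c
    by (cases b; cases c) (auto simp: b'_def form_basis form_commute[of k "hbasis (Inr _)" "hbasis (Inl _)"])
  have n: "int (Suc j) > 0" and i: "nat (int (Suc j)) - 1 = j" by simp_all
  have "h (hbasis b') (int (Suc j)) g = ps (of_int (int (Suc j)) * of_int k) (annih (b, j) g)" for g
  proof -
    have "h (hbasis b') (int (Suc j)) g = (\<Sum>c\<in>UNIV. if c = b then ps (of_int (int (Suc j)) * of_int k) (annih (b, j) g) else 0)"
      unfolding h_pos[OF n] i f by (intro sum.cong refl) auto
    then show ?thesis by simp
  qed
  then have "annih (b, j) g = ps (1 / (of_int (int (Suc j)) * of_int k)) (h (hbasis b') (int (Suc j)) g)" for g
    using assms by (simp del: of_nat_Suc)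
  then show ?thesis by blast
qed

lemma exists_vacuum_vector:
  assumes k: "k \<noteq> 0" and U: "P.subspace U" and hU: "\<And>\<alpha> n f. f \<in> U \<Longrightarrow> h \<alpha> n f \<in> U"
    and f: "f \<in> U" "f \<noteq> 0"
  shows "\<exists>w. w \<noteq> 0 \<and> Poly_Mapping.single {#} w \<in> U"
proof -
  obtain d :: nat where "weight_le (int d) f" using weight_le_exists_nat by blast
  with f show ?thesis
  proof (induction d arbitrary: f rule: less_induct)
    case (less d)
    show ?case
    proof (cases "\<exists>M. M \<noteq> {#} \<and> Poly_Mapping.lookup f M \<noteq> 0")
      case True
      then obtain M where M: "M \<noteq> {#}" "Poly_Mapping.lookup f M \<noteq> 0" by blast
      then obtain v M' where v: "M = add_mset v M'" by (meson multiset_cases)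
      obtain b j where bj: "v = (b, j)" by (cases v)
      \<comment> \<open>Differentiating by a variable of an occurring monomial keeps f nonzero and
        lowers the weight bound, which drives the induction.\<close>
      have "Poly_Mapping.lookup (annih v f) M' \<noteq> 0"
        using M(2) by (simp add: lookup_annih v del: of_nat_Suc)
      then have nz: "annih v f \<noteq> 0" by auto
      obtain \<alpha> c n where "\<And>f. annih v f = ps c (h \<alpha> n f)" using annih_from_h[OF k] unfolding bj by blast
      then have U': "annih v f \<in> U" using P.subspace_scale[OF U] hU less.prems(1) by simp
      have w: "weight_le (int d - int (Suc (snd v))) (annih v f)" by (rule weight_le_annih[OF less.prems(3)])
      then have "\<not> int d - int (Suc (snd v)) < 0" using weight_le_neg_0 nz by blast
      then have "int d - int (Suc (snd v)) = int (d - Suc (snd v))" "d - Suc (snd v) < d" by auto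
      with w less.IH[OF _ U' nz] show ?thesis by metis
    next
      case False
      have "f = Poly_Mapping.single {#} (Poly_Mapping.lookup f {#})"
        using False by (intro poly_mapping_eqI) (auto simp: lookup_single when_def)
      with less.prems show ?thesis by (metis single_zero)
    qed
  qed
qed

text \<open>Phrased through \<open>Z\<close> and \<open>E\<close>, since the locale does not know
  the algebra A; \<open>A_submodule_iff\<close> translates the condition.\<close>

lemma irreducible_iff:
  assumes k: "k \<noteq> 0"
  shows "vertex_irreducible ps YN \<longleftrightarrow> (UNIV :: 'w set) \<noteq> {0} \<and>
    (\<forall>U. subspace U \<longrightarrow> (\<forall>\<alpha> w. w \<in> U \<longrightarrow> Z \<alpha> w \<in> U) \<longrightarrow> (\<forall>\<beta> w. w \<in> U \<longrightarrow> E \<beta> w \<in> U) \<longrightarrow> U = {0} \<or> U = UNIV)"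
    (is "_ \<longleftrightarrow> ?R")
proof
  assume irr: "vertex_irreducible ps YN"
  show ?R
  proof (intro conjI allI impI)
    show "(UNIV :: 'w set) \<noteq> {0}"
    proof
      assume "(UNIV :: 'w set) = {0}"
      then have "(y :: 'w) = 0" for y by blast
      then have "f = 0" for f :: "('n, 'w) fock" by (intro poly_mapping_eqI) auto
      then have "(UNIV :: ('n, 'w) fock set) = {0}" by blast
      with irr show False by (simp add: vertex_irreducible_def)
    qed
  next
    fix U0 assume U0: "subspace U0" "\<forall>\<alpha> w. w \<in> U0 \<longrightarrow> Z \<alpha> w \<in> U0" "\<forall>\<beta> w. w \<in> U0 \<longrightarrow> E \<beta> w \<in> U0"
    define U where "U = {f :: ('n, 'w) fock. \<forall>M. Poly_Mapping.lookup f M \<in> U0}"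
    have "vertex_submodule ps YN U"
      unfolding vertex_submodule_def U_def YN_eq
      by (intro conjI allI ballI Ymode_closed[OF U0(1)]) (use U0 in auto)
    with irr have "U = {0} \<or> U = UNIV" by (simp add: vertex_irreducible_def)
    then show "U0 = {0} \<or> U0 = UNIV"
    proof
      assume U: "U = {0}"
      have "w = 0" if "w \<in> U0" for w
      proof -
        have "Poly_Mapping.single {#} w \<in> U"
          using that by (auto simp: U_def lookup_single when_def subspace_0[OF U0(1)])
        then have "Poly_Mapping.lookup (Poly_Mapping.single ({#} :: 'n fvar multiset) w) {#} = 0" by (simp add: U)
        then show ?thesis by simp
      qed
      then show ?thesis using subspace_0[OF U0(1)] by auto
    next
      assume U: "U = UNIV"
      have "w \<in> U0" for w
      proof -
        have "Poly_Mapping.single {#} w \<in> U" by (simp add: U)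
        then have "Poly_Mapping.lookup (Poly_Mapping.single ({#} :: 'n fvar multiset) w) {#} \<in> U0"
          unfolding U_def by blast
        then show ?thesis by simp
      qed
      then show ?thesis by auto
    qed
  qed
next
  assume R: ?R
  show "vertex_irreducible ps YN"
    unfolding vertex_irreducible_def
  proof (intro conjI allI impI)
    show "(UNIV :: ('n, 'w) fock set) \<noteq> {0}"
    proof
      assume e: "(UNIV :: ('n, 'w) fock set) = {0}"
      have "w = 0" for w :: 'w
      proof -
        have "(Poly_Mapping.single {#} w :: ('n, 'w) fock) = 0" using e by blast
        then show ?thesis by (metis lookup_single_eq lookup_zero)
      qed
      with R show False by auto
    qed
  next
    fix U assume "vertex_submodule ps YN U"
    then have U: "P.subspace U" and YU: "\<And>u n w. w \<in> U \<Longrightarrow> Ymode u n w \<in> U"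
      by (auto simp: vertex_submodule_def YN_eq)
    have hU: "h \<alpha> n f \<in> U" if "f \<in> U" for \<alpha> n f
      unfolding h_from_Ymode by (rule YU[OF that])
    have eU: "exp_coeff \<beta> m f \<in> U" if "f \<in> U" for \<beta> m f
      unfolding exp_coeff_from_Ymode by (rule YU[OF that])
    show "U = {0} \<or> U = UNIV"
    proof (cases "U = {0}")
      case False
      then obtain f where "f \<in> U" "f \<noteq> 0" using P.subspace_0[OF U] by blast
      from exists_vacuum_vector[OF k U hU this] obtain w0 where w0: "w0 \<noteq> 0" "Poly_Mapping.single {#} w0 \<in> U" by blast
      \<comment> \<open>The slice of U over the vacuum. It contains w0 and is stable under
        \<open>Z\<close> and \<open>E\<close>, hence is everything; creation modes then fill the
        whole space.\<close>
      define U0 where "U0 = {w. Poly_Mapping.single {#} w \<in> U}"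
      have s: "subspace U0"
        unfolding U0_def
      proof (rule subspaceI)
        show "0 \<in> {w. Poly_Mapping.single {#} w \<in> U}" by (simp add: P.subspace_0[OF U])
        show "x + y \<in> {w. Poly_Mapping.single {#} w \<in> U}" if "x \<in> {w. Poly_Mapping.single {#} w \<in> U}" "y \<in> {w. Poly_Mapping.single {#} w \<in> U}" for x y
          using P.subspace_add[OF U] that by (simp add: single_add)
        show "s c x \<in> {w. Poly_Mapping.single {#} w \<in> U}" if "x \<in> {w. Poly_Mapping.single {#} w \<in> U}" for c x
        proof -
          have "ps c (Poly_Mapping.single {#} x) \<in> U" using P.subspace_scale[OF U] that by blast
          then show ?thesis by simp
        qed
      qed
      have z: "Z \<alpha> w \<in> U0" if "w \<in> U0" for \<alpha> w
        using hU[of "Poly_Mapping.single {#} w" \<alpha> 0] that by (simp add: U0_def h_0_single)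
      have e: "E \<beta> w \<in> U0" if "w \<in> U0" for \<beta> w
        using eU[of "Poly_Mapping.single {#} w" \<beta> "xi \<beta>"] that by (simp add: U0_def exp_coeff_vac)
      have "U0 = {0} \<or> U0 = UNIV" using R s z e by blast
      moreover have "w0 \<in> U0" using w0 by (simp add: U0_def)
      ultimately have U0: "U0 = UNIV" using w0(1) by auto
      have single: "Poly_Mapping.single M w \<in> U" for M w
      proof (induction M)
        case empty
        then show ?case using U0 by (auto simp: U0_def)
      next
        case (add v M)
        obtain b t where v: "v = (b, t)" by (cases v)
        have "create v (Poly_Mapping.single M w) \<in> U"
          unfolding v h_basis_neg[symmetric] by (rule hU[OF add])
        then show ?case by simp
      qed
      have "g \<in> U" for g
        by (induction g rule: pm_induct) (auto intro: single P.subspace_0[OF U] P.subspace_add[OF U])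
      then show ?thesis by auto
    qed simp
  qed
qed

end

section \<open>Modules over \<open>A\<close>\<close>

lemma ring_of_type_algebra_ring: "ring (ring_of_type_algebra :: 'a::ring_1 ring)"
proof -
  have "\<exists>y. x + y = 0" for x :: 'a
    using add.right_inverse by blast
  then show ?thesis
    unfolding ring_of_type_algebra_def using add.right_inverse
    by unfold_locales (auto simp: algebra_simps Units_def)
qed

lemma A_ideal_ideal: "ideal (A_ideal k) ring_of_type_algebra"
  unfolding A_ideal_def
  by (rule ring.genideal_ideal[OF ring_of_type_algebra_ring]) (simp add: ring_of_type_algebra_def)

lemma A_class_hom: "A_class k \<in> ring_hom ring_of_type_algebra (A_alg k)"
  unfolding A_alg_def A_class_def[abs_def] by (rule ideal.rcos_ring_hom[OF A_ideal_ideal])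

lemma A_class_carrier: "A_class k y \<in> carrier (A_alg k)"
  using ring_hom_closed[OF A_class_hom, of y] by (simp add: ring_of_type_algebra_def)

lemma A_class_add: "A_class k (y + z) = A_class k y \<oplus>\<^bsub>A_alg k\<^esub> A_class k z"
  using ring_hom_add[OF A_class_hom, of y z] by (simp add: ring_of_type_algebra_def)

lemma A_class_mult: "A_class k (y * z) = A_class k y \<otimes>\<^bsub>A_alg k\<^esub> A_class k z"
  using ring_hom_mult[OF A_class_hom, of y z] by (simp add: ring_of_type_algebra_def)

lemma A_class_one: "A_class k 1 = \<one>\<^bsub>A_alg k\<^esub>"
  using ring_hom_one[OF A_class_hom] by (simp add: ring_of_type_algebra_def)

lemma A_carrier: "a \<in> carrier (A_alg k) \<Longrightarrow> \<exists>y. a = A_class k y"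
  unfolding A_alg_def FactRing_def A_class_def by (auto simp: A_RCOSETS_def')

text \<open>The defining relations of A are listed as differences, and through this they become
  equations in the quotient.\<close>

lemma A_class_eq:
  assumes "y - z \<in> A_rels k"
  shows "A_class k y = A_class k z"
proof -
  interpret I: ideal "A_ideal k" "ring_of_type_algebra :: 'n::finite freealg ring" by (rule A_ideal_ideal)
  have "y - z \<in> A_ideal k"
    unfolding A_ideal_def
    using assms ring.genideal_self[OF ring_of_type_algebra_ring, of "A_rels k"] by (auto simp: ring_of_type_algebra_def)
  then have "y \<in> A_class k z"
    unfolding A_class_def a_r_coset_def' by (intro UN_I[of "y - z"]) (auto simp: ring_of_type_algebra_def)
  then show ?thesis
    unfolding A_class_def
    by (intro I.a_repr_independence'[symmetric]) (auto simp: ring_of_type_algebra_def)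
qed

text \<open>Constants and letters generate the free algebra, which lets stability of a subspace pass
  from generators to all of A.\<close>

lemma freealg_induct:
  fixes y :: "'n::finite freealg"
  assumes "\<And>c. P (fconst c)" "\<And>g. P (fgen g)" "\<And>y z. P y \<Longrightarrow> P z \<Longrightarrow> P (y + z)" "\<And>y z. P y \<Longrightarrow> P z \<Longrightarrow> P (y * z)"
  shows "P y"
proof (induction y rule: pm_induct)
  case zero
  have "fconst 0 = (0 :: 'n freealg)" by (simp add: fconst_def)
  then show ?case using assms(1)[of 0] by simp
next
  case (single M c)
  obtain l where M: "M = Word l" by (cases M)
  show ?case
    unfolding M
  proof (induction l)
    case Nil
    then show ?case using assms(1)[of c] by (simp add: fconst_def zero_word_def)
  next
    case (Cons g l)
    have "Poly_Mapping.single (Word (g # l)) c = fgen g * Poly_Mapping.single (Word l) c"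
      by (simp add: fgen_def mult_single)
    then show ?case using assms(4)[OF assms(2) Cons] by simp
  qed
qed (use assms in auto)

locale A_mod =
  fixes k :: int and s :: "complex \<Rightarrow> 'w::ab_group_add \<Rightarrow> 'w" and \<rho> :: "'n::finite freealg set \<Rightarrow> 'w \<Rightarrow> 'w" and lam :: "'n hh"
  assumes k: "k \<noteq> 0" and A: "A_module k s \<rho>" and lam: "lam \<in> scaled_LD k"
begin

sublocale complex_vs s
  using A by (simp add: A_module_def complex_vs_def)

lemma \<rho>_lin: "a \<in> carrier (A_alg k) \<Longrightarrow> lin s (\<rho> a)"
proof -
  assume "a \<in> carrier (A_alg k)"
  then have "Vector_Spaces.linear s s (\<rho> a)" using A by (simp add: A_module_def)
  then interpret Vector_Spaces.linear s s "\<rho> a" .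
  show ?thesis by (rule linI) (rule add scale)+
qed

lemma \<rho>_class_lin: "lin s (\<rho> (A_class k y))"
  by (rule \<rho>_lin[OF A_class_carrier])

lemma \<rho>_add: "\<rho> (A_class k (y + z)) w = \<rho> (A_class k y) w + \<rho> (A_class k z) w"
  using A unfolding A_module_def A_class_add by (blast intro: A_class_carrier)

lemma \<rho>_mult: "\<rho> (A_class k (y * z)) w = \<rho> (A_class k y) (\<rho> (A_class k z) w)"
  using A unfolding A_module_def A_class_mult by (blast intro: A_class_carrier)

lemma \<rho>_one: "\<rho> (A_class k 1) w = w"
  using A by (simp add: A_module_def A_class_one)

lemma \<rho>_const: "\<rho> (A_class k (fconst c)) w = s c w"
  using A by (simp add: A_module_def)

lemma e_0: "\<rho> (A_e k 0) w = w"
proof -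
  have "A_class k (fgen (Egen 0)) = A_class k (1 :: 'n freealg)"
    by (rule A_class_eq) (simp add: A_rels_def)
  then show ?thesis by (simp add: A_e_def \<rho>_one)
qed

lemma e_add: "\<rho> (A_e k (\<beta> + \<gamma>)) w = \<rho> (A_e k \<beta>) (\<rho> (A_e k \<gamma>) w)"
proof -
  have "A_class k (fgen (Egen (\<beta> + \<gamma>))) = A_class k (fgen (Egen \<beta>) * fgen (Egen \<gamma>) :: 'n freealg)"
    by (rule A_class_eq) (auto simp: A_rels_def)
  then show ?thesis by (simp add: A_e_def \<rho>_mult)
qed

lemma d_e: "\<rho> (A_d k i) (\<rho> (A_e k \<beta>) w) =
    \<rho> (A_e k \<beta>) (\<rho> (A_d k i) w) + s (form k (hbasis (Inr i)) (emb_C \<beta>)) (\<rho> (A_e k \<beta>) w)"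
proof -
  have "A_class k (fgen (Dgen i) * fgen (Egen \<beta>)) =
      A_class k (fgen (Egen \<beta>) * fgen (Dgen i) + fconst (form k (hbasis (Inr i)) (emb_C \<beta>)) * fgen (Egen \<beta>) :: 'n freealg)"
    by (rule A_class_eq) (auto simp: A_rels_def diff_diff_eq[symmetric])
  then show ?thesis
    by (simp add: A_e_def A_d_def \<rho>_const flip: \<rho>_mult) (simp add: \<rho>_add \<rho>_mult \<rho>_const)
qed

lemma d_d: "\<rho> (A_d k i) (\<rho> (A_d k j) w) = \<rho> (A_d k j) (\<rho> (A_d k i) w)"
proof -
  have "A_class k (fgen (Dgen i) * fgen (Dgen j)) = A_class k (fgen (Dgen j) * fgen (Dgen i) :: 'n freealg)"
    by (rule A_class_eq) (auto simp: A_rels_def)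
  then show ?thesis by (simp add: A_d_def flip: \<rho>_mult)
qed

lemma d_lin: "lin s (\<rho> (A_d k i))" and e_lin: "lin s (\<rho> (A_e k \<beta>))"
  by (simp_all add: A_d_def A_e_def \<rho>_class_lin)

lemma Z_Inl: "W_zero_mode k s \<rho> lam (hbasis (Inl i)) w = s (form k (hbasis (Inl i)) lam) w"
proof -
  have "proj_C (hbasis (Inl i)) = (hbasis (Inl i) :: 'n hh)"
    by (simp add: proj_C_def axis_def vec_eq_iff split: sum.split)
  then show ?thesis by (simp add: W_zero_mode_def axis_def)
qed

lemma Z_Inr: "W_zero_mode k s \<rho> lam (hbasis (Inr i)) w = \<rho> (A_d k i) w"
proof -
  have p: "proj_C (hbasis (Inr i)) = (0 :: 'n hh)"
    by (simp add: proj_C_def axis_def vec_eq_iff split: sum.split)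
  have "(\<Sum>j\<in>UNIV. s (hbasis (Inr i :: 'n + 'n) $ Inr j) (\<rho> (A_d k j) w)) = (\<Sum>j\<in>UNIV. if j = i then \<rho> (A_d k i) w else 0)"
    by (intro sum.cong refl) (auto simp: axis_def)
  then show ?thesis by (simp add: W_zero_mode_def p form_def)
qed

text \<open>The relations of A yield the axioms on \<open>Z\<close> and \<open>E\<close>. The part
  of the zero mode in h_C is a scalar and drops out of all commutators.\<close>

lemma fock: "fock_data s k (W_zero_mode k s \<rho> lam) (\<lambda>\<beta>. \<rho> (A_e k \<beta>)) (\<lambda>\<beta>. form k (emb_C \<beta>) lam)"
proof (intro fock_data.intro fock_data_axioms.intro complex_vs_axioms)
  note ld = lin_simps[OF d_lin] and le = lin_simps[OF e_lin]
  let ?Z = "W_zero_mode k s \<rho> lam"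
  fix \<alpha> \<alpha>' :: "'n hh" and \<beta> \<gamma> :: "'n lattC" and w :: 'w
  show "lin s (?Z \<alpha>)"
    by (rule linI) (simp_all add: W_zero_mode_def ld scale_right_distrib sum.distrib scale_sum_right mult.commute)
  show "lin s (\<rho> (A_e k \<beta>))" by (rule e_lin)
  show "?Z \<alpha> w = (\<Sum>b\<in>UNIV. s (\<alpha> $ b) (?Z (hbasis b) w))"
  proof -
    have "form k (proj_C \<alpha>) lam = (\<Sum>i\<in>UNIV. \<alpha> $ Inl i * form k (hbasis (Inl i)) lam)"
    proof -
      have "form k lam (proj_C \<alpha>) = (\<Sum>i\<in>UNIV. \<alpha> $ Inl i * form k lam (hbasis (Inl i)))"
        unfolding form_expand[of k lam "proj_C \<alpha>"] sum_UNIV_Plus by (simp add: proj_C_def)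
      then show ?thesis by (simp only: form_commute[of k lam])
    qed
    then show ?thesis
      unfolding sum_UNIV_Plus Z_Inl Z_Inr by (simp add: W_zero_mode_def scale_sum_left)
  qed
  show "?Z \<alpha> (?Z \<alpha>' w) = ?Z \<alpha>' (?Z \<alpha> w)"
  proof -
    have "(\<Sum>i\<in>UNIV. \<Sum>j\<in>UNIV. s (\<alpha> $ Inr i * \<alpha>' $ Inr j) (\<rho> (A_d k i) (\<rho> (A_d k j) w))) =
        (\<Sum>j\<in>UNIV. \<Sum>i\<in>UNIV. s (\<alpha>' $ Inr j * \<alpha> $ Inr i) (\<rho> (A_d k j) (\<rho> (A_d k i) w)))"
      by (subst sum.swap, intro sum.cong refl) (simp only: mult.commute, rule arg_cong[OF d_d])
    then show ?thesis
      by (simp add: W_zero_mode_def ld scale_right_distrib scale_sum_right sum.distrib mult.commute add_ac)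
  qed
  show "\<rho> (A_e k 0) w = w" by (rule e_0)
  show "\<rho> (A_e k (\<beta> + \<gamma>)) w = \<rho> (A_e k \<beta>) (\<rho> (A_e k \<gamma>) w)" by (rule e_add)
  show "?Z \<alpha> (\<rho> (A_e k \<beta>) w) = \<rho> (A_e k \<beta>) (?Z \<alpha> w) + s (form k \<alpha> (emb_C \<beta>)) (\<rho> (A_e k \<beta>) w)"
  proof -
    have "form k \<alpha> (emb_C \<beta>) = (\<Sum>i\<in>UNIV. \<alpha> $ Inr i * form k (hbasis (Inr i)) (emb_C \<beta>))"
    proof -
      have "form k (hbasis (Inr i)) (emb_C \<beta>) = of_int k * of_int (\<beta> $ i)" for i
        by (simp add: form_commute[of k "hbasis (Inr i)"] form_Inr emb_C_def)
      then show ?thesis by (simp add: form_def emb_C_def sum_distrib_left mult_ac)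
    qed
    then show ?thesis
      by (simp add: W_zero_mode_def le d_e scale_right_distrib sum.distrib scale_sum_left)
  qed
  show "?Z (emb_C \<beta>) w = s (form k (emb_C \<beta>) lam) w"
  proof -
    have "proj_C (emb_C \<beta>) = (emb_C \<beta> :: 'n hh)"
      by (simp add: proj_C_def emb_C_def vec_eq_iff split: sum.split)
    then show ?thesis by (simp add: W_zero_mode_def emb_C_def)
  qed
  show "form k (emb_C \<beta>) lam \<in> \<int>"
  proof -
    obtain l :: "int ^ 'n" where l: "lam = (\<chi> b. case b of Inl i \<Rightarrow> 0 | Inr i \<Rightarrow> of_int (l $ i) / of_int k)"
      using lam by (auto simp: scaled_LD_def)
    \<comment> \<open>The factor k of the form cancels the denominators of \<open>lam\<close>, so
      z^\<beta> has integral exponent.\<close>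
    have "form k (emb_C \<beta>) lam = of_int (\<Sum>i\<in>UNIV. \<beta> $ i * l $ i)"
      using k by (simp add: form_def emb_C_def l sum_distrib_left)
    then show ?thesis by (simp only: Ints_of_int)
  qed
  show "form k (emb_C 0) lam = 0" by (simp add: form_def emb_C_def)
  show "form k (emb_C (\<beta> + \<gamma>)) lam = form k (emb_C \<beta>) lam + form k (emb_C \<gamma>) lam"
    by (simp only: emb_C_add form_commute[of k _ lam] form_add_right)
qed

sublocale F: fock_data s k "W_zero_mode k s \<rho> lam" "\<lambda>\<beta>. \<rho> (A_e k \<beta>)" "\<lambda>\<beta>. form k (emb_C \<beta>) lam"
  by (rule fock)

text \<open>Zero modes are combinations of the d_i and scalars, and the zero mode of
  \<open>hbasis (Inr i)\<close> is d_i itself. As the e_\<beta> and d_i generate A, stability under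
  them is stability under A.\<close>

lemma A_submodule_iff:
  "A_submodule k s \<rho> U \<longleftrightarrow> subspace U \<and> (\<forall>\<alpha> w. w \<in> U \<longrightarrow> W_zero_mode k s \<rho> lam \<alpha> w \<in> U) \<and>
     (\<forall>\<beta> w. w \<in> U \<longrightarrow> \<rho> (A_e k \<beta>) w \<in> U)"
proof
  assume U: "A_submodule k s \<rho> U"
  then have s: "subspace U" and c: "\<And>y w. w \<in> U \<Longrightarrow> \<rho> (A_class k y) w \<in> U"
    by (auto simp: A_submodule_def A_class_carrier)
  show "subspace U \<and> (\<forall>\<alpha> w. w \<in> U \<longrightarrow> W_zero_mode k s \<rho> lam \<alpha> w \<in> U) \<and> (\<forall>\<beta> w. w \<in> U \<longrightarrow> \<rho> (A_e k \<beta>) w \<in> U)"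
    unfolding W_zero_mode_def A_e_def A_d_def
    by (intro conjI allI impI s c subspace_add[OF s] subspace_scale[OF s] subspace_sum[OF s])
next
  assume U: "subspace U \<and> (\<forall>\<alpha> w. w \<in> U \<longrightarrow> W_zero_mode k s \<rho> lam \<alpha> w \<in> U) \<and> (\<forall>\<beta> w. w \<in> U \<longrightarrow> \<rho> (A_e k \<beta>) w \<in> U)"
  then have s: "subspace U" by blast
  have "\<forall>w\<in>U. \<rho> (A_class k y) w \<in> U" for y
  proof (induction y rule: freealg_induct)
    case (1 c)
    then show ?case by (simp add: \<rho>_const subspace_scale[OF s])
  next
    case (2 g)
    show ?case
    proof (cases g)
      case (Egen \<beta>)
      then show ?thesis using U by (simp add: A_e_def)
    next
      case (Dgen i)
      have "W_zero_mode k s \<rho> lam (hbasis (Inr i)) w \<in> U" if "w \<in> U" for w using U that by blast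
      then show ?thesis by (simp add: Z_Inr Dgen A_d_def)
    qed
  qed (simp_all add: \<rho>_add \<rho>_mult subspace_add[OF s])
  then show "A_submodule k s \<rho> U"
    unfolding A_submodule_def using s A_carrier by blast
qed

end

theorem theorem4p9:
  fixes k :: int
    and s :: "complex \<Rightarrow> 'w::ab_group_add \<Rightarrow> 'w"
    and \<rho> :: "'n::finite freealg set \<Rightarrow> 'w \<Rightarrow> 'w"
    and lam :: "'n hh"
  assumes "k \<noteq> 0"
    and "A_module k s \<rho>"
    and "lam \<in> scaled_LD k"
  shows "vertex_module V_scale (Y_V k) V_vac (pm_scale s) (Y_W k s \<rho> lam)
       \<and> (vertex_irreducible (pm_scale s) (Y_W k s \<rho> lam) \<longleftrightarrow> A_simple k s \<rho>)"
proof -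
  interpret A_mod k s \<rho> lam by unfold_locales fact+
  have "A_simple k s \<rho> \<longleftrightarrow> vertex_irreducible (pm_scale s) (Y_W k s \<rho> lam)"
    unfolding A_simple_def A_submodule_iff Y_W_def F.irreducible_iff[OF assms(1)] by blast
  then show ?thesis
    unfolding Y_W_def using F.vertex_module_YN by blast
qed

end
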